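(* Let $P$ be a submonoid of a group $G$. The following $\mathrm C^*$-algebras are isomorphic, via isomorphisms that identify the canonical generating elements: (1) the covariance algebra $\mathbb C\times_{\mathbb C^P}P$ of the canonical product system $\mathbb C^P$ over $P$; (2) the universal $\mathrm C^*$-algebra with generating set $\{v_p: p\in P\}$ subject to the relations (T1)--(T3) together with the relations $\prod_{\beta\in A}(\dot v_\alpha-\dot v_\beta)=0$ for every neutral word $\alpha$ in $\mathcal W$ and foundation set $\{K(\beta):\beta\in A\}$ for $K(\alpha)$, where $A$ is a finite collection of neutral words in $\mathcal W$; (3) the universal $\mathrm C^*$-algebra with generating set $\{v_p:p\in P\}$ subject to the relations (T1)--(T4) together with the boundary relations $\prod_{\beta\in A}(\dot v_\alpha-\dot v_\beta)=0$ for every neutral word $\alpha$ in $\mathcal W$ and proper foundation set $\{K(\beta):\beta\in A\}$ for $K(\alpha)$, where $A$ is a finite collection of neutral words in $\mathcal W$; (4) the full partial crossed product $(D_r/D_r^{\mathrm o})\rtimes_{\dot\gamma}G$; (5) the full partial crossed product $\mathrm C(\partial\Omega_P)\rtimes G$ of $\mathrm C(\partial\Omega_P)$ by the restriction $\hat\gamma^*|_{\mathrm C(\partial\Omega_P)}$ of the partial action of $G$.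
   Context: $P$ is a submonoid of a group $G$ with identity $e$. A word is a finite sequence $\alpha=(p_1,p_2,\ldots,p_{2k-1},p_{2k})$ of even length $2k\ge 0$ with entries in $P$; $\mathcal W$ is the set of all words (including the empty word). Put $\dot\alpha:=p_1^{-1}p_2\cdots p_{2k-1}^{-1}p_{2k}\in G$ (equal to $e$ for the empty word); $\alpha$ is neutral if $\dot\alpha=e$. Put $\tilde\alpha:=(p_{2k},p_{2k-1},\ldots,p_2,p_1)$ and $K(\alpha):=P\cap p_{2k}^{-1}p_{2k-1}P\cap p_{2k}^{-1}p_{2k-1}p_{2k-2}^{-1}p_{2k-3}P\cap\cdots\cap p_{2k}^{-1}p_{2k-1}\cdots p_2^{-1}p_1P$ (equal to $P$ for the empty word). The constructible right ideals of $P$ are the members of $\mathfrak J:=\{K(\alpha):\alpha\in\mathcal W\}=\{K(\alpha):\dot\alpha=e\}$. For a map $w\colon P\to B$ into a unital $\mathrm C^*$-algebra, $\dot w_\alpha:=w_{p_1}^*w_{p_2}\cdots w_{p_{2k-1}}^*w_{p_{2k}}$ ($=1$ for the empty word). Relations for a family $\{w_p\}$: (T1) $w_e=1$; (T2) $\dot w_\alpha=0$ if $\alpha$ is neutral and $K(\alpha)=\emptyset$; (T3) $\dot w_\alpha=\dot w_\beta$ if $\alpha,\beta$ are neutral and $K(\alpha)=K(\beta)$; (T4) $\prod_{\beta\in F}(\dot w_\alpha-\dot w_\beta)=0$ if $\alpha$ is neutral and $F$ is a finite set of neutral words with $K(\alpha)=\bigcup_{\beta\in F}K(\beta)$. An empty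 product $\prod_{\beta\in\emptyset}(\dot w_\alpha-\dot w_\beta)$ is interpreted as $\dot w_\alpha$. Foundation sets: for $S\in\mathfrak J$, a finite collection $\mathcal C\subset\mathfrak J$ is a foundation set for $S$ if $R\subset S$ for all $R\in\mathcal C$ and $pP\cap\bigcup_{R\in\mathcal C}R\neq\emptyset$ for all $p\in S$; it is proper if $S\setminus\bigcup_{R\in\mathcal C}R\neq\emptyset$. $L_p\delta_q=\delta_{pq}$ is the left regular representation of $P$ on $\ell^2(P)$; for neutral $\alpha$, $\dot L_\alpha$ is multiplication by $\mathbb 1_{K(\alpha)}$; $D_r:=\overline{\mathrm{span}}\{\mathbb 1_S:S\in\mathfrak J\}\subseteq\ell^\infty(P)$. For finite $F\subseteq G$ let $\Delta_F$ be the set of $p\in P$ such that for all $g\in F$ either $pP\cap gP=\emptyset$ or $pP\cap gP=pP$. With finite subsets $F$ of $G$ directed by inclusion, $D_r^{\mathrm o}:=\{b\in D_r:\lim_F\|b|_{\ell^2(\Delta_F)}\|=0\}$, an ideal of $D_r$. An isometric representation $w\colon P\to B$ ($w_p$ isometries, $w_pw_q=w_{pq}$, $w_e=1$) is strongly covariant if $\dot L_\alpha\mapsto\dot w_\alpha$ ($\alpha$ neutral) extends to a well-defined $*$-homomorphism $D_r\to B$ that factors through $D_r/D_r^{\mathrm o}$. $\mathbb C^P$ is the product system over $P$ with one-dimensional fibers $\mathbb C_p=\mathbb C$ (multiplication in $\mathbb C$), whose representations correspond to isometric representations of $P$; its covariance algebra $\mathbb C\times_{\mathbb C^P}P$ is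 the universal $\mathrm C^*$-algebra for strongly covariant isometric representations of $P$, with canonical generators $j_p$, $p\in P$. Partial actions: for $g\in G$ let $A_{g^{-1}}:=\overline{\mathrm{span}}\{\mathbb 1_{K(\alpha)}:\dot\alpha=g\}$ (an ideal of $D_r$) and $\gamma_g\colon A_{g^{-1}}\to A_g$ the $*$-isomorphism with $\gamma_g(\mathbb 1_{K(\alpha)})=\mathbb 1_{gK(\alpha)}=\mathbb 1_{K(\tilde\alpha)}$ for $\dot\alpha=g$; this is a partial action $\gamma$ of $G$ on $D_r$, $D_r^{\mathrm o}$ is $\gamma$-invariant, and $\dot\gamma$ is the induced partial action on $D_r/D_r^{\mathrm o}$ ($\dot\gamma_g(a+D_r^{\mathrm o})=\gamma_g(a)+D_r^{\mathrm o}$, defined on the image of $A_{g^{-1}}$). $\hat{\mathfrak J}$ is the compact space (pointwise convergence) of nonzero functions $\chi\colon\mathfrak J\to\{0,1\}$ with $\chi(R\cap S)=\chi(R)\chi(S)$ and $\chi(\emptyset)=0$ if $\emptyset\in\mathfrak J$; $\Omega_P\subseteq\hat{\mathfrak J}$ is the closed subspace of those $\chi$ such that $S=\bigcup_{i=1}^nS_i$ in $\mathfrak J$ and $\chi(S)=1$ imply $\chi(S_i)=1$ for some $i$; it is the spectrum of $D_r$. $\hat\gamma$ is the corresponding partial action on $\Omega_P$ (with $\hat\gamma_g\colon U_{g^{-1}}\to U_g$, where $U_{g^{-1}}=\{\chi:\chi(K(\alpha))=1\text{ for some }\alpha,\dot\alpha=g\}$) and $\hat\gamma^*$ the transpose partial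 action on $\mathrm C(\Omega_P)\cong D_r$, corresponding to $\gamma$. $\partial\Omega_P$ is the closure of the set of $\chi\in\hat{\mathfrak J}$ for which $\chi^{-1}(1)$ is maximal; it is a closed $\hat\gamma$-invariant subset of $\Omega_P$, so $G$ acts partially on $\mathrm C(\partial\Omega_P)$ by restriction. The full partial crossed product of a partial action $\theta$ on $A$ with ideals $A_g$ is the full cross-sectional $\mathrm C^*$-algebra of the Fell bundle with fibers $A_g\delta_g$, $(a\delta_g)(b\delta_h)=\theta_g(\theta_{g^{-1}}(a)b)\delta_{gh}$, $(a\delta_g)^*=\theta_{g^{-1}}(a^* )\delta_{g^{-1}}$. The canonical generating elements in (4) and (5) are the images of $\mathbb 1_{pP}\delta_p$, $p\in P$. *)

theory Defs
  imports
    "HOL-Analysis.Analysis"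
    "HOL-Algebra.QuotRing"
    "HOL-Algebra.Module"
begin

section \<open>Unital star-algebras and unital C*-algebras with explicit carriers\<close>

definition complex_ring :: "complex ring" where
  "complex_ring = \<lparr>carrier = UNIV, mult = (*), one = 1, zero = 0, add = (+)\<rparr>"

record 'a star_alg = "(complex, 'a) module" +
  star :: "'a \<Rightarrow> 'a"

record 'a cstar_alg = "'a star_alg" +
  nrm :: "'a \<Rightarrow> real"

text \<open>Algebras are unital but need not be commutative, so the locale \<open>algebra\<close> of the library does
  not apply. The zero algebra is allowed.\<close>

locale star_algebra = ring A + Module.module complex_ring A
  for A :: "('a, 'm) star_alg_scheme" (structure) +
  assumes smult_mult_left: "\<lbrakk>x \<in> carrier A; y \<in> carrier A\<rbrakk> \<Longrightarrow> (c \<odot> x) \<otimes> y = c \<odot> (x \<otimes> y)"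
    and smult_mult_right: "\<lbrakk>x \<in> carrier A; y \<in> carrier A\<rbrakk> \<Longrightarrow> x \<otimes> (c \<odot> y) = c \<odot> (x \<otimes> y)"
    and star_closed: "x \<in> carrier A \<Longrightarrow> star A x \<in> carrier A"
    and star_star: "x \<in> carrier A \<Longrightarrow> star A (star A x) = x"
    and star_add: "\<lbrakk>x \<in> carrier A; y \<in> carrier A\<rbrakk> \<Longrightarrow> star A (x \<oplus> y) = star A x \<oplus> star A y"
    and star_smult: "x \<in> carrier A \<Longrightarrow> star A (c \<odot> x) = cnj c \<odot> star A x"
    and star_mult: "\<lbrakk>x \<in> carrier A; y \<in> carrier A\<rbrakk> \<Longrightarrow> star A (x \<otimes> y) = star A y \<otimes> star A x"

definition cstar_seminorm :: "('a, 'm) star_alg_scheme \<Rightarrow> ('a \<Rightarrow> real) \<Rightarrow> bool" where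
  "cstar_seminorm A p \<longleftrightarrow>
     (\<forall>x\<in>carrier A. 0 \<le> p x) \<and>
     (\<forall>x\<in>carrier A. \<forall>y\<in>carrier A. p (x \<oplus>\<^bsub>A\<^esub> y) \<le> p x + p y) \<and>
     (\<forall>c. \<forall>x\<in>carrier A. p (c \<odot>\<^bsub>A\<^esub> x) = cmod c * p x) \<and>
     (\<forall>x\<in>carrier A. \<forall>y\<in>carrier A. p (x \<otimes>\<^bsub>A\<^esub> y) \<le> p x * p y) \<and>
     (\<forall>x\<in>carrier A. p (star A x \<otimes>\<^bsub>A\<^esub> x) = (p x)\<^sup>2)"

definition Cauchy_seqs :: "('a, 'm) star_alg_scheme \<Rightarrow> ('a \<Rightarrow> real) \<Rightarrow> (nat \<Rightarrow> 'a) set" where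
  "Cauchy_seqs A p = {x. (\<forall>n. x n \<in> carrier A) \<and>
     (\<forall>e>0. \<exists>N. \<forall>m\<ge>N. \<forall>n\<ge>N. p (x m \<ominus>\<^bsub>A\<^esub> x n) < e)}"

locale cstar_algebra = star_algebra A for A :: "('a, 'm) cstar_alg_scheme" (structure) +
  assumes nrm_cstar_seminorm: "cstar_seminorm A (nrm A)"
    and nrm_definite: "\<lbrakk>x \<in> carrier A; nrm A x = 0\<rbrakk> \<Longrightarrow> x = \<zero>"
    and complete: "X \<in> Cauchy_seqs A (nrm A) \<Longrightarrow>
      \<exists>x\<in>carrier A. (\<lambda>n. nrm A (X n \<ominus> x)) \<longlonglongrightarrow> 0"

definition star_hom ::
  "('a, 'm) star_alg_scheme \<Rightarrow> ('b, 'n) star_alg_scheme \<Rightarrow> ('a \<Rightarrow> 'b) set" where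
  "star_hom A B = {\<phi> \<in> ring_hom A B.
     (\<forall>c. \<forall>x\<in>carrier A. \<phi> (c \<odot>\<^bsub>A\<^esub> x) = c \<odot>\<^bsub>B\<^esub> \<phi> x) \<and>
     (\<forall>x\<in>carrier A. \<phi> (star A x) = star B (\<phi> x))}"

definition isomorphic_via ::
  "'i set \<Rightarrow> ('a, 'm) cstar_alg_scheme \<Rightarrow> ('i \<Rightarrow> 'a) \<Rightarrow> ('b, 'n) cstar_alg_scheme \<Rightarrow> ('i \<Rightarrow> 'b) \<Rightarrow> bool"
  where
  "isomorphic_via I A a B b \<longleftrightarrow> cstar_algebra A \<and> cstar_algebra B \<and>
     (\<exists>\<phi>\<in>star_hom A B. bij_betw \<phi> (carrier A) (carrier B) \<and> (\<forall>i\<in>I. \<phi> (a i) = b i))"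

subsection \<open>Hausdorff completion of a star-algebra in a C*-seminorm\<close>

definition null_rel :: "('a, 'm) star_alg_scheme \<Rightarrow> ('a \<Rightarrow> real) \<Rightarrow> ((nat \<Rightarrow> 'a) \<times> (nat \<Rightarrow> 'a)) set" where
  "null_rel A p = {(x, y). x \<in> Cauchy_seqs A p \<and> y \<in> Cauchy_seqs A p \<and>
     (\<lambda>n. p (x n \<ominus>\<^bsub>A\<^esub> y n)) \<longlonglongrightarrow> 0}"

definition completion_emb ::
  "('a, 'm) star_alg_scheme \<Rightarrow> ('a \<Rightarrow> real) \<Rightarrow> 'a \<Rightarrow> (nat \<Rightarrow> 'a) set" where
  "completion_emb A p a = null_rel A p `` {\<lambda>_. a}"

definition completion ::
  "('a, 'm) star_alg_scheme \<Rightarrow> ('a \<Rightarrow> real) \<Rightarrow> (nat \<Rightarrow> 'a) set cstar_alg" where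
  "completion A p =
     \<lparr>carrier = Cauchy_seqs A p // null_rel A p,
      mult = (\<lambda>X Y. \<Union>x\<in>X. \<Union>y\<in>Y. null_rel A p `` {\<lambda>n. x n \<otimes>\<^bsub>A\<^esub> y n}),
      one = completion_emb A p \<one>\<^bsub>A\<^esub>,
      zero = completion_emb A p \<zero>\<^bsub>A\<^esub>,
      add = (\<lambda>X Y. \<Union>x\<in>X. \<Union>y\<in>Y. null_rel A p `` {\<lambda>n. x n \<oplus>\<^bsub>A\<^esub> y n}),
      smult = (\<lambda>c X. \<Union>x\<in>X. null_rel A p `` {\<lambda>n. c \<odot>\<^bsub>A\<^esub> x n}),
      star = (\<lambda>X. \<Union>x\<in>X. null_rel A p `` {\<lambda>n. star A (x n)}),
      nrm = (\<lambda>X. THE r. \<forall>x\<in>X. (\<lambda>n. p (x n)) \<longlonglongrightarrow> r)\<rparr>"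

subsection \<open>Universal C*-algebras\<close>

text \<open>The free unital star-algebra on the generators \<open>x\<^sub>p\<close>, \<open>p \<in> P\<close>: finitely supported functions on
  words in the letters \<open>(p, False)\<close> (for \<open>x\<^sub>p\<close>) and \<open>(p, True)\<close> (for its adjoint).\<close>

definition free_star_alg :: "'g set \<Rightarrow> (('g \<times> bool) list \<Rightarrow> complex) star_alg" where
  "free_star_alg P =
     \<lparr>carrier = {f. finite {u. f u \<noteq> 0} \<and> (\<forall>u. f u \<noteq> 0 \<longrightarrow> fst ` set u \<subseteq> P)},
      mult = (\<lambda>f h u. \<Sum>i\<le>length u. f (take i u) * h (drop i u)),
      one = (\<lambda>u. if u = [] then 1 else 0),
      zero = (\<lambda>_. 0),
      add = (\<lambda>f h u. f u + h u),
      smult = (\<lambda>c f u. c * f u),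
      star = (\<lambda>f u. cnj (f (rev (map (map_prod id Not) u))))\<rparr>"

definition free_gen :: "'g \<Rightarrow> ('g \<times> bool) list \<Rightarrow> complex" where
  "free_gen p = (\<lambda>u. if u = [(p, False)] then 1 else 0)"

text \<open>The universal C*-algebra for the families \<open>w\<close> indexed by \<open>P\<close> in unital C*-algebras that
  satisfy \<open>\<Phi>\<close> is the completion of the free star-algebra in the supremum of the seminorms
  \<open>x \<mapsto> \<parallel>x(w)\<parallel>\<close> for such families. A family \<open>w\<close> in \<open>B\<close> is recorded by its C*-seminorm
  \<open>p\<close>: the completion in \<open>p\<close> is the C*-subalgebra of \<open>B\<close> generated by \<open>w\<close>, and the class of the
  \<open>g\<close>-th generator is \<open>w\<^sub>g\<close>. This ranges over unital C*-algebras of all sizes.\<close>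

type_synonym 'g univ_elem = "(nat \<Rightarrow> ('g \<times> bool) list \<Rightarrow> complex) set"

definition univ_seminorm ::
  "'g set \<Rightarrow> ('g univ_elem cstar_alg \<Rightarrow> ('g \<Rightarrow> 'g univ_elem) \<Rightarrow> bool)
     \<Rightarrow> (('g \<times> bool) list \<Rightarrow> complex) \<Rightarrow> real" where
  "univ_seminorm P \<Phi> x =
     (SUP p\<in>{p. cstar_seminorm (free_star_alg P) p \<and>
                \<Phi> (completion (free_star_alg P) p)
                  (\<lambda>g. completion_emb (free_star_alg P) p (free_gen g))}. p x)"

definition univ_cstar ::
  "'g set \<Rightarrow> ('g univ_elem cstar_alg \<Rightarrow> ('g \<Rightarrow> 'g univ_elem) \<Rightarrow> bool) \<Rightarrow> 'g univ_elem cstar_alg" where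
  "univ_cstar P \<Phi> = completion (free_star_alg P) (univ_seminorm P \<Phi>)"

definition univ_gen ::
  "'g set \<Rightarrow> ('g univ_elem cstar_alg \<Rightarrow> ('g \<Rightarrow> 'g univ_elem) \<Rightarrow> bool) \<Rightarrow> 'g \<Rightarrow> 'g univ_elem" where
  "univ_gen P \<Phi> g = completion_emb (free_star_alg P) (univ_seminorm P \<Phi>) (free_gen g)"

subsection \<open>Full partial crossed products\<close>

text \<open>For ideals \<open>I g\<close> of \<open>A\<close> and \<open>\<theta> g : I (inv g) \<rightarrow> I g\<close>: the star-algebra of finitely supported
  sections \<open>\<Sum>\<^sub>g a\<^sub>g \<delta>\<^sub>g\<close> of the Fell bundle with fibers \<open>I g \<delta>\<^sub>g\<close>, where
  \<open>(a \<delta>\<^sub>g)(b \<delta>\<^sub>h) = \<theta>\<^sub>g(\<theta>\<^bsub>g\<inverse>\<^esub>(a) b) \<delta>\<^bsub>gh\<^esub>\<close> and \<open>(a \<delta>\<^sub>g)* = \<theta>\<^bsub>g\<inverse>\<^esub>(a*) \<delta>\<^bsub>g\<inverse>\<^esub>\<close>.\<close>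

definition delta_section ::
  "('a, 'm) star_alg_scheme \<Rightarrow> 'a \<Rightarrow> 'g \<Rightarrow> 'g \<Rightarrow> 'a" where
  "delta_section A a g = (\<lambda>h. if h = g then a else \<zero>\<^bsub>A\<^esub>)"

definition partial_sections ::
  "('g, 'k) monoid_scheme \<Rightarrow> ('a, 'm) star_alg_scheme \<Rightarrow> ('g \<Rightarrow> 'a set) \<Rightarrow> ('g \<Rightarrow> 'a \<Rightarrow> 'a)
     \<Rightarrow> ('g \<Rightarrow> 'a) star_alg" where
  "partial_sections G A I \<theta> =
     \<lparr>carrier = {f. finite {g. f g \<noteq> \<zero>\<^bsub>A\<^esub>} \<and> (\<forall>g\<in>carrier G. f g \<in> I g) \<and>
                    (\<forall>g. g \<notin> carrier G \<longrightarrow> f g = \<zero>\<^bsub>A\<^esub>)},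
      mult = (\<lambda>f h k. if k \<in> carrier G
                then (\<Oplus>\<^bsub>A\<^esub>g\<in>{g \<in> carrier G. f g \<noteq> \<zero>\<^bsub>A\<^esub>}.
                        \<theta> g (\<theta> (inv\<^bsub>G\<^esub> g) (f g) \<otimes>\<^bsub>A\<^esub> h (inv\<^bsub>G\<^esub> g \<otimes>\<^bsub>G\<^esub> k)))
                else \<zero>\<^bsub>A\<^esub>),
      one = delta_section A \<one>\<^bsub>A\<^esub> \<one>\<^bsub>G\<^esub>,
      zero = (\<lambda>_. \<zero>\<^bsub>A\<^esub>),
      add = (\<lambda>f h g. f g \<oplus>\<^bsub>A\<^esub> h g),
      smult = (\<lambda>c f g. c \<odot>\<^bsub>A\<^esub> f g),
      star = (\<lambda>f g. if g \<in> carrier G then \<theta> g (star A (f (inv\<^bsub>G\<^esub> g))) else \<zero>\<^bsub>A\<^esub>)\<rparr>"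

text \<open>The full cross-sectional C*-algebra is the completion of the finitely supported sections
  in the largest C*-seminorm.\<close>

definition largest_cstar_seminorm :: "('a, 'm) star_alg_scheme \<Rightarrow> 'a \<Rightarrow> real" where
  "largest_cstar_seminorm A x = (SUP p\<in>{p. cstar_seminorm A p}. p x)"

definition full_crossed_product ::
  "('g, 'k) monoid_scheme \<Rightarrow> ('a, 'm) star_alg_scheme \<Rightarrow> ('g \<Rightarrow> 'a set) \<Rightarrow> ('g \<Rightarrow> 'a \<Rightarrow> 'a)
     \<Rightarrow> (nat \<Rightarrow> 'g \<Rightarrow> 'a) set cstar_alg" where
  "full_crossed_product G A I \<theta> =
     completion (partial_sections G A I \<theta>) (largest_cstar_seminorm (partial_sections G A I \<theta>))"

definition crossed_product_elem ::
  "('g, 'k) monoid_scheme \<Rightarrow> ('a, 'm) star_alg_scheme \<Rightarrow> ('g \<Rightarrow> 'a set) \<Rightarrow> ('g \<Rightarrow> 'a \<Rightarrow> 'a)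
     \<Rightarrow> 'a \<Rightarrow> 'g \<Rightarrow> (nat \<Rightarrow> 'g \<Rightarrow> 'a) set" where
  "crossed_product_elem G A I \<theta> a g =
     completion_emb (partial_sections G A I \<theta>) (largest_cstar_seminorm (partial_sections G A I \<theta>))
       (delta_section A a g)"

section \<open>Words, constructible ideals and relations\<close>

definition words :: "'g set \<Rightarrow> 'g list set" where
  "words P = {\<alpha>. even (length \<alpha>) \<and> set \<alpha> \<subseteq> P}"

fun word_dot :: "('g, 'k) monoid_scheme \<Rightarrow> 'g list \<Rightarrow> 'g" where
  "word_dot G [] = \<one>\<^bsub>G\<^esub>"
| "word_dot G [p] = undefined"
| "word_dot G (p # q # \<alpha>) = inv\<^bsub>G\<^esub> p \<otimes>\<^bsub>G\<^esub> q \<otimes>\<^bsub>G\<^esub> word_dot G \<alpha>"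

definition neutral_words :: "('g, 'k) monoid_scheme \<Rightarrow> 'g set \<Rightarrow> 'g list set" where
  "neutral_words G P = {\<alpha> \<in> words P. word_dot G \<alpha> = \<one>\<^bsub>G\<^esub>}"

text \<open>The group elements \<open>p\<^bsub>2k\<^esub>\<inverse> p\<^bsub>2k-1\<^esub> \<dots> p\<^bsub>2j\<^esub>\<inverse> p\<^bsub>2j-1\<^esub>\<close> are the values of the even-length initial
  segments of the reversed word; the empty segment contributes \<open>P\<close> itself.\<close>

definition K :: "('g, 'k) monoid_scheme \<Rightarrow> 'g set \<Rightarrow> 'g list \<Rightarrow> 'g set" where
  "K G P \<alpha> = (\<Inter>i\<le>length \<alpha> div 2. word_dot G (take (2 * i) (rev \<alpha>)) <#\<^bsub>G\<^esub> P)"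

definition constructible :: "('g, 'k) monoid_scheme \<Rightarrow> 'g set \<Rightarrow> 'g set set" where
  "constructible G P = K G P ` words P"

fun word_val :: "('b, 'm) star_alg_scheme \<Rightarrow> ('g \<Rightarrow> 'b) \<Rightarrow> 'g list \<Rightarrow> 'b" where
  "word_val B w [] = \<one>\<^bsub>B\<^esub>"
| "word_val B w [p] = undefined"
| "word_val B w (p # q # \<alpha>) = star B (w p) \<otimes>\<^bsub>B\<^esub> w q \<otimes>\<^bsub>B\<^esub> word_val B w \<alpha>"

text \<open>The product of the differences in the order given by the list, with the convention that
  the empty product is \<open>word_val B w \<alpha>\<close>. A finite set of words enters the relations below through
  all of its enumerations by distinct lists, so that no ordering of the factors is singled out.\<close>

definition diff_prod ::
  "('b, 'm) star_alg_scheme \<Rightarrow> ('g \<Rightarrow> 'b) \<Rightarrow> 'g list \<Rightarrow> 'g list list \<Rightarrow> 'b" where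
  "diff_prod B w \<alpha> \<beta>s = (if \<beta>s = [] then word_val B w \<alpha>
     else foldr (\<lambda>\<beta> y. (word_val B w \<alpha> \<ominus>\<^bsub>B\<^esub> word_val B w \<beta>) \<otimes>\<^bsub>B\<^esub> y) \<beta>s \<one>\<^bsub>B\<^esub>)"

definition T1 :: "('g, 'k) monoid_scheme \<Rightarrow> ('b, 'm) star_alg_scheme \<Rightarrow> ('g \<Rightarrow> 'b) \<Rightarrow> bool" where
  "T1 G B w \<longleftrightarrow> w \<one>\<^bsub>G\<^esub> = \<one>\<^bsub>B\<^esub>"

definition T2 ::
  "('g, 'k) monoid_scheme \<Rightarrow> 'g set \<Rightarrow> ('b, 'm) star_alg_scheme \<Rightarrow> ('g \<Rightarrow> 'b) \<Rightarrow> bool" where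
  "T2 G P B w \<longleftrightarrow> (\<forall>\<alpha>\<in>neutral_words G P. K G P \<alpha> = {} \<longrightarrow> word_val B w \<alpha> = \<zero>\<^bsub>B\<^esub>)"

definition T3 ::
  "('g, 'k) monoid_scheme \<Rightarrow> 'g set \<Rightarrow> ('b, 'm) star_alg_scheme \<Rightarrow> ('g \<Rightarrow> 'b) \<Rightarrow> bool" where
  "T3 G P B w \<longleftrightarrow> (\<forall>\<alpha>\<in>neutral_words G P. \<forall>\<beta>\<in>neutral_words G P.
     K G P \<alpha> = K G P \<beta> \<longrightarrow> word_val B w \<alpha> = word_val B w \<beta>)"

definition T4 ::
  "('g, 'k) monoid_scheme \<Rightarrow> 'g set \<Rightarrow> ('b, 'm) star_alg_scheme \<Rightarrow> ('g \<Rightarrow> 'b) \<Rightarrow> bool" where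
  "T4 G P B w \<longleftrightarrow> (\<forall>\<alpha>\<in>neutral_words G P. \<forall>\<beta>s. distinct \<beta>s \<and> set \<beta>s \<subseteq> neutral_words G P \<and>
     K G P \<alpha> = (\<Union>\<beta>\<in>set \<beta>s. K G P \<beta>) \<longrightarrow> diff_prod B w \<alpha> \<beta>s = \<zero>\<^bsub>B\<^esub>)"

definition foundation_set ::
  "('g, 'k) monoid_scheme \<Rightarrow> 'g set \<Rightarrow> 'g set \<Rightarrow> 'g set set \<Rightarrow> bool" where
  "foundation_set G P S \<C> \<longleftrightarrow> S \<in> constructible G P \<and> finite \<C> \<and> \<C> \<subseteq> constructible G P \<and>
     (\<forall>R\<in>\<C>. R \<subseteq> S) \<and> (\<forall>p\<in>S. (p <#\<^bsub>G\<^esub> P) \<inter> \<Union>\<C> \<noteq> {})"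

definition proper_foundation_set ::
  "('g, 'k) monoid_scheme \<Rightarrow> 'g set \<Rightarrow> 'g set \<Rightarrow> 'g set set \<Rightarrow> bool" where
  "proper_foundation_set G P S \<C> \<longleftrightarrow> foundation_set G P S \<C> \<and> S - \<Union>\<C> \<noteq> {}"

definition foundation_relations ::
  "('g, 'k) monoid_scheme \<Rightarrow> 'g set \<Rightarrow> ('b, 'm) star_alg_scheme \<Rightarrow> ('g \<Rightarrow> 'b) \<Rightarrow> bool" where
  "foundation_relations G P B w \<longleftrightarrow> (\<forall>\<alpha>\<in>neutral_words G P. \<forall>\<beta>s.
     distinct \<beta>s \<and> set \<beta>s \<subseteq> neutral_words G P \<and> foundation_set G P (K G P \<alpha>) (K G P ` set \<beta>s)
     \<longrightarrow> diff_prod B w \<alpha> \<beta>s = \<zero>\<^bsub>B\<^esub>)"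

definition boundary_relations ::
  "('g, 'k) monoid_scheme \<Rightarrow> 'g set \<Rightarrow> ('b, 'm) star_alg_scheme \<Rightarrow> ('g \<Rightarrow> 'b) \<Rightarrow> bool" where
  "boundary_relations G P B w \<longleftrightarrow> (\<forall>\<alpha>\<in>neutral_words G P. \<forall>\<beta>s.
     distinct \<beta>s \<and> set \<beta>s \<subseteq> neutral_words G P \<and> proper_foundation_set G P (K G P \<alpha>) (K G P ` set \<beta>s)
     \<longrightarrow> diff_prod B w \<alpha> \<beta>s = \<zero>\<^bsub>B\<^esub>)"

definition foundation_family ::
  "('g, 'k) monoid_scheme \<Rightarrow> 'g set \<Rightarrow> ('b, 'm) star_alg_scheme \<Rightarrow> ('g \<Rightarrow> 'b) \<Rightarrow> bool" where
  "foundation_family G P B w \<longleftrightarrow>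
     T1 G B w \<and> T2 G P B w \<and> T3 G P B w \<and> foundation_relations G P B w"

definition boundary_family ::
  "('g, 'k) monoid_scheme \<Rightarrow> 'g set \<Rightarrow> ('b, 'm) star_alg_scheme \<Rightarrow> ('g \<Rightarrow> 'b) \<Rightarrow> bool" where
  "boundary_family G P B w \<longleftrightarrow>
     T1 G B w \<and> T2 G P B w \<and> T3 G P B w \<and> T4 G P B w \<and> boundary_relations G P B w"

section \<open>The diagonal algebra and its quotient\<close>

text \<open>Functions on a set \<open>X\<close> are extended by zero to the whole type.\<close>

definition fun_star_alg :: "'x set \<Rightarrow> ('x \<Rightarrow> complex) set \<Rightarrow> ('x \<Rightarrow> complex) star_alg" where
  "fun_star_alg X C =
     \<lparr>carrier = C,
      mult = (\<lambda>f h x. f x * h x),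
      one = indicator X,
      zero = (\<lambda>_. 0),
      add = (\<lambda>f h x. f x + h x),
      smult = (\<lambda>c f x. c * f x),
      star = (\<lambda>f x. cnj (f x))\<rparr>"

definition indicator_span :: "'x set set \<Rightarrow> ('x \<Rightarrow> complex) set" where
  "indicator_span \<S> = {\<lambda>x. \<Sum>S\<in>F. c S * indicator S x | F c. finite F \<and> F \<subseteq> \<S>}"

definition closed_indicator_span :: "'x set set \<Rightarrow> ('x \<Rightarrow> complex) set" where
  "closed_indicator_span \<S> =
     {f. \<exists>s. (\<forall>n. s n \<in> indicator_span \<S>) \<and> uniform_limit UNIV s f sequentially}"

definition Dr :: "('g, 'k) monoid_scheme \<Rightarrow> 'g set \<Rightarrow> ('g \<Rightarrow> complex) set" where
  "Dr G P = closed_indicator_span (constructible G P)"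

definition Dr_alg :: "('g, 'k) monoid_scheme \<Rightarrow> 'g set \<Rightarrow> ('g \<Rightarrow> complex) star_alg" where
  "Dr_alg G P = fun_star_alg P (Dr G P)"

definition l2_norm :: "('g \<Rightarrow> complex) \<Rightarrow> real" where
  "l2_norm \<xi> = sqrt (\<Sum>\<^sub>\<infinity>p. (cmod (\<xi> p))\<^sup>2)"

definition l2_space :: "'g set \<Rightarrow> ('g \<Rightarrow> complex) set" where
  "l2_space X = {\<xi>. (\<forall>p. p \<notin> X \<longrightarrow> \<xi> p = 0) \<and> (\<lambda>p. (cmod (\<xi> p))\<^sup>2) summable_on UNIV}"

text \<open>The operator norm of the restriction to \<open>l2_space X\<close> of multiplication by \<open>b\<close>.\<close>

definition mult_op_norm :: "('g \<Rightarrow> complex) \<Rightarrow> 'g set \<Rightarrow> real" where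
  "mult_op_norm b X = (SUP \<xi>\<in>{\<xi> \<in> l2_space X. l2_norm \<xi> \<le> 1}. l2_norm (\<lambda>p. b p * \<xi> p))"

definition Delta :: "('g, 'k) monoid_scheme \<Rightarrow> 'g set \<Rightarrow> 'g set \<Rightarrow> 'g set" where
  "Delta G P F = {p \<in> P. \<forall>g\<in>F. (p <#\<^bsub>G\<^esub> P) \<inter> (g <#\<^bsub>G\<^esub> P) = {} \<or>
                              (p <#\<^bsub>G\<^esub> P) \<inter> (g <#\<^bsub>G\<^esub> P) = p <#\<^bsub>G\<^esub> P}"

definition Dr0 :: "('g, 'k) monoid_scheme \<Rightarrow> 'g set \<Rightarrow> ('g \<Rightarrow> complex) set" where
  "Dr0 G P = {b \<in> Dr G P.
     ((\<lambda>F. mult_op_norm b (Delta G P F)) \<longlongrightarrow> 0) (finite_subsets_at_top (carrier G))}"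

definition quot_star_alg :: "('a, 'm) star_alg_scheme \<Rightarrow> 'a set \<Rightarrow> 'a set star_alg" where
  "quot_star_alg A I =
     \<lparr>carrier = carrier (A Quot I), mult = mult (A Quot I), one = one (A Quot I),
      zero = zero (A Quot I), add = add (A Quot I),
      smult = (\<lambda>c X. \<Union>a\<in>X. I +>\<^bsub>A\<^esub> (c \<odot>\<^bsub>A\<^esub> a)),
      star = (\<lambda>X. \<Union>a\<in>X. I +>\<^bsub>A\<^esub> star A a)\<rparr>"

definition Dr_quot :: "('g, 'k) monoid_scheme \<Rightarrow> 'g set \<Rightarrow> ('g \<Rightarrow> complex) set star_alg" where
  "Dr_quot G P = quot_star_alg (Dr_alg G P) (Dr0 G P)"

subsection \<open>Strongly covariant isometric representations\<close>

definition isometric_rep ::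
  "('g, 'k) monoid_scheme \<Rightarrow> 'g set \<Rightarrow> ('b, 'm) star_alg_scheme \<Rightarrow> ('g \<Rightarrow> 'b) \<Rightarrow> bool" where
  "isometric_rep G P B w \<longleftrightarrow> w \<in> P \<rightarrow> carrier B \<and> w \<one>\<^bsub>G\<^esub> = \<one>\<^bsub>B\<^esub> \<and>
     (\<forall>p\<in>P. star B (w p) \<otimes>\<^bsub>B\<^esub> w p = \<one>\<^bsub>B\<^esub>) \<and>
     (\<forall>p\<in>P. \<forall>q\<in>P. w p \<otimes>\<^bsub>B\<^esub> w q = w (p \<otimes>\<^bsub>G\<^esub> q))"

text \<open>For a neutral word \<open>\<alpha>\<close>, the operator \<open>L\<^sub>\<alpha>\<close> of the regular representation is multiplication by the
  indicator function of \<open>K G P \<alpha>\<close>.\<close>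

definition strongly_covariant ::
  "('g, 'k) monoid_scheme \<Rightarrow> 'g set \<Rightarrow> ('b, 'm) star_alg_scheme \<Rightarrow> ('g \<Rightarrow> 'b) \<Rightarrow> bool" where
  "strongly_covariant G P B w \<longleftrightarrow> isometric_rep G P B w \<and>
     (\<exists>\<phi>\<in>star_hom (Dr_alg G P) B.
        (\<forall>\<alpha>\<in>neutral_words G P. \<phi> (indicator (K G P \<alpha>)) = word_val B w \<alpha>) \<and>
        (\<exists>\<psi>\<in>star_hom (Dr_quot G P) B. \<forall>a\<in>Dr G P. \<phi> a = \<psi> (Dr0 G P +>\<^bsub>Dr_alg G P\<^esub> a)))"

text \<open>The covariance algebra of the product system with fibers \<open>\<complex>\<close>; its representations are the
  isometric representations of \<open>P\<close>.\<close>

definition covariance_algebra :: "('g, 'k) monoid_scheme \<Rightarrow> 'g set \<Rightarrow> 'g univ_elem cstar_alg" where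
  "covariance_algebra G P = univ_cstar P (strongly_covariant G P)"

definition covariance_gen :: "('g, 'k) monoid_scheme \<Rightarrow> 'g set \<Rightarrow> 'g \<Rightarrow> 'g univ_elem" where
  "covariance_gen G P = univ_gen P (strongly_covariant G P)"

subsection \<open>The partial action on the diagonal algebra and on its quotient\<close>

definition gamma_ideal :: "('g, 'k) monoid_scheme \<Rightarrow> 'g set \<Rightarrow> 'g \<Rightarrow> ('g \<Rightarrow> complex) set" where
  "gamma_ideal G P g = closed_indicator_span {K G P \<alpha> | \<alpha>. \<alpha> \<in> words P \<and> word_dot G \<alpha> = inv\<^bsub>G\<^esub> g}"

text \<open>Translation by \<open>g\<close>, to be applied to functions in \<open>gamma_ideal G P (inv g)\<close>.\<close>

definition gamma :: "('g, 'k) monoid_scheme \<Rightarrow> 'g \<Rightarrow> ('g \<Rightarrow> complex) \<Rightarrow> 'g \<Rightarrow> complex" where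
  "gamma G g a = (\<lambda>x. if x \<in> carrier G then a (inv\<^bsub>G\<^esub> g \<otimes>\<^bsub>G\<^esub> x) else 0)"

lemma gamma_indicator:
  assumes "group G" "g \<in> carrier G" "S \<subseteq> carrier G"
  shows "gamma G g (indicator S) = indicator (g <#\<^bsub>G\<^esub> S)"
proof
  interpret group G by fact
  fix x
  have "inv\<^bsub>G\<^esub> g \<otimes>\<^bsub>G\<^esub> x \<in> S \<longleftrightarrow> x \<in> g <#\<^bsub>G\<^esub> S" if x: "x \<in> carrier G"
  proof
    assume "inv\<^bsub>G\<^esub> g \<otimes>\<^bsub>G\<^esub> x \<in> S"
    moreover have "x = g \<otimes>\<^bsub>G\<^esub> (inv\<^bsub>G\<^esub> g \<otimes>\<^bsub>G\<^esub> x)"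
      using assms x by (simp add: m_assoc[symmetric])
    ultimately show "x \<in> g <#\<^bsub>G\<^esub> S"
      unfolding l_coset_def by blast
  next
    assume "x \<in> g <#\<^bsub>G\<^esub> S"
    then obtain y where y: "y \<in> S" "x = g \<otimes>\<^bsub>G\<^esub> y"
      unfolding l_coset_def by blast
    then show "inv\<^bsub>G\<^esub> g \<otimes>\<^bsub>G\<^esub> x \<in> S"
      using assms by (simp add: m_assoc[symmetric] subsetD[OF assms(3)])
  qed
  moreover have "x \<in> carrier G" if "x \<in> g <#\<^bsub>G\<^esub> S"
    using assms that unfolding l_coset_def by auto
  ultimately show "gamma G g (indicator S) x = indicator (g <#\<^bsub>G\<^esub> S) x"
    unfolding gamma_def by (auto simp: indicator_def)
qed

definition dot_gamma_ideal :: "('g, 'k) monoid_scheme \<Rightarrow> 'g set \<Rightarrow> 'g \<Rightarrow> ('g \<Rightarrow> complex) set set" where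
  "dot_gamma_ideal G P g = (\<lambda>a. Dr0 G P +>\<^bsub>Dr_alg G P\<^esub> a) ` gamma_ideal G P g"

definition dot_gamma ::
  "('g, 'k) monoid_scheme \<Rightarrow> 'g set \<Rightarrow> 'g \<Rightarrow> ('g \<Rightarrow> complex) set \<Rightarrow> ('g \<Rightarrow> complex) set" where
  "dot_gamma G P g X =
     (\<Union>a\<in>X \<inter> gamma_ideal G P (inv\<^bsub>G\<^esub> g). Dr0 G P +>\<^bsub>Dr_alg G P\<^esub> gamma G g a)"

definition quotient_crossed_product ::
  "('g, 'k) monoid_scheme \<Rightarrow> 'g set \<Rightarrow> (nat \<Rightarrow> 'g \<Rightarrow> ('g \<Rightarrow> complex) set) set cstar_alg" where
  "quotient_crossed_product G P =
     full_crossed_product G (Dr_quot G P) (dot_gamma_ideal G P) (dot_gamma G P)"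

definition quotient_crossed_product_gen ::
  "('g, 'k) monoid_scheme \<Rightarrow> 'g set \<Rightarrow> 'g \<Rightarrow> (nat \<Rightarrow> 'g \<Rightarrow> ('g \<Rightarrow> complex) set) set" where
  "quotient_crossed_product_gen G P p =
     crossed_product_elem G (Dr_quot G P) (dot_gamma_ideal G P) (dot_gamma G P)
       (Dr0 G P +>\<^bsub>Dr_alg G P\<^esub> indicator (p <#\<^bsub>G\<^esub> P)) p"

section \<open>The spectrum, its boundary and the boundary action\<close>

text \<open>Functions from the constructible ideals to \<open>{0, 1}\<close> are extended by zero to all sets; the topology is that
  of pointwise convergence, i.e. the product topology of the function type.\<close>

definition J_hat :: "('g, 'k) monoid_scheme \<Rightarrow> 'g set \<Rightarrow> ('g set \<Rightarrow> nat) set" where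
  "J_hat G P = {\<eta>. (\<forall>S. S \<notin> constructible G P \<longrightarrow> \<eta> S = 0) \<and>
     (\<forall>S\<in>constructible G P. \<eta> S \<in> {0, 1}) \<and> (\<exists>S\<in>constructible G P. \<eta> S \<noteq> 0) \<and>
     (\<forall>R\<in>constructible G P. \<forall>S\<in>constructible G P. \<eta> (R \<inter> S) = \<eta> R * \<eta> S) \<and>
     ({} \<in> constructible G P \<longrightarrow> \<eta> {} = 0)}"

definition Omega :: "('g, 'k) monoid_scheme \<Rightarrow> 'g set \<Rightarrow> ('g set \<Rightarrow> nat) set" where
  "Omega G P = {\<eta> \<in> J_hat G P. \<forall>S\<in>constructible G P. \<forall>\<C>.
     finite \<C> \<and> \<C> \<subseteq> constructible G P \<and> S = \<Union>\<C> \<and> \<eta> S = 1 \<longrightarrow> (\<exists>R\<in>\<C>. \<eta> R = 1)}"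

definition maximal_characters :: "('g, 'k) monoid_scheme \<Rightarrow> 'g set \<Rightarrow> ('g set \<Rightarrow> nat) set" where
  "maximal_characters G P = {\<eta> \<in> J_hat G P. \<forall>\<eta>'\<in>J_hat G P.
     \<eta> -` {1} \<subseteq> \<eta>' -` {1} \<longrightarrow> \<eta>' -` {1} = \<eta> -` {1}}"

definition boundary :: "('g, 'k) monoid_scheme \<Rightarrow> 'g set \<Rightarrow> ('g set \<Rightarrow> nat) set" where
  "boundary G P = top_of_set (J_hat G P) closure_of maximal_characters G P"

definition hat_domain :: "('g, 'k) monoid_scheme \<Rightarrow> 'g set \<Rightarrow> 'g \<Rightarrow> ('g set \<Rightarrow> nat) set" where
  "hat_domain G P g =
     {\<eta> \<in> Omega G P. \<exists>\<alpha>\<in>words P. word_dot G \<alpha> = inv\<^bsub>G\<^esub> g \<and> \<eta> (K G P \<alpha>) = 1}"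

text \<open>A point \<open>\<eta>\<close> of \<open>Omega G P\<close> is the character of \<open>Dr_alg G P\<close> with \<open>indicator S \<mapsto> \<eta> S\<close>. If
  \<open>\<eta> (K \<alpha>) = 1\<close> with \<open>\<alpha>\<close> of value \<open>g\<close>, then its image under the action of \<open>g\<close> takes the value 1 at
  \<open>indicator (g K \<alpha>)\<close>, so its value at \<open>indicator S\<close> is that of \<open>\<eta>\<close> at
  \<open>gamma (inv g) (indicator (S \<inter> g K \<alpha>))\<close>, which is the indicator function of \<open>K \<alpha> \<inter> inv g S\<close>. By
  monotonicity of \<open>\<eta>\<close>, the condition below entails \<open>\<eta> (K \<alpha>) = 1\<close>.\<close>

definition hat_gamma ::
  "('g, 'k) monoid_scheme \<Rightarrow> 'g set \<Rightarrow> 'g \<Rightarrow> ('g set \<Rightarrow> nat) \<Rightarrow> 'g set \<Rightarrow> nat" where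
  "hat_gamma G P g \<eta> S =
     (if S \<in> constructible G P \<and>
         (\<exists>\<alpha>\<in>words P. word_dot G \<alpha> = g \<and> \<eta> (K G P \<alpha> \<inter> (inv\<^bsub>G\<^esub> g <#\<^bsub>G\<^esub> S)) = 1)
      then 1 else 0)"

definition C_boundary ::
  "('g, 'k) monoid_scheme \<Rightarrow> 'g set \<Rightarrow> (('g set \<Rightarrow> nat) \<Rightarrow> complex) set" where
  "C_boundary G P = {f. continuous_on (boundary G P) f \<and> (\<forall>\<eta>. \<eta> \<notin> boundary G P \<longrightarrow> f \<eta> = 0)}"

definition C_boundary_alg ::
  "('g, 'k) monoid_scheme \<Rightarrow> 'g set \<Rightarrow> (('g set \<Rightarrow> nat) \<Rightarrow> complex) star_alg" where
  "C_boundary_alg G P = fun_star_alg (boundary G P) (C_boundary G P)"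

definition boundary_ideal ::
  "('g, 'k) monoid_scheme \<Rightarrow> 'g set \<Rightarrow> 'g \<Rightarrow> (('g set \<Rightarrow> nat) \<Rightarrow> complex) set" where
  "boundary_ideal G P g = {f \<in> C_boundary G P. \<forall>\<eta>. \<eta> \<notin> hat_domain G P g \<longrightarrow> f \<eta> = 0}"

definition boundary_action ::
  "('g, 'k) monoid_scheme \<Rightarrow> 'g set \<Rightarrow> 'g \<Rightarrow> (('g set \<Rightarrow> nat) \<Rightarrow> complex) \<Rightarrow> ('g set \<Rightarrow> nat) \<Rightarrow> complex"
  where
  "boundary_action G P g f =
     (\<lambda>\<eta>. if \<eta> \<in> boundary G P \<inter> hat_domain G P g then f (hat_gamma G P (inv\<^bsub>G\<^esub> g) \<eta>) else 0)"

definition boundary_crossed_product ::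
  "('g, 'k) monoid_scheme \<Rightarrow> 'g set \<Rightarrow> (nat \<Rightarrow> 'g \<Rightarrow> ('g set \<Rightarrow> nat) \<Rightarrow> complex) set cstar_alg" where
  "boundary_crossed_product G P =
     full_crossed_product G (C_boundary_alg G P) (boundary_ideal G P) (boundary_action G P)"

text \<open>The function on the spectrum corresponding to \<open>indicator S\<close> is \<open>\<eta> \<mapsto> \<eta> S\<close>.\<close>

definition boundary_crossed_product_gen ::
  "('g, 'k) monoid_scheme \<Rightarrow> 'g set \<Rightarrow> 'g \<Rightarrow> (nat \<Rightarrow> 'g \<Rightarrow> ('g set \<Rightarrow> nat) \<Rightarrow> complex) set" where
  "boundary_crossed_product_gen G P p =
     crossed_product_elem G (C_boundary_alg G P) (boundary_ideal G P) (boundary_action G P)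
       (\<lambda>\<eta>. if \<eta> \<in> boundary G P then of_nat (\<eta> (p <#\<^bsub>G\<^esub> P)) else 0) p"

end

theory Submission
  imports Defs
begin

text \<open>The boundary consists of the characters \<open>\<eta>\<close> that are tight for foundation sets: if \<open>\<eta> S = 1\<close> and \<open>\<C>\<close>
  is a foundation set for \<open>S\<close>, then \<open>\<eta> R = 1\<close> for some \<open>R \<in> \<C>\<close>. On a finite combination of indicator
  functions such a character takes a value that is also taken at points of every \<open>\<Delta>\<^sub>F\<close>, and for large \<open>F\<close>
  all values on \<open>\<Delta>\<^sub>F\<close> arise in this way. Hence restriction to the boundary identifies \<open>D\<^sub>r / D\<^sub>r\<^sup>o\<close> with the
  continuous functions on the boundary, compatibly with the partial actions, which gives (4) = (5).

  The free star-algebra on \<open>P\<close> maps onto a dense subalgebra of the sections of the boundary action, and the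
  main point is that \<open>\<parallel>x(w)\<parallel>\<close>, for a family \<open>w\<close> that satisfies the relations of (2), is at most the
  \<open>\<ell>\<^sup>1\<close>-norm of the image of \<open>x\<close>. By the C*-identity it suffices to treat combinations of the commuting
  projections given by neutral words; these are diagonal on the atoms that the projections generate, and the
  relations say that an atom without a boundary point vanishes. So the universal norm of (2) is the pullback
  of the largest C*-seminorm on the sections, which gives (2) = (5). A foundation set is either proper or a
  cover, whence (2) = (3), and the families in (2) are those whose diagonal part is a homomorphism of the
  functions on the boundary, whence (1) = (2).\<close>

section \<open>Star-algebras\<close>

text \<open>Two obstacles shape the proof. The seminorms in question are arbitrary C*-seminorms on
  explicit star-algebras, and they are bounded without functional calculus or representations on a
  Hilbert space. Every bound comes from one device: if star(u) u = 1, then u has seminorm at most 1,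
  so a mean of two such elements does as well. On the sections this bounds all C*-seminorms by the
  l1-norm, which is why a largest one exists; in the algebra of a family it bounds the combinations
  of diagonal projections, with the two elements glued together atom by atom.

  The second obstacle is that \<open>D\<^sub>r\<close> consists of functions on P, while points of P
  need not give characters on the boundary. Hence no restriction map is available pointwise, and the
  two sides are compared through common approximants: finite combinations of constructible ideals,
  which can be read as functions at points of P and at boundary characters alike. Bounds pass easily
  from P to the boundary; the opposite direction needs cut-offs.\<close>

lemma cring_complex_ring: "cring complex_ring"
proof (rule cringI)
  show "abelian_group complex_ring"
    by (rule abelian_groupI) (auto simp: complex_ring_def intro: exI[of _ "- x" for x] left_minus)
  show "comm_monoid complex_ring"
    by (rule comm_monoidI) (auto simp: complex_ring_def)
qed (auto simp: complex_ring_def algebra_simps)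

text \<open>Additive inverses are asked for only in the form that (-1) times x is a left negative of
  x, so a concrete algebra supplies them through its scalar multiplication.\<close>

lemma star_algebraI:
  fixes A (structure)
  assumes closed:
    "\<And>x y. x \<in> carrier A ==> y \<in> carrier A ==> x \<oplus> y \<in> carrier A"
    "\<And>x y. x \<in> carrier A ==> y \<in> carrier A ==> x \<otimes> y \<in> carrier A"
    "\<And>c x. x \<in> carrier A ==> c \<odot> x \<in> carrier A"
    "\<And>x. x \<in> carrier A ==> star A x \<in> carrier A"
    "\<zero> \<in> carrier A" "\<one> \<in> carrier A"
  and add:
    "\<And>x y z. x \<in> carrier A ==> y \<in> carrier A ==> z \<in> carrier A ==> (x \<oplus> y) \<oplus> z = x \<oplus> (y \<oplus> z)"
    "\<And>x y. x \<in> carrier A ==> y \<in> carrier A ==> x \<oplus> y = y \<oplus> x"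
    "\<And>x. x \<in> carrier A ==> \<zero> \<oplus> x = x"
    "\<And>x. x \<in> carrier A ==> (-1) \<odot> x \<oplus> x = \<zero>"
  and mult:
    "\<And>x y z. x \<in> carrier A ==> y \<in> carrier A ==> z \<in> carrier A ==> (x \<otimes> y) \<otimes> z = x \<otimes> (y \<otimes> z)"
    "\<And>x. x \<in> carrier A ==> \<one> \<otimes> x = x"
    "\<And>x. x \<in> carrier A ==> x \<otimes> \<one> = x"
    "\<And>x y z. x \<in> carrier A ==> y \<in> carrier A ==> z \<in> carrier A ==> (x \<oplus> y) \<otimes> z = x \<otimes> z \<oplus> y \<otimes> z"
    "\<And>x y z. x \<in> carrier A ==> y \<in> carrier A ==> z \<in> carrier A ==> z \<otimes> (x \<oplus> y) = z \<otimes> x \<oplus> z \<otimes> y"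
  and smult:
    "\<And>a b x. x \<in> carrier A ==> (a + b) \<odot> x = a \<odot> x \<oplus> b \<odot> x"
    "\<And>a x y. x \<in> carrier A ==> y \<in> carrier A ==> a \<odot> (x \<oplus> y) = a \<odot> x \<oplus> a \<odot> y"
    "\<And>a b x. x \<in> carrier A ==> (a * b) \<odot> x = a \<odot> (b \<odot> x)"
    "\<And>x. x \<in> carrier A ==> 1 \<odot> x = x"
    "\<And>c x y. x \<in> carrier A ==> y \<in> carrier A ==> (c \<odot> x) \<otimes> y = c \<odot> (x \<otimes> y)"
    "\<And>c x y. x \<in> carrier A ==> y \<in> carrier A ==> x \<otimes> (c \<odot> y) = c \<odot> (x \<otimes> y)"
  and star:
    "\<And>x. x \<in> carrier A ==> star A (star A x) = x"
    "\<And>x y. x \<in> carrier A ==> y \<in> carrier A ==> star A (x \<oplus> y) = star A x \<oplus> star A y"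
    "\<And>c x. x \<in> carrier A ==> star A (c \<odot> x) = cnj c \<odot> star A x"
    "\<And>x y. x \<in> carrier A ==> y \<in> carrier A ==> star A (x \<otimes> y) = star A y \<otimes> star A x"
  shows "star_algebra A"
proof -
  have ag: "abelian_group A"
  proof (rule abelian_groupI)
    show "\<exists>y\<in>carrier A. y \<oplus> x = \<zero>" if "x \<in> carrier A" for x
      using closed(3)[OF that] add(4)[OF that] by blast
  qed (fact closed add)+
  have "ring A"
  proof (rule ringI[OF ag])
    show "Group.monoid A" by (rule monoidI) (auto simp: closed mult)
  qed (auto simp: mult)
  moreover have "Module.module complex_ring A"
    by (rule moduleI[OF cring_complex_ring ag]) (auto simp: complex_ring_def closed smult)
  moreover have "star_algebra_axioms A"
    by unfold_locales (auto simp: closed smult star)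
  ultimately show ?thesis by (rule star_algebra.intro)
qed

context star_algebra
begin

text \<open>Inside \<open>star_algebra\<close> the unqualified names of ring lemmas refer to \<open>complex_ring\<close>, the scalar
  ring of \<open>module\<close>; the lemmas for \<open>A\<close> are restated with the prefix \<open>alg\<close>.\<close>

lemma ring_A: "ring A"
  by (rule star_algebra.axioms(1)[OF star_algebra_axioms])

lemmas alg_a_assoc = ring.ring_simprules(7)[OF ring_A]
lemmas alg_l_neg = ring.ring_simprules(9)[OF ring_A]
lemmas alg_a_comm = ring.ring_simprules(10)[OF ring_A]
lemmas alg_m_assoc = ring.ring_simprules(11)[OF ring_A]
lemmas alg_l_distr = ring.ring_simprules(13)[OF ring_A]
lemmas alg_minus_eq = ring.ring_simprules(14)[OF ring_A]
lemmas alg_r_neg = ring.ring_simprules(16)[OF ring_A]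
lemmas alg_r_neg2 = ring.ring_simprules(17)[OF ring_A]
lemmas alg_r_neg1 = ring.ring_simprules(18)[OF ring_A]
lemmas alg_minus_add = ring.ring_simprules(19)[OF ring_A]
lemmas alg_minus_minus = ring.ring_simprules(20)[OF ring_A]
lemmas alg_a_lcomm = ring.ring_simprules(22)[OF ring_A]
lemmas alg_r_distr = ring.ring_simprules(23)[OF ring_A]
lemmas alg_l_null = ring.ring_simprules(24)[OF ring_A]
lemmas alg_r_null = ring.ring_simprules(25)[OF ring_A]
lemmas alg_l_minus = ring.ring_simprules(26)[OF ring_A]
lemmas alg_r_minus = ring.ring_simprules(27)[OF ring_A]
lemmas alg_a_closed = ring.ring_simprules(1)[OF ring_A]
lemmas alg_m_closed = ring.ring_simprules(5)[OF ring_A]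
lemmas alg_a_inv_closed = ring.ring_simprules(3)[OF ring_A]
lemmas alg_zero_closed = ring.ring_simprules(2)[OF ring_A]
lemmas alg_one_closed = ring.ring_simprules(6)[OF ring_A]
lemmas alg_l_zero = ring.ring_simprules(8)[OF ring_A]
lemmas alg_r_zero = ring.ring_simprules(15)[OF ring_A]
lemmas alg_l_one = ring.ring_simprules(12)[OF ring_A]
lemmas alg_r_one = monoid.r_one[OF ring.is_monoid[OF ring_A]]
lemmas alg_minus_equality = abelian_group.minus_equality[OF ring.is_abelian_group[OF ring_A]]
lemmas alg_a_ac = alg_a_assoc alg_a_comm alg_a_lcomm

lemma smult_closed' [simp, intro]: "x \<in> carrier A ==> c \<odot> x \<in> carrier A"
  using smult_closed[of c x] by (simp add: complex_ring_def)

lemma smult_l_distr': "x \<in> carrier A ==> (a + b) \<odot> x = a \<odot> x \<oplus> b \<odot> x"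
  using smult_l_distr[of a b x] by (simp add: complex_ring_def)

lemma smult_r_distr': "[|x \<in> carrier A; y \<in> carrier A|] ==> a \<odot> (x \<oplus> y) = a \<odot> x \<oplus> a \<odot> y"
  using smult_r_distr[of a x y] by (simp add: complex_ring_def)

lemma smult_assoc: "x \<in> carrier A ==> (a * b) \<odot> x = a \<odot> (b \<odot> x)"
  using smult_assoc1[of a b x] by (simp add: complex_ring_def)

lemma smult_one' [simp]: "x \<in> carrier A ==> 1 \<odot> x = x"
  using smult_one[of x] by (simp add: complex_ring_def)

lemma add_idem_zero: "[|z \<in> carrier A; z \<oplus> z = z|] ==> z = \<zero>"
  using alg_r_neg2[of z z] by (simp add: alg_l_neg)

lemma smult_zero_left [simp]: "x \<in> carrier A ==> 0 \<odot> x = \<zero>"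
  using smult_l_distr'[of x 0 0, symmetric] by (intro add_idem_zero) auto

lemma smult_zero_right [simp]: "a \<odot> \<zero> = \<zero>"
  using smult_r_distr'[of \<zero> \<zero> a, symmetric] by (intro add_idem_zero) auto

lemma neg_eq_smult: "x \<in> carrier A ==> \<ominus> x = (-1) \<odot> x"
  using smult_l_distr'[of x "-1" 1] by (intro alg_minus_equality) auto

lemma diff_eq_smult: "[|x \<in> carrier A; y \<in> carrier A|] ==> x \<ominus> y = x \<oplus> (-1) \<odot> y"
  by (simp add: alg_minus_eq neg_eq_smult)

lemma diff_closed [simp, intro]: "[|x \<in> carrier A; y \<in> carrier A|] ==> x \<ominus> y \<in> carrier A"
  by simp

lemma diff_add_swap:
  "[|a \<in> carrier A; b \<in> carrier A; c \<in> carrier A; d \<in> carrier A|] ==>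
     (a \<oplus> b) \<ominus> (c \<oplus> d) = (a \<ominus> c) \<oplus> (b \<ominus> d)"
  by (simp add: alg_minus_eq alg_minus_add alg_a_ac)

lemma diff_split:
  "[|a \<in> carrier A; b \<in> carrier A; c \<in> carrier A|] ==> a \<ominus> c = (a \<ominus> b) \<oplus> (b \<ominus> c)"
  by (simp add: alg_minus_eq alg_a_assoc alg_r_neg1)

lemma diff_mult_split:
  "[|a \<in> carrier A; b \<in> carrier A; c \<in> carrier A; d \<in> carrier A|] ==>
     a \<otimes> b \<ominus> c \<otimes> d = a \<otimes> (b \<ominus> d) \<oplus> (a \<ominus> c) \<otimes> d"
  by (simp add: alg_minus_eq alg_r_distr alg_l_distr alg_l_minus alg_r_minus alg_a_assoc alg_r_neg1)

lemma diff_smult: "[|a \<in> carrier A; b \<in> carrier A|] ==> c \<odot> a \<ominus> c \<odot> b = c \<odot> (a \<ominus> b)"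
  by (simp add: diff_eq_smult smult_r_distr' smult_assoc[symmetric])

lemma star_zero [simp]: "star A \<zero> = \<zero>"
proof -
  have "star A (0 \<odot> \<zero>) = cnj 0 \<odot> star A \<zero>" by (rule star_smult) simp
  then show ?thesis by (simp add: star_closed)
qed

lemma star_one [simp]: "star A \<one> = \<one>"
proof -
  have "star A (star A \<one> \<otimes> \<one>) = star A \<one> \<otimes> star A (star A \<one>)"
    by (rule star_mult) (auto simp: star_closed)
  then show ?thesis by (simp add: star_closed star_star)
qed

lemma star_diff: "[|a \<in> carrier A; b \<in> carrier A|] ==> star A (a \<ominus> b) = star A a \<ominus> star A b"
  by (simp add: diff_eq_smult star_add star_smult star_closed)

lemma diff_self [simp]: "a \<in> carrier A ==> a \<ominus> a = \<zero>"
  by (simp add: alg_minus_eq alg_r_neg)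

lemma diff_zero [simp]: "a \<in> carrier A ==> a \<ominus> \<zero> = a"
  by (simp add: alg_minus_eq)

lemma diff_add_cancel: "[|a \<in> carrier A; b \<in> carrier A|] ==> (a \<ominus> b) \<oplus> b = a"
  by (simp add: alg_minus_eq alg_a_assoc alg_l_neg)

lemma diff_eq_zeroD: "[|a \<in> carrier A; b \<in> carrier A; a \<ominus> b = \<zero>|] ==> a = b"
  using diff_add_cancel[of a b] by (simp add: alg_l_zero)

end

lemma star_homI:
  assumes "\<And>x. x \<in> carrier A ==> h x \<in> carrier B"
    and "\<And>x y. x \<in> carrier A ==> y \<in> carrier A ==> h (x \<otimes>\<^bsub>A\<^esub> y) = h x \<otimes>\<^bsub>B\<^esub> h y"
    and "\<And>x y. x \<in> carrier A ==> y \<in> carrier A ==> h (x \<oplus>\<^bsub>A\<^esub> y) = h x \<oplus>\<^bsub>B\<^esub> h y"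
    and "h \<one>\<^bsub>A\<^esub> = \<one>\<^bsub>B\<^esub>"
    and "\<And>c x. x \<in> carrier A ==> h (c \<odot>\<^bsub>A\<^esub> x) = c \<odot>\<^bsub>B\<^esub> h x"
    and "\<And>x. x \<in> carrier A ==> h (star A x) = star B (h x)"
  shows "h \<in> star_hom A B"
  using assms by (auto simp: star_hom_def intro!: ring_hom_memI)

lemma star_homD:
  assumes "h \<in> star_hom A B"
  shows "x \<in> carrier A ==> h x \<in> carrier B"
    and "[|x \<in> carrier A; y \<in> carrier A|] ==> h (x \<otimes>\<^bsub>A\<^esub> y) = h x \<otimes>\<^bsub>B\<^esub> h y"
    and "[|x \<in> carrier A; y \<in> carrier A|] ==> h (x \<oplus>\<^bsub>A\<^esub> y) = h x \<oplus>\<^bsub>B\<^esub> h y"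
    and "h \<one>\<^bsub>A\<^esub> = \<one>\<^bsub>B\<^esub>"
    and "x \<in> carrier A ==> h (c \<odot>\<^bsub>A\<^esub> x) = c \<odot>\<^bsub>B\<^esub> h x"
    and "x \<in> carrier A ==> h (star A x) = star B (h x)"
  using assms by (auto simp: star_hom_def dest: ring_hom_memE)

lemma star_hom_zero:
  assumes "h \<in> star_hom A B" "star_algebra A" "star_algebra B"
  shows "h \<zero>\<^bsub>A\<^esub> = \<zero>\<^bsub>B\<^esub>"
  using assms ring_hom_zero[of h A B] by (auto simp: star_hom_def star_algebra_def)

lemma star_hom_diff:
  assumes "h \<in> star_hom A B" "star_algebra A" "star_algebra B" "x \<in> carrier A" "y \<in> carrier A"
  shows "h (x \<ominus>\<^bsub>A\<^esub> y) = h x \<ominus>\<^bsub>B\<^esub> h y"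
  using assms by (simp add: star_algebra.diff_eq_smult star_homD star_algebra.smult_closed')

lemma star_hom_comp:
  assumes "g \<in> star_hom A B" "h \<in> star_hom B C"
  shows "(\<lambda>x. h (g x)) \<in> star_hom A C"
  using assms by (intro star_homI) (simp_all add: star_homD)

text \<open>Identities pass to the image of a map that preserves all operations, even if the target
  is a mere record. This is how the completion, the quotient of the diagonal algebra and the
  sections over that quotient become star-algebras.\<close>

lemma star_algebra_image:
  assumes "star_algebra A"
    and onto: "h ` carrier A = carrier B"
    and mult: "\<And>x y. x \<in> carrier A ==> y \<in> carrier A ==> h (x \<otimes>\<^bsub>A\<^esub> y) = h x \<otimes>\<^bsub>B\<^esub> h y"
    and add: "\<And>x y. x \<in> carrier A ==> y \<in> carrier A ==> h (x \<oplus>\<^bsub>A\<^esub> y) = h x \<oplus>\<^bsub>B\<^esub> h y"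
    and one: "h \<one>\<^bsub>A\<^esub> = \<one>\<^bsub>B\<^esub>" and zero: "h \<zero>\<^bsub>A\<^esub> = \<zero>\<^bsub>B\<^esub>"
    and smult: "\<And>c x. x \<in> carrier A ==> h (c \<odot>\<^bsub>A\<^esub> x) = c \<odot>\<^bsub>B\<^esub> h x"
    and star: "\<And>x. x \<in> carrier A ==> h (star A x) = star B (h x)"
  shows "star_algebra B"
proof -
  interpret A: star_algebra A by fact
  have rep: "\<exists>a\<in>carrier A. x = h a" if "x \<in> carrier B" for x using that onto by auto
  have hB: "h a \<in> carrier B" if "a \<in> carrier A" for a using that onto by auto
  note s = mult[symmetric] add[symmetric] one[symmetric] zero[symmetric] smult[symmetric] star[symmetric]
  show ?thesis
    \<comment> \<open>Every variable of an axiom is replaced by the image of an element of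
      \<open>A\<close>; what remains is the image of the same axiom in \<open>A\<close>.\<close>
    apply (rule star_algebraI; ((drule rep)+)?; (elim bexE)?)
                        apply (simp_all add: hB s A.star_closed A.alg_a_assoc A.alg_m_assoc A.alg_l_distr A.alg_r_distr
         A.smult_l_distr' A.smult_r_distr' A.smult_assoc A.smult_mult_left A.smult_mult_right
         A.star_star A.star_add A.star_smult A.star_mult A.alg_l_neg A.neg_eq_smult[symmetric])
    by (simp_all add: A.alg_a_comm)
qed

section \<open>C*-seminorms and completions\<close>

lemma tendsto_zero_sandwich:
  fixes f g :: "nat => real"
  assumes "g \<longlonglongrightarrow> 0" "\<And>n. 0 \<le> f n" "\<And>n. f n \<le> g n"
  shows "f \<longlonglongrightarrow> 0"
  using assms by (intro tendsto_sandwich[OF _ _ tendsto_const assms(1)]) auto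

locale cstar_seminormed = star_algebra A for A :: "('a, 'm) star_alg_scheme" (structure) +
  fixes p :: "'a => real"
  assumes cstar_seminorm_p: "cstar_seminorm A p"
begin

lemma p_nonneg [simp]: "x \<in> carrier A ==> 0 \<le> p x"
  and p_triangle: "[|x \<in> carrier A; y \<in> carrier A|] ==> p (x \<oplus> y) \<le> p x + p y"
  and p_smult: "x \<in> carrier A ==> p (c \<odot> x) = cmod c * p x"
  and p_mult: "[|x \<in> carrier A; y \<in> carrier A|] ==> p (x \<otimes> y) \<le> p x * p y"
  and p_cstar: "x \<in> carrier A ==> p (star A x \<otimes> x) = (p x)\<^sup>2"
  using cstar_seminorm_p unfolding cstar_seminorm_def by auto

lemma p_zero [simp]: "p \<zero> = 0"
  using p_smult[of \<zero> 0] by (simp add: alg_zero_closed)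

text \<open>From p(x)^2 = p(star(x) x) \<le> p(star(x)) p(x). Invariance under the involution is
  thus a consequence of the C*-identity; it is not among the conditions of
  \<open>cstar_seminorm\<close>.\<close>

lemma p_star_le: "x \<in> carrier A ==> p x \<le> p (star A x)"
proof -
  assume x: "x \<in> carrier A"
  have "(p x)\<^sup>2 \<le> p (star A x) * p x"
    using p_cstar[OF x] p_mult[of "star A x" x] x by (simp add: star_closed)
  then show ?thesis
    using x by (cases "p x = 0") (simp_all add: power2_eq_square star_closed less_le)
qed

lemma p_star [simp]: "x \<in> carrier A ==> p (star A x) = p x"
  using p_star_le[of x] p_star_le[of "star A x"] by (simp add: star_closed star_star)

text \<open>The C*-identity at the unit makes the value idempotent, hence 0 or 1. The value 0
  occurs, as the zero seminorm is allowed.\<close>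

lemma p_one_le: "p \<one> \<le> 1"
  using p_cstar[of \<one>] p_nonneg[of \<one>]
  by (simp add: alg_one_closed alg_l_one) (metis power2_eq_square mult_cancel_right1 order_refl zero_le_one)

text \<open>The means by which algebraic identities become estimates for an unknown
  seminorm.\<close>

lemma p_isometry_le:
  assumes "u \<in> carrier A" "p (star A u \<otimes> u) \<le> 1"
  shows "p u \<le> 1"
  using assms p_cstar[of u] by (simp add: power2_le_iff_abs_le abs_square_le_1)

lemma p_minus_commute: "[|x \<in> carrier A; y \<in> carrier A|] ==> p (x \<ominus> y) = p (y \<ominus> x)"
proof -
  assume x: "x \<in> carrier A" "y \<in> carrier A"
  have "y \<ominus> x = (-1) \<odot> (x \<ominus> y)"
    using x by (simp add: diff_eq_smult smult_r_distr' smult_assoc[symmetric] alg_a_comm)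
  then show ?thesis using p_smult[of "x \<ominus> y" "-1"] x by simp
qed

lemma p_diff_triangle:
  "[|x \<in> carrier A; y \<in> carrier A; z \<in> carrier A|] ==> p (x \<ominus> z) \<le> p (x \<ominus> y) + p (y \<ominus> z)"
  using diff_split[of x y z] p_triangle[of "x \<ominus> y" "y \<ominus> z"] by simp

lemma p_diff_abs: "[|x \<in> carrier A; y \<in> carrier A|] ==> \<bar>p x - p y\<bar> \<le> p (x \<ominus> y)"
proof -
  assume x: "x \<in> carrier A" "y \<in> carrier A"
  show ?thesis
    using p_triangle[of "x \<ominus> y" y] p_triangle[of "y \<ominus> x" x] x p_minus_commute[OF x]
    by (simp add: diff_add_cancel)
qed

lemma p_add_diff:
  "[|a \<in> carrier A; b \<in> carrier A; c \<in> carrier A; d \<in> carrier A|] ==>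
     p ((a \<oplus> b) \<ominus> (c \<oplus> d)) \<le> p (a \<ominus> c) + p (b \<ominus> d)"
  using p_triangle[of "a \<ominus> c" "b \<ominus> d"] by (simp add: diff_add_swap)

lemma p_mult_diff:
  assumes "a \<in> carrier A" "b \<in> carrier A" "c \<in> carrier A" "d \<in> carrier A"
  shows "p (a \<otimes> b \<ominus> c \<otimes> d) \<le> p a * p (b \<ominus> d) + p (a \<ominus> c) * p d"
  using assms p_triangle[of "a \<otimes> (b \<ominus> d)" "(a \<ominus> c) \<otimes> d"] p_mult[of a "b \<ominus> d"] p_mult[of "a \<ominus> c" d]
  by (simp add: diff_mult_split alg_m_closed)

lemma p_smult_diff: "[|a \<in> carrier A; b \<in> carrier A|] ==> p (c \<odot> a \<ominus> c \<odot> b) = cmod c * p (a \<ominus> b)"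
  by (simp add: diff_smult p_smult)

lemma p_star_diff: "[|a \<in> carrier A; b \<in> carrier A|] ==> p (star A a \<ominus> star A b) = p (a \<ominus> b)"
  by (simp add: star_diff[symmetric])

section \<open>Cauchy sequences in a C*-seminorm\<close>

abbreviation "CS \<equiv> Cauchy_seqs A p"

lemma CS_carrier: "x \<in> CS ==> x n \<in> carrier A"
  by (simp add: Cauchy_seqs_def)

lemma CSI:
  assumes "\<And>n. x n \<in> carrier A" "\<And>e. e > 0 ==> \<exists>N. \<forall>m\<ge>N. \<forall>n\<ge>N. p (x m \<ominus> x n) < e"
  shows "x \<in> CS"
  using assms by (simp add: Cauchy_seqs_def)

lemma CS_const: "a \<in> carrier A ==> (\<lambda>_. a) \<in> CS"
  by (simp add: Cauchy_seqs_def)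

lemma CS_add: "x \<in> CS ==> y \<in> CS ==> (\<lambda>n. x n \<oplus> y n) \<in> CS"
proof (rule CSI, simp add: alg_a_closed CS_carrier)
  fix e :: real assume x: "x \<in> CS" and y: "y \<in> CS" and e: "e > 0"
  obtain N1 where N1: "\<forall>m\<ge>N1. \<forall>n\<ge>N1. p (x m \<ominus> x n) < e/2"
    using x e unfolding Cauchy_seqs_def by (auto dest!: spec[of _ "e/2"])
  obtain N2 where N2: "\<forall>m\<ge>N2. \<forall>n\<ge>N2. p (y m \<ominus> y n) < e/2"
    using y e unfolding Cauchy_seqs_def by (auto dest!: spec[of _ "e/2"])
  show "\<exists>N. \<forall>m\<ge>N. \<forall>n\<ge>N. p (x m \<oplus> y m \<ominus> (x n \<oplus> y n)) < e"
  proof (intro exI allI impI)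
    fix m n assume "max N1 N2 \<le> m" "max N1 N2 \<le> n"
    then show "p (x m \<oplus> y m \<ominus> (x n \<oplus> y n)) < e"
      using p_add_diff[of "x m" "y m" "x n" "y n"] N1[rule_format, of m n] N2[rule_format, of m n]
        CS_carrier[OF x] CS_carrier[OF y] by simp
  qed
qed

lemma CS_smult: "x \<in> CS ==> (\<lambda>n. c \<odot> x n) \<in> CS"
proof (rule CSI, simp add: smult_closed' CS_carrier)
  fix e :: real assume x: "x \<in> CS" and e: "e > 0"
  have "e / (cmod c + 1) > 0" using e by (intro divide_pos_pos) (auto simp: add_nonneg_pos)
  then obtain N where N: "\<forall>m\<ge>N. \<forall>n\<ge>N. p (x m \<ominus> x n) < e / (cmod c + 1)"
    using x unfolding Cauchy_seqs_def by blast
  have "p (c \<odot> x m \<ominus> c \<odot> x n) < e" if "m \<ge> N" "n \<ge> N" for m n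
  proof -
    have nn: "0 \<le> p (x m \<ominus> x n)" using CS_carrier[OF x] by simp
    have "cmod c * p (x m \<ominus> x n) \<le> (cmod c + 1) * p (x m \<ominus> x n)"
      using nn by (simp add: algebra_simps)
    also have "\<dots> < (cmod c + 1) * (e / (cmod c + 1))"
      using N that by (intro mult_strict_left_mono) (auto simp: add_nonneg_pos)
    also have "\<dots> = e"
      by (simp add: add_nonneg_eq_0_iff)
    finally show ?thesis using CS_carrier[OF x] by (simp add: p_smult_diff)
  qed
  then show "\<exists>N. \<forall>m\<ge>N. \<forall>n\<ge>N. p (c \<odot> x m \<ominus> c \<odot> x n) < e" by blast
qed

lemma CS_star: "x \<in> CS ==> (\<lambda>n. star A (x n)) \<in> CS"
  by (auto simp: Cauchy_seqs_def p_star_diff star_closed)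

lemma CS_diff: "x \<in> CS ==> y \<in> CS ==> (\<lambda>n. x n \<ominus> y n) \<in> CS"
  using CS_add[of x "\<lambda>n. (-1) \<odot> y n"] CS_smult[of y "-1"] by (simp add: diff_eq_smult CS_carrier)

lemma CS_norm_convergent:
  assumes x: "x \<in> CS" shows "convergent (\<lambda>n. p (x n))"
proof (rule Cauchy_convergent, rule CauchyI)
  fix e :: real assume "e > 0"
  then obtain N where N: "\<forall>m\<ge>N. \<forall>n\<ge>N. p (x m \<ominus> x n) < e"
    using x unfolding Cauchy_seqs_def by blast
  show "\<exists>M. \<forall>m\<ge>M. \<forall>n\<ge>M. norm (p (x m) - p (x n)) < e"
  proof (intro exI allI impI)
    fix m n assume "N \<le> m" "N \<le> n"
    then show "norm (p (x m) - p (x n)) < e"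
      using p_diff_abs[of "x m" "x n"] N[rule_format, of m n] CS_carrier[OF x] by simp
  qed
qed

lemma CS_bounded:
  assumes x: "x \<in> CS" shows "\<exists>K>0. \<forall>n. p (x n) \<le> K"
  using convergent_imp_Bseq[OF CS_norm_convergent[OF x]] CS_carrier[OF x]
  by (auto simp: Bseq_def)

lemma CS_mult: "x \<in> CS ==> y \<in> CS ==> (\<lambda>n. x n \<otimes> y n) \<in> CS"
proof (rule CSI, simp add: alg_m_closed CS_carrier)
  fix e :: real assume x: "x \<in> CS" and y: "y \<in> CS" and e: "e > 0"
  obtain K1 where K1: "K1 > 0" "\<And>n. p (x n) \<le> K1" using CS_bounded[OF x] by blast
  obtain K2 where K2: "K2 > 0" "\<And>n. p (y n) \<le> K2" using CS_bounded[OF y] by blast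
  have "e/(2*K2) > 0" "e/(2*K1) > 0" using e K1 K2 by auto
  then obtain N1 N2 where N1: "\<forall>m\<ge>N1. \<forall>n\<ge>N1. p (x m \<ominus> x n) < e/(2*K2)"
    and N2: "\<forall>m\<ge>N2. \<forall>n\<ge>N2. p (y m \<ominus> y n) < e/(2*K1)"
    using x y unfolding Cauchy_seqs_def by blast
  show "\<exists>N. \<forall>m\<ge>N. \<forall>n\<ge>N. p (x m \<otimes> y m \<ominus> x n \<otimes> y n) < e"
  proof (intro exI allI impI)
    fix m n assume mn: "max N1 N2 \<le> m" "max N1 N2 \<le> n"
    note c = CS_carrier[OF x] CS_carrier[OF y]
    have "p (x m \<otimes> y m \<ominus> x n \<otimes> y n) \<le> p (x m) * p (y m \<ominus> y n) + p (x m \<ominus> x n) * p (y n)"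
      using c by (simp add: p_mult_diff)
    also have "\<dots> \<le> K1 * p (y m \<ominus> y n) + p (x m \<ominus> x n) * K2"
      using c K1 K2 by (intro add_mono mult_right_mono mult_left_mono) auto
    also have "\<dots> < K1 * (e/(2*K1)) + (e/(2*K2)) * K2"
      using c K1(1) K2(1) mn N1 N2 by (intro add_strict_mono mult_strict_left_mono mult_strict_right_mono) auto
    also have "\<dots> = e" using K1(1) K2(1) by simp
    finally show "p (x m \<otimes> y m \<ominus> x n \<otimes> y n) < e" .
  qed
qed

text \<open>An auxiliary algebra with pointwise operations. The completion is its image under
  passage to classes, so that the axioms are transported instead of being verified in the
  quotient.\<close>

definition seq_alg :: "(nat => 'a) star_alg" where
  "seq_alg = \<lparr>carrier = CS, mult = (\<lambda>x y n. x n \<otimes> y n), one = (\<lambda>_. \<one>), zero = (\<lambda>_. \<zero>),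
     add = (\<lambda>x y n. x n \<oplus> y n), smult = (\<lambda>c x n. c \<odot> x n), star = (\<lambda>x n. star A (x n))\<rparr>"

lemma star_algebra_seq_alg: "star_algebra seq_alg"
proof -
  show ?thesis
    by (rule star_algebraI)
      (simp_all add: seq_alg_def CS_const CS_add CS_mult CS_smult CS_star CS_carrier
        alg_zero_closed alg_one_closed alg_a_assoc alg_m_assoc alg_l_distr alg_r_distr
        smult_l_distr' smult_r_distr' smult_assoc smult_mult_left smult_mult_right alg_l_zero
        star_star star_add star_smult star_mult alg_l_neg neg_eq_smult[symmetric] alg_l_one alg_r_one alg_a_comm alg_a_lcomm alg_r_neg)
qed

section \<open>The quotient by null sequences\<close>

abbreviation "cls x \<equiv> null_rel A p `` {x}"

lemma null_rel_equiv: "equiv CS (null_rel A p)"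
proof (rule equivI)
  show "null_rel A p \<subseteq> CS \<times> CS" by (auto simp: null_rel_def)
  show "refl_on CS (null_rel A p)" by (auto simp: refl_on_def null_rel_def CS_carrier)
  show "sym (null_rel A p)"
  proof (rule symI)
    fix x y assume "(x, y) \<in> null_rel A p"
    moreover from this have "(\<lambda>n. p (x n \<ominus> y n)) = (\<lambda>n. p (y n \<ominus> x n))"
      by (auto simp: null_rel_def CS_carrier intro!: p_minus_commute)
    ultimately show "(y, x) \<in> null_rel A p" by (auto simp: null_rel_def)
  qed
  show "trans (null_rel A p)"
  proof (rule transI)
    fix x y z assume xy: "(x, y) \<in> null_rel A p" and yz: "(y, z) \<in> null_rel A p"
    have c: "x \<in> CS" "y \<in> CS" "z \<in> CS" using xy yz by (auto simp: null_rel_def)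
    have "(\<lambda>n. p (x n \<ominus> z n)) \<longlonglongrightarrow> 0"
    proof (rule tendsto_sandwich[OF _ _ tendsto_const])
      show "(\<lambda>n. p (x n \<ominus> y n) + p (y n \<ominus> z n)) \<longlonglongrightarrow> 0"
        using xy yz tendsto_add[of "\<lambda>n. p (x n \<ominus> y n)" 0 sequentially "\<lambda>n. p (y n \<ominus> z n)" 0]
        by (auto simp: null_rel_def)
    qed (use c in \<open>auto simp: CS_carrier p_diff_triangle\<close>)
    then show "(x, z) \<in> null_rel A p" using c by (auto simp: null_rel_def)
  qed
qed

lemma cls_eq_iff: "[|x \<in> CS; y \<in> CS|] ==> cls x = cls y \<longleftrightarrow> (\<lambda>n. p (x n \<ominus> y n)) \<longlonglongrightarrow> 0"
  using eq_equiv_class_iff[OF null_rel_equiv] by (simp add: null_rel_def)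

lemma cls_self: "x \<in> CS ==> x \<in> cls x"
  using equiv_class_self[OF null_rel_equiv] .

lemma cls_memD: "y \<in> cls x ==> x \<in> CS \<and> y \<in> CS \<and> cls y = cls x"
  using equiv_class_eq[OF null_rel_equiv, of x y] by (auto simp: null_rel_def)

lemma cls_memD2: "y \<in> cls x ==> (\<lambda>n. p (y n \<ominus> x n)) \<longlonglongrightarrow> 0"
  using cls_memD[of y x] cls_eq_iff[of y x] by simp

text \<open>The operations of \<open>completion\<close> are unions over all representatives; such a
  union collapses to its value at one representative once all its members agree.\<close>

lemma UN_cls:
  assumes "x \<in> CS" "\<And>x'. x' \<in> cls x ==> F x' = F x"
  shows "(\<Union>x'\<in>cls x. F x') = F x"
  using assms(2) by (intro UN_constant_eq[OF cls_self[OF assms(1)]]) blast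

lemma UN_cls2:
  assumes "x \<in> CS" "y \<in> CS" "\<And>x' y'. [|x' \<in> cls x; y' \<in> cls y|] ==> F x' y' = F x y"
  shows "(\<Union>x'\<in>cls x. \<Union>y'\<in>cls y. F x' y') = F x y"
proof -
  note y = cls_self[OF assms(2)]
  have inner: "(\<Union>y'\<in>cls y. F x' y') = F x' y" if "x' \<in> cls x" for x'
    by (rule UN_cls[OF assms(2)]) (rule trans[OF assms(3)[OF that] assms(3)[OF that y, symmetric]])
  have "(\<Union>x'\<in>cls x. \<Union>y'\<in>cls y. F x' y') = (\<Union>y'\<in>cls y. F x y')"
  proof (rule UN_cls[OF assms(1)])
    fix x' assume x': "x' \<in> cls x"
    show "(\<Union>y'\<in>cls y. F x' y') = (\<Union>y'\<in>cls y. F x y')"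
      by (rule trans[OF inner[OF x'] trans[OF assms(3)[OF x' y] inner[OF cls_self[OF assms(1)], symmetric]]])
  qed
  then show ?thesis
    using inner[OF cls_self[OF assms(1)]] by (rule trans)
qed

lemma cls_add:
  assumes x: "x \<in> CS" and y: "y \<in> CS"
  shows "add (completion A p) (cls x) (cls y) = cls (\<lambda>n. x n \<oplus> y n)"
proof -
  have "cls (\<lambda>n. x' n \<oplus> y' n) = cls (\<lambda>n. x n \<oplus> y n)" if "x' \<in> cls x" "y' \<in> cls y" for x' y'
  proof -
    have c: "x' \<in> CS" "y' \<in> CS" using that cls_memD by auto
    have "(\<lambda>n. p (x' n \<ominus> x n) + p (y' n \<ominus> y n)) \<longlonglongrightarrow> 0 + 0"
      by (intro tendsto_add cls_memD2 that)
    then have "(\<lambda>n. p ((x' n \<oplus> y' n) \<ominus> (x n \<oplus> y n))) \<longlonglongrightarrow> 0"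
      unfolding add_0 mult_zero_right mult_zero_left
      by (rule tendsto_zero_sandwich) (use c x y in \<open>simp_all add: CS_carrier p_add_diff alg_a_closed\<close>)
    then show ?thesis using c x y by (subst cls_eq_iff) (auto intro: CS_add)
  qed
  then show ?thesis
    unfolding completion_def cstar_alg.simps star_alg.simps module.simps ring.simps monoid.simps
    by (rule UN_cls2[OF x y])
qed

lemma cls_mult:
  assumes x: "x \<in> CS" and y: "y \<in> CS"
  shows "mult (completion A p) (cls x) (cls y) = cls (\<lambda>n. x n \<otimes> y n)"
proof -
  have "cls (\<lambda>n. x' n \<otimes> y' n) = cls (\<lambda>n. x n \<otimes> y n)" if "x' \<in> cls x" "y' \<in> cls y" for x' y'
  proof -
    have c: "x' \<in> CS" "y' \<in> CS" using that cls_memD by auto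
    have "(\<lambda>n. p (x' n)) \<longlonglongrightarrow> lim (\<lambda>n. p (x' n))" "(\<lambda>n. p (y n)) \<longlonglongrightarrow> lim (\<lambda>n. p (y n))"
      using CS_norm_convergent c y by (auto simp: convergent_LIMSEQ_iff)
    then have "(\<lambda>n. p (x' n) * p (y' n \<ominus> y n) + p (x' n \<ominus> x n) * p (y n)) \<longlonglongrightarrow>
        lim (\<lambda>n. p (x' n)) * 0 + 0 * lim (\<lambda>n. p (y n))"
      by (intro tendsto_add tendsto_mult cls_memD2 that)
    then have "(\<lambda>n. p ((x' n \<otimes> y' n) \<ominus> (x n \<otimes> y n))) \<longlonglongrightarrow> 0"
      unfolding add_0 mult_zero_right mult_zero_left
      by (rule tendsto_zero_sandwich) (use c x y in \<open>simp_all add: CS_carrier p_mult_diff alg_m_closed\<close>)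
    then show ?thesis using c x y by (subst cls_eq_iff) (auto intro: CS_mult)
  qed
  then show ?thesis
    unfolding completion_def cstar_alg.simps star_alg.simps module.simps ring.simps monoid.simps
    by (rule UN_cls2[OF x y])
qed

lemma cls_smult:
  assumes x: "x \<in> CS"
  shows "smult (completion A p) c (cls x) = cls (\<lambda>n. c \<odot> x n)"
proof -
  have "cls (\<lambda>n. c \<odot> x' n) = cls (\<lambda>n. c \<odot> x n)" if "x' \<in> cls x" for x'
  proof -
    have c: "x' \<in> CS" using that cls_memD by auto
    have "(\<lambda>n. cmod c * p (x' n \<ominus> x n)) \<longlonglongrightarrow> cmod c * 0"
      by (intro tendsto_mult tendsto_const cls_memD2 that)
    then show ?thesis using c x
      by (subst cls_eq_iff) (auto intro: CS_smult simp: p_smult_diff CS_carrier)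
  qed
  then show ?thesis
    unfolding completion_def cstar_alg.simps star_alg.simps module.simps ring.simps monoid.simps
    by (rule UN_cls[OF x])
qed

lemma cls_star:
  assumes x: "x \<in> CS"
  shows "star (completion A p) (cls x) = cls (\<lambda>n. star A (x n))"
proof -
  have "cls (\<lambda>n. star A (x' n)) = cls (\<lambda>n. star A (x n))" if "x' \<in> cls x" for x'
    using that x cls_memD[OF that] cls_memD2[OF that]
    by (subst cls_eq_iff) (auto intro: CS_star simp: p_star_diff CS_carrier)
  then show ?thesis
    unfolding completion_def cstar_alg.simps star_alg.simps module.simps ring.simps monoid.simps
    by (rule UN_cls[OF x])
qed

lemma completion_carrier: "carrier (completion A p) = cls ` CS"
  by (auto simp: completion_def quotient_def)

lemma completion_one_zero: "one (completion A p) = cls (\<lambda>_. \<one>)" "zero (completion A p) = cls (\<lambda>_. \<zero>)"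
  by (auto simp: completion_def completion_emb_def)

lemma star_algebra_completion: "star_algebra (completion A p)"
  by (rule star_algebra_image[OF star_algebra_seq_alg, of cls])
    (simp_all add: completion_carrier seq_alg_def cls_add cls_mult cls_smult cls_star completion_one_zero)

text \<open>By the reverse triangle inequality equivalent sequences have the same limit of
  seminorms, so the definite description in \<open>completion\<close> denotes this limit.\<close>

lemma nrm_cls:
  assumes x: "x \<in> CS" shows "(\<lambda>n. p (x n)) \<longlonglongrightarrow> nrm (completion A p) (cls x)"
proof -
  obtain r where r: "(\<lambda>n. p (x n)) \<longlonglongrightarrow> r"
    using CS_norm_convergent[OF x] by (auto simp: convergent_def)
  have all: "(\<lambda>n. p (x' n)) \<longlonglongrightarrow> r" if "x' \<in> cls x" for x'
  proof (rule Lim_transform[OF r])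
    have c: "x' \<in> CS" using that cls_memD by auto
    have "norm (p (x' n) - p (x n)) \<le> p (x' n \<ominus> x n)" for n
      using p_diff_abs[of "x' n" "x n"] CS_carrier[OF c] CS_carrier[OF x] by simp
    then show "(\<lambda>n. p (x' n) - p (x n)) \<longlonglongrightarrow> 0"
      by (intro Lim_null_comparison[OF _ cls_memD2[OF that]] always_eventually allI)
  qed
  have "nrm (completion A p) (cls x) = (THE r. \<forall>x'\<in>cls x. (\<lambda>n. p (x' n)) \<longlonglongrightarrow> r)"
    by (simp add: completion_def)
  also have "\<dots> = r"
    using all cls_self[OF x] r by (intro the_equality) (blast intro: LIMSEQ_unique)+
  finally show ?thesis using r by simp
qed

lemma completion_diff:
  assumes "x \<in> CS" "y \<in> CS"
  shows "cls x \<ominus>\<^bsub>completion A p\<^esub> cls y = cls (\<lambda>n. x n \<ominus> y n)"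
  using assms star_algebra.diff_eq_smult[OF star_algebra_completion, of "cls x" "cls y"]
  by (simp add: completion_carrier cls_smult cls_add CS_smult diff_eq_smult CS_carrier)

lemma nrm_cls_le:
  assumes "x \<in> CS" "\<And>n. n \<ge> N ==> p (x n) \<le> r"
  shows "nrm (completion A p) (cls x) \<le> r"
  using nrm_cls[OF assms(1)] by (rule Lim_bounded[where M = N]) (use assms in auto)

abbreviation "emb \<equiv> completion_emb A p"

lemma emb_cls: "emb a = cls (\<lambda>_. a)"
  by (simp add: completion_emb_def)

lemma nrm_emb: "a \<in> carrier A ==> nrm (completion A p) (emb a) = p a"
  using nrm_cls[OF CS_const, of a] by (simp add: emb_cls LIMSEQ_const_iff)

lemma emb_star_hom: "emb \<in> star_hom A (completion A p)"
  by (rule star_homI)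
    (simp_all add: emb_cls cls_add cls_mult cls_smult cls_star CS_const completion_carrier completion_one_zero)

lemma emb_dense:
  assumes "X \<in> carrier (completion A p)" "e > 0"
  shows "\<exists>a\<in>carrier A. nrm (completion A p) (X \<ominus>\<^bsub>completion A p\<^esub> emb a) < e"
proof -
  obtain x where x: "x \<in> CS" "X = cls x" using assms(1) completion_carrier by auto
  have "e/2 > 0" using assms by simp
  then obtain N where N: "\<forall>m\<ge>N. \<forall>n\<ge>N. p (x m \<ominus> x n) < e/2"
    using x(1) unfolding Cauchy_seqs_def by blast
  have "nrm (completion A p) (X \<ominus>\<^bsub>completion A p\<^esub> emb (x N)) \<le> e/2"
    unfolding x(2) emb_cls completion_diff[OF x(1) CS_const[OF CS_carrier[OF x(1)]]]
    using N by (intro nrm_cls_le[where N=N] CS_diff x CS_const CS_carrier) (auto simp: less_imp_le)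
  then show ?thesis using assms x CS_carrier[OF x(1)] by (intro bexI[of _ "x N"]) auto
qed

lemma nrm_completion_cstar_seminorm: "cstar_seminorm (completion A p) (nrm (completion A p))"
  unfolding cstar_seminorm_def
proof (intro conjI ballI allI)
  fix X assume "X \<in> carrier (completion A p)"
  then obtain x where x: "x \<in> CS" "X = cls x" using completion_carrier by auto
  show "0 \<le> nrm (completion A p) X"
    using nrm_cls[OF x(1)] x CS_carrier[OF x(1)] by (auto intro: LIMSEQ_le_const)
  show "nrm (completion A p) (c \<odot>\<^bsub>completion A p\<^esub> X) = cmod c * nrm (completion A p) X" for c
  proof (rule LIMSEQ_unique)
    show "(\<lambda>n. p (c \<odot> x n)) \<longlonglongrightarrow> nrm (completion A p) (c \<odot>\<^bsub>completion A p\<^esub> X)"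
      using nrm_cls[OF CS_smult[OF x(1)]] x by (simp add: cls_smult)
    show "(\<lambda>n. p (c \<odot> x n)) \<longlonglongrightarrow> cmod c * nrm (completion A p) X"
      using tendsto_mult[OF tendsto_const nrm_cls[OF x(1)]] x by (simp add: p_smult CS_carrier)
  qed
  show "nrm (completion A p) (star (completion A p) X \<otimes>\<^bsub>completion A p\<^esub> X) = (nrm (completion A p) X)\<^sup>2"
  proof (rule LIMSEQ_unique)
    show "(\<lambda>n. p (star A (x n) \<otimes> x n)) \<longlonglongrightarrow> nrm (completion A p) (star (completion A p) X \<otimes>\<^bsub>completion A p\<^esub> X)"
      using nrm_cls[OF CS_mult[OF CS_star[OF x(1)] x(1)]] x by (simp add: cls_star cls_mult CS_star)
    show "(\<lambda>n. p (star A (x n) \<otimes> x n)) \<longlonglongrightarrow> (nrm (completion A p) X)\<^sup>2"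
      using tendsto_power[OF nrm_cls[OF x(1)], of 2] x by (simp add: p_cstar CS_carrier)
  qed
  fix Y assume "Y \<in> carrier (completion A p)"
  then obtain y where y: "y \<in> CS" "Y = cls y" using completion_carrier by auto
  show "nrm (completion A p) (X \<oplus>\<^bsub>completion A p\<^esub> Y) \<le> nrm (completion A p) X + nrm (completion A p) Y"
    using LIMSEQ_le[OF nrm_cls[OF CS_add[OF x(1) y(1)]] tendsto_add[OF nrm_cls[OF x(1)] nrm_cls[OF y(1)]]]
      x y by (simp add: cls_add p_triangle CS_carrier)
  show "nrm (completion A p) (X \<otimes>\<^bsub>completion A p\<^esub> Y) \<le> nrm (completion A p) X * nrm (completion A p) Y"
    using LIMSEQ_le[OF nrm_cls[OF CS_mult[OF x(1) y(1)]] tendsto_mult[OF nrm_cls[OF x(1)] nrm_cls[OF y(1)]]]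
      x y by (simp add: cls_mult p_mult CS_carrier)
qed

lemma cstar_seminormed_completion: "cstar_seminormed (completion A p) (nrm (completion A p))"
  by (intro cstar_seminormed.intro cstar_seminormed_axioms.intro star_algebra_completion nrm_completion_cstar_seminorm)

lemma cstar_algebra_completion: "cstar_algebra (completion A p)"
proof (intro cstar_algebra.intro cstar_algebra_axioms.intro star_algebra_completion nrm_completion_cstar_seminorm)
  let ?C = "completion A p"
  interpret C: cstar_seminormed ?C "nrm ?C" by (rule cstar_seminormed_completion)
  fix X assume X: "X \<in> carrier ?C" "nrm ?C X = 0"
  then obtain x where x: "x \<in> CS" "X = cls x" using completion_carrier by auto
  show "X = \<zero>\<^bsub>?C\<^esub>"
    using nrm_cls[OF x(1)] X x unfolding x(2) completion_one_zero
    by (subst cls_eq_iff) (auto simp: CS_const alg_zero_closed CS_carrier)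
next
  let ?C = "completion A p"
  interpret C: cstar_seminormed ?C "nrm ?C" by (rule cstar_seminormed_completion)
  fix X assume X: "X \<in> Cauchy_seqs ?C (nrm ?C)"
  have Xc: "X n \<in> carrier ?C" for n using X by (auto simp: Cauchy_seqs_def)
  define r where "r n = 1 / real (Suc n)" for n
  have r_pos: "r n > 0" for n by (simp add: r_def)
  have r0: "r \<longlonglongrightarrow> 0" unfolding r_def using LIMSEQ_inverse_real_of_nat by (simp add: inverse_eq_divide)
  \<comment> \<open>Completeness: each \<open>X n\<close> is replaced by a constant sequence at
    distance less than \<open>r n\<close>. The constants form a Cauchy sequence in \<open>A\<close>,
    and its class is the limit of \<open>X\<close>.\<close>
  have "\<exists>a. a \<in> carrier A \<and> nrm ?C (X n \<ominus>\<^bsub>?C\<^esub> emb a) < r n" for n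
    using emb_dense[OF Xc r_pos] by blast
  then obtain y where y: "\<And>n. y n \<in> carrier A" "\<And>n. nrm ?C (X n \<ominus>\<^bsub>?C\<^esub> emb (y n)) < r n"
    by metis
  have ey: "emb (y n) \<in> carrier ?C" for n using y star_homD(1)[OF emb_star_hom] by auto
  have pe: "p (y m \<ominus> y n) = nrm ?C (emb (y m) \<ominus>\<^bsub>?C\<^esub> emb (y n))" for m n
    using y(1) star_hom_diff[OF emb_star_hom star_algebra_axioms star_algebra_completion, of "y m" "y n"]
      nrm_emb[of "y m \<ominus> y n"] by simp
  have yC: "y \<in> CS"
  proof (rule CSI[OF y(1)])
    fix e :: real assume e: "e > 0"
    then have "e/3 > 0" by simp
    then obtain N1 where N1: "\<forall>m\<ge>N1. \<forall>n\<ge>N1. nrm ?C (X m \<ominus>\<^bsub>?C\<^esub> X n) < e/3"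
      using X unfolding Cauchy_seqs_def by blast
    obtain N2 where N2: "\<And>n. n \<ge> N2 ==> r n < e/3"
      using order_tendstoD(2)[OF r0 \<open>e/3 > 0\<close>] by (auto simp: eventually_sequentially)
    have "p (y m \<ominus> y n) < e" if "m \<ge> max N1 N2" "n \<ge> max N1 N2" for m n
    proof -
      have "nrm ?C (emb (y m) \<ominus>\<^bsub>?C\<^esub> emb (y n)) \<le> nrm ?C (emb (y m) \<ominus>\<^bsub>?C\<^esub> X m) +
          (nrm ?C (X m \<ominus>\<^bsub>?C\<^esub> X n) + nrm ?C (X n \<ominus>\<^bsub>?C\<^esub> emb (y n)))"
        using C.p_diff_triangle[OF ey[of m] Xc[of m] ey[of n]] C.p_diff_triangle[OF Xc[of m] Xc[of n] ey[of n]]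
        by linarith
      also have "\<dots> < e/3 + (e/3 + e/3)"
        using y(2)[of m] y(2)[of n] N1 N2[of m] N2[of n] that C.p_minus_commute[OF ey[of m] Xc[of m]]
        by (intro add_strict_mono) (auto intro: less_trans)
      finally show ?thesis using pe by simp
    qed
    then show "\<exists>N. \<forall>m\<ge>N. \<forall>n\<ge>N. p (y m \<ominus> y n) < e" by blast
  qed
  have Yc: "cls y \<in> carrier ?C" using yC completion_carrier by auto
  have "(\<lambda>n. nrm ?C (emb (y n) \<ominus>\<^bsub>?C\<^esub> cls y)) \<longlonglongrightarrow> 0"
  proof (rule LIMSEQ_I)
    fix e :: real assume "e > 0"
    then have "e/2 > 0" by simp
    then obtain N where N: "\<forall>m\<ge>N. \<forall>n\<ge>N. p (y m \<ominus> y n) < e/2"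
      using yC unfolding Cauchy_seqs_def by blast
    have "nrm ?C (emb (y n) \<ominus>\<^bsub>?C\<^esub> cls y) \<le> e/2" if "n \<ge> N" for n
      unfolding emb_cls completion_diff[OF CS_const[OF y(1)] yC]
      using N that by (intro nrm_cls_le[where N=N] CS_diff yC CS_const y) (auto simp: less_imp_le)
    then show "\<exists>N. \<forall>n\<ge>N. norm (nrm ?C (emb (y n) \<ominus>\<^bsub>?C\<^esub> cls y) - 0) < e"
      using \<open>e > 0\<close> ey Yc by (intro exI[of _ N]) (fastforce intro: le_less_trans)
  qed
  then have lim: "(\<lambda>n. r n + nrm ?C (emb (y n) \<ominus>\<^bsub>?C\<^esub> cls y)) \<longlonglongrightarrow> 0"
    using tendsto_add[OF r0] by fastforce
  have "nrm ?C (X n \<ominus>\<^bsub>?C\<^esub> cls y) \<le> r n + nrm ?C (emb (y n) \<ominus>\<^bsub>?C\<^esub> cls y)" for n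
    using C.p_diff_triangle[OF Xc ey Yc, of n n] y(2)[of n] by linarith
  then have "(\<lambda>n. nrm ?C (X n \<ominus>\<^bsub>?C\<^esub> cls y)) \<longlonglongrightarrow> 0"
    by (intro tendsto_sandwich[OF _ _ tendsto_const lim] always_eventually) (auto simp: Xc Yc)
  then show "\<exists>x\<in>carrier ?C. (\<lambda>n. nrm ?C (X n \<ominus>\<^bsub>?C\<^esub> x)) \<longlonglongrightarrow> 0"
    using Yc by blast
qed

end

lemma cstar_algebra_seminormed: "cstar_algebra A ==> cstar_seminormed A (nrm A)"
  by (simp add: cstar_algebra_def cstar_algebra_axioms_def cstar_seminormed_def cstar_seminormed_axioms_def)

subsection \<open>Extension of star-homomorphisms from a dense image\<close>

text \<open>The C*-identity is left out, so that besides the norm of a C*-algebra the l1-norm on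
  finitely supported sections is covered.\<close>

definition continuous_norm :: "('a, 'm) star_alg_scheme => ('a => real) => bool" where
  "continuous_norm S N \<longleftrightarrow>
     (\<forall>x\<in>carrier S. 0 \<le> N x) \<and>
     (\<forall>x\<in>carrier S. \<forall>y\<in>carrier S. N (x \<oplus>\<^bsub>S\<^esub> y) \<le> N x + N y) \<and>
     (\<forall>c. \<forall>x\<in>carrier S. N (c \<odot>\<^bsub>S\<^esub> x) = cmod c * N x) \<and>
     (\<forall>x\<in>carrier S. \<forall>y\<in>carrier S. N (x \<otimes>\<^bsub>S\<^esub> y) \<le> N x * N y) \<and>
     (\<forall>x\<in>carrier S. N (star S x) \<le> N x)"

lemma (in cstar_seminormed) continuous_norm_p: "continuous_norm A p"
  unfolding continuous_norm_def by (simp add: p_triangle p_smult p_mult)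

text \<open>The closure of the set of pairs \<open>(f a, ev a)\<close> is the graph of a map: the
  bound makes the values unique, density and the completeness of \<open>B\<close> make them exist,
  and every operation passes to limits. It is also the bound that lets \<open>ev\<close> factor
  through \<open>f\<close> on the image of \<open>f\<close>.\<close>

lemma star_hom_extension:
  assumes A: "star_algebra A" and S: "star_algebra S" and B: "cstar_algebra B"
    and f: "f \<in> star_hom A S" and ev: "ev \<in> star_hom A B"
    and N: "continuous_norm S N"
    and bound: "\<And>a. a \<in> carrier A ==> nrm B (ev a) \<le> N (f a)"
    and dense: "\<And>s e. [|s \<in> carrier S; e > 0|] ==> \<exists>a\<in>carrier A. N (s \<ominus>\<^bsub>S\<^esub> f a) < e"
  obtains \<pi> where "\<pi> \<in> star_hom S B" "\<And>a. a \<in> carrier A ==> \<pi> (f a) = ev a"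
    "\<And>s. s \<in> carrier S ==> nrm B (\<pi> s) \<le> N s"
proof -
  interpret A: star_algebra A by fact
  interpret S: star_algebra S by fact
  interpret B: cstar_seminormed B "nrm B" by (rule cstar_algebra_seminormed[OF B])
  note fD = star_homD[OF f] and eD = star_homD[OF ev]
  note fdiff = star_hom_diff[OF f A S] and ediff = star_hom_diff[OF ev A B.star_algebra_axioms]
  have N_nonneg: "0 \<le> N x" if "x \<in> carrier S" for x
    using N that by (simp add: continuous_norm_def)
  have N_tri: "N (x \<oplus>\<^bsub>S\<^esub> y) \<le> N x + N y" if "x \<in> carrier S" "y \<in> carrier S" for x y
    using N that by (simp add: continuous_norm_def)
  have N_smult: "N (c \<odot>\<^bsub>S\<^esub> x) = cmod c * N x" if "x \<in> carrier S" for c x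
    using N that by (simp add: continuous_norm_def)
  have N_mult: "N (x \<otimes>\<^bsub>S\<^esub> y) \<le> N x * N y" if "x \<in> carrier S" "y \<in> carrier S" for x y
    using N that by (simp add: continuous_norm_def)
  have N_star: "N (star S x) \<le> N x" if "x \<in> carrier S" for x
    using N that by (simp add: continuous_norm_def)
  have N_zero: "N \<zero>\<^bsub>S\<^esub> = 0"
    using N_smult[of "\<zero>\<^bsub>S\<^esub>" 0] by (simp add: S.alg_zero_closed)
  have N_comm: "N (x \<ominus>\<^bsub>S\<^esub> y) = N (y \<ominus>\<^bsub>S\<^esub> x)" if x: "x \<in> carrier S" "y \<in> carrier S" for x y
  proof -
    have "y \<ominus>\<^bsub>S\<^esub> x = (-1) \<odot>\<^bsub>S\<^esub> (x \<ominus>\<^bsub>S\<^esub> y)"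
      using x by (simp add: S.diff_eq_smult S.smult_r_distr' S.smult_assoc[symmetric] S.alg_a_comm)
    then show ?thesis using N_smult[of "x \<ominus>\<^bsub>S\<^esub> y" "-1"] x by simp
  qed
  have N_diff_tri: "N (x \<ominus>\<^bsub>S\<^esub> z) \<le> N (x \<ominus>\<^bsub>S\<^esub> y) + N (y \<ominus>\<^bsub>S\<^esub> z)"
    if "x \<in> carrier S" "y \<in> carrier S" "z \<in> carrier S" for x y z
    using that S.diff_split[of x y z] N_tri[of "x \<ominus>\<^bsub>S\<^esub> y" "y \<ominus>\<^bsub>S\<^esub> z"] by simp
  \<comment> \<open>One and the same \<open>a\<close> serves both approximations; the pairs related
    by \<open>R\<close> form the closure of the graph.\<close>
  define R where "R s b \<longleftrightarrow> b \<in> carrier B \<and>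
     (\<forall>e>0. \<exists>a\<in>carrier A. N (s \<ominus>\<^bsub>S\<^esub> f a) < e \<and> nrm B (b \<ominus>\<^bsub>B\<^esub> ev a) < e)" for s b
  have bound_diff: "nrm B (ev a \<ominus>\<^bsub>B\<^esub> ev a') \<le> N (s \<ominus>\<^bsub>S\<^esub> f a) + N (s \<ominus>\<^bsub>S\<^esub> f a')"
    if "a \<in> carrier A" "a' \<in> carrier A" "s \<in> carrier S" for a a' s
    using bound[of "a \<ominus>\<^bsub>A\<^esub> a'"] that N_diff_tri[of "f a" s "f a'"] N_comm[of "f a" s] fD(1)
    by (simp add: fdiff ediff)
  have uniq: "b = b'" if s: "s \<in> carrier S" and b: "R s b" "R s b'" for s b b'
  proof -
    have bc: "b \<in> carrier B" "b' \<in> carrier B" using b by (auto simp: R_def)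
    have "nrm B (b \<ominus>\<^bsub>B\<^esub> b') \<le> 0"
    proof (rule field_le_epsilon)
      fix e :: real assume "e > 0"
      then have e: "e/4 > 0" by simp
      obtain a where a: "a \<in> carrier A" "N (s \<ominus>\<^bsub>S\<^esub> f a) < e/4" "nrm B (b \<ominus>\<^bsub>B\<^esub> ev a) < e/4"
        using b(1) e unfolding R_def by blast
      obtain a' where a': "a' \<in> carrier A" "N (s \<ominus>\<^bsub>S\<^esub> f a') < e/4" "nrm B (b' \<ominus>\<^bsub>B\<^esub> ev a') < e/4"
        using b(2) e unfolding R_def by blast
      have ec: "ev a \<in> carrier B" "ev a' \<in> carrier B" using a a' eD(1) by auto
      show "nrm B (b \<ominus>\<^bsub>B\<^esub> b') \<le> 0 + e"
        using B.p_diff_triangle[OF bc(1) ec(1) bc(2)] B.p_diff_triangle[OF ec(1) ec(2) bc(2)]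
          bound_diff[OF a(1) a'(1) s] B.p_minus_commute[OF bc(2) ec(2)] a a' by linarith
    qed
    then have "nrm B (b \<ominus>\<^bsub>B\<^esub> b') = 0" using bc by (simp add: order_antisym)
    then show ?thesis
      using bc by (intro B.diff_eq_zeroD[OF bc cstar_algebra.nrm_definite[OF B]]) auto
  qed
  have exist: "\<exists>b. R s b" if s: "s \<in> carrier S" for s
  proof -
    define r where "r n = 1 / real (Suc n)" for n
    have r_pos: "r n > 0" for n by (simp add: r_def)
    have r0: "r \<longlonglongrightarrow> 0" unfolding r_def using LIMSEQ_inverse_real_of_nat by (simp add: inverse_eq_divide)
    have "\<exists>a. a \<in> carrier A \<and> N (s \<ominus>\<^bsub>S\<^esub> f a) < r n" for n
      using dense[OF s r_pos] by blast
    then obtain a where a: "\<And>n. a n \<in> carrier A" "\<And>n. N (s \<ominus>\<^bsub>S\<^esub> f (a n)) < r n"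
      by metis
    have "(\<lambda>n. ev (a n)) \<in> Cauchy_seqs B (nrm B)"
    proof (rule B.CSI)
      show "ev (a n) \<in> carrier B" for n using a eD(1) by auto
      fix e :: real assume "e > 0"
      then have "e/2 > 0" by simp
      then obtain M where M: "\<And>n. n \<ge> M ==> r n < e/2"
        using order_tendstoD(2)[OF r0 \<open>e/2 > 0\<close>] by (auto simp: eventually_sequentially)
      have "nrm B (ev (a m) \<ominus>\<^bsub>B\<^esub> ev (a n)) < e" if "m \<ge> M" "n \<ge> M" for m n
        using bound_diff[OF a(1) a(1) s, of m n] a(2)[of m] a(2)[of n] M[OF that(1)] M[OF that(2)] by linarith
      then show "\<exists>N. \<forall>m\<ge>N. \<forall>n\<ge>N. nrm B (ev (a m) \<ominus>\<^bsub>B\<^esub> ev (a n)) < e" by blast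
    qed
    from cstar_algebra.complete[OF B this] obtain b where b: "b \<in> carrier B"
      "(\<lambda>n. nrm B (ev (a n) \<ominus>\<^bsub>B\<^esub> b)) \<longlonglongrightarrow> 0" by blast
    have "\<exists>a\<in>carrier A. N (s \<ominus>\<^bsub>S\<^esub> f a) < e \<and> nrm B (b \<ominus>\<^bsub>B\<^esub> ev a) < e" if "e > 0" for e
    proof -
      have "\<forall>\<^sub>F n in sequentially. r n < e \<and> nrm B (ev (a n) \<ominus>\<^bsub>B\<^esub> b) < e"
        using order_tendstoD(2)[OF r0 \<open>e > 0\<close>] order_tendstoD(2)[OF b(2) \<open>e > 0\<close>] by eventually_elim simp
      then obtain n where "r n < e" "nrm B (ev (a n) \<ominus>\<^bsub>B\<^esub> b) < e"
        by (auto simp: eventually_sequentially)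
      then show ?thesis
        using a[of n] b(1) eD(1)[OF a(1)] B.p_minus_commute[of b "ev (a n)"] by (intro bexI[of _ "a n"]) auto
    qed
    then show ?thesis using b by (auto simp: R_def)
  qed
  define \<pi> where "\<pi> s = (SOME b. R s b)" for s
  have R: "R s (\<pi> s)" if "s \<in> carrier S" for s
    unfolding \<pi>_def using exist[OF that] by (rule someI_ex)
  have eq: "\<pi> s = b" if "s \<in> carrier S" "R s b" for s b
    using uniq R that by blast
  have c: "\<pi> s \<in> carrier B" if "s \<in> carrier S" for s using R[OF that] by (simp add: R_def)
  have on_f: "\<pi> (f a) = ev a" if "a \<in> carrier A" for a
    using that fD(1) eD(1) N_zero by (intro eq) (auto simp: R_def intro!: bexI[of _ a])
  have nrm_le: "nrm B (\<pi> s) \<le> N s" if s: "s \<in> carrier S" for s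
  proof (rule field_le_epsilon)
    fix e :: real assume "e > 0"
    then have e: "e/2 > 0" by simp
    then obtain a where a: "a \<in> carrier A" "N (s \<ominus>\<^bsub>S\<^esub> f a) < e/2" "nrm B (\<pi> s \<ominus>\<^bsub>B\<^esub> ev a) < e/2"
      using R[OF s] unfolding R_def by blast
    have fa: "f a \<in> carrier S" using a fD by auto
    have "nrm B (\<pi> s) \<le> nrm B (\<pi> s \<ominus>\<^bsub>B\<^esub> ev a) + nrm B (ev a)"
      using B.p_triangle[of "\<pi> s \<ominus>\<^bsub>B\<^esub> ev a" "ev a"] a c[OF s] eD(1) by (simp add: B.diff_add_cancel)
    moreover have "N (f a) \<le> N (f a \<ominus>\<^bsub>S\<^esub> s) + N s"
      using N_tri[of "f a \<ominus>\<^bsub>S\<^esub> s" s] s fa by (simp add: S.diff_add_cancel)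
    ultimately show "nrm B (\<pi> s) \<le> N s + e"
      using bound[OF a(1)] a N_comm[OF s fa] by linarith
  qed
  have approx: "\<exists>a\<in>carrier A. N (s \<ominus>\<^bsub>S\<^esub> f a) < e \<and> nrm B (\<pi> s \<ominus>\<^bsub>B\<^esub> ev a) < e"
    if "s \<in> carrier S" "e > 0" for s e
    using R[OF that(1)] that(2) by (auto simp: R_def)
  have "\<pi> \<in> star_hom S B"
  proof (rule star_homI)
    show "\<pi> x \<in> carrier B" if "x \<in> carrier S" for x using c[OF that] .
    show "\<pi> \<one>\<^bsub>S\<^esub> = \<one>\<^bsub>B\<^esub>"
      using on_f[of "\<one>\<^bsub>A\<^esub>"] fD(4) eD(4) by (simp add: A.alg_one_closed)
    show "\<pi> (star S x) = star B (\<pi> x)" if x: "x \<in> carrier S" for x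
    proof (rule eq)
      show "R (star S x) (star B (\<pi> x))"
        unfolding R_def
      proof (intro conjI allI impI)
        fix e :: real assume "e > 0"
        with approx[OF x] obtain a where a: "a \<in> carrier A" "N (x \<ominus>\<^bsub>S\<^esub> f a) < e" "nrm B (\<pi> x \<ominus>\<^bsub>B\<^esub> ev a) < e"
          by blast
        then show "\<exists>a\<in>carrier A. N (star S x \<ominus>\<^bsub>S\<^esub> f a) < e \<and> nrm B (star B (\<pi> x) \<ominus>\<^bsub>B\<^esub> ev a) < e"
          using N_star[of "x \<ominus>\<^bsub>S\<^esub> f a"] x c[OF x] fD(1) eD(1)
          by (intro bexI[of _ "star A a"])
            (auto simp: A.star_closed fD eD S.star_diff[symmetric] B.p_star_diff intro: le_less_trans)
      qed (use x c B.star_closed in auto)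
    qed (use x S.star_closed in auto)
    show "\<pi> (k \<odot>\<^bsub>S\<^esub> x) = k \<odot>\<^bsub>B\<^esub> \<pi> x" if x: "x \<in> carrier S" for k x
    proof (rule eq)
      show "R (k \<odot>\<^bsub>S\<^esub> x) (k \<odot>\<^bsub>B\<^esub> \<pi> x)"
        unfolding R_def
      proof (intro conjI allI impI)
        fix e :: real assume e: "e > 0"
        have k: "cmod k + 1 > 0" by (simp add: add_nonneg_pos)
        then obtain a where a: "a \<in> carrier A" "N (x \<ominus>\<^bsub>S\<^esub> f a) < e / (cmod k + 1)"
          "nrm B (\<pi> x \<ominus>\<^bsub>B\<^esub> ev a) < e / (cmod k + 1)"
          using approx[OF x, of "e / (cmod k + 1)"] e by auto
        have *: "cmod k * t < e" if "0 \<le> t" "t < e / (cmod k + 1)" for t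
        proof -
          have "cmod k * t \<le> (cmod k + 1) * t" using that by (simp add: algebra_simps)
          also have "\<dots> < e" using that k by (simp add: field_simps)
          finally show ?thesis .
        qed
        show "\<exists>a\<in>carrier A. N (k \<odot>\<^bsub>S\<^esub> x \<ominus>\<^bsub>S\<^esub> f a) < e \<and> nrm B (k \<odot>\<^bsub>B\<^esub> \<pi> x \<ominus>\<^bsub>B\<^esub> ev a) < e"
          using a x c[OF x] fD(1) eD(1) *[OF N_nonneg a(2)] *[OF B.p_nonneg a(3)]
          by (intro bexI[of _ "k \<odot>\<^bsub>A\<^esub> a"]) (auto simp: fD eD S.diff_smult N_smult B.p_smult_diff)
      qed (use x c in auto)
    qed (use x in auto)
    fix x y assume x: "x \<in> carrier S" and y: "y \<in> carrier S"
    show "\<pi> (x \<oplus>\<^bsub>S\<^esub> y) = \<pi> x \<oplus>\<^bsub>B\<^esub> \<pi> y"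
    proof (rule eq)
      show "R (x \<oplus>\<^bsub>S\<^esub> y) (\<pi> x \<oplus>\<^bsub>B\<^esub> \<pi> y)"
        unfolding R_def
      proof (intro conjI allI impI)
        fix e :: real assume "e > 0"
        then have e: "e/2 > 0" by simp
        obtain a where a: "a \<in> carrier A" "N (x \<ominus>\<^bsub>S\<^esub> f a) < e/2" "nrm B (\<pi> x \<ominus>\<^bsub>B\<^esub> ev a) < e/2"
          using approx[OF x e] by blast
        obtain b where b: "b \<in> carrier A" "N (y \<ominus>\<^bsub>S\<^esub> f b) < e/2" "nrm B (\<pi> y \<ominus>\<^bsub>B\<^esub> ev b) < e/2"
          using approx[OF y e] by blast
        note cc = c[OF x] c[OF y] fD(1)[OF a(1)] fD(1)[OF b(1)] eD(1)[OF a(1)] eD(1)[OF b(1)]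
        have "N (x \<oplus>\<^bsub>S\<^esub> y \<ominus>\<^bsub>S\<^esub> (f a \<oplus>\<^bsub>S\<^esub> f b)) < e"
          using N_tri[of "x \<ominus>\<^bsub>S\<^esub> f a" "y \<ominus>\<^bsub>S\<^esub> f b"] x y a b cc by (simp add: S.diff_add_swap)
        moreover have "nrm B (\<pi> x \<oplus>\<^bsub>B\<^esub> \<pi> y \<ominus>\<^bsub>B\<^esub> (ev a \<oplus>\<^bsub>B\<^esub> ev b)) < e"
          using B.p_add_diff[of "\<pi> x" "\<pi> y" "ev a" "ev b"] x y a b cc by linarith
        ultimately show "\<exists>a\<in>carrier A. N (x \<oplus>\<^bsub>S\<^esub> y \<ominus>\<^bsub>S\<^esub> f a) < e \<and> nrm B (\<pi> x \<oplus>\<^bsub>B\<^esub> \<pi> y \<ominus>\<^bsub>B\<^esub> ev a) < e"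
          using a b by (intro bexI[of _ "a \<oplus>\<^bsub>A\<^esub> b"]) (auto simp: fD eD A.alg_a_closed)
      qed (use x y c B.alg_a_closed in auto)
    qed (use x y S.alg_a_closed in auto)
    show "\<pi> (x \<otimes>\<^bsub>S\<^esub> y) = \<pi> x \<otimes>\<^bsub>B\<^esub> \<pi> y"
    proof (rule eq)
      show "R (x \<otimes>\<^bsub>S\<^esub> y) (\<pi> x \<otimes>\<^bsub>B\<^esub> \<pi> y)"
        unfolding R_def
      proof (intro conjI allI impI)
        fix e :: real assume e0: "e > 0"
        define M where "M = N x + N y + 1"
        have M: "M > 0" using N_nonneg[OF x] N_nonneg[OF y] by (simp add: M_def)
        \<comment> \<open>Chosen for the product estimate
          \<open>N x * d + d * (N y + 1) = d * M\<close>. The bound \<open>d \<le> 1\<close> gives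
          \<open>N (f b) \<le> N y + 1\<close>, and the factor 2 makes the final inequality
          strict.\<close>
        define d where "d = min 1 (e / (2 * M))"
        have d: "d > 0" "d \<le> 1" "d * (2 * M) \<le> e" using e0 M by (auto simp: d_def min_def field_simps)
        obtain a where a: "a \<in> carrier A" "N (x \<ominus>\<^bsub>S\<^esub> f a) < d" "nrm B (\<pi> x \<ominus>\<^bsub>B\<^esub> ev a) < d"
          using approx[OF x d(1)] by blast
        obtain b where b: "b \<in> carrier A" "N (y \<ominus>\<^bsub>S\<^esub> f b) < d" "nrm B (\<pi> y \<ominus>\<^bsub>B\<^esub> ev b) < d"
          using approx[OF y d(1)] by blast
        note cc = c[OF x] c[OF y] fD(1)[OF a(1)] fD(1)[OF b(1)] eD(1)[OF a(1)] eD(1)[OF b(1)]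
        have fb: "N (f b) \<le> N y + 1"
          using N_tri[of "f b \<ominus>\<^bsub>S\<^esub> y" y] y cc b d N_comm[OF y cc(4)] by (simp add: S.diff_add_cancel)
        have *: "t * s + t' * s' < e" if "0 \<le> t" "t \<le> N x" "0 \<le> s" "s < d" "0 \<le> t'" "t' < d" "0 \<le> s'" "s' \<le> N y + 1"
          for t s t' s'
        proof -
          have "t * s + t' * s' \<le> N x * d + d * (N y + 1)"
            using that d by (intro add_mono mult_mono) auto
          also have "\<dots> = d * M" by (simp add: M_def algebra_simps)
          also have "\<dots> < d * (2 * M)" using d M by simp
          finally show ?thesis using d by linarith
        qed
        have "N (x \<otimes>\<^bsub>S\<^esub> y \<ominus>\<^bsub>S\<^esub> f a \<otimes>\<^bsub>S\<^esub> f b) \<le> N x * N (y \<ominus>\<^bsub>S\<^esub> f b) + N (x \<ominus>\<^bsub>S\<^esub> f a) * N (f b)"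
          using x y cc N_tri[of "x \<otimes>\<^bsub>S\<^esub> (y \<ominus>\<^bsub>S\<^esub> f b)" "(x \<ominus>\<^bsub>S\<^esub> f a) \<otimes>\<^bsub>S\<^esub> f b"]
            N_mult[of x "y \<ominus>\<^bsub>S\<^esub> f b"] N_mult[of "x \<ominus>\<^bsub>S\<^esub> f a" "f b"]
          by (simp add: S.diff_mult_split S.alg_m_closed)
        also have "\<dots> < e"
          using a b fb x y cc by (intro *) (auto simp: N_nonneg)
        finally have 1: "N (x \<otimes>\<^bsub>S\<^esub> y \<ominus>\<^bsub>S\<^esub> f a \<otimes>\<^bsub>S\<^esub> f b) < e" .
        have "nrm B (\<pi> x \<otimes>\<^bsub>B\<^esub> \<pi> y \<ominus>\<^bsub>B\<^esub> ev a \<otimes>\<^bsub>B\<^esub> ev b) \<le>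
            nrm B (\<pi> x) * nrm B (\<pi> y \<ominus>\<^bsub>B\<^esub> ev b) + nrm B (\<pi> x \<ominus>\<^bsub>B\<^esub> ev a) * nrm B (ev b)"
          by (rule B.p_mult_diff) (use cc in auto)
        also have "\<dots> < e"
          using a b fb x y cc nrm_le[OF x] bound[OF b(1)] by (intro *) (auto simp: B.p_nonneg)
        finally have 2: "nrm B (\<pi> x \<otimes>\<^bsub>B\<^esub> \<pi> y \<ominus>\<^bsub>B\<^esub> ev a \<otimes>\<^bsub>B\<^esub> ev b) < e" .
        show "\<exists>a\<in>carrier A. N (x \<otimes>\<^bsub>S\<^esub> y \<ominus>\<^bsub>S\<^esub> f a) < e \<and> nrm B (\<pi> x \<otimes>\<^bsub>B\<^esub> \<pi> y \<ominus>\<^bsub>B\<^esub> ev a) < e"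
          using a b 1 2 by (intro bexI[of _ "a \<otimes>\<^bsub>A\<^esub> b"]) (auto simp: fD eD A.alg_m_closed)
      qed (use x y c B.alg_m_closed in auto)
    qed (use x y S.alg_m_closed in auto)
  qed
  then show thesis using on_f nrm_le by (rule that)
qed

text \<open>By the equality of norms each of the two maps extends along the other to a contraction;
  the two composites fix a dense set and are therefore identities.\<close>

lemma isomorphic_via_of_dense:
  assumes A: "star_algebra A" and B: "cstar_algebra B" and C: "cstar_algebra C"
    and f: "f \<in> star_hom A B" and g: "g \<in> star_hom A C"
    and eq: "\<And>a. a \<in> carrier A ==> nrm B (f a) = nrm C (g a)"
    and f_dense: "\<And>s e. [|s \<in> carrier B; e > 0|] ==> \<exists>a\<in>carrier A. nrm B (s \<ominus>\<^bsub>B\<^esub> f a) < e"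
    and g_dense: "\<And>s e. [|s \<in> carrier C; e > 0|] ==> \<exists>a\<in>carrier A. nrm C (s \<ominus>\<^bsub>C\<^esub> g a) < e"
    and gens: "\<And>i. i \<in> I ==> x i \<in> carrier A" "\<And>i. i \<in> I ==> f (x i) = b i" "\<And>i. i \<in> I ==> g (x i) = c i"
  shows "isomorphic_via I B b C c"
proof -
  interpret B: cstar_seminormed B "nrm B" by (rule cstar_algebra_seminormed[OF B])
  interpret C: cstar_seminormed C "nrm C" by (rule cstar_algebra_seminormed[OF C])
  obtain \<phi> where \<phi>: "\<phi> \<in> star_hom B C" "\<And>a. a \<in> carrier A ==> \<phi> (f a) = g a"
    "\<And>s. s \<in> carrier B ==> nrm C (\<phi> s) \<le> nrm B s"
    using star_hom_extension[OF A B.star_algebra_axioms C f g B.continuous_norm_p _ f_dense] eq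
    by (metis order_refl)
  obtain \<psi> where \<psi>: "\<psi> \<in> star_hom C B" "\<And>a. a \<in> carrier A ==> \<psi> (g a) = f a"
    "\<And>s. s \<in> carrier C ==> nrm B (\<psi> s) \<le> nrm C s"
    using star_hom_extension[OF A C.star_algebra_axioms B g f C.continuous_norm_p _ g_dense] eq
    by (metis order_refl)
  \<comment> \<open>Stated for arbitrary algebras because it is used for both orders of composition.
    A point \<open>f' a\<close> near \<open>s\<close> is fixed by the composite, which is a
    contraction, so \<open>s\<close> and its image are both close to \<open>f' a\<close>.\<close>
  have inv: "\<psi>' (\<phi>' s) = s"
    if B': "cstar_algebra B'" and C': "cstar_algebra C'" and f': "f' \<in> star_hom A B'"
      and d: "\<And>s e. [|s \<in> carrier B'; e > 0|] ==> \<exists>a\<in>carrier A. nrm B' (s \<ominus>\<^bsub>B'\<^esub> f' a) < e"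
      and \<phi>': "\<phi>' \<in> star_hom B' C'" "\<And>a. a \<in> carrier A ==> \<phi>' (f' a) = g' a"
        "\<And>s. s \<in> carrier B' ==> nrm C' (\<phi>' s) \<le> nrm B' s"
      and \<psi>': "\<psi>' \<in> star_hom C' B'" "\<And>a. a \<in> carrier A ==> \<psi>' (g' a) = f' a"
        "\<And>s. s \<in> carrier C' ==> nrm B' (\<psi>' s) \<le> nrm C' s"
      and s: "s \<in> carrier B'"
    for B' :: "('x, 'xm) cstar_alg_scheme" and C' :: "('y, 'ym) cstar_alg_scheme" and f' g' \<phi>' \<psi>' s
  proof -
    interpret B': cstar_seminormed B' "nrm B'" by (rule cstar_algebra_seminormed[OF B'])
    interpret C': cstar_seminormed C' "nrm C'" by (rule cstar_algebra_seminormed[OF C'])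
    let ?t = "\<psi>' (\<phi>' s)"
    have t: "?t \<in> carrier B'" using s \<phi>'(1) \<psi>'(1) by (simp add: star_homD)
    have "nrm B' (?t \<ominus>\<^bsub>B'\<^esub> s) \<le> 0"
    proof (rule field_le_epsilon)
      fix e :: real assume "e > 0"
      then have "e/2 > 0" by simp
      then obtain a where a: "a \<in> carrier A" "nrm B' (s \<ominus>\<^bsub>B'\<^esub> f' a) < e/2" using d[OF s] by blast
      have fa: "f' a \<in> carrier B'" using f' a by (simp add: star_homD)
      have "?t \<ominus>\<^bsub>B'\<^esub> f' a = \<psi>' (\<phi>' (s \<ominus>\<^bsub>B'\<^esub> f' a))"
      proof -
        have "g' a \<in> carrier C'" using star_homD(1)[OF \<phi>'(1) fa] \<phi>'(2)[OF a(1)] by simp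
        then have "\<psi>' (\<phi>' s \<ominus>\<^bsub>C'\<^esub> g' a) = ?t \<ominus>\<^bsub>B'\<^esub> f' a"
          using star_hom_diff[OF \<psi>'(1) C'.star_algebra_axioms B'.star_algebra_axioms star_homD(1)[OF \<phi>'(1) s]]
            \<psi>'(2)[OF a(1)] by simp
        then show ?thesis
          using star_hom_diff[OF \<phi>'(1) B'.star_algebra_axioms C'.star_algebra_axioms s fa] \<phi>'(2)[OF a(1)] by simp
      qed
      then have "nrm B' (?t \<ominus>\<^bsub>B'\<^esub> f' a) \<le> nrm B' (s \<ominus>\<^bsub>B'\<^esub> f' a)"
        using order_trans[OF \<psi>'(3)[OF star_homD(1)[OF \<phi>'(1)]] \<phi>'(3)] B'.diff_closed[OF s fa] by simp
      then show "nrm B' (?t \<ominus>\<^bsub>B'\<^esub> s) \<le> 0 + e"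
        using B'.p_diff_triangle[OF t fa s] B'.p_minus_commute[OF s fa] a by linarith
    qed
    then have "nrm B' (?t \<ominus>\<^bsub>B'\<^esub> s) = 0" using s t by (simp add: order_antisym)
    then show ?thesis
      using s t by (intro B'.diff_eq_zeroD[OF t s cstar_algebra.nrm_definite[OF B']]) auto
  qed
  have 1: "\<psi> (\<phi> s) = s" if "s \<in> carrier B" for s
    by (rule inv[OF B C f f_dense \<phi> \<psi>]) (use that in auto)
  have 2: "\<phi> (\<psi> s) = s" if "s \<in> carrier C" for s
    by (rule inv[OF C B g g_dense \<psi> \<phi>]) (use that in auto)
  have "bij_betw \<phi> (carrier B) (carrier C)"
    by (rule bij_betw_byWitness[where f' = \<psi>])
      (use 1 2 star_homD(1)[OF \<phi>(1)] star_homD(1)[OF \<psi>(1)] in auto)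
  moreover have "\<phi> (b i) = c i" if "i \<in> I" for i
    using \<phi>(2)[OF gens(1)[OF that]] gens(2,3)[OF that] by simp
  ultimately show ?thesis
    unfolding isomorphic_via_def using B C \<phi>(1) by blast
qed

section \<open>The free star-algebra\<close>

context star_algebra
begin

lemma abelian_monoid_A: "abelian_monoid A"
  using ring_A by (simp add: ring_def abelian_group_def)

lemmas alg_finsum_closed = abelian_monoid.finsum_closed[OF abelian_monoid_A]
lemmas alg_finsum_cong' = abelian_monoid.finsum_cong'[OF abelian_monoid_A]
lemmas alg_finsum_addf = abelian_monoid.finsum_addf[OF abelian_monoid_A]
lemmas alg_finsum_insert = abelian_monoid.finsum_insert[OF abelian_monoid_A]
lemmas alg_finsum_empty [simp] = abelian_monoid.finsum_empty[OF abelian_monoid_A]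

lemma alg_finsum_mono_neutral:
  assumes "finite Y" "X \<subseteq> Y" "\<And>i. i \<in> Y - X ==> h i = \<zero>" "\<And>i. i \<in> X ==> f i = h i" "h \<in> Y \<rightarrow> carrier A"
  shows "finsum A f X = finsum A h Y"
  using comm_monoid.finprod_mono_neutral_cong_left[OF abelian_monoid.a_comm_monoid[OF abelian_monoid_A], of Y X h f] assms
  unfolding finsum_def by simp

end

text \<open>The adjoint of a monomial: the order is reversed and each generator is exchanged with
  its adjoint.\<close>

definition inv_word :: "('g \<times> bool) list => ('g \<times> bool) list" where
  "inv_word u = rev (map (map_prod id Not) u)"

lemma inv_word_simps [simp]:
  "inv_word [] = []" "inv_word (u @ v) = inv_word v @ inv_word u"
  "inv_word (a # u) = inv_word u @ [map_prod id Not a]"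
  "inv_word (inv_word u) = u" "length (inv_word u) = length u"
  "fst ` set (inv_word u) = fst ` set u"
  by (auto simp: inv_word_def rev_map image_image o_def map_prod_def case_prod_unfold)

lemma inv_word_eq_iff: "inv_word u = v \<longleftrightarrow> u = inv_word v"
  by auto

lemma take_inv_word: "take i (inv_word u) = inv_word (drop (length u - i) u)"
  and drop_inv_word: "drop i (inv_word u) = inv_word (take (length u - i) u)"
  by (auto simp: inv_word_def take_rev drop_rev drop_map take_map)

lemma free_carrier: "x \<in> carrier (free_star_alg P) \<longleftrightarrow> finite {u. x u \<noteq> 0} \<and> (\<forall>u. x u \<noteq> 0 \<longrightarrow> fst ` set u \<subseteq> P)"
  by (simp add: free_star_alg_def)

lemma free_ops:
  "mult (free_star_alg P) x y = (\<lambda>u. \<Sum>i\<le>length u. x (take i u) * y (drop i u))"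
  "add (free_star_alg P) x y = (\<lambda>u. x u + y u)"
  "one (free_star_alg P) = (\<lambda>u. if u = [] then 1 else 0)"
  "zero (free_star_alg P) = (\<lambda>_. 0)"
  "smult (free_star_alg P) c x = (\<lambda>u. c * x u)"
  "star (free_star_alg P) x = (\<lambda>u. cnj (x (inv_word u)))"
  by (simp_all add: free_star_alg_def inv_word_def)

lemma free_mult_support:
  assumes "(\<Sum>i\<le>length u. x (take i u) * y (drop i u)) \<noteq> (0::complex)"
  shows "\<exists>a b. u = a @ b \<and> x a \<noteq> 0 \<and> y b \<noteq> 0"
proof -
  obtain i where "x (take i u) * y (drop i u) \<noteq> 0"
    using assms by (meson sum.neutral)
  then show ?thesis by (intro exI[of _ "take i u"] exI[of _ "drop i u"]) auto
qed

lemma star_algebra_free: "star_algebra (free_star_alg P)"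
proof (rule star_algebraI)
  let ?F = "free_star_alg P"
  fix x y z assume x: "x \<in> carrier ?F"
  show "c \<odot>\<^bsub>?F\<^esub> x \<in> carrier ?F" for c
    using x by (auto simp: free_carrier free_ops elim: rev_finite_subset)
  show "star ?F x \<in> carrier ?F"
  proof -
    have "{u. x (inv_word u) \<noteq> 0} = inv_word ` {u. x u \<noteq> 0}"
      by (auto simp: image_iff) (metis inv_word_simps(4))
    then show ?thesis using x inv_word_simps(6) by (fastforce simp: free_carrier free_ops)
  qed
  show "\<zero>\<^bsub>?F\<^esub> \<oplus>\<^bsub>?F\<^esub> x = x" "- 1 \<odot>\<^bsub>?F\<^esub> x \<oplus>\<^bsub>?F\<^esub> x = \<zero>\<^bsub>?F\<^esub>" "1 \<odot>\<^bsub>?F\<^esub> x = x"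
    "star ?F (star ?F x) = x"
    "\<And>a b. (a + b) \<odot>\<^bsub>?F\<^esub> x = a \<odot>\<^bsub>?F\<^esub> x \<oplus>\<^bsub>?F\<^esub> b \<odot>\<^bsub>?F\<^esub> x"
    "\<And>a b. (a * b) \<odot>\<^bsub>?F\<^esub> x = a \<odot>\<^bsub>?F\<^esub> (b \<odot>\<^bsub>?F\<^esub> x)"
    "\<And>c. star ?F (c \<odot>\<^bsub>?F\<^esub> x) = cnj c \<odot>\<^bsub>?F\<^esub> star ?F x"
    by (auto simp: free_ops algebra_simps)
  show "\<one>\<^bsub>?F\<^esub> \<otimes>\<^bsub>?F\<^esub> x = x"
  proof
    fix u :: "('a \<times> bool) list"
    have "(\<Sum>i\<le>length u. (if take i u = [] then 1 else 0) * x (drop i u))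
        = (\<Sum>i\<le>length u. if i = 0 then x u else 0)"
      by (rule sum.cong) auto
    then show "(\<one>\<^bsub>?F\<^esub> \<otimes>\<^bsub>?F\<^esub> x) u = x u" by (simp add: free_ops)
  qed
  show "x \<otimes>\<^bsub>?F\<^esub> \<one>\<^bsub>?F\<^esub> = x"
  proof
    fix u :: "('a \<times> bool) list"
    have "(\<Sum>i\<le>length u. x (take i u) * (if drop i u = [] then 1 else 0))
        = (\<Sum>i\<le>length u. if i = length u then x u else 0)"
      by (rule sum.cong) auto
    then show "(x \<otimes>\<^bsub>?F\<^esub> \<one>\<^bsub>?F\<^esub>) u = x u" by (simp add: free_ops)
  qed
  assume y: "y \<in> carrier ?F"
  show "x \<oplus>\<^bsub>?F\<^esub> y \<in> carrier ?F"
  proof -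
    have "finite {u. x u + y u \<noteq> 0}"
      by (rule finite_subset[of _ "{u. x u \<noteq> 0} \<union> {u. y u \<noteq> 0}"]) (use x y in \<open>auto simp: free_carrier\<close>)
    moreover have "fst ` set u \<subseteq> P" if "x u + y u \<noteq> 0" for u
      using that x y unfolding free_carrier by (cases "x u = 0") simp_all
    ultimately show ?thesis by (simp add: free_carrier free_ops)
  qed
  show "x \<otimes>\<^bsub>?F\<^esub> y \<in> carrier ?F"
  proof -
    have "{u. (\<Sum>i\<le>length u. x (take i u) * y (drop i u)) \<noteq> 0} \<subseteq>
        (\<lambda>(a, b). a @ b) ` ({u. x u \<noteq> 0} \<times> {u. y u \<noteq> 0})"
      using free_mult_support[of x _ y] by fast
    then have "finite {u. (\<Sum>i\<le>length u. x (take i u) * y (drop i u)) \<noteq> 0}"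
      using x y by (auto simp: free_carrier intro: finite_subset)
    moreover have "fst ` set u \<subseteq> P" if u: "(\<Sum>i\<le>length u. x (take i u) * y (drop i u)) \<noteq> 0" for u
    proof -
      obtain a b where "u = a @ b" "x a \<noteq> 0" "y b \<noteq> 0" using free_mult_support[OF u] by blast
      then show ?thesis using x y by (auto simp: free_carrier)
    qed
    ultimately show ?thesis by (simp add: free_carrier free_ops)
  qed
  show "x \<oplus>\<^bsub>?F\<^esub> y = y \<oplus>\<^bsub>?F\<^esub> x" "\<And>a. a \<odot>\<^bsub>?F\<^esub> (x \<oplus>\<^bsub>?F\<^esub> y) = a \<odot>\<^bsub>?F\<^esub> x \<oplus>\<^bsub>?F\<^esub> a \<odot>\<^bsub>?F\<^esub> y"
    "\<And>c. c \<odot>\<^bsub>?F\<^esub> x \<otimes>\<^bsub>?F\<^esub> y = c \<odot>\<^bsub>?F\<^esub> (x \<otimes>\<^bsub>?F\<^esub> y)"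
    "\<And>c. x \<otimes>\<^bsub>?F\<^esub> (c \<odot>\<^bsub>?F\<^esub> y) = c \<odot>\<^bsub>?F\<^esub> (x \<otimes>\<^bsub>?F\<^esub> y)"
    "star ?F (x \<oplus>\<^bsub>?F\<^esub> y) = star ?F x \<oplus>\<^bsub>?F\<^esub> star ?F y"
    by (auto simp: free_ops algebra_simps sum_distrib_left)
  show "star ?F (x \<otimes>\<^bsub>?F\<^esub> y) = star ?F y \<otimes>\<^bsub>?F\<^esub> star ?F x"
  proof
    fix u :: "('a \<times> bool) list"
    show "star ?F (x \<otimes>\<^bsub>?F\<^esub> y) u = (star ?F y \<otimes>\<^bsub>?F\<^esub> star ?F x) u"
      unfolding free_ops cnj_sum
      by (rule sum.reindex_bij_witness[where i = "\<lambda>i. length u - i" and j = "\<lambda>i. length u - i"])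
        (auto simp: take_inv_word drop_inv_word)
  qed
  assume z: "z \<in> carrier ?F"
  show "x \<oplus>\<^bsub>?F\<^esub> y \<oplus>\<^bsub>?F\<^esub> z = x \<oplus>\<^bsub>?F\<^esub> (y \<oplus>\<^bsub>?F\<^esub> z)"
    "(x \<oplus>\<^bsub>?F\<^esub> y) \<otimes>\<^bsub>?F\<^esub> z = x \<otimes>\<^bsub>?F\<^esub> z \<oplus>\<^bsub>?F\<^esub> y \<otimes>\<^bsub>?F\<^esub> z"
    "z \<otimes>\<^bsub>?F\<^esub> (x \<oplus>\<^bsub>?F\<^esub> y) = z \<otimes>\<^bsub>?F\<^esub> x \<oplus>\<^bsub>?F\<^esub> z \<otimes>\<^bsub>?F\<^esub> y"
    by (auto simp: free_ops algebra_simps sum.distrib)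
  show "x \<otimes>\<^bsub>?F\<^esub> y \<otimes>\<^bsub>?F\<^esub> z = x \<otimes>\<^bsub>?F\<^esub> (y \<otimes>\<^bsub>?F\<^esub> z)"
  proof
    fix u :: "('a \<times> bool) list"
    let ?n = "length u"
    \<comment> \<open>Both bracketings are sums over the factorisations of \<open>u\<close> into
      three pieces, of lengths \<open>j\<close>, \<open>l\<close> and the rest.\<close>
    define g where "g j l = x (take j u) * y (take l (drop j u)) * z (drop (j + l) u)" for j l
    have "(x \<otimes>\<^bsub>?F\<^esub> y \<otimes>\<^bsub>?F\<^esub> z) u = (\<Sum>i\<le>?n. \<Sum>j\<le>i. g j (i - j))"
      unfolding free_ops g_def
      by (rule sum.cong) (auto simp: sum_distrib_right min_def drop_take intro!: sum.cong)
    also have "\<dots> = (\<Sum>(j, l)\<in>{(j, l). j + l \<le> ?n}. g j l)"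
      by (rule sum.triangle_reindex_eq[symmetric])
    also have "{(j, l). j + l \<le> ?n} = Sigma {..?n} (\<lambda>j. {..?n - j})" by auto
    also have "(\<Sum>(j, l)\<in>Sigma {..?n} (\<lambda>j. {..?n - j}). g j l) = (\<Sum>j\<le>?n. \<Sum>l\<le>?n - j. g j l)"
      by (subst sum.Sigma) auto
    also have "\<dots> = (x \<otimes>\<^bsub>?F\<^esub> (y \<otimes>\<^bsub>?F\<^esub> z)) u"
      unfolding free_ops g_def
      by (rule sum.cong) (auto simp: sum_distrib_left mult.assoc add.commute intro!: sum.cong)
    finally show "(x \<otimes>\<^bsub>?F\<^esub> y \<otimes>\<^bsub>?F\<^esub> z) u = (x \<otimes>\<^bsub>?F\<^esub> (y \<otimes>\<^bsub>?F\<^esub> z)) u" .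
  qed
qed (auto simp: free_carrier free_ops)

definition free_mono :: "('g \<times> bool) list => ('g \<times> bool) list => complex" where
  "free_mono u = (\<lambda>v. if v = u then 1 else 0)"

lemma free_mono_carrier: "fst ` set u \<subseteq> P ==> free_mono u \<in> carrier (free_star_alg P)"
  by (auto simp: free_mono_def free_carrier)

lemma free_gen_mono: "free_gen p = free_mono [(p, False)]"
  by (simp add: free_gen_def free_mono_def)

lemma free_gen_carrier: "p \<in> P ==> free_gen p \<in> carrier (free_star_alg P)"
  by (simp add: free_gen_mono free_mono_carrier)

lemma free_mono_one: "one (free_star_alg P) = free_mono []"
  by (simp add: free_ops free_mono_def)

lemma free_mono_star: "star (free_star_alg P) (free_mono u) = free_mono (inv_word u)"
  by (auto simp: free_ops free_mono_def inv_word_eq_iff)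

lemma free_mono_mult: "mult (free_star_alg P) (free_mono u) (free_mono v) = free_mono (u @ v)"
proof
  fix w :: "('a \<times> bool) list"
  have "(\<Sum>i\<le>length w. free_mono u (take i w) * free_mono v (drop i w)) =
      (\<Sum>i\<le>length w. if i = length u then free_mono (u @ v) w else 0)"
  proof (rule sum.cong)
    fix i assume i: "i \<in> {..length w}"
    show "free_mono u (take i w) * free_mono v (drop i w) = (if i = length u then free_mono (u @ v) w else 0)"
    proof (cases "i = length u")
      case True
      have "w = u @ v \<longleftrightarrow> take i w = u \<and> drop i w = v"
        using True append_eq_conv_conj[of u v w] by metis
      then show ?thesis using True by (simp add: free_mono_def)
    next
      case False
      then have "take i w \<noteq> u" using i by auto
      then show ?thesis using False by (simp add: free_mono_def)
    qed
  qed simp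
  also have "\<dots> = free_mono (u @ v) w"
    by (auto simp: free_mono_def sum.delta)
  finally show "mult (free_star_alg P) (free_mono u) (free_mono v) w = free_mono (u @ v) w"
    by (simp add: free_ops)
qed

text \<open>Induction on the size of the support, removing one monomial at a time.\<close>

lemma free_induct [consumes 1, case_names zero add]:
  assumes x: "x \<in> carrier (free_star_alg P)"
    and zero: "Q \<zero>\<^bsub>free_star_alg P\<^esub>"
    and add: "\<And>x c u. [|x \<in> carrier (free_star_alg P); fst ` set u \<subseteq> P; Q x|] ==>
      Q (x \<oplus>\<^bsub>free_star_alg P\<^esub> c \<odot>\<^bsub>free_star_alg P\<^esub> free_mono u)"
  shows "Q x"
proof -
  have "Q x" if "finite X" "{u. x u \<noteq> 0} = X" "x \<in> carrier (free_star_alg P)" for X x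
    using that
  proof (induction X arbitrary: x)
    case empty
    then have "x = \<zero>\<^bsub>free_star_alg P\<^esub>" by (auto simp: free_ops)
    then show ?case using zero by simp
  next
    case (insert u X)
    let ?y = "x(u := 0)"
    have supp: "{v. ?y v \<noteq> 0} = X" using insert.hyps insert.prems(1) by auto
    then have y: "?y \<in> carrier (free_star_alg P)"
      using insert by (auto simp: free_carrier)
    have u: "fst ` set u \<subseteq> P" using insert.prems by (auto simp: free_carrier)
    have "x = ?y \<oplus>\<^bsub>free_star_alg P\<^esub> x u \<odot>\<^bsub>free_star_alg P\<^esub> free_mono u"
      by (auto simp: free_ops free_mono_def)
    then show ?case using add[OF y u insert.IH[OF supp y], of "x u"] by (simp only:)
  qed
  then show ?thesis using x by (auto simp: free_carrier)
qed

subsection \<open>Evaluation\<close>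

definition letters_val :: "('b, 'm) star_alg_scheme => ('g => 'b) => ('g \<times> bool) list => 'b" where
  "letters_val B w u = foldr (\<lambda>(q, s) y. (if s then star B (w q) else w q) \<otimes>\<^bsub>B\<^esub> y) u \<one>\<^bsub>B\<^esub>"

definition free_eval :: "('b, 'm) star_alg_scheme => ('g => 'b) => (('g \<times> bool) list => complex) => 'b" where
  "free_eval B w x = (\<Oplus>\<^bsub>B\<^esub>u\<in>{u. x u \<noteq> 0}. x u \<odot>\<^bsub>B\<^esub> letters_val B w u)"

lemma letters_val_simps [simp]:
  "letters_val B w [] = \<one>\<^bsub>B\<^esub>"
  "letters_val B w ((q, s) # u) = (if s then star B (w q) else w q) \<otimes>\<^bsub>B\<^esub> letters_val B w u"
  by (simp_all add: letters_val_def)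

context
  fixes B :: "('b, 'm) star_alg_scheme" (structure) and P :: "'g set" and w :: "'g => 'b"
  assumes B: "star_algebra B" and w: "w \<in> P \<rightarrow> carrier B"
begin

interpretation B: star_algebra B by (rule B)

lemma letters_val_closed: "fst ` set u \<subseteq> P ==> letters_val B w u \<in> carrier B"
  using w by (induction u) (auto simp: B.star_closed B.alg_one_closed intro!: B.alg_m_closed B.star_closed)

lemma letters_val_append:
  "[|fst ` set u \<subseteq> P; fst ` set v \<subseteq> P|] ==> letters_val B w (u @ v) = letters_val B w u \<otimes> letters_val B w v"
proof (induction u)
  case (Cons a u)
  obtain q s where a: "a = (q, s)" by force
  then show ?case
    using Cons w letters_val_closed[of u] letters_val_closed[of v]
    by (auto simp: B.alg_m_assoc B.star_closed Pi_iff)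
qed (simp add: letters_val_closed B.alg_l_one)

lemma letters_val_inv_word:
  "fst ` set u \<subseteq> P ==> letters_val B w (inv_word u) = star B (letters_val B w u)"
proof (induction u)
  case (Cons a u)
  obtain q s where a: "a = (q, s)" by force
  then show ?case
    using Cons w letters_val_closed[of u]
    by (auto simp: letters_val_append B.star_mult B.star_closed Pi_iff B.star_star B.alg_r_one)
qed simp

lemma free_eval_superset:
  assumes "x \<in> carrier (free_star_alg P)" "finite X" "{u. x u \<noteq> 0} \<subseteq> X" "\<And>u. u \<in> X ==> fst ` set u \<subseteq> P"
  shows "free_eval B w x = (\<Oplus>u\<in>X. x u \<odot> letters_val B w u)"
proof -
  show ?thesis unfolding free_eval_def
    by (rule B.alg_finsum_mono_neutral) (use assms in \<open>auto simp: letters_val_closed\<close>)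
qed

lemma free_eval_closed: "x \<in> carrier (free_star_alg P) ==> free_eval B w x \<in> carrier B"
proof -
  assume "x \<in> carrier (free_star_alg P)"
  then show ?thesis unfolding free_eval_def
    by (intro B.alg_finsum_closed) (auto simp: free_carrier letters_val_closed)
qed

lemma free_eval_mono: "fst ` set u \<subseteq> P ==> free_eval B w (free_mono u) = letters_val B w u"
proof -
  assume "fst ` set u \<subseteq> P"
  then show ?thesis
    using free_eval_superset[OF free_mono_carrier, of u "{u}"] letters_val_closed[of u]
    by (auto simp: free_mono_def)
qed

lemma free_eval_add:
  assumes x: "x \<in> carrier (free_star_alg P)" and y: "y \<in> carrier (free_star_alg P)"
  shows "free_eval B w (x \<oplus>\<^bsub>free_star_alg P\<^esub> y) = free_eval B w x \<oplus> free_eval B w y"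
proof -
  interpret F: star_algebra "free_star_alg P" by (rule star_algebra_free)
  let ?X = "{u. x u \<noteq> 0} \<union> {u. y u \<noteq> 0}"
  have X: "finite ?X" "\<And>u. u \<in> ?X ==> fst ` set u \<subseteq> P" using x y unfolding free_carrier by blast+
  have l: "letters_val B w u \<in> carrier B" if "u \<in> ?X" for u using X(2)[OF that] by (rule letters_val_closed)
  have "free_eval B w (x \<oplus>\<^bsub>free_star_alg P\<^esub> y) = (\<Oplus>u\<in>?X. (x \<oplus>\<^bsub>free_star_alg P\<^esub> y) u \<odot> letters_val B w u)"
    by (rule free_eval_superset[OF F.alg_a_closed[OF x y] X(1) _ X(2)]) (auto simp: free_ops)
  also have "\<dots> = (\<Oplus>u\<in>?X. x u \<odot> letters_val B w u \<oplus> y u \<odot> letters_val B w u)"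
    using l by (intro B.alg_finsum_cong') (auto simp: free_ops B.smult_l_distr' intro!: B.alg_a_closed)
  also have "\<dots> = (\<Oplus>u\<in>?X. x u \<odot> letters_val B w u) \<oplus> (\<Oplus>u\<in>?X. y u \<odot> letters_val B w u)"
    using l by (intro B.alg_finsum_addf) auto
  also have "\<dots> = free_eval B w x \<oplus> free_eval B w y"
    using free_eval_superset[OF x X(1) _ X(2)] free_eval_superset[OF y X(1) _ X(2)] by simp
  finally show ?thesis .
qed

lemma free_eval_zero: "free_eval B w \<zero>\<^bsub>free_star_alg P\<^esub> = \<zero>"
proof -
  show ?thesis by (simp add: free_eval_def free_ops)
qed

lemma free_eval_smult_mono:
  assumes u: "fst ` set u \<subseteq> P"
  shows "free_eval B w (c \<odot>\<^bsub>free_star_alg P\<^esub> free_mono u) = c \<odot> letters_val B w u"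
proof -
  interpret F: star_algebra "free_star_alg P" by (rule star_algebra_free)
  have "{v. (c \<odot>\<^bsub>free_star_alg P\<^esub> free_mono u) v \<noteq> 0} \<subseteq> {u}" by (auto simp: free_ops free_mono_def)
  from free_eval_superset[OF F.smult_closed'[OF free_mono_carrier[OF u]] _ this]
  show ?thesis
    using letters_val_closed[OF u] u by (simp add: B.alg_finsum_insert B.alg_r_zero) (simp add: free_ops free_mono_def)
qed

lemma free_eval_star_hom: "free_eval B w \<in> star_hom (free_star_alg P) B"
proof -
  let ?F = "free_star_alg P" and ?e = "free_eval B w"
  interpret F: star_algebra ?F by (rule star_algebra_free)
  note cl = free_eval_closed free_mono_carrier F.alg_a_closed F.alg_m_closed F.smult_closed' F.star_closed
    letters_val_closed F.alg_zero_closed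
  have smult: "?e (c \<odot>\<^bsub>?F\<^esub> x) = c \<odot> ?e x" if "x \<in> carrier ?F" for c x
    using that
  proof (induction rule: free_induct)
    case (add x d u)
    then show ?case
      by (simp add: cl F.smult_r_distr' F.smult_assoc[symmetric] free_eval_add free_eval_smult_mono
          B.smult_r_distr' B.smult_assoc)
  qed (simp add: free_eval_zero)
  have star: "?e (star ?F x) = star B (?e x)" if "x \<in> carrier ?F" for x
    using that
  proof (induction rule: free_induct)
    case (add x d u)
    then show ?case
      by (simp add: cl F.star_add F.star_smult free_mono_star free_eval_add free_eval_smult_mono
          B.star_add B.star_smult letters_val_inv_word)
  qed (simp add: free_eval_zero)
  \<comment> \<open>Multiplicativity is shown for a monomial on the left before a general left
    factor; each of the two inductions then runs over a single factor.\<close>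
  have mult1: "?e (free_mono u \<otimes>\<^bsub>?F\<^esub> y) = letters_val B w u \<otimes> ?e y"
    if "y \<in> carrier ?F" "fst ` set u \<subseteq> P" for u y
    using that
  proof (induction rule: free_induct)
    case (add y d v)
    then show ?case
      by (simp add: cl F.alg_r_distr F.smult_mult_right free_mono_mult free_eval_add free_eval_smult_mono
          B.alg_r_distr B.smult_mult_right letters_val_append image_Un)
  qed (simp add: free_eval_zero cl F.alg_r_null B.alg_r_null)
  have mult: "?e (x \<otimes>\<^bsub>?F\<^esub> y) = ?e x \<otimes> ?e y" if "x \<in> carrier ?F" "y \<in> carrier ?F" for x y
    using that
  proof (induction rule: free_induct)
    case (add x d v)
    then show ?case
      by (simp add: cl F.alg_l_distr F.smult_mult_left free_eval_add free_eval_smult_mono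
          B.alg_l_distr B.smult_mult_left smult free_eval_mono mult1)
  qed (simp add: free_eval_zero cl F.alg_l_null B.alg_l_null)
  show ?thesis
    by (rule star_homI)
      (use free_eval_closed mult free_eval_add smult star free_eval_mono[of "[]"] in \<open>auto simp: free_mono_one\<close>)
qed

lemma free_eval_gen: "p \<in> P ==> free_eval B w (free_gen p) = w p"
  using w free_eval_mono[of "[(p, False)]"] by (auto simp: free_gen_mono Pi_iff B.alg_r_one)

end

lemma star_hom_letters_val:
  assumes h: "h \<in> star_hom A B" and A: "star_algebra A" and w: "w \<in> P \<rightarrow> carrier A"
    and u: "fst ` set u \<subseteq> P"
  shows "h (letters_val A w u) = letters_val B (\<lambda>q. h (w q)) u"
  using u
proof (induction u)
  case (Cons a u)
  obtain q s where a: "a = (q, s)" by force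
  interpret A: star_algebra A by fact
  show ?case
    using Cons a w letters_val_closed[OF A w, of u] by (auto simp: star_homD[OF h] A.star_closed Pi_iff)
qed (simp add: star_homD[OF h])

lemma free_hom_mono:
  assumes h: "h \<in> star_hom (free_star_alg P) B" and u: "fst ` set u \<subseteq> P"
  shows "h (free_mono u) = letters_val B (\<lambda>q. h (free_gen q)) u"
proof -
  have "letters_val (free_star_alg P) free_gen u = free_mono u"
    by (induction u) (auto simp: free_mono_one free_gen_mono free_mono_star free_mono_mult)
  then show ?thesis
    using star_hom_letters_val[OF h star_algebra_free _ u, of free_gen] by (simp add: Pi_iff free_gen_carrier)
qed

text \<open>The monomial whose evaluation is \<open>word_val\<close>: the entries in odd position,
  counted from 1, become adjoints.\<close>

fun letters :: "'g list => ('g \<times> bool) list" where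
  "letters (p # q # \<alpha>) = (p, True) # (q, False) # letters \<alpha>"
| "letters _ = []"

lemma words_induct [consumes 1, case_names Nil Cons]:
  assumes "\<alpha> \<in> words P" "Q []"
    "\<And>p q \<alpha>. [|p \<in> P; q \<in> P; \<alpha> \<in> words P; Q \<alpha>|] ==> Q (p # q # \<alpha>)"
  shows "Q \<alpha>"
  using assms(1)
proof (induction \<alpha> rule: induct_list012)
  case (3 p q \<alpha>)
  then show ?case using assms(3) by (simp add: words_def)
qed (use assms in \<open>auto simp: words_def\<close>)

lemma letters_P: "\<alpha> \<in> words P ==> fst ` set (letters \<alpha>) \<subseteq> P"
  by (induction rule: words_induct) auto

lemma word_val_letters:
  assumes B: "star_algebra B" and w: "w \<in> P \<rightarrow> carrier B" and \<alpha>: "\<alpha> \<in> words P"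
  shows "word_val B w \<alpha> = letters_val B w (letters \<alpha>)"
proof -
  interpret B: star_algebra B by fact
  show ?thesis
    using \<alpha>
  proof (induction rule: words_induct)
    case (Cons p q \<alpha>)
    then show ?case
      using w letters_val_closed[OF B w letters_P[of \<alpha> P]] by (auto simp: Pi_iff B.alg_m_assoc B.star_closed)
  qed simp
qed

lemma word_val_closed:
  assumes "star_algebra B" "w \<in> P \<rightarrow> carrier B" "\<alpha> \<in> words P"
  shows "word_val B w \<alpha> \<in> carrier B"
  using assms by (simp add: word_val_letters[OF assms] letters_val_closed letters_P)

lemma word_val_append:
  assumes "star_algebra B" "w \<in> P \<rightarrow> carrier B" "\<alpha> \<in> words P" "\<beta> \<in> words P"
  shows "word_val B w (\<alpha> @ \<beta>) = word_val B w \<alpha> \<otimes>\<^bsub>B\<^esub> word_val B w \<beta>"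
proof -
  interpret B: star_algebra B by fact
  show ?thesis
    using assms(3)
  proof (induction rule: words_induct)
    case (Cons p q \<alpha>)
    then show ?case
      using assms(2) word_val_closed[OF assms(1,2)] assms(4)
      by (auto simp: Pi_iff B.alg_m_assoc B.star_closed B.alg_m_closed)
  qed (simp add: word_val_closed[OF assms(1,2,4)] B.alg_l_one)
qed

lemma word_val_rev:
  assumes "star_algebra B" "w \<in> P \<rightarrow> carrier B" "\<alpha> \<in> words P"
  shows "word_val B w (rev \<alpha>) = star B (word_val B w \<alpha>)"
proof -
  interpret B: star_algebra B by fact
  show ?thesis
    using assms(3)
  proof (induction rule: words_induct)
    case (Cons p q \<alpha>)
    have "rev \<alpha> \<in> words P" "[q, p] \<in> words P" using Cons by (auto simp: words_def)
    from word_val_append[OF assms(1,2) this] show ?case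
      using Cons assms(2) word_val_closed[OF assms(1,2) Cons(3)]
      by (simp add: Pi_iff B.alg_m_closed B.star_closed B.star_mult B.star_star B.alg_r_one B.alg_m_assoc)
  qed simp
qed

lemma star_hom_word_val:
  assumes h: "h \<in> star_hom A B" and A: "star_algebra A" and w: "w \<in> P \<rightarrow> carrier A" and \<alpha>: "\<alpha> \<in> words P"
  shows "h (word_val A w \<alpha>) = word_val B (\<lambda>q. h (w q)) \<alpha>"
proof -
  interpret A: star_algebra A by fact
  show ?thesis
    using \<alpha>
  proof (induction rule: words_induct)
    case (Cons p q \<alpha>)
    then show ?case
      using w word_val_closed[OF A w, of \<alpha>] by (simp add: star_homD[OF h] A.star_closed A.alg_m_closed Pi_iff)
  qed (simp add: star_homD[OF h])
qed

lemma star_hom_diff_prod: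
  assumes h: "h \<in> star_hom A B" and A: "star_algebra A" and B: "star_algebra B" and w: "w \<in> P \<rightarrow> carrier A"
    and \<alpha>: "\<alpha> \<in> words P" and \<beta>s: "set \<beta>s \<subseteq> words P"
  shows "h (diff_prod A w \<alpha> \<beta>s) = diff_prod B (\<lambda>q. h (w q)) \<alpha> \<beta>s"
proof -
  interpret A: star_algebra A by fact
  let ?f = "foldr (\<lambda>\<beta> y. (word_val A w \<alpha> \<ominus>\<^bsub>A\<^esub> word_val A w \<beta>) \<otimes>\<^bsub>A\<^esub> y)"
  note c = word_val_closed[OF A w]
  have "?f \<beta>s \<one>\<^bsub>A\<^esub> \<in> carrier A \<and> h (?f \<beta>s \<one>\<^bsub>A\<^esub>) =
      foldr (\<lambda>\<beta> y. (word_val B (\<lambda>q. h (w q)) \<alpha> \<ominus>\<^bsub>B\<^esub> word_val B (\<lambda>q. h (w q)) \<beta>) \<otimes>\<^bsub>B\<^esub> y) \<beta>s \<one>\<^bsub>B\<^esub>"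
    using \<beta>s
  proof (induction \<beta>s)
    case (Cons \<beta> \<beta>s)
    then show ?case
      using \<alpha> c by (simp add: A.alg_m_closed star_homD[OF h] star_hom_diff[OF h A B] star_hom_word_val[OF h A w])
  qed (simp add: star_homD[OF h] A.alg_one_closed)
  then show ?thesis
    using star_hom_word_val[OF h A w \<alpha>] by (simp add: diff_prod_def)
qed

lemma diff_prod_closed:
  assumes A: "star_algebra A" and w: "w \<in> P \<rightarrow> carrier A" and \<alpha>: "\<alpha> \<in> words P" and \<beta>s: "set \<beta>s \<subseteq> words P"
  shows "diff_prod A w \<alpha> \<beta>s \<in> carrier A"
proof -
  interpret A: star_algebra A by fact
  have "foldr (\<lambda>\<beta> y. (word_val A w \<alpha> \<ominus>\<^bsub>A\<^esub> word_val A w \<beta>) \<otimes>\<^bsub>A\<^esub> y) \<beta>s \<one>\<^bsub>A\<^esub> \<in> carrier A"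
    using \<beta>s word_val_closed[OF A w] \<alpha> by (induction \<beta>s) (auto simp: A.alg_one_closed intro!: A.alg_m_closed)
  then show ?thesis using word_val_closed[OF A w \<alpha>] by (simp add: diff_prod_def)
qed

section \<open>Words and constructible ideals\<close>

locale submonoid_of_group = group G for G :: "('g, 'k) monoid_scheme" (structure) +
  fixes P :: "'g set"
  assumes submonoid_P: "submonoid P G"
begin

lemma P_carrier: "P \<subseteq> carrier G" and P_one [simp]: "\<one> \<in> P"
  and P_mult [simp, intro]: "[|p \<in> P; q \<in> P|] ==> p \<otimes> q \<in> P"
  using submonoid_P by (auto simp: submonoid_def)

lemma P_in [simp, intro]: "p \<in> P ==> p \<in> carrier G"
  using P_carrier by auto

lemma mult_inv_cancel [simp]:
  "[|a \<in> carrier G; y \<in> carrier G|] ==> a \<otimes> (inv a \<otimes> y) = y"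
  "[|a \<in> carrier G; y \<in> carrier G|] ==> inv a \<otimes> (a \<otimes> y) = y"
  by (simp_all add: m_assoc[symmetric])

abbreviation "dot \<equiv> word_dot G"
abbreviation "W \<equiv> words P"
abbreviation "KK \<equiv> K G P"
abbreviation "J \<equiv> constructible G P"
abbreviation "NW \<equiv> neutral_words G P"

lemma W_Nil [simp]: "[] \<in> W"
  and W_Cons [simp]: "p # q # \<alpha> \<in> W \<longleftrightarrow> p \<in> P \<and> q \<in> P \<and> \<alpha> \<in> W"
  and W_single [simp]: "[p] \<notin> W"
  and W_rev [simp]: "rev \<alpha> \<in> W \<longleftrightarrow> \<alpha> \<in> W"
  and W_append [simp, intro]: "[|\<alpha> \<in> W; \<beta> \<in> W|] ==> \<alpha> @ \<beta> \<in> W"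
  by (auto simp: words_def)

lemma dot_closed [simp, intro]: "\<alpha> \<in> W ==> dot \<alpha> \<in> carrier G"
  by (induction rule: words_induct) auto

lemma dot_append: "[|\<alpha> \<in> W; \<beta> \<in> W|] ==> dot (\<alpha> @ \<beta>) = dot \<alpha> \<otimes> dot \<beta>"
  by (induction rule: words_induct) (auto simp: m_assoc)

lemma dot_rev: "\<alpha> \<in> W ==> dot (rev \<alpha>) = inv (dot \<alpha>)"
proof (induction rule: words_induct)
  case (Cons p q \<alpha>)
  then have "dot (rev \<alpha> @ [q, p]) = inv (dot \<alpha>) \<otimes> (inv q \<otimes> p)" by (subst dot_append) auto
  then show ?case using Cons by (simp add: inv_mult_group m_assoc)
qed simp

lemma in_l_coset_iff: "[|g \<in> carrier G; x \<in> carrier G; S \<subseteq> carrier G|] ==> x \<in> g <# S \<longleftrightarrow> inv g \<otimes> x \<in> S"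
proof
  assume *: "g \<in> carrier G" "x \<in> carrier G" "S \<subseteq> carrier G"
  show "inv g \<otimes> x \<in> S" if "x \<in> g <# S"
    using that * by (auto simp: l_coset_def m_assoc[symmetric])
  show "x \<in> g <# S" if "inv g \<otimes> x \<in> S"
    using that * by (force simp: l_coset_def m_assoc[symmetric])
qed

lemma K_Nil [simp]: "KK [] = P"
  using P_carrier by (auto simp: K_def l_coset_def)

text \<open>The full reversed word has the value \<open>inv (dot (p # q # \<alpha>))\<close>, and
  its shorter initial segments are those of \<open>rev \<alpha>\<close>. Iterated, this exhibits
  \<open>KK \<alpha>\<close> as the domain of a partial translation: the points x that every suffix
  of \<alpha> of even length sends into P.\<close>

lemma K_Cons:
  assumes "p \<in> P" "q \<in> P" "\<alpha> \<in> W"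
  shows "KK (p # q # \<alpha>) = {x \<in> KK \<alpha>. dot (p # q # \<alpha>) \<otimes> x \<in> P}"
proof -
  let ?\<beta> = "p # q # \<alpha>" and ?n = "length \<alpha> div 2"
  have W: "?\<beta> \<in> W" using assms by simp
  have ev: "2 * ?n = length \<alpha>" using assms by (simp add: words_def)
  have "KK ?\<beta> = (\<Inter>i\<le>Suc ?n. dot (take (2 * i) (rev ?\<beta>)) <# P)" by (simp add: K_def)
  also have "\<dots> = (dot (take (2 * Suc ?n) (rev ?\<beta>)) <# P) \<inter> (\<Inter>i\<le>?n. dot (take (2 * i) (rev ?\<beta>)) <# P)"
    by (simp add: atMost_Suc)
  also have "take (2 * Suc ?n) (rev ?\<beta>) = rev ?\<beta>" using ev by simp
  also have "(\<Inter>i\<le>?n. dot (take (2 * i) (rev ?\<beta>)) <# P) = (\<Inter>i\<le>?n. dot (take (2 * i) (rev \<alpha>)) <# P)"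
    using ev by (intro INF_cong) auto
  also have "\<dots> = KK \<alpha>" by (simp add: K_def)
  finally have eq: "KK ?\<beta> = (dot (rev ?\<beta>) <# P) \<inter> KK \<alpha>" .
  have "KK \<alpha> \<subseteq> dot (take (2 * 0) (rev \<alpha>)) <# P" unfolding K_def by (rule INF_lower) simp
  then have "KK \<alpha> \<subseteq> carrier G" using P_carrier by (auto simp: l_coset_def)
  then show ?thesis
    using eq W dot_rev[OF W] dot_closed[OF W] P_carrier by (auto simp: in_l_coset_iff simp del: word_dot.simps rev.simps)
qed

lemma K_subset_P: "\<alpha> \<in> W ==> KK \<alpha> \<subseteq> P"
  by (induction rule: words_induct) (auto simp: K_Cons)

lemma K_in_P [simp]: "[|x \<in> KK \<alpha>; \<alpha> \<in> W|] ==> x \<in> P"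
  using K_subset_P by auto

lemma K_right_ideal: "[|\<alpha> \<in> W; x \<in> KK \<alpha>; p \<in> P|] ==> x \<otimes> p \<in> KK \<alpha>"
proof (induction rule: words_induct)
  case (Cons a b \<alpha>)
  then have "x \<in> carrier G" by (auto simp: K_Cons)
  then have "dot (a # b # \<alpha>) \<otimes> (x \<otimes> p) = dot (a # b # \<alpha>) \<otimes> x \<otimes> p"
    using Cons by (intro m_assoc[symmetric] dot_closed) auto
  then show ?case using Cons by (simp add: K_Cons)
qed simp

text \<open>Concatenation of words is composition of partial translations, the right-hand word being
  applied before the left-hand one; the ideal is the domain of the composite.\<close>

lemma K_append: "[|\<alpha> \<in> W; \<beta> \<in> W|] ==> KK (\<alpha> @ \<beta>) = {x \<in> KK \<beta>. dot \<beta> \<otimes> x \<in> KK \<alpha>}"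
proof (induction rule: words_induct)
  case Nil
  then show ?case
  proof (induction rule: words_induct)
    case (Cons p q \<alpha>) then show ?case by (auto simp: K_Cons)
  qed auto
next
  case (Cons p q \<alpha>)
  have "dot (p # q # \<alpha> @ \<beta>) \<otimes> x = dot (p # q # \<alpha>) \<otimes> (dot \<beta> \<otimes> x)" if "x \<in> KK \<beta>" for x
    using Cons that dot_append[of "p # q # \<alpha>" \<beta>] by (simp add: m_assoc del: word_dot.simps)
  then show ?case using Cons by (auto simp: K_Cons simp del: word_dot.simps)
qed

text \<open>The reversed word describes the inverse partial translation: it passes the same
  intermediate points in the opposite order.\<close>

lemma K_rev_mem: "[|\<alpha> \<in> W; x \<in> KK \<alpha>|] ==> dot \<alpha> \<otimes> x \<in> KK (rev \<alpha>)"
proof (induction rule: words_induct)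
  case (Cons p q \<alpha>)
  have x: "x \<in> KK \<alpha>" "dot (p # q # \<alpha>) \<otimes> x \<in> P" "x \<in> carrier G" using Cons by (auto simp: K_Cons)
  have d: "dot (p # q # \<alpha>) \<otimes> x = inv p \<otimes> q \<otimes> (dot \<alpha> \<otimes> x)" using x Cons by (simp add: m_assoc)
  have "inv q \<otimes> p \<otimes> (dot (p # q # \<alpha>) \<otimes> x) = dot \<alpha> \<otimes> x"
    unfolding d using x(3) Cons by (simp add: m_assoc)
  then have e: "dot [q, p] \<otimes> (dot (p # q # \<alpha>) \<otimes> x) = dot \<alpha> \<otimes> x" using Cons by simp
  have aP: "dot \<alpha> \<otimes> x \<in> P" using Cons.IH[OF x(1)] Cons by auto
  have "rev (p # q # \<alpha>) = rev \<alpha> @ [q, p]" by simp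
  moreover have "dot (p # q # \<alpha>) \<otimes> x \<in> KK [q, p]"
    using Cons x(2) e aP K_Cons[of q p "[]"] by (simp del: word_dot.simps(3))
  ultimately show ?case
    using Cons x e by (simp add: K_append del: word_dot.simps)
qed simp

lemma K_rev: "\<alpha> \<in> W ==> KK (rev \<alpha>) = dot \<alpha> <# KK \<alpha>"
proof (rule Set.set_eqI)
  fix y assume \<alpha>: "\<alpha> \<in> W"
  have sub: "KK \<alpha> \<subseteq> carrier G" "KK (rev \<alpha>) \<subseteq> carrier G" using \<alpha> K_subset_P P_carrier by (meson W_rev order_trans)+
  show "y \<in> KK (rev \<alpha>) \<longleftrightarrow> y \<in> dot \<alpha> <# KK \<alpha>"
  proof
    assume "y \<in> KK (rev \<alpha>)"
    then show "y \<in> dot \<alpha> <# KK \<alpha>"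
      using K_rev_mem[of "rev \<alpha>" y] \<alpha> sub by (subst in_l_coset_iff) (auto simp: dot_rev)
  next
    assume y: "y \<in> dot \<alpha> <# KK \<alpha>"
    then obtain x where x: "x \<in> KK \<alpha>" "y = dot \<alpha> \<otimes> x" by (auto simp: l_coset_def)
    then show "y \<in> KK (rev \<alpha>)"
      using K_rev_mem[OF \<alpha> x(1)] by simp
  qed
qed

section \<open>Neutral words and the intersection structure of the constructible ideals\<close>

lemma NW_iff: "\<alpha> \<in> NW \<longleftrightarrow> \<alpha> \<in> W \<and> dot \<alpha> = \<one>"
  by (auto simp: neutral_words_def)

lemma NW_W: "\<alpha> \<in> NW ==> \<alpha> \<in> W" by (simp add: NW_iff)

lemma NW_append: "[|\<alpha> \<in> NW; \<beta> \<in> NW|] ==> \<alpha> @ \<beta> \<in> NW"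
  by (auto simp: NW_iff dot_append)

lemma NW_rev: "\<alpha> \<in> NW ==> rev \<alpha> \<in> NW"
  by (auto simp: NW_iff dot_rev)

lemma K_append_neutral: "[|\<alpha> \<in> W; \<beta> \<in> NW|] ==> KK (\<alpha> @ \<beta>) = KK \<alpha> \<inter> KK \<beta>"
  by (auto simp: NW_iff K_append)

lemma K_rev_neutral: "\<alpha> \<in> NW ==> KK (rev \<alpha>) = KK \<alpha>"
proof -
  assume \<alpha>: "\<alpha> \<in> NW"
  have "\<one> <# KK \<alpha> = KK \<alpha>"
    using \<alpha> K_subset_P[of \<alpha>] P_carrier by (intro lcos_mult_one) (auto simp: NW_iff)
  then show ?thesis using \<alpha> by (auto simp: NW_iff K_rev)
qed

text \<open>Going along \<beta> and back along \<alpha> is the identity on the common domain. For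
  \<alpha> = \<beta> this shows that every constructible ideal arises from a neutral word.\<close>

lemma rev_append_neutral:
  assumes "\<alpha> \<in> W" "\<beta> \<in> W" "dot \<alpha> = dot \<beta>"
  shows "rev \<alpha> @ \<beta> \<in> NW" "KK (rev \<alpha> @ \<beta>) = KK \<alpha> \<inter> KK \<beta>"
proof -
  show "rev \<alpha> @ \<beta> \<in> NW" using assms by (auto simp: NW_iff dot_append dot_rev)
  have "dot \<alpha> \<otimes> x \<in> dot \<alpha> <# KK \<alpha> \<longleftrightarrow> x \<in> KK \<alpha>" if x: "x \<in> carrier G" for x
  proof -
    have "KK \<alpha> \<subseteq> carrier G" using K_subset_P[OF assms(1)] P_carrier by blast
    moreover have "inv (dot \<alpha>) \<otimes> (dot \<alpha> \<otimes> x) = x" using x assms by (simp add: m_assoc[symmetric])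
    ultimately show ?thesis using x assms in_l_coset_iff[of "dot \<alpha>" "dot \<alpha> \<otimes> x" "KK \<alpha>"] by auto
  qed
  then show "KK (rev \<alpha> @ \<beta>) = KK \<alpha> \<inter> KK \<beta>"
    using assms by (auto simp: K_append K_rev)
qed

lemma J_neutral: "S \<in> J ==> \<exists>\<alpha>\<in>NW. S = KK \<alpha>"
proof -
  assume "S \<in> J"
  then obtain \<alpha> where "\<alpha> \<in> W" "S = KK \<alpha>" by (auto simp: constructible_def)
  then show ?thesis using rev_append_neutral[of \<alpha> \<alpha>] by (intro bexI[of _ "rev \<alpha> @ \<alpha>"]) auto
qed

lemma K_J [simp, intro]: "\<alpha> \<in> W ==> KK \<alpha> \<in> J"
  by (auto simp: constructible_def)

lemma J_Int [intro]: "[|R \<in> J; S \<in> J|] ==> R \<inter> S \<in> J"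
proof -
  assume "R \<in> J" "S \<in> J"
  then obtain \<alpha> \<beta> where "\<alpha> \<in> NW" "R = KK \<alpha>" "\<beta> \<in> NW" "S = KK \<beta>" using J_neutral by metis
  then show ?thesis using K_append_neutral[of \<alpha> \<beta>] NW_append[of \<alpha> \<beta>] by (metis K_J NW_W)
qed

lemma P_J [simp, intro]: "P \<in> J"
  using K_J[of "[]"] by simp

lemma J_subset: "S \<in> J ==> S \<subseteq> P"
  using K_subset_P by (auto simp: constructible_def)

lemma J_right_ideal: "[|S \<in> J; x \<in> S; p \<in> P|] ==> x \<otimes> p \<in> S"
  using K_right_ideal by (auto simp: constructible_def)

lemma K_principal: "p \<in> P ==> KK [p, \<one>] = p <# P"
proof (rule Set.set_eqI)
  fix x assume p: "p \<in> P"
  show "x \<in> KK [p, \<one>] \<longleftrightarrow> x \<in> p <# P"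
  proof (cases "x \<in> P")
    case True
    then show ?thesis using p P_carrier in_l_coset_iff[of p x P] by (auto simp: K_Cons)
  next
    case False
    then have "x \<notin> p <# P" using p by (auto simp: l_coset_def)
    then show ?thesis using False p by (auto simp: K_Cons)
  qed
qed

lemma principal_J [simp, intro]: "p \<in> P ==> p <# P \<in> J"
  using K_J[of "[p, \<one>]"] by (simp add: K_principal)

lemma principal_mem [simp]: "p \<in> P ==> p \<in> p <# P"
  using P_one by (force simp: l_coset_def)

lemma principal_subset: "[|S \<in> J; p \<in> S|] ==> p <# P \<subseteq> S"
  using J_right_ideal by (auto simp: l_coset_def)

text \<open>A neutral word for S placed in front of \<alpha> restricts the domain of \<alpha> to the
  points that land in S, and leaves the value of the word unchanged.\<close>

lemma J_translate:
  assumes "\<alpha> \<in> W" "S \<in> J"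
  shows "KK \<alpha> \<inter> (inv (dot \<alpha>) <# S) \<in> J"
    and "\<exists>\<beta>\<in>W. KK \<beta> = KK \<alpha> \<inter> (inv (dot \<alpha>) <# S) \<and> dot \<beta> = dot \<alpha>"
proof -
  obtain \<beta> where \<beta>: "\<beta> \<in> NW" "S = KK \<beta>" using J_neutral assms by blast
  have S: "S \<subseteq> carrier G" using J_subset assms P_carrier by blast
  have "x \<in> inv (dot \<alpha>) <# S \<longleftrightarrow> dot \<alpha> \<otimes> x \<in> S" if "x \<in> KK \<alpha>" for x
    using that assms S in_l_coset_iff[of "inv (dot \<alpha>)" x S] by auto
  then have "KK (\<beta> @ \<alpha>) = KK \<alpha> \<inter> (inv (dot \<alpha>) <# S)"
    using assms \<beta> NW_W[of \<beta>] by (auto simp: K_append)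
  moreover have "dot (\<beta> @ \<alpha>) = dot \<alpha>" "\<beta> @ \<alpha> \<in> W" using assms \<beta> by (auto simp: NW_iff dot_append)
  ultimately show "KK \<alpha> \<inter> (inv (dot \<alpha>) <# S) \<in> J"
    and "\<exists>\<beta>\<in>W. KK \<beta> = KK \<alpha> \<inter> (inv (dot \<alpha>) <# S) \<and> dot \<beta> = dot \<alpha>" by (metis K_J)+
qed

text \<open>The domains of words of value \<open>inv g\<close>, that is, the ranges of words of
  value g. Their indicator functions span \<open>gamma_ideal G P g\<close>, whose convention
  explains the inverse.\<close>

definition JJ :: "'g => 'g set set" where
  "JJ g = {KK \<alpha> |\<alpha>. \<alpha> \<in> W \<and> dot \<alpha> = inv g}"

lemma JJ_J: "S \<in> JJ g ==> S \<in> J"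
  by (auto simp: JJ_def)

lemma JJ_Int_J: "[|R \<in> JJ g; S \<in> J|] ==> R \<inter> S \<in> JJ g"
proof -
  assume "R \<in> JJ g" "S \<in> J"
  then obtain \<alpha> \<beta> where *: "\<alpha> \<in> W" "dot \<alpha> = inv g" "R = KK \<alpha>" "\<beta> \<in> NW" "S = KK \<beta>"
    using J_neutral[of S] unfolding JJ_def by blast
  then have "dot (\<alpha> @ \<beta>) = inv g" "\<alpha> @ \<beta> \<in> W"
    using dot_closed[of \<alpha>] by (auto simp: NW_iff dot_append)
  then show ?thesis using * K_append_neutral[of \<alpha> \<beta>] unfolding JJ_def by blast
qed

lemma JJ_one: "JJ \<one> = J"
proof
  show "JJ \<one> \<subseteq> J" using JJ_J by blast
  show "J \<subseteq> JJ \<one>" using J_neutral by (fastforce simp: JJ_def NW_iff)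
qed

text \<open>On ideals, translation by g is reversal of words.\<close>

lemma JJ_translate:
  assumes "g \<in> carrier G" "S \<in> JJ (inv g)"
  shows "g <# S \<in> JJ g" "inv g <# (g <# S) = S"
proof -
  obtain \<alpha> where \<alpha>: "\<alpha> \<in> W" "dot \<alpha> = g" "S = KK \<alpha>" using assms by (auto simp: JJ_def)
  then show "g <# S \<in> JJ g" using K_rev[of \<alpha>] dot_rev[of \<alpha>] by (auto simp: JJ_def intro!: exI[of _ "rev \<alpha>"])
  have "S \<subseteq> carrier G" using \<alpha> K_subset_P[of \<alpha>] P_carrier by blast
  then show "inv g <# (g <# S) = S" using assms(1) by (simp add: lcos_m_assoc lcos_mult_one)
qed

lemma JJ_subset: "[|S \<in> JJ g; g \<in> carrier G; x \<in> S|] ==> inv g \<otimes> x \<in> P"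
  using K_rev_mem K_in_P W_rev unfolding JJ_def by (smt (verit, ccfv_SIG) mem_Collect_eq)

lemma foundation_set_Int:
  "foundation_set G P S \<C> \<longleftrightarrow> S \<in> J \<and> finite \<C> \<and> \<C> \<subseteq> J \<and> (\<forall>R\<in>\<C>. R \<subseteq> S) \<and>
     (\<forall>p\<in>S. \<exists>R\<in>\<C>. (p <# P) \<inter> R \<noteq> {})"
  by (auto simp: foundation_set_def) blast+

subsection \<open>Alternating words and free words\<close>

text \<open>Padding with the neutral element turns any monomial into a word of even length: a
  generator p becomes (1, p) and its adjoint becomes (p, 1). The value in a family w is unchanged as
  soon as w(1) = 1.\<close>

definition alternate :: "('g \<times> bool) list => 'g list" where
  "alternate u = concat (map (\<lambda>(p, s). if s then [p, \<one>] else [\<one>, p]) u)"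

lemma alternate_simps [simp]:
  "alternate [] = []" "alternate (u @ v) = alternate u @ alternate v"
  "alternate ((p, s) # u) = (if s then [p, \<one>] else [\<one>, p]) @ alternate u"
  by (simp_all add: alternate_def)

lemma alternate_W [simp]: "fst ` set u \<subseteq> P ==> alternate u \<in> W"
  by (induction u) auto

lemma alternate_inv_word: "alternate (inv_word u) = rev (alternate u)"
  by (induction u) auto

lemma K_alternate_letters: "\<alpha> \<in> W ==> KK (alternate (letters \<alpha>)) = KK \<alpha>"
  and dot_alternate_letters: "\<alpha> \<in> W ==> dot (alternate (letters \<alpha>)) = dot \<alpha>"
proof -
  show 1: "dot (alternate (letters \<alpha>)) = dot \<alpha>" if "\<alpha> \<in> W" for \<alpha>
    using that by (induction rule: words_induct) (auto simp: m_assoc letters_P)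
  show "KK (alternate (letters \<alpha>)) = KK \<alpha>" if "\<alpha> \<in> W"
    using that
  proof (induction rule: words_induct)
    case (Cons p q \<alpha>)
    have l: "alternate (letters \<alpha>) \<in> W" using Cons by (intro alternate_W letters_P)
    \<comment> \<open>The padding adds \<open>q \<otimes> (dot \<alpha> \<otimes> x)\<close> as a
      new intermediate point; it lies in P because q and \<open>dot \<alpha> \<otimes> x\<close>
      do.\<close>
    have 2: "q \<otimes> (dot \<alpha> \<otimes> x) \<in> P" if "x \<in> KK \<alpha>" for x
      using K_rev_mem[of \<alpha> x] K_in_P[of "dot \<alpha> \<otimes> x" "rev \<alpha>"] Cons that by auto
    show ?case
      using Cons l 2 by (auto simp: K_Cons 1 m_assoc)
  qed simp
qed

end

section \<open>Characters and the boundary\<close>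

text \<open>Characters take the natural number values 0 and 1; the equations \<open>\<eta> S = 1\<close> are kept in this form.\<close>

declare One_nat_def [simp del]

context submonoid_of_group
begin

abbreviation "JH \<equiv> J_hat G P"
abbreviation "MX \<equiv> maximal_characters G P"
abbreviation "\<Delta> \<equiv> Delta G P"

lemma JH_cases: "\<eta> \<in> JH ==> \<eta> S = 0 \<or> \<eta> S = 1"
  by (cases "S \<in> J") (auto simp: J_hat_def)

lemma JH_one_J: "[|\<eta> \<in> JH; \<eta> S = 1|] ==> S \<in> J"
  by (cases "S \<in> J") (auto simp: J_hat_def)

lemma JH_not_J: "[|\<eta> \<in> JH; S \<notin> J|] ==> \<eta> S = 0"
  unfolding J_hat_def by blast

lemma JH_Int: "[|\<eta> \<in> JH; R \<in> J; S \<in> J|] ==> \<eta> (R \<inter> S) = \<eta> R * \<eta> S"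
  by (auto simp: J_hat_def)

lemma JH_Int_iff: "[|\<eta> \<in> JH; R \<in> J; S \<in> J|] ==> \<eta> (R \<inter> S) = 1 \<longleftrightarrow> \<eta> R = 1 \<and> \<eta> S = 1"
  by (auto simp: JH_Int)

lemma JH_mono: "[|\<eta> \<in> JH; \<eta> R = 1; R \<subseteq> S; S \<in> J|] ==> \<eta> S = 1"
  using JH_Int_iff[of \<eta> R S] JH_one_J[of \<eta> R] by (simp add: Int_absorb2)

lemma JH_P: "\<eta> \<in> JH ==> \<eta> P = 1"
proof -
  assume \<eta>: "\<eta> \<in> JH"
  then obtain S where S: "S \<in> J" "\<eta> S \<noteq> 0" by (auto simp: J_hat_def)
  then have "\<eta> S = 1" using JH_cases[OF \<eta>, of S] by auto
  then show ?thesis using JH_mono[OF \<eta> _ J_subset[OF S(1)]] by auto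
qed

lemma JH_empty: "\<eta> \<in> JH ==> \<eta> {} \<noteq> 1"
proof
  assume \<eta>: "\<eta> \<in> JH" and 1: "\<eta> {} = 1"
  have "{} \<in> J \<longrightarrow> \<eta> {} = 0" using \<eta> unfolding J_hat_def by blast
  then show False using JH_one_J[OF \<eta> 1] 1 by simp
qed

lemma JHI:
  assumes "\<And>S. \<eta> S = 0 \<or> \<eta> S = 1" "\<And>S. \<eta> S = 1 ==> S \<in> J" "\<eta> P = 1" "\<eta> {} \<noteq> 1"
    "\<And>R S. [|R \<in> J; S \<in> J|] ==> \<eta> (R \<inter> S) = 1 \<longleftrightarrow> \<eta> R = 1 \<and> \<eta> S = 1"
  shows "\<eta> \<in> JH"
proof -
  have "\<eta> (R \<inter> S) = \<eta> R * \<eta> S" if "R \<in> J" "S \<in> J" for R S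
    using assms(1)[of R] assms(1)[of S] assms(1)[of "R \<inter> S"] assms(5)[OF that] by auto
  moreover have "\<eta> S = 0" if "S \<notin> J" for S using assms(1)[of S] assms(2)[of S] that by auto
  moreover have "\<eta> {} = 0" using assms(1)[of "{}"] assms(4) by auto
  moreover have "\<exists>S\<in>J. \<eta> S \<noteq> 0" using assms(3) by (intro bexI[of _ P]) auto
  ultimately show ?thesis using assms(1) by (auto simp: J_hat_def)
qed

lemma JH_eqI: "[|\<eta> \<in> JH; \<eta>' \<in> JH; \<And>S. \<eta> S = 1 \<longleftrightarrow> \<eta>' S = 1|] ==> \<eta> = \<eta>'"
  using JH_cases by (metis ext)

text \<open>The character of evaluation at x. It need not lie on the boundary.\<close>

definition point :: "'g => 'g set => nat" where
  "point x S = (if S \<in> J \<and> x \<in> S then 1 else 0)"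

lemma point_JH: "x \<in> P ==> point x \<in> JH"
  by (rule JHI) (auto simp: point_def split: if_splits)

text \<open>Zorn's lemma for families of constructible ideals that are closed under intersection,
  contain P and pP, and omit the empty set. Upward closure is not imposed on these families; a
  maximal one has it.\<close>

lemma maximal_above_principal:
  assumes p: "p \<in> P"
  shows "\<exists>\<xi>\<in>MX. \<xi> (p <# P) = 1"
proof -
  define \<A> where "\<A> = {\<F>. \<F> \<subseteq> J \<and> P \<in> \<F> \<and> p <# P \<in> \<F> \<and> {} \<notin> \<F> \<and> (\<forall>R\<in>\<F>. \<forall>S\<in>\<F>. R \<inter> S \<in> \<F>)}"
  have pP: "p <# P \<subseteq> P" "p <# P \<noteq> {}" using J_subset p principal_mem by blast+
  have "\<exists>M\<in>\<A>. \<forall>X\<in>\<A>. M \<subseteq> X \<longrightarrow> X = M"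
  proof (rule subset_Zorn_nonempty)
    have "{P, p <# P} \<in> \<A>" unfolding \<A>_def using p pP P_one by (auto simp: Int_absorb1 Int_absorb2)
    then show "\<A> \<noteq> {}" by blast
    fix \<C> assume C: "\<C> \<noteq> {}" "subset.chain \<A> \<C>"
    then have sub: "\<C> \<subseteq> \<A>" by (simp add: subset.chain_def)
    have "R \<inter> S \<in> \<Union>\<C>" if RS: "R \<in> \<Union>\<C>" "S \<in> \<Union>\<C>" for R S
    proof -
      obtain X Y where XY: "X \<in> \<C>" "R \<in> X" "Y \<in> \<C>" "S \<in> Y" using RS by blast
      then have "X \<subseteq> Y \<or> Y \<subseteq> X" using C(2) by (auto simp: subset_chain_def)
      then obtain Z where "Z \<in> \<C>" "R \<in> Z" "S \<in> Z" using XY by blast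
      then show ?thesis using sub by (auto simp: \<A>_def)
    qed
    then show "\<Union>\<C> \<in> \<A>" using C(1) sub unfolding \<A>_def by blast
  qed
  then obtain M where M: "M \<in> \<A>" and max: "\<And>X. [|X \<in> \<A>; M \<subseteq> X|] ==> X = M" by blast
  note MD = M[unfolded \<A>_def, simplified]
  \<comment> \<open>Adjoining the intersections of T with the members of \<open>M\<close> gives an
    admissible family, so maximality puts T into \<open>M\<close>. This yields upward closure, the
    part of multiplicativity that closure under intersection does not give.\<close>
  have meets: "T \<in> M" if T: "T \<in> J" "\<And>S. S \<in> M ==> T \<inter> S \<noteq> {}" for T
  proof -
    let ?X = "M \<union> (\<lambda>S. T \<inter> S) ` M"
    have "R \<inter> S \<in> ?X" if RS: "R \<in> ?X" "S \<in> ?X" for R S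
    proof -
      obtain R' where R': "R' \<in> M" "R = R' \<or> R = T \<inter> R'" using RS(1) by blast
      obtain S' where S': "S' \<in> M" "S = S' \<or> S = T \<inter> S'" using RS(2) by blast
      have "R' \<inter> S' \<in> M" using R' S' MD by blast
      moreover have "R \<inter> S = R' \<inter> S' \<or> R \<inter> S = T \<inter> (R' \<inter> S')" using R' S' by blast
      ultimately show ?thesis by (metis UnI1 UnI2 imageI)
    qed
    moreover have "{} \<notin> ?X" using T(2) MD by (metis UnE imageE)
    moreover have "?X \<subseteq> J" using T(1) MD by auto
    moreover have "P \<in> ?X" "p <# P \<in> ?X" using MD by auto
    ultimately have "?X \<in> \<A>" unfolding \<A>_def by simp
    then have "?X = M" using max by blast
    moreover have "T \<inter> P = T" using T J_subset by blast
    ultimately show ?thesis using MD by (metis UnCI imageI)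
  qed
  define \<xi> where "\<xi> S = (if S \<in> M then 1 else 0 :: nat)" for S
  have \<xi>1: "\<xi> S = 1 \<longleftrightarrow> S \<in> M" for S by (simp add: \<xi>_def)
  have "\<xi> \<in> JH"
  proof (rule JHI)
    show "\<xi> (R \<inter> S) = 1 \<longleftrightarrow> \<xi> R = 1 \<and> \<xi> S = 1" if "R \<in> J" "S \<in> J" for R S
    proof
      assume "\<xi> (R \<inter> S) = 1"
      then have RS: "R \<inter> S \<in> M" by (simp add: \<xi>1)
      have "R \<in> M" using MD RS by (intro meets that) (metis Int_assoc Int_commute Int_empty_left)
      moreover have "S \<in> M" using MD RS by (intro meets that) (metis Int_assoc Int_empty_right)
      ultimately show "\<xi> R = 1 \<and> \<xi> S = 1" by (simp add: \<xi>1)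
    qed (use MD in \<open>auto simp: \<xi>1\<close>)
  qed (use MD in \<open>auto simp: \<xi>_def split: if_splits\<close>)
  moreover have "\<eta> -` {1} = \<xi> -` {1}" if \<eta>: "\<eta> \<in> JH" "\<xi> -` {1} \<subseteq> \<eta> -` {1}" for \<eta>
  proof -
    have "{S. \<eta> S = 1} \<in> \<A>"
      using \<eta> MD JH_one_J[OF \<eta>(1)] JH_empty[OF \<eta>(1)] JH_Int_iff[OF \<eta>(1)] by (auto simp: \<A>_def \<xi>1)
    moreover have "M \<subseteq> {S. \<eta> S = 1}" using \<eta>(2) by (auto simp: \<xi>1)
    ultimately have "{S. \<eta> S = 1} = M" by (rule max)
    then show ?thesis by (auto simp: \<xi>1)
  qed
  ultimately have "\<xi> \<in> MX" by (auto simp: maximal_characters_def)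
  then show ?thesis using MD by (intro bexI[of _ \<xi>]) (auto simp: \<xi>1)
qed

text \<open>The tight characters; they turn out to be exactly the points of the boundary.\<close>

definition Bd :: "('g set => nat) set" where
  "Bd = {\<eta> \<in> JH. \<forall>S \<C>. foundation_set G P S \<C> \<longrightarrow> \<eta> S = 1 \<longrightarrow> (\<exists>R\<in>\<C>. \<eta> R = 1)}"

lemma Bd_JH: "\<eta> \<in> Bd ==> \<eta> \<in> JH"
  by (simp add: Bd_def)

lemma JH_INT:
  assumes \<eta>: "\<eta> \<in> JH" and S: "\<eta> S = 1" and "finite \<D>" "\<And>T. T \<in> \<D> ==> \<eta> T = 1"
  shows "\<eta> (S \<inter> \<Inter>\<D>) = 1"
  using assms(3,4)
proof (induction \<D>)
  case (insert T \<D>)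
  then have "\<eta> (T \<inter> (S \<inter> \<Inter>\<D>)) = 1"
    using JH_Int_iff[OF \<eta>, of T "S \<inter> \<Inter>\<D>"] JH_one_J[OF \<eta>] by simp
  then show ?case by (simp add: Int_ac)
qed (simp add: S)

text \<open>An ideal R of value 0 is disjoint from some T of value 1, since otherwise R could be
  adjoined to the filter. If all members of a foundation set for S had value 0, a point p common to
  S and the corresponding T would have pP disjoint from every member.\<close>

lemma MX_Bd: "\<xi> \<in> MX ==> \<xi> \<in> Bd"
proof -
  assume \<xi>M: "\<xi> \<in> MX"
  then have \<xi>: "\<xi> \<in> JH" by (simp add: maximal_characters_def)
  have sep: "\<exists>T. \<xi> T = 1 \<and> T \<inter> R = {}" if R: "R \<in> J" "\<xi> R \<noteq> 1" for R
  proof (rule ccontr)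
    assume "\<nexists>T. \<xi> T = 1 \<and> T \<inter> R = {}"
    then have ne: "T \<inter> R \<noteq> {}" if "\<xi> T = 1" for T using that by blast
    \<comment> \<open>The filter generated by R and the ideals on which \<xi> is 1.\<close>
    define \<eta> where "\<eta> Y = (if Y \<in> J \<and> (\<exists>T. \<xi> T = 1 \<and> T \<inter> R \<subseteq> Y) then 1 else 0 :: nat)" for Y
    have \<eta>1: "\<eta> Y = 1 \<longleftrightarrow> Y \<in> J \<and> (\<exists>T. \<xi> T = 1 \<and> T \<inter> R \<subseteq> Y)" for Y by (simp add: \<eta>_def)
    have "\<eta> \<in> JH"
    proof (rule JHI)
      show "\<eta> P = 1" using JH_P[OF \<xi>] by (auto simp: \<eta>1)
      show "\<eta> {} \<noteq> 1" using ne by (auto simp: \<eta>1)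
      show "\<eta> (X \<inter> Y) = 1 \<longleftrightarrow> \<eta> X = 1 \<and> \<eta> Y = 1" if XY: "X \<in> J" "Y \<in> J" for X Y
      proof
        assume "\<eta> X = 1 \<and> \<eta> Y = 1"
        then obtain T T' where T: "\<xi> T = 1" "T \<inter> R \<subseteq> X" "\<xi> T' = 1" "T' \<inter> R \<subseteq> Y" by (auto simp: \<eta>1)
        then have "\<xi> (T \<inter> T') = 1" using JH_Int_iff[OF \<xi>] JH_one_J[OF \<xi>] by simp
        then show "\<eta> (X \<inter> Y) = 1" using T XY unfolding \<eta>1 by blast
      qed (use XY in \<open>auto simp: \<eta>1\<close>)
    qed (auto simp: \<eta>_def split: if_splits)
    moreover have "\<xi> -` {1} \<subseteq> \<eta> -` {1}" using JH_one_J[OF \<xi>] by (auto simp: \<eta>1)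
    ultimately have "\<eta> -` {1} = \<xi> -` {1}" using \<xi>M by (auto simp: maximal_characters_def)
    moreover have "\<eta> R = 1" using R JH_P[OF \<xi>] by (auto simp: \<eta>1)
    ultimately show False using R by auto
  qed
  have "\<exists>R\<in>\<C>. \<xi> R = 1" if F: "foundation_set G P S \<C>" and S: "\<xi> S = 1" for S \<C>
  proof (rule ccontr)
    assume no: "\<not> (\<exists>R\<in>\<C>. \<xi> R = 1)"
    have FD: "finite \<C>" "\<C> \<subseteq> J" "\<And>p. p \<in> S ==> \<exists>R\<in>\<C>. (p <# P) \<inter> R \<noteq> {}" "S \<in> J"
      using F by (auto simp: foundation_set_Int)
    have "\<forall>R\<in>\<C>. \<exists>T. \<xi> T = 1 \<and> T \<inter> R = {}" using sep FD(2) no by blast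
    then obtain T where T: "\<And>R. R \<in> \<C> ==> \<xi> (T R) = 1 \<and> T R \<inter> R = {}" by metis
    have "\<xi> (S \<inter> \<Inter>(T ` \<C>)) = 1" using T FD(1) by (intro JH_INT[OF \<xi> S]) auto
    then obtain p where p: "p \<in> S \<inter> \<Inter>(T ` \<C>)" using JH_empty[OF \<xi>] by (metis ex_in_conv)
    then obtain R where R: "R \<in> \<C>" "(p <# P) \<inter> R \<noteq> {}" using FD(3) by blast
    have "p <# P \<subseteq> T R" using p R T JH_one_J[OF \<xi>] by (intro principal_subset) auto
    then show False using R T by blast
  qed
  then show ?thesis using \<xi> by (auto simp: Bd_def)
qed

section \<open>Comparison of tight characters with the points of \<Delta> F\<close>

lemma Delta_mono: "F \<subseteq> F' ==> \<Delta> F' \<subseteq> \<Delta> F"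
  by (auto simp: Delta_def)

lemma Delta_P: "q \<in> \<Delta> F ==> q \<in> P"
  by (simp add: Delta_def)

text \<open>The elements of F are treated one by one. If qP meets gP, q is moved to a point x of the
  intersection, whereupon xP lies in gP; otherwise q stays. The alternative for the elements treated
  before is inherited by xP, a subset of qP.\<close>

lemma Delta_meets_principal:
  assumes "finite F" "F \<subseteq> carrier G" "p \<in> P"
  shows "\<exists>q\<in>\<Delta> F. q \<in> p <# P"
  using assms
proof (induction F)
  case empty
  then show ?case by (intro bexI[of _ p]) (auto simp: Delta_def)
next
  case (insert g F)
  then obtain q where q: "q \<in> \<Delta> F" "q \<in> p <# P" by auto
  have qP: "q \<in> P" using q by (simp add: Delta_P)
  have sub: "x <# P \<subseteq> q <# P" if "x \<in> q <# P" for x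
    using principal_subset[of "q <# P" x] qP that by blast
  have subp: "q <# P \<subseteq> p <# P" using principal_subset[of "p <# P" q] insert q by blast
  show ?case
  proof (cases "(q <# P) \<inter> (g <# P) = {}")
    case True
    then have "q \<in> \<Delta> (insert g F)" using q by (simp add: Delta_def)
    then show ?thesis using q by blast
  next
    case False
    then obtain x where x: "x \<in> q <# P" "x \<in> g <# P" by blast
    have xP: "x \<in> P" using x qP J_subset[of "q <# P"] by blast
    obtain r where r: "r \<in> P" "x = g \<otimes> r" using x by (auto simp: l_coset_def)
    have gsub: "x <# P \<subseteq> g <# P"
    proof
      fix y assume "y \<in> x <# P"
      then obtain s where "s \<in> P" "y = x \<otimes> s" by (auto simp: l_coset_def)
      then have "y = g \<otimes> (r \<otimes> s)" "r \<otimes> s \<in> P" using r insert by (auto simp: m_assoc)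
      then show "y \<in> g <# P" by (auto simp: l_coset_def)
    qed
    have "(x <# P) \<inter> (h <# P) = {} \<or> (x <# P) \<inter> (h <# P) = x <# P" if "h \<in> F" for h
      using q(1) that sub[OF x(1)] by (auto simp: Delta_def)
    then have "x \<in> \<Delta> (insert g F)" using xP gsub by (auto simp: Delta_def)
    then show ?thesis using x subp by blast
  qed
qed

text \<open>Let X be the intersection of P with the members of \<D> of value 1. The other members,
  cut down to X, have value 0 and hence do not form a foundation set for X. So some p in X has pP
  disjoint from all of them, every point of pP has the prescribed memberships, and one such point
  lies in \<Delta> F.\<close>

lemma Bd_density:
  assumes \<xi>: "\<xi> \<in> Bd" and D: "finite \<D>" "\<D> \<subseteq> J" and F: "finite F" "F \<subseteq> carrier G"
  shows "\<exists>q\<in>\<Delta> F. \<forall>S\<in>\<D>. q \<in> S \<longleftrightarrow> \<xi> S = 1"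
proof -
  define X where "X = P \<inter> \<Inter>{S \<in> \<D>. \<xi> S = 1}"
  have X: "\<xi> X = 1" unfolding X_def using D by (intro JH_INT[OF Bd_JH[OF \<xi>] JH_P[OF Bd_JH[OF \<xi>]]]) auto
  have XJ: "X \<in> J" using JH_one_J[OF Bd_JH[OF \<xi>] X] .
  let ?C = "(\<lambda>S. S \<inter> X) ` {S \<in> \<D>. \<xi> S \<noteq> 1}"
  have "\<xi> (S \<inter> X) \<noteq> 1" if "S \<in> \<D>" "\<xi> S \<noteq> 1" for S
    using JH_Int_iff[OF Bd_JH[OF \<xi>], of S X] XJ that D by auto
  then have "\<not> foundation_set G P X ?C" using \<xi> X unfolding Bd_def by blast
  moreover have "finite ?C" "?C \<subseteq> J" using D XJ by auto
  ultimately obtain p where p: "p \<in> X" "\<And>S. [|S \<in> \<D>; \<xi> S \<noteq> 1|] ==> (p <# P) \<inter> (S \<inter> X) = {}"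
    using XJ by (auto simp: foundation_set_Int)
  have pP: "p \<in> P" using p(1) by (simp add: X_def)
  obtain q where q: "q \<in> \<Delta> F" "q \<in> p <# P" using Delta_meets_principal[OF F pP] by blast
  have qX: "q \<in> X" using principal_subset[OF XJ p(1)] q by blast
  have "q \<in> S \<longleftrightarrow> \<xi> S = 1" if S: "S \<in> \<D>" for S
    using p(2)[OF S] q qX S by (auto simp: X_def)
  then show ?thesis using q by blast
qed

text \<open>A constructible ideal S is a finite intersection of translates gP. If F contains these
  g, a point q of \<Delta> F lies in S or has qP disjoint from S; accordingly a maximal character
  above qP has value 1 or 0 at S.\<close>

lemma Delta_agrees:
  assumes D: "finite \<D>" "\<D> \<subseteq> J"
  shows "\<exists>F. finite F \<and> F \<subseteq> carrier G \<and> (\<forall>q\<in>\<Delta> F. \<exists>\<xi>\<in>MX. \<forall>S\<in>\<D>. q \<in> S \<longleftrightarrow> \<xi> S = 1)"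
proof -
  have "\<exists>F. finite F \<and> F \<subseteq> carrier G \<and> (\<forall>q\<in>\<Delta> F. q \<in> S \<or> (q <# P) \<inter> S = {})" if SJ: "S \<in> J" for S
  proof -
    obtain \<alpha> where \<alpha>: "\<alpha> \<in> W" "S = KK \<alpha>" using SJ unfolding constructible_def by blast
    let ?F = "(\<lambda>i. dot (take (2 * i) (rev \<alpha>))) ` {..length \<alpha> div 2}"
    have "take (2 * i) (rev \<alpha>) \<in> W" if "i \<le> length \<alpha> div 2" for i
      using \<alpha> that set_take_subset[of "2 * i" "rev \<alpha>"] by (auto simp: words_def min_def)
    then have "?F \<subseteq> carrier G" by auto
    moreover have "q \<in> S \<or> (q <# P) \<inter> S = {}" if q: "q \<in> \<Delta> ?F" for q
    proof (rule disjCI)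
      assume "(q <# P) \<inter> S \<noteq> {}"
      then have "(q <# P) \<inter> (dot (take (2 * i) (rev \<alpha>)) <# P) \<noteq> {}" if "i \<le> length \<alpha> div 2" for i
        using that by (auto simp: \<alpha> K_def)
      then have "q <# P \<subseteq> dot (take (2 * i) (rev \<alpha>)) <# P" if "i \<le> length \<alpha> div 2" for i
        using q that by (force simp: Delta_def)
      then show "q \<in> S" using principal_mem[OF Delta_P[OF q]] by (auto simp: \<alpha> K_def)
    qed
    ultimately show ?thesis by (intro exI[of _ ?F]) auto
  qed
  then obtain F where F: "\<And>S. S \<in> J ==> finite (F S) \<and> F S \<subseteq> carrier G \<and> (\<forall>q\<in>\<Delta> (F S). q \<in> S \<or> (q <# P) \<inter> S = {})"
    by metis
  show ?thesis
  proof (intro exI[of _ "\<Union>(F ` \<D>)"] conjI ballI)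
    show "finite (\<Union>(F ` \<D>))" "\<Union>(F ` \<D>) \<subseteq> carrier G" using F D by blast+
    fix q assume q: "q \<in> \<Delta> (\<Union>(F ` \<D>))"
    obtain \<xi> where \<xi>: "\<xi> \<in> MX" "\<xi> (q <# P) = 1" using maximal_above_principal[OF Delta_P[OF q]] by blast
    then have \<xi>J: "\<xi> \<in> JH" by (simp add: maximal_characters_def)
    have "q \<in> S \<longleftrightarrow> \<xi> S = 1" if S: "S \<in> \<D>" for S
    proof -
      have SJ: "S \<in> J" using S D by blast
      have "q \<in> \<Delta> (F S)" using q S Delta_mono[of "F S" "\<Union>(F ` \<D>)"] by blast
      then consider "q \<in> S" | "q \<notin> S" "(q <# P) \<inter> S = {}" using F[OF SJ] by blast
      then show ?thesis
      proof cases
        case 1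
        then show ?thesis using JH_mono[OF \<xi>J \<xi>(2) principal_subset[OF SJ 1] SJ] by simp
      next
        case 2
        have "q <# P \<in> J" using Delta_P[OF q] by blast
        then have "\<xi> S \<noteq> 1" using JH_Int_iff[OF \<xi>J _ SJ, of "q <# P"] \<xi>(2) 2 JH_empty[OF \<xi>J] by auto
        then show ?thesis using 2 by simp
      qed
    qed
    then show "\<exists>\<xi>\<in>MX. \<forall>S\<in>\<D>. q \<in> S \<longleftrightarrow> \<xi> S = 1" using \<xi> by blast
  qed
qed

text \<open>On finitely many ideals a tight character is matched by a point of some \<Delta> F, and
  this point by a maximal character. In the pointwise topology this is density of the maximal
  characters.\<close>

lemma maximal_approx:
  assumes \<xi>: "\<xi> \<in> Bd" and D: "finite \<D>"
  shows "\<exists>\<eta>\<in>MX. \<forall>S\<in>\<D>. \<eta> S = \<xi> S"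
proof -
  have D': "finite (\<D> \<inter> J)" "\<D> \<inter> J \<subseteq> J" using D by auto
  obtain F where F: "finite F" "F \<subseteq> carrier G" "\<forall>q\<in>\<Delta> F. \<exists>\<xi>\<in>MX. \<forall>S\<in>\<D> \<inter> J. q \<in> S \<longleftrightarrow> \<xi> S = 1"
    using Delta_agrees[OF D'] by blast
  obtain q where q: "q \<in> \<Delta> F" "\<forall>S\<in>\<D> \<inter> J. q \<in> S \<longleftrightarrow> \<xi> S = 1"
    using Bd_density[OF \<xi> D' F(1,2)] by blast
  obtain \<eta> where \<eta>: "\<eta> \<in> MX" "\<forall>S\<in>\<D> \<inter> J. q \<in> S \<longleftrightarrow> \<eta> S = 1" using F(3) q(1) by blast
  have \<eta>J: "\<eta> \<in> JH" using \<eta> by (simp add: maximal_characters_def)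
  have "\<eta> S = \<xi> S" if "S \<in> \<D>" for S
  proof (cases "S \<in> J")
    case True
    then have "\<eta> S = 1 \<longleftrightarrow> \<xi> S = 1" using q(2) \<eta>(2) that by blast
    then show ?thesis using JH_cases[OF \<eta>J, of S] JH_cases[OF Bd_JH[OF \<xi>], of S] by metis
  next
    case False
    then show ?thesis using JH_not_J[OF \<eta>J] JH_not_J[OF Bd_JH[OF \<xi>]] by metis
  qed
  then show ?thesis using \<eta> by blast
qed

section \<open>The topology of pointwise convergence\<close>

lemma open_agree: "finite \<D> ==> open {\<eta> :: 'g set => nat. \<forall>S\<in>\<D>. \<eta> S = \<xi> S}"
proof -
  assume "finite \<D>"
  have "{\<eta> :: 'g set => nat. \<forall>S\<in>\<D>. \<eta> S = \<xi> S} = (\<Inter>S\<in>\<D>. (\<lambda>\<eta>. \<eta> S) -` {\<xi> S})" by auto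
  moreover have "open ((\<lambda>\<eta> :: 'g set => nat. \<eta> S) -` {\<xi> S})" for S
    by (intro open_vimage open_discrete continuous_on_product_coordinates)
  ultimately show ?thesis using \<open>finite \<D>\<close> by (simp add: open_INT)
qed

lemma closure_agree:
  assumes "\<xi> \<in> closure A" "finite \<D>"
  shows "\<exists>\<eta>\<in>A. \<forall>S\<in>\<D>. \<eta> S = (\<xi> :: 'g set => nat) S"
proof -
  let ?U = "{\<eta> :: 'g set => nat. \<forall>S\<in>\<D>. \<eta> S = \<xi> S}"
  have "?U \<inter> closure A \<noteq> {}" using assms(1) by blast
  then have "?U \<inter> A \<noteq> {}" using open_Int_closure_eq_empty[OF open_agree[OF assms(2)], of \<xi> A] by simp
  then show ?thesis by blast
qed

lemma agree_nbhd:
  assumes "open U" "\<xi> \<in> U"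
  shows "\<exists>\<D>. finite \<D> \<and> {\<eta> :: 'g set => nat. \<forall>S\<in>\<D>. \<eta> S = \<xi> S} \<subseteq> U"
proof -
  have "openin (product_topology (\<lambda>i. euclidean) UNIV) U" using assms(1) by (simp add: open_fun_def)
  from product_topology_open_contains_basis[OF this assms(2)]
  obtain X where X: "\<xi> \<in> (\<Pi>\<^sub>E i\<in>UNIV. X i)" "finite {i. X i \<noteq> UNIV}" "(\<Pi>\<^sub>E i\<in>UNIV. X i) \<subseteq> U" by auto
  have "{\<eta>. \<forall>S\<in>{i. X i \<noteq> UNIV}. \<eta> S = \<xi> S} \<subseteq> (\<Pi>\<^sub>E i\<in>UNIV. X i)"
  proof (clarsimp simp: PiE_UNIV_domain)
    fix \<eta> :: "'g set => nat" and S assume "\<forall>S. X S \<noteq> UNIV \<longrightarrow> \<eta> S = \<xi> S"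
    then show "\<eta> S \<in> X S" using X(1) by (cases "X S = UNIV") (auto simp: PiE_UNIV_domain)
  qed
  then show ?thesis
    by (intro exI[of _ "{i. X i \<noteq> UNIV}"] conjI X(2)) (rule order_trans[OF _ X(3)])
qed

text \<open>Each condition on a tight character involves finitely many ideals, since foundation sets
  are finite; it may therefore be checked on a tight character that agrees there with the given
  limit point.\<close>

lemma closure_Bd: "closure Bd = Bd"
proof
  show "closure Bd \<subseteq> Bd"
  proof
    fix \<xi> assume c: "\<xi> \<in> closure Bd"
    note ag = closure_agree[OF c]
    have ag1: "\<exists>\<eta>\<in>Bd. \<eta> S = \<xi> S" for S using ag[of "{S}"] by auto
    have "\<xi> \<in> JH"
    proof (rule JHI)
      fix S
      obtain \<eta> where "\<eta> \<in> Bd" "\<eta> S = \<xi> S" using ag1 by blast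
      then show "\<xi> S = 0 \<or> \<xi> S = 1" "\<xi> S = 1 ==> S \<in> J"
        using JH_cases[OF Bd_JH, of \<eta> S] JH_one_J[OF Bd_JH, of \<eta> S] by auto
    next
      obtain \<eta> where "\<eta> \<in> Bd" "\<eta> P = \<xi> P" using ag1 by blast
      then show "\<xi> P = 1" using JH_P[OF Bd_JH, of \<eta>] by simp
    next
      obtain \<eta> where "\<eta> \<in> Bd" "\<eta> {} = \<xi> {}" using ag1 by blast
      then show "\<xi> {} \<noteq> 1" using JH_empty[OF Bd_JH, of \<eta>] by simp
    next
      fix R S assume RS: "R \<in> J" "S \<in> J"
      obtain \<eta> where "\<eta> \<in> Bd" "\<eta> R = \<xi> R" "\<eta> S = \<xi> S" "\<eta> (R \<inter> S) = \<xi> (R \<inter> S)"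
        using ag[of "{R, S, R \<inter> S}"] by auto
      then show "\<xi> (R \<inter> S) = 1 \<longleftrightarrow> \<xi> R = 1 \<and> \<xi> S = 1" using JH_Int_iff[OF Bd_JH RS, of \<eta>] by simp
    qed
    moreover have "\<exists>R\<in>\<C>. \<xi> R = 1" if F: "foundation_set G P S \<C>" and S: "\<xi> S = 1" for S \<C>
    proof -
      have "finite (insert S \<C>)" using F by (simp add: foundation_set_def)
      then obtain \<eta> where \<eta>: "\<eta> \<in> Bd" "\<forall>R\<in>insert S \<C>. \<eta> R = \<xi> R" using ag by blast
      then show ?thesis using F S unfolding Bd_def by fastforce
    qed
    ultimately show "\<xi> \<in> Bd" by (auto simp: Bd_def)
  qed
qed (rule closure_subset)

lemma boundary_eq_Bd: "boundary G P = Bd"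
proof -
  have MJ: "JH \<inter> MX = MX" by (auto simp: maximal_characters_def)
  have "boundary G P = JH \<inter> closure MX"
    by (simp add: boundary_def closure_of_subtopology MJ)
  also have "\<dots> = Bd"
  proof
    show "JH \<inter> closure MX \<subseteq> Bd" using closure_mono[of MX Bd] MX_Bd closure_Bd by blast
    show "Bd \<subseteq> JH \<inter> closure MX"
    proof
      fix \<xi> assume \<xi>: "\<xi> \<in> Bd"
      have "\<xi> \<in> closure MX"
      proof (rule ccontr)
        assume "\<xi> \<notin> closure MX"
        then have "open (- closure MX)" "\<xi> \<in> - closure MX" by auto
        from agree_nbhd[OF this] obtain \<D>
          where "finite \<D>" "{\<eta>. \<forall>S\<in>\<D>. \<eta> S = \<xi> S} \<subseteq> - closure MX" by blast
        then show False using maximal_approx[OF \<xi>, of \<D>] closure_subset[of MX] by blast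
      qed
      then show "\<xi> \<in> JH \<inter> closure MX" using Bd_JH[OF \<xi>] by blast
    qed
  qed
  finally show ?thesis .
qed

text \<open>A closed subset of a product of two-point spaces.\<close>

lemma compact_Bd: "compact Bd"
proof -
  have "compactin (product_topology (\<lambda>_. euclidean) (UNIV :: 'g set set)) (PiE UNIV (\<lambda>_. {0, 1 :: nat}))"
    unfolding compactin_PiE by simp
  then have "compact (PiE UNIV (\<lambda>_ :: 'g set. {0, 1 :: nat}))"
    by (simp add: euclidean_product_topology)
  moreover have "closed Bd" using closure_Bd closure_eq by blast
  ultimately have "compact (PiE UNIV (\<lambda>_ :: 'g set. {0, 1 :: nat}) \<inter> Bd)" by (rule compact_Int_closed)
  moreover have "Bd \<subseteq> PiE UNIV (\<lambda>_. {0, 1})"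
  proof
    fix \<eta> assume "\<eta> \<in> Bd"
    from JH_cases[OF Bd_JH[OF this]] show "\<eta> \<in> PiE UNIV (\<lambda>_. {0, 1})" unfolding PiE_UNIV_domain by blast
  qed
  ultimately show ?thesis by (simp add: Int_absorb1)
qed

text \<open>A finite cover of S by constructible ideals is a foundation set for S, so tightness
  contains the condition that defines the spectrum.\<close>

lemma Bd_Omega: "Bd \<subseteq> Omega G P"
proof
  fix \<xi> assume \<xi>: "\<xi> \<in> Bd"
  have "\<exists>R\<in>\<C>. \<xi> R = 1" if "S \<in> J" "finite \<C>" "\<C> \<subseteq> J" "S = \<Union>\<C>" "\<xi> S = 1" for S \<C>
  proof -
    have "foundation_set G P S \<C>"
      unfolding foundation_set_Int
    proof (intro conjI ballI)
      fix p assume p: "p \<in> S"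
      then have "p \<in> p <# P" using J_subset[OF that(1)] by auto
      then show "\<exists>R\<in>\<C>. (p <# P) \<inter> R \<noteq> {}" using p that(4) by blast
    qed (use that in auto)
    then show ?thesis using \<xi> that by (auto simp: Bd_def)
  qed
  then show "\<xi> \<in> Omega G P" using Bd_JH[OF \<xi>] by (auto simp: Omega_def)
qed

subsection \<open>Simple functions\<close>

text \<open>The functions on characters given by the span of the indicator functions of members of
  \<S>. Values outside \<open>JH\<close> are left free, so representatives may be chosen by any
  convenient formula.\<close>

definition SF :: "'g set set => (('g set => nat) => complex) set" where
  "SF \<S> = {s. \<exists>F c. finite F \<and> F \<subseteq> \<S> \<and> (\<forall>\<eta>\<in>JH. s \<eta> = (\<Sum>S\<in>F. c S * of_nat (\<eta> S)))}"

lemma SF_E: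
  assumes "s \<in> SF \<S>"
  obtains F c where "finite F" "F \<subseteq> \<S>" "\<And>\<eta>. \<eta> \<in> JH ==> s \<eta> = (\<Sum>S\<in>F. c S * of_nat (\<eta> S))"
  using assms by (auto simp: SF_def)

lemma SF_cong: "[|s \<in> SF \<S>; \<And>\<eta>. \<eta> \<in> JH ==> s \<eta> = t \<eta>|] ==> t \<in> SF \<S>"
  unfolding SF_def by simp

lemma SF_mono: "[|s \<in> SF \<S>; \<S> \<subseteq> \<T>|] ==> s \<in> SF \<T>"
  unfolding SF_def by blast

lemma SF_zero: "(\<lambda>_. 0) \<in> SF \<S>"
  unfolding SF_def by (auto intro!: exI[of _ "{}"])

lemma SF_ind: "S \<in> \<S> ==> (\<lambda>\<eta>. of_nat (\<eta> S)) \<in> SF \<S>"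
  unfolding SF_def by (auto intro!: exI[of _ "{S}"] exI[of _ "\<lambda>_. 1"])

lemma SF_smult: "s \<in> SF \<S> ==> (\<lambda>\<eta>. a * s \<eta>) \<in> SF \<S>"
proof -
  assume "s \<in> SF \<S>"
  then obtain F c where "finite F" "F \<subseteq> \<S>" "\<And>\<eta>. \<eta> \<in> JH ==> s \<eta> = (\<Sum>S\<in>F. c S * of_nat (\<eta> S))"
    by (rule SF_E) blast
  then show ?thesis unfolding SF_def
    by (auto intro!: exI[of _ F] exI[of _ "\<lambda>S. a * c S"] simp: sum_distrib_left mult.assoc)
qed

lemma SF_add: "[|s \<in> SF \<S>; t \<in> SF \<S>|] ==> (\<lambda>\<eta>. s \<eta> + t \<eta>) \<in> SF \<S>"
proof -
  assume s: "s \<in> SF \<S>" and t: "t \<in> SF \<S>"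
  obtain F c where F: "finite F" "F \<subseteq> \<S>" "\<And>\<eta>. \<eta> \<in> JH ==> s \<eta> = (\<Sum>S\<in>F. c S * of_nat (\<eta> S))"
    using s by (rule SF_E) blast
  obtain F' c' where F': "finite F'" "F' \<subseteq> \<S>" "\<And>\<eta>. \<eta> \<in> JH ==> t \<eta> = (\<Sum>S\<in>F'. c' S * of_nat (\<eta> S))"
    using t by (rule SF_E) blast
  have "s \<eta> + t \<eta> = (\<Sum>S\<in>F \<union> F'. ((if S \<in> F then c S else 0) + (if S \<in> F' then c' S else 0)) * of_nat (\<eta> S))"
    if "\<eta> \<in> JH" for \<eta>
  proof -
    have "s \<eta> = (\<Sum>S\<in>F \<union> F'. (if S \<in> F then c S else 0) * of_nat (\<eta> S))"
      unfolding F(3)[OF that] using F F' by (intro sum.mono_neutral_cong_left) auto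
    moreover have "t \<eta> = (\<Sum>S\<in>F \<union> F'. (if S \<in> F' then c' S else 0) * of_nat (\<eta> S))"
      unfolding F'(3)[OF that] using F F' by (intro sum.mono_neutral_cong_left) auto
    ultimately show ?thesis by (simp add: sum.distrib distrib_right)
  qed
  then show ?thesis
    unfolding SF_def using F F'
    by (intro CollectI exI[of _ "F \<union> F'"]
        exI[of _ "\<lambda>S. (if S \<in> F then c S else 0) + (if S \<in> F' then c' S else 0)"]) simp
qed

lemma SF_diff: "[|s \<in> SF \<S>; t \<in> SF \<S>|] ==> (\<lambda>\<eta>. s \<eta> - t \<eta>) \<in> SF \<S>"
  using SF_add[OF _ SF_smult[of t \<S> "-1"], of s] by simp

lemma SF_sum: "(\<And>i. i \<in> I ==> s i \<in> SF \<S>) ==> (\<lambda>\<eta>. \<Sum>i\<in>I. s i \<eta>) \<in> SF \<S>"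
  by (induction I rule: infinite_finite_induct) (auto simp: SF_zero SF_add)

lemma SF_cnj: "s \<in> SF \<S> ==> (\<lambda>\<eta>. cnj (s \<eta>)) \<in> SF \<S>"
proof -
  assume "s \<in> SF \<S>"
  then obtain F c where "finite F" "F \<subseteq> \<S>" "\<And>\<eta>. \<eta> \<in> JH ==> s \<eta> = (\<Sum>S\<in>F. c S * of_nat (\<eta> S))"
    by (rule SF_E) blast
  then show ?thesis unfolding SF_def
    by (auto intro!: exI[of _ F] exI[of _ "\<lambda>S. cnj (c S)"])
qed

text \<open>Since characters are multiplicative, a product of two coordinates is the coordinate of
  the intersection.\<close>

lemma SF_mult:
  assumes s: "s \<in> SF \<S>" and t: "t \<in> SF \<T>" and cl: "\<And>R S. [|R \<in> \<S>; S \<in> \<T>|] ==> R \<inter> S \<in> \<S>"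
    and J: "\<S> \<subseteq> J" "\<T> \<subseteq> J"
  shows "(\<lambda>\<eta>. s \<eta> * t \<eta>) \<in> SF \<S>"
proof -
  obtain F c where F: "finite F" "F \<subseteq> \<S>" "\<And>\<eta>. \<eta> \<in> JH ==> s \<eta> = (\<Sum>S\<in>F. c S * of_nat (\<eta> S))"
    using s by (rule SF_E) blast
  obtain F' c' where F': "finite F'" "F' \<subseteq> \<T>" "\<And>\<eta>. \<eta> \<in> JH ==> t \<eta> = (\<Sum>S\<in>F'. c' S * of_nat (\<eta> S))"
    using t by (rule SF_E) blast
  have "(\<lambda>\<eta>. \<Sum>R\<in>F. \<Sum>S\<in>F'. (c R * c' S) * of_nat (\<eta> (R \<inter> S))) \<in> SF \<S>"
    using F(2) F'(2) cl by (intro SF_sum SF_smult SF_ind) auto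
  moreover have "(\<Sum>R\<in>F. \<Sum>S\<in>F'. (c R * c' S) * of_nat (\<eta> (R \<inter> S))) = s \<eta> * t \<eta>" if "\<eta> \<in> JH" for \<eta>
  proof -
    have "\<eta> (R \<inter> S) = \<eta> R * \<eta> S" if "R \<in> F" "S \<in> F'" for R S
      using that F(2) F'(2) J by (intro JH_Int \<open>\<eta> \<in> JH\<close>) auto
    then show ?thesis unfolding F(3)[OF that] F'(3)[OF that] sum_product
      by (intro sum.cong) (auto simp: algebra_simps)
  qed
  ultimately show ?thesis by (rule SF_cong)
qed

text \<open>A function of finitely many coordinates with values 0 and 1 is a polynomial in them, and
  products of coordinates are again coordinates. Vanishing at 0 rules out a constant term, which
  need not lie in the span.\<close>

lemma SF_determined:
  assumes "finite \<D>" "\<D> \<subseteq> \<S>" "\<S> \<subseteq> J" and cl: "\<And>R S. [|R \<in> \<S>; S \<in> \<S>|] ==> R \<inter> S \<in> \<S>"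
    and "\<And>\<eta> \<eta>'. (\<forall>S\<in>\<D>. \<eta> S = \<eta>' S) ==> s \<eta> = s \<eta>'" "s (\<lambda>_. 0) = 0"
  shows "s \<in> SF \<S>"
  using assms(1,2,5,6)
proof (induction \<D> arbitrary: s)
  case empty
  have "s \<eta> = 0" for \<eta> using empty.prems(2)[of \<eta> "\<lambda>_. 0"] empty.prems(3) by simp
  then show ?case by (intro SF_cong[OF SF_zero]) simp
next
  case (insert S \<D>)
  \<comment> \<open>Splitting at the coordinate S: s is its value at 0 plus the increment times the
    coordinate. The increment is written as \<open>d\<close> plus the constant \<open>k\<close>, so
    that \<open>d\<close> vanishes at 0 as the induction hypothesis demands.\<close>
  define s0 where "s0 \<eta> = s (\<eta>(S := 0))" for \<eta>
  define k where "k = s ((\<lambda>_. 0)(S := 1)) - s0 (\<lambda>_. 0)"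
  define d where "d \<eta> = s (\<eta>(S := 1)) - s0 \<eta> - k" for \<eta>
  have s0: "s0 \<in> SF \<S>"
  proof (rule insert.IH)
    show "s0 \<eta> = s0 \<eta>'" if "\<forall>S\<in>\<D>. \<eta> S = \<eta>' S" for \<eta> \<eta>'
      unfolding s0_def using that by (intro insert.prems(2)) auto
    have "(\<lambda>_. 0)(S := 0) = (\<lambda>_. 0 :: nat)" by auto
    then show "s0 (\<lambda>_. 0) = 0" using insert.prems(3) by (simp add: s0_def)
  qed (use insert.prems in auto)
  have d: "d \<in> SF \<S>"
  proof (rule insert.IH)
    show "d \<eta> = d \<eta>'" if ag: "\<forall>S\<in>\<D>. \<eta> S = \<eta>' S" for \<eta> \<eta>'
    proof -
      have "s (\<eta>(S := 1)) = s (\<eta>'(S := 1))" "s (\<eta>(S := 0)) = s (\<eta>'(S := 0))"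
        using ag by (intro insert.prems(2); auto)+
      then show ?thesis by (simp add: d_def s0_def)
    qed
  qed (use insert.prems in \<open>auto simp: d_def k_def\<close>)
  have "(\<lambda>\<eta>. s0 \<eta> + (d \<eta> * of_nat (\<eta> S) + k * of_nat (\<eta> S))) \<in> SF \<S>"
    using insert.prems(1) assms(3) cl by (intro SF_add SF_smult s0 SF_mult[OF d, of _ \<S>] SF_ind) auto
  moreover have "s0 \<eta> + (d \<eta> * of_nat (\<eta> S) + k * of_nat (\<eta> S)) = s \<eta>" if "\<eta> \<in> JH" for \<eta>
    using JH_cases[OF that, of S]
  proof
    assume "\<eta> S = 0"
    then have "\<eta>(S := 0) = \<eta>" by auto
    then show ?thesis using \<open>\<eta> S = 0\<close> by (simp add: s0_def)
  next
    assume "\<eta> S = 1"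
    then have "\<eta>(S := 1) = \<eta>" by auto
    then show ?thesis using \<open>\<eta> S = 1\<close> by (simp add: d_def)
  qed
  ultimately show ?case by (rule SF_cong)
qed

text \<open>A constant term is carried by P, at which every character has value 1.\<close>

lemma SF_determined_J:
  assumes "finite \<D>" "\<D> \<subseteq> J" "\<And>\<eta> \<eta>'. (\<forall>S\<in>\<D>. \<eta> S = \<eta>' S) ==> s \<eta> = s \<eta>'"
  shows "s \<in> SF J"
proof -
  have "(\<lambda>\<eta>. s \<eta> - s (\<lambda>_. 0)) \<in> SF J"
    using assms by (intro SF_determined[OF assms(1,2)]) auto
  then have "(\<lambda>\<eta>. (s \<eta> - s (\<lambda>_. 0)) + s (\<lambda>_. 0) * of_nat (\<eta> P)) \<in> SF J"
    by (intro SF_add SF_smult SF_ind) auto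
  then show ?thesis by (rule SF_cong) (simp add: JH_P)
qed

text \<open>No regularity of \<tau> enters, because the function depends on finitely many
  coordinates only. Cut-offs of a combination are therefore again combinations.\<close>

lemma SF_comp:
  assumes s: "s \<in> SF \<S>" and J: "\<S> \<subseteq> J" and cl: "\<And>R S. [|R \<in> \<S>; S \<in> \<S>|] ==> R \<inter> S \<in> \<S>"
    and \<tau>: "\<tau> 0 = 0"
  shows "(\<lambda>\<eta>. \<tau> (s \<eta>)) \<in> SF \<S>"
proof -
  obtain F c where F: "finite F" "F \<subseteq> \<S>" "\<And>\<eta>. \<eta> \<in> JH ==> s \<eta> = (\<Sum>S\<in>F. c S * of_nat (\<eta> S))"
    using s by (rule SF_E) blast
  have "(\<lambda>\<eta>. \<tau> (\<Sum>S\<in>F. c S * of_nat (\<eta> S))) \<in> SF \<S>"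
    by (rule SF_determined[OF F(1,2) J cl]) (auto simp: \<tau> cong: sum.cong)
  then show ?thesis by (rule SF_cong) (simp add: F(3))
qed

text \<open>The values agree exactly, not just approximately, since a combination sees only finitely
  many ideals.\<close>

lemma SF_density:
  assumes s: "s \<in> SF J" and \<xi>: "\<xi> \<in> Bd" and F: "finite F" "F \<subseteq> carrier G"
  shows "\<exists>q\<in>\<Delta> F. s (point q) = s \<xi>"
proof -
  obtain \<D> c where D: "finite \<D>" "\<D> \<subseteq> J" "\<And>\<eta>. \<eta> \<in> JH ==> s \<eta> = (\<Sum>S\<in>\<D>. c S * of_nat (\<eta> S))"
    using s by (rule SF_E) blast
  obtain q where q: "q \<in> \<Delta> F" "\<forall>S\<in>\<D>. q \<in> S \<longleftrightarrow> \<xi> S = 1" using Bd_density[OF \<xi> D(1,2) F] by blast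
  have "point q S = \<xi> S" if "S \<in> \<D>" for S
    using q(2) that D(2) JH_cases[OF Bd_JH[OF \<xi>], of S] by (auto simp: point_def)
  then have "s (point q) = s \<xi>"
    unfolding D(3)[OF point_JH[OF Delta_P[OF q(1)]]] D(3)[OF Bd_JH[OF \<xi>]] by (intro sum.cong) auto
  then show ?thesis using q by blast
qed

lemma SF_Delta:
  assumes s: "s \<in> SF J"
  shows "\<exists>F. finite F \<and> F \<subseteq> carrier G \<and> (\<forall>q\<in>\<Delta> F. \<exists>\<xi>\<in>Bd. s \<xi> = s (point q))"
proof -
  obtain \<D> c where D: "finite \<D>" "\<D> \<subseteq> J" "\<And>\<eta>. \<eta> \<in> JH ==> s \<eta> = (\<Sum>S\<in>\<D>. c S * of_nat (\<eta> S))"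
    using s by (rule SF_E) blast
  obtain F where F: "finite F" "F \<subseteq> carrier G" "\<forall>q\<in>\<Delta> F. \<exists>\<xi>\<in>MX. \<forall>S\<in>\<D>. q \<in> S \<longleftrightarrow> \<xi> S = 1"
    using Delta_agrees[OF D(1,2)] by blast
  have "\<exists>\<xi>\<in>Bd. s \<xi> = s (point q)" if q: "q \<in> \<Delta> F" for q
  proof -
    obtain \<xi> where \<xi>: "\<xi> \<in> MX" "\<forall>S\<in>\<D>. q \<in> S \<longleftrightarrow> \<xi> S = 1" using F(3) q by blast
    note b = MX_Bd[OF \<xi>(1)]
    have "\<xi> S = point q S" if "S \<in> \<D>" for S
      using \<xi>(2) that D(2) JH_cases[OF Bd_JH[OF b], of S] by (auto simp: point_def)
    then have "s \<xi> = s (point q)"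
      unfolding D(3)[OF point_JH[OF Delta_P[OF q]]] D(3)[OF Bd_JH[OF b]] by (intro sum.cong) auto
    then show ?thesis using b by blast
  qed
  then show ?thesis using F by blast
qed

lemma SF_continuous: "s \<in> SF \<S> ==> continuous_on JH s"
proof -
  assume "s \<in> SF \<S>"
  then obtain F c where F: "finite F" "F \<subseteq> \<S>" "\<And>\<eta>. \<eta> \<in> JH ==> s \<eta> = (\<Sum>S\<in>F. c S * of_nat (\<eta> S))"
    by (rule SF_E) blast
  have 1: "continuous_on JH (\<lambda>\<eta>. of_nat (\<eta> S) :: complex)" for S
  proof (rule continuous_on_compose2[of UNIV "of_nat :: nat => complex"])
    show "continuous_on JH (\<lambda>\<eta>. \<eta> S)" by (rule continuous_on_subset[OF continuous_on_product_coordinates]) simp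
  qed auto
  have "continuous_on JH (\<lambda>\<eta>. \<Sum>S\<in>F. c S * of_nat (\<eta> S))"
    by (intro continuous_on_sum continuous_on_mult continuous_on_const 1)
  then show ?thesis by (rule continuous_on_eq) (simp add: F(3))
qed

text \<open>By compactness the values at finitely many ideals determine f up to e. The approximant
  is f composed with the choice of one boundary point for each pattern of such values.\<close>

lemma SF_approx_continuous:
  assumes f: "continuous_on Bd f" and e: "e > 0"
  shows "\<exists>s\<in>SF J. \<forall>\<eta>\<in>Bd. cmod (f \<eta> - s \<eta>) \<le> e"
proof -
  have "\<exists>\<D>. finite \<D> \<and> (\<forall>\<eta>\<in>Bd. (\<forall>S\<in>\<D>. \<eta> S = \<xi> S) \<longrightarrow> cmod (f \<eta> - f \<xi>) < e/2)" if \<xi>: "\<xi> \<in> Bd" for \<xi>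
  proof -
    have "open (ball (f \<xi>) (e/2))" "f \<xi> \<in> ball (f \<xi>) (e/2)" using e by auto
    then obtain U where U: "open U" "\<xi> \<in> U" "\<forall>\<eta>\<in>Bd. \<eta> \<in> U \<longrightarrow> f \<eta> \<in> ball (f \<xi>) (e/2)"
      using f \<xi> unfolding continuous_on_topological by blast
    obtain \<D> where "finite \<D>" "{\<eta>. \<forall>S\<in>\<D>. \<eta> S = \<xi> S} \<subseteq> U" using agree_nbhd[OF U(1,2)] by blast
    then show ?thesis using U(3) by (intro exI[of _ \<D>]) (auto simp: dist_norm norm_minus_commute subset_iff)
  qed
  then obtain \<D> where D: "\<And>\<xi>. \<xi> \<in> Bd ==> finite (\<D> \<xi>)"
    "\<And>\<xi> \<eta>. [|\<xi> \<in> Bd; \<eta> \<in> Bd; \<forall>S\<in>\<D> \<xi>. \<eta> S = \<xi> S|] ==> cmod (f \<eta> - f \<xi>) < e/2"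
    by metis
  define N where "N \<xi> = {\<eta>. \<forall>S\<in>\<D> \<xi>. \<eta> S = \<xi> S}" for \<xi>
  have "\<exists>C\<subseteq>Bd. finite C \<and> Bd \<subseteq> (\<Union>\<xi>\<in>C. N \<xi>)"
  proof (rule compactE_image[OF compact_Bd, of Bd N])
    show "open (N \<xi>)" if "\<xi> \<in> Bd" for \<xi> unfolding N_def by (rule open_agree[OF D(1)[OF that]])
    show "Bd \<subseteq> \<Union> (N ` Bd)" by (auto simp: N_def)
  qed blast
  then obtain C where C: "C \<subseteq> Bd" "finite C" "Bd \<subseteq> (\<Union>\<xi>\<in>C. N \<xi>)" by blast
  define \<E> where "\<E> = (\<Union>\<xi>\<in>C. \<D> \<xi>) \<inter> J"
  have E: "finite \<E>" "\<E> \<subseteq> J" using C(1,2) D(1) unfolding \<E>_def by blast+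
  have close: "cmod (f \<eta> - f \<eta>') \<le> e" if \<eta>: "\<eta> \<in> Bd" "\<eta>' \<in> Bd" "\<forall>S\<in>\<E>. \<eta> S = \<eta>' S" for \<eta> \<eta>'
  proof -
    obtain \<xi> where \<xi>: "\<xi> \<in> C" "\<eta> \<in> N \<xi>" using C(3) \<eta>(1) by blast
    have "\<eta>' S = \<eta> S" if S: "S \<in> \<D> \<xi>" for S
    proof (cases "S \<in> J")
      case True
      then have "S \<in> \<E>" using S \<xi>(1) unfolding \<E>_def by blast
      then show ?thesis using \<eta>(3) by simp
    next
      case False then show ?thesis using JH_not_J[OF Bd_JH[OF \<eta>(1)]] JH_not_J[OF Bd_JH[OF \<eta>(2)]] by metis
    qed
    then have "cmod (f \<eta> - f \<xi>) < e/2" "cmod (f \<eta>' - f \<xi>) < e/2"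
      using D(2)[of \<xi>] \<xi> C(1) \<eta> by (auto simp: N_def)
    then show ?thesis using norm_triangle_ineq4[of "f \<eta> - f \<xi>" "f \<eta>' - f \<xi>"] by simp
  qed
  \<comment> \<open>For a pattern that no boundary point has, the choice is arbitrary; it still
    depends on the pattern alone, and this is what membership in \<open>SF J\<close> rests
    on.\<close>
  define r where "r \<eta> = (SOME \<eta>'. \<eta>' \<in> Bd \<and> (\<forall>S\<in>\<E>. \<eta>' S = \<eta> S))" for \<eta>
  have "(\<lambda>\<eta>. f (r \<eta>)) \<in> SF J"
  proof (rule SF_determined_J[OF E])
    fix \<eta> \<eta>' :: "'g set => nat" assume "\<forall>S\<in>\<E>. \<eta> S = \<eta>' S"
    then have "(\<lambda>\<zeta>. \<zeta> \<in> Bd \<and> (\<forall>S\<in>\<E>. \<zeta> S = \<eta> S)) = (\<lambda>\<zeta>. \<zeta> \<in> Bd \<and> (\<forall>S\<in>\<E>. \<zeta> S = \<eta>' S))" by auto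
    then have "r \<eta> = r \<eta>'" by (simp add: r_def)
    then show "f (r \<eta>) = f (r \<eta>')" by simp
  qed
  moreover have "cmod (f \<eta> - f (r \<eta>)) \<le> e" if \<eta>: "\<eta> \<in> Bd" for \<eta>
  proof -
    have r: "r \<eta> \<in> Bd \<and> (\<forall>S\<in>\<E>. r \<eta> S = \<eta> S)"
      unfolding r_def by (rule someI[where P = "\<lambda>\<zeta>. \<zeta> \<in> Bd \<and> (\<forall>S\<in>\<E>. \<zeta> S = \<eta> S)" and x = \<eta>]) (simp add: \<eta>)
    show ?thesis by (rule close[OF \<eta>]) (use r in simp_all)
  qed
  ultimately show ?thesis by (intro bexI[of _ "\<lambda>\<eta>. f (r \<eta>)"] ballI)
qed

text \<open>Continuity and vanishing off the domain are encoded together in uniform approximation by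
  combinations from \<open>JJ g\<close>. Later arguments about these ideals can then work with
  finite combinations instead of the topology.\<close>

lemma boundary_ideal_iff:
  "f \<in> boundary_ideal G P g \<longleftrightarrow>
     (\<forall>\<eta>. \<eta> \<notin> Bd \<longrightarrow> f \<eta> = 0) \<and> (\<forall>e>0. \<exists>s\<in>SF (JJ g). \<forall>\<eta>\<in>Bd. cmod (f \<eta> - s \<eta>) \<le> e)"
proof
  assume "f \<in> boundary_ideal G P g"
  then have f: "continuous_on Bd f" "\<And>\<eta>. \<eta> \<notin> Bd ==> f \<eta> = 0" "\<And>\<eta>. \<eta> \<notin> hat_domain G P g ==> f \<eta> = 0"
    by (auto simp: boundary_ideal_def C_boundary_def boundary_eq_Bd)
  have "\<exists>s\<in>SF (JJ g). \<forall>\<eta>\<in>Bd. cmod (f \<eta> - s \<eta>) \<le> e" if e: "e > 0" for e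
  proof -
    obtain s where s: "s \<in> SF J" "\<And>\<eta>. \<eta> \<in> Bd ==> cmod (f \<eta> - s \<eta>) \<le> e"
      using SF_approx_continuous[OF f(1) e] by blast
    have "closedin (top_of_set Bd) (Bd \<inter> (\<lambda>\<eta>. cmod (f \<eta>)) -` {e..})"
      by (intro continuous_closedin_preimage continuous_on_norm f(1)) auto
    then have cpt: "compact (Bd \<inter> (\<lambda>\<eta>. cmod (f \<eta>)) -` {e..})"
      using compact_Bd closedin_compact by blast
    have op: "open {\<eta> :: 'g set => nat. \<eta> T = 1}" for T
      using open_agree[of "{T}" "\<lambda>_. 1"] by simp
    have "(Bd \<inter> (\<lambda>\<eta>. cmod (f \<eta>)) -` {e..}) \<subseteq> (\<Union>T\<in>JJ g. {\<eta>. \<eta> T = 1})"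
    proof
      fix \<eta> assume "\<eta> \<in> (Bd \<inter> (\<lambda>\<eta>. cmod (f \<eta>)) -` {e..})"
      then have "\<eta> \<in> hat_domain G P g" using f(3)[of \<eta>] e by (cases "\<eta> \<in> hat_domain G P g") auto
      then show "\<eta> \<in> (\<Union>T\<in>JJ g. {\<eta>. \<eta> T = 1})" by (auto simp: hat_domain_def JJ_def)
    qed
    then obtain \<T> where T: "\<T> \<subseteq> JJ g" "finite \<T>" "(Bd \<inter> (\<lambda>\<eta>. cmod (f \<eta>)) -` {e..}) \<subseteq> (\<Union>T\<in>\<T>. {\<eta>. \<eta> T = 1})"
      using compactE_image[OF cpt, of "JJ g" "\<lambda>T. {\<eta>. \<eta> T = 1}"] op by metis
    \<comment> \<open>The compact set where f has modulus at least e is covered by finitely many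
      sets of characters with value 1 at some T in \<open>JJ g\<close>. Multiplication by the
      indicator function u of their union moves s into \<open>SF (JJ g)\<close>; off the union f
      itself is smaller than e.\<close>
    define u where "u \<eta> = (if \<exists>T\<in>\<T>. \<eta> T = 1 then 1 else 0 :: complex)" for \<eta> :: "'g set => nat"
    have "u \<in> SF (JJ g)"
      by (rule SF_determined[OF T(2,1)]) (auto simp: u_def JJ_J JJ_Int_J)
    then have "(\<lambda>\<eta>. u \<eta> * s \<eta>) \<in> SF (JJ g)"
      using s(1) by (rule SF_mult) (auto simp: JJ_J JJ_Int_J)
    moreover have "cmod (f \<eta> - u \<eta> * s \<eta>) \<le> e" if "\<eta> \<in> Bd" for \<eta>
    proof (cases "\<exists>T\<in>\<T>. \<eta> T = 1")
      case False
      then have "cmod (f \<eta>) < e" using T(3) that by force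
      then show ?thesis using False by (simp add: u_def)
    qed (use s(2)[OF that] in \<open>simp add: u_def\<close>)
    ultimately show ?thesis by (intro bexI[of _ "\<lambda>\<eta>. u \<eta> * s \<eta>"] ballI)
  qed
  then show "(\<forall>\<eta>. \<eta> \<notin> Bd \<longrightarrow> f \<eta> = 0) \<and> (\<forall>e>0. \<exists>s\<in>SF (JJ g). \<forall>\<eta>\<in>Bd. cmod (f \<eta> - s \<eta>) \<le> e)"
    using f(2) by blast
next
  assume *: "(\<forall>\<eta>. \<eta> \<notin> Bd \<longrightarrow> f \<eta> = 0) \<and> (\<forall>e>0. \<exists>s\<in>SF (JJ g). \<forall>\<eta>\<in>Bd. cmod (f \<eta> - s \<eta>) \<le> e)"
  have "continuous_on Bd f"
  proof -
    have "\<exists>s. s \<in> SF (JJ g) \<and> (\<forall>\<eta>\<in>Bd. cmod (f \<eta> - s \<eta>) \<le> 1 / real (Suc n))" for n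
      using * by (simp add: Bex_def)
    then obtain s where s: "\<And>n. s n \<in> SF (JJ g)" "\<And>n \<eta>. \<eta> \<in> Bd ==> cmod (f \<eta> - s n \<eta>) \<le> 1 / real (Suc n)"
      by metis
    have "uniform_limit Bd s f sequentially"
    proof (rule uniform_limitI)
      fix e :: real assume "e > 0"
      then obtain M where M: "1 / real (Suc M) < e" using nat_approx_posE by blast
      show "\<forall>\<^sub>F n in sequentially. \<forall>x\<in>Bd. dist (s n x) (f x) < e"
        unfolding eventually_sequentially
      proof (intro exI allI impI ballI)
        fix n x assume "M \<le> n" "x \<in> Bd"
        have "1 / real (Suc n) \<le> 1 / real (Suc M)" using \<open>M \<le> n\<close> by (simp add: field_simps)
        then show "dist (s n x) (f x) < e" using s(2)[OF \<open>x \<in> Bd\<close>, of n] M by (simp add: dist_norm norm_minus_commute)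
      qed
    qed
    moreover have "\<forall>\<^sub>F n in sequentially. continuous_on Bd (s n)"
      using continuous_on_subset[OF SF_continuous[OF s(1)]] Bd_JH by (intro always_eventually) blast
    ultimately show ?thesis by (intro uniform_limit_theorem[OF _ _ trivial_limit_sequentially])
  qed
  moreover have "f \<eta> = 0" if \<eta>: "\<eta> \<notin> hat_domain G P g" for \<eta>
  proof (cases "\<eta> \<in> Bd")
    case True
    have z: "\<eta> T = 0" if "T \<in> JJ g" for T
    proof -
      have "\<eta> T \<noteq> 1" using \<eta> that True Bd_Omega by (auto simp: hat_domain_def JJ_def)
      then show ?thesis using JH_cases[OF Bd_JH[OF True], of T] by simp
    qed
    have "cmod (f \<eta>) \<le> 0 + e" if "e > 0" for e
    proof -
      obtain s where s: "s \<in> SF (JJ g)" "cmod (f \<eta> - s \<eta>) \<le> e" using * True \<open>e > 0\<close> by blast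
      obtain F c where F: "F \<subseteq> JJ g" "s \<eta> = (\<Sum>S\<in>F. c S * of_nat (\<eta> S))"
        using s(1) Bd_JH[OF True] by (auto simp: SF_def)
      have "s \<eta> = 0" unfolding F(2) using F(1) z by (intro sum.neutral) auto
      then show ?thesis using s(2) by simp
    qed
    then have "cmod (f \<eta>) \<le> 0" by (rule field_le_epsilon)
    then show ?thesis by simp
  qed (use * in blast)
  ultimately show "f \<in> boundary_ideal G P g"
    using * by (auto simp: boundary_ideal_def C_boundary_def boundary_eq_Bd)
qed

lemma hat_domain_Bd: "\<eta> \<in> Bd ==> \<eta> \<in> hat_domain G P g \<longleftrightarrow> (\<exists>T\<in>JJ g. \<eta> T = 1)"
  using Bd_Omega by (auto simp: hat_domain_def JJ_def)

lemma boundary_ideal_one: "boundary_ideal G P \<one> = C_boundary G P"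
proof -
  have "f \<eta> = 0" if "f \<in> C_boundary G P" "\<eta> \<notin> hat_domain G P \<one>" for f \<eta>
  proof (cases "\<eta> \<in> Bd")
    case True
    then show ?thesis using that hat_domain_Bd[OF True, of \<one>] JH_P[OF Bd_JH[OF True]] P_J by (auto simp: JJ_one)
  qed (use that in \<open>auto simp: C_boundary_def boundary_eq_Bd\<close>)
  then show ?thesis by (auto simp: boundary_ideal_def)
qed

end

section \<open>The partial action on the boundary\<close>

context submonoid_of_group
begin

text \<open>The part of T that translation by g carries into S. The form by membership lets
  preimages under successive translations compose without computations with cosets.\<close>

definition pre :: "'g => 'g set => 'g set => 'g set" where
  "pre g T S = {x \<in> T. g \<otimes> x \<in> S}"

lemma JJ_inv_iff: "g \<in> carrier G ==> S \<in> JJ (inv g) \<longleftrightarrow> (\<exists>\<alpha>\<in>W. dot \<alpha> = g \<and> S = KK \<alpha>)"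
  by (auto simp: JJ_def)

lemma JJ_carrier: "S \<in> JJ g ==> x \<in> S ==> x \<in> carrier G"
  using JJ_J J_subset P_carrier by blast

lemma pre_eq: "[|g \<in> carrier G; T \<in> J; S \<in> J|] ==> pre g T S = T \<inter> (inv g <# S)"
proof -
  assume g: "g \<in> carrier G" and TS: "T \<in> J" "S \<in> J"
  have "T \<subseteq> carrier G" "S \<subseteq> carrier G" using TS J_subset P_carrier by blast+
  then show ?thesis using g in_l_coset_iff[of "inv g" _ S] by (auto simp: pre_def)
qed

lemma pre_JJ:
  assumes g: "g \<in> carrier G" and h: "h \<in> carrier G" and T: "T \<in> JJ (inv h)" and S: "S \<in> JJ (inv g)"
  shows "pre h T S \<in> JJ (inv (g \<otimes> h))"
proof -
  obtain \<beta> where \<beta>: "\<beta> \<in> W" "dot \<beta> = h" "T = KK \<beta>" using T h JJ_inv_iff by blast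
  obtain \<alpha> where \<alpha>: "\<alpha> \<in> W" "dot \<alpha> = g" "S = KK \<alpha>" using S g JJ_inv_iff by blast
  have "KK (\<alpha> @ \<beta>) = pre h T S" using \<alpha> \<beta> by (simp add: K_append pre_def)
  moreover have "dot (\<alpha> @ \<beta>) = g \<otimes> h" using \<alpha> \<beta> by (simp add: dot_append)
  moreover have "\<alpha> @ \<beta> \<in> W" using \<alpha> \<beta> by simp
  moreover have "g \<otimes> h \<in> carrier G" using g h by simp
  ultimately show ?thesis using JJ_inv_iff by metis
qed

lemma pre_JJ_J:
  assumes h: "h \<in> carrier G" and T: "T \<in> JJ (inv h)" and S: "S \<in> J"
  shows "pre h T S \<in> JJ (inv h)" "pre h T S \<in> J"
proof -
  have "S \<in> JJ (inv \<one>)" using S by (simp add: JJ_one)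
  then show "pre h T S \<in> JJ (inv h)" using pre_JJ[OF one_closed h T] h by simp
  then show "pre h T S \<in> J" by (rule JJ_J)
qed

abbreviation "act \<equiv> hat_gamma G P"

text \<open>The part of \<open>hat_domain\<close> on the boundary, i.e. the boundary points in the
  range of the action of g.\<close>

definition V :: "'g => ('g set => nat) set" where
  "V g = {\<eta> \<in> Bd. \<exists>T\<in>JJ g. \<eta> T = 1}"

lemma V_Bd: "\<eta> \<in> V g ==> \<eta> \<in> Bd"
  by (simp add: V_def)

lemma V_JH: "\<eta> \<in> V g ==> \<eta> \<in> JH"
  using V_Bd Bd_JH by blast

lemma V_hat: "\<eta> \<in> Bd ==> \<eta> \<in> hat_domain G P g \<longleftrightarrow> \<eta> \<in> V g"
  by (simp add: hat_domain_Bd V_def)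

lemma VI: "[|\<eta> \<in> Bd; T \<in> JJ g; \<eta> T = 1|] ==> \<eta> \<in> V g"
  unfolding V_def by blast

lemma V_E:
  assumes "\<eta> \<in> V g" obtains T where "T \<in> JJ g" "\<eta> T = 1"
  using assms unfolding V_def by blast

lemma act_cases: "act g \<eta> S = 0 \<or> act g \<eta> S = 1"
  by (simp add: hat_gamma_def)

text \<open>The existential over words in \<open>hat_gamma\<close> can be tested on a single T with
  \<eta> T = 1: intersecting another witness with T keeps the value 1, and the intersection lies in
  \<open>pre g T S\<close>.\<close>

lemma act_one_iff:
  assumes g: "g \<in> carrier G" and \<eta>: "\<eta> \<in> JH" and T: "T \<in> JJ (inv g)" "\<eta> T = 1"
  shows "act g \<eta> S = 1 \<longleftrightarrow> S \<in> J \<and> \<eta> (pre g T S) = 1"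
proof -
  have "act g \<eta> S = 1 \<longleftrightarrow> S \<in> J \<and> (\<exists>\<alpha>\<in>W. dot \<alpha> = g \<and> \<eta> (KK \<alpha> \<inter> (inv g <# S)) = 1)"
    by (simp add: hat_gamma_def)
  also have "\<dots> \<longleftrightarrow> S \<in> J \<and> \<eta> (pre g T S) = 1"
  proof (rule conj_cong[OF refl])
    assume S: "S \<in> J"
    show "(\<exists>\<alpha>\<in>W. dot \<alpha> = g \<and> \<eta> (KK \<alpha> \<inter> (inv g <# S)) = 1) \<longleftrightarrow> \<eta> (pre g T S) = 1"
    proof
      assume "\<eta> (pre g T S) = 1"
      then have "\<eta> (T \<inter> (inv g <# S)) = 1" using pre_eq[OF g JJ_J[OF T(1)] S] by simp
      moreover obtain \<alpha> where "\<alpha> \<in> W" "dot \<alpha> = g" "T = KK \<alpha>" using T(1) JJ_inv_iff[OF g] by blast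
      ultimately show "\<exists>\<alpha>\<in>W. dot \<alpha> = g \<and> \<eta> (KK \<alpha> \<inter> (inv g <# S)) = 1" by (intro bexI[of _ \<alpha>]) simp_all
    next
      assume "\<exists>\<alpha>\<in>W. dot \<alpha> = g \<and> \<eta> (KK \<alpha> \<inter> (inv g <# S)) = 1"
      then obtain \<alpha> where \<alpha>: "\<alpha> \<in> W" "dot \<alpha> = g" "\<eta> (KK \<alpha> \<inter> (inv g <# S)) = 1" by blast
      have "KK \<alpha> \<inter> (inv g <# S) \<in> J" using J_translate(1)[OF \<alpha>(1) S] \<alpha>(2) by simp
      then have "\<eta> (T \<inter> (KK \<alpha> \<inter> (inv g <# S))) = 1" using JH_Int_iff[OF \<eta> JJ_J[OF T(1)]] \<alpha>(3) T(2) by blast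
      moreover have "T \<inter> (KK \<alpha> \<inter> (inv g <# S)) \<subseteq> pre g T S" using pre_eq[OF g JJ_J[OF T(1)] S] by blast
      ultimately show "\<eta> (pre g T S) = 1" using JH_mono[OF \<eta>] pre_JJ_J(2)[OF g T(1) S] by blast
    qed
  qed
  finally show ?thesis .
qed

text \<open>Invariance of the boundary. Foundation sets pull back along the translation: if g p r
  lies in R, then p r lies in the preimage of R, because T is a right ideal.\<close>

lemma act_Bd:
  assumes g: "g \<in> carrier G" and \<eta>: "\<eta> \<in> V (inv g)"
  shows "act g \<eta> \<in> Bd"
proof -
  obtain T where T: "T \<in> JJ (inv g)" "\<eta> T = 1" using V_E[OF \<eta>] by blast
  note \<eta>J = V_JH[OF \<eta>]
  note one = act_one_iff[OF g \<eta>J T]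
  have "act g \<eta> \<in> JH"
  proof (rule JHI)
    show "act g \<eta> S = 0 \<or> act g \<eta> S = 1" for S by (rule act_cases)
    show "act g \<eta> S = 1 ==> S \<in> J" for S using one by blast
    have "pre g T P = T" using JJ_subset[OF T(1)] g by (auto simp: pre_def)
    then show "act g \<eta> P = 1" using one T P_J by metis
    have "pre g T {} = {}" by (simp add: pre_def)
    then show "act g \<eta> {} \<noteq> 1" using one JH_empty[OF \<eta>J] by metis
    fix R S assume RS: "R \<in> J" "S \<in> J"
    have "pre g T (R \<inter> S) = pre g T R \<inter> pre g T S" by (auto simp: pre_def)
    then show "act g \<eta> (R \<inter> S) = 1 \<longleftrightarrow> act g \<eta> R = 1 \<and> act g \<eta> S = 1"
      using one RS J_Int[OF RS] JH_Int_iff[OF \<eta>J pre_JJ_J(2)[OF g T(1) RS(1)] pre_JJ_J(2)[OF g T(1) RS(2)]]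
      by metis
  qed
  moreover have "\<exists>R\<in>\<C>. act g \<eta> R = 1" if F: "foundation_set G P S \<C>" and S: "act g \<eta> S = 1" for S \<C>
  proof -
    note FD = F[unfolded foundation_set_Int]
    have "foundation_set G P (pre g T S) (pre g T ` \<C>)"
      unfolding foundation_set_Int
    proof (intro conjI ballI)
      show "pre g T S \<in> J" "finite (pre g T ` \<C>)" "pre g T ` \<C> \<subseteq> J"
        using FD pre_JJ_J(2)[OF g T(1)] by auto
      show "R \<subseteq> pre g T S" if "R \<in> pre g T ` \<C>" for R using that FD by (auto simp: pre_def)
      fix p assume p: "p \<in> pre g T S"
      then have gp: "g \<otimes> p \<in> S" "p \<in> T" "p \<in> carrier G" using JJ_carrier[OF T(1)] by (auto simp: pre_def)
      then obtain R where R: "R \<in> \<C>" "((g \<otimes> p) <# P) \<inter> R \<noteq> {}" using FD by blast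
      then obtain r where r: "r \<in> P" "g \<otimes> p \<otimes> r \<in> R" by (auto simp: l_coset_def)
      have "p \<otimes> r \<in> pre g T R"
        using r gp g J_right_ideal[OF JJ_J[OF T(1)]] by (auto simp: pre_def m_assoc)
      moreover have "p \<otimes> r \<in> p <# P" using r by (auto simp: l_coset_def)
      ultimately show "\<exists>R\<in>pre g T ` \<C>. (p <# P) \<inter> R \<noteq> {}" using R(1) by blast
    qed
    moreover have "\<eta> (pre g T S) = 1" using S one by blast
    ultimately have "\<exists>R\<in>pre g T ` \<C>. \<eta> R = 1" using V_Bd[OF \<eta>] unfolding Bd_def by blast
    then show ?thesis using FD one by blast
  qed
  ultimately show ?thesis unfolding Bd_def by blast
qed

lemma act_value:
  assumes g: "g \<in> carrier G" and \<eta>: "\<eta> \<in> V g" and S: "S \<in> JJ (inv g)"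
  shows "act (inv g) \<eta> S = \<eta> (g <# S)"
proof -
  obtain T where T: "T \<in> JJ g" "\<eta> T = 1" using V_E[OF \<eta>] by blast
  have T': "T \<in> JJ (inv (inv g))" using T g by simp
  note J = JJ_J[OF T(1)] JJ_J[OF S] JJ_J[OF JJ_translate(1)[OF g S]]
  have "pre (inv g) T S = T \<inter> (g <# S)" using pre_eq[of "inv g" T S] J g by simp
  then have "act (inv g) \<eta> S = 1 \<longleftrightarrow> \<eta> (g <# S) = 1"
    using act_one_iff[OF inv_closed[OF g] V_JH[OF \<eta>] T' T(2), of S] JH_Int_iff[OF V_JH[OF \<eta>] J(1,3)] J T(2) by simp
  then show ?thesis using act_cases[of "inv g" \<eta> S] JH_cases[OF V_JH[OF \<eta>], of "g <# S"] by metis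
qed

lemma act_V:
  assumes g: "g \<in> carrier G" and \<eta>: "\<eta> \<in> V (inv g)"
  shows "act g \<eta> \<in> V g"
proof -
  obtain T where T: "T \<in> JJ (inv g)" "\<eta> T = 1" using V_E[OF \<eta>] by blast
  note gT = JJ_translate[OF g T(1)]
  have "act g \<eta> (g <# T) = \<eta> (inv g <# (g <# T))"
    using act_value[OF inv_closed[OF g] \<eta>, of "g <# T"] gT g by simp
  then have "act g \<eta> (g <# T) = 1" using gT T by simp
  then show ?thesis using VI[OF act_Bd[OF g \<eta>] gT(1)] by blast
qed

text \<open>With T for h and S for g, the ideal \<open>pre h T S\<close> witnesses the domain of the
  composite, and iterated preimages of any R agree with preimages under the product.\<close>

lemma act_comp:
  assumes g: "g \<in> carrier G" and h: "h \<in> carrier G"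
    and \<eta>: "\<eta> \<in> V (inv h)" and a\<eta>: "act h \<eta> \<in> V (inv g)"
  shows "\<eta> \<in> V (inv (g \<otimes> h))" "act g (act h \<eta>) = act (g \<otimes> h) \<eta>"
proof -
  have gh: "g \<otimes> h \<in> carrier G" using g h by simp
  obtain T where T: "T \<in> JJ (inv h)" "\<eta> T = 1" using V_E[OF \<eta>] by blast
  obtain S where S: "S \<in> JJ (inv g)" "act h \<eta> S = 1" using V_E[OF a\<eta>] by blast
  note one = act_one_iff[OF h V_JH[OF \<eta>] T]
  have U: "pre h T S \<in> JJ (inv (g \<otimes> h))" "\<eta> (pre h T S) = 1" using pre_JJ[OF g h T(1) S(1)] one S(2) by blast+
  then show V: "\<eta> \<in> V (inv (g \<otimes> h))" using VI[OF V_Bd[OF \<eta>]] by blast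
  show "act g (act h \<eta>) = act (g \<otimes> h) \<eta>"
  proof (rule JH_eqI[OF Bd_JH[OF act_Bd[OF g a\<eta>]] Bd_JH[OF act_Bd[OF gh V]]])
    fix R
    have "pre h T (pre g S R) = pre (g \<otimes> h) (pre h T S) R"
      using JJ_carrier[OF T(1)] g h by (auto simp: pre_def m_assoc)
    then show "act g (act h \<eta>) R = 1 \<longleftrightarrow> act (g \<otimes> h) \<eta> R = 1"
      using act_one_iff[OF g V_JH[OF a\<eta>] S, of R] act_one_iff[OF gh V_JH[OF \<eta>] U, of R]
        one[of "pre g S R"] pre_JJ_J(2)[OF g S(1), of R] by metis
  qed
qed

lemma V_one: "V \<one> = Bd"
  using JH_P[OF Bd_JH] P_J unfolding V_def JJ_one by blast

lemma act_one:
  assumes \<eta>: "\<eta> \<in> Bd"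
  shows "act \<one> \<eta> = \<eta>"
proof -
  have V: "\<eta> \<in> V (inv \<one>)" using \<eta> V_one by simp
  have P: "P \<in> JJ (inv \<one>)" by (simp add: JJ_one)
  show ?thesis
  proof (rule JH_eqI[OF Bd_JH[OF act_Bd[OF one_closed V]] Bd_JH[OF \<eta>]])
    fix R
    have "pre \<one> P R = R" if "R \<in> J" using J_subset[OF that] by (auto simp: pre_def)
    then show "act \<one> \<eta> R = 1 \<longleftrightarrow> \<eta> R = 1"
      using act_one_iff[OF one_closed Bd_JH[OF \<eta>] P JH_P[OF Bd_JH[OF \<eta>]], of R] JH_one_J[OF Bd_JH[OF \<eta>], of R] by metis
  qed
qed

lemma act_inv_V: "[|g \<in> carrier G; \<eta> \<in> V g|] ==> act (inv g) \<eta> \<in> V (inv g)"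
  using act_V[of "inv g" \<eta>] by simp

lemma act_act_inv: "[|g \<in> carrier G; \<eta> \<in> V g|] ==> act g (act (inv g) \<eta>) = \<eta>"
  using act_comp(2)[of g "inv g" \<eta>] act_inv_V[of g \<eta>] act_one[OF V_Bd, of \<eta> g] by simp

lemma act_inv_comp:
  assumes "g \<in> carrier G" "h \<in> carrier G" "\<eta> \<in> V g" "act (inv g) \<eta> \<in> V h"
  shows "\<eta> \<in> V (g \<otimes> h)" "act (inv h) (act (inv g) \<eta>) = act (inv (g \<otimes> h)) \<eta>"
  using act_comp[of "inv h" "inv g" \<eta>] assms by (simp_all add: inv_mult_group)

text \<open>Controls supports in convolutions: a coefficient at \<open>inv g \<otimes> k\<close>,
  moved by g, is supported where a coefficient at k may be.\<close>

lemma act_inv_V_iff: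
  assumes g: "g \<in> carrier G" and k: "k \<in> carrier G" and \<eta>: "\<eta> \<in> V g"
  shows "act (inv g) \<eta> \<in> V (inv g \<otimes> k) \<longleftrightarrow> \<eta> \<in> V k"
proof
  assume "act (inv g) \<eta> \<in> V (inv g \<otimes> k)"
  then show "\<eta> \<in> V k" using act_inv_comp(1)[OF g _ \<eta>, of "inv g \<otimes> k"] g k by simp
next
  assume "\<eta> \<in> V k"
  then have "act g (act (inv g) \<eta>) \<in> V (inv (inv k))" using act_act_inv[OF g \<eta>] k by simp
  then show "act (inv g) \<eta> \<in> V (inv g \<otimes> k)"
    using act_comp(1)[of "inv k" g "act (inv g) \<eta>"] act_inv_V[OF g \<eta>] g k by (simp add: inv_mult_group)
qed

text \<open>Replacing each S by gS produces one function t that is the translate of s both at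
  boundary points and at points of P. This simultaneity is what later identifies the two partial
  actions.\<close>

lemma SF_translate:
  assumes g: "g \<in> carrier G" and s: "s \<in> SF (JJ (inv g))"
  shows "\<exists>t\<in>SF (JJ g). (\<forall>\<eta>\<in>Bd. t \<eta> = (if \<eta> \<in> V g then s (act (inv g) \<eta>) else 0)) \<and>
    (\<forall>x\<in>carrier G. (if x \<in> P then t (point x) else 0) =
       (if inv g \<otimes> x \<in> P then s (point (inv g \<otimes> x)) else 0))"
proof -
  obtain F c where F: "finite F" "F \<subseteq> JJ (inv g)" "\<And>\<eta>. \<eta> \<in> JH ==> s \<eta> = (\<Sum>S\<in>F. c S * of_nat (\<eta> S))"
    using s by (rule SF_E) blast
  define t where "t \<eta> = (\<Sum>S\<in>F. c S * of_nat (\<eta> (g <# S)))" for \<eta> :: "'g set => nat"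
  have "t \<in> SF (JJ g)" unfolding t_def
    using F(2) JJ_translate(1)[OF g] by (intro SF_sum SF_smult SF_ind) auto
  moreover have "t \<eta> = (if \<eta> \<in> V g then s (act (inv g) \<eta>) else 0)" if \<eta>: "\<eta> \<in> Bd" for \<eta>
  proof (cases "\<eta> \<in> V g")
    case True
    have "act (inv g) \<eta> \<in> JH" using V_JH[OF act_inv_V[OF g True]] .
    then show ?thesis using True F(2) act_value[OF g True] by (auto simp: t_def F(3) intro!: sum.cong)
  next
    case False
    have "\<eta> (g <# S) = 0" if "S \<in> F" for S
      using False VI[OF \<eta>] JJ_translate(1)[OF g, of S] JH_cases[OF Bd_JH[OF \<eta>]] F(2) that by blast
    then show ?thesis using False by (simp add: t_def)
  qed
  moreover have "(if x \<in> P then t (point x) else 0) = (if inv g \<otimes> x \<in> P then s (point (inv g \<otimes> x)) else 0)"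
    if x: "x \<in> carrier G" for x
  proof -
    have mem: "x \<in> g <# S \<longleftrightarrow> inv g \<otimes> x \<in> S" if "S \<in> F" for S
      using in_l_coset_iff[OF g x, of S] JJ_carrier[of S "inv g"] F(2) that by blast
    have 1: "(if x \<in> P then t (point x) else 0) = (\<Sum>S\<in>F. c S * (if x \<in> g <# S then 1 else 0))"
    proof -
      have "g <# S \<in> J \<and> g <# S \<subseteq> P" if "S \<in> F" for S
        using JJ_J[OF JJ_translate(1)[OF g]] J_subset F(2) that by blast
      then have sub: "g <# S \<in> J" "x \<in> g <# S ==> x \<in> P" if "S \<in> F" for S using that by blast+
      show ?thesis
      proof (cases "x \<in> P")
        case True
        then show ?thesis using sub(1) by (auto simp: t_def point_def intro!: sum.cong)
      next
        case False
        then have "(\<Sum>S\<in>F. c S * (if x \<in> g <# S then 1 else 0)) = 0" using sub(2) by (intro sum.neutral) auto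
        then show ?thesis using False by (simp only: if_False)
      qed
    qed
    have 2: "(if inv g \<otimes> x \<in> P then s (point (inv g \<otimes> x)) else 0) = (\<Sum>S\<in>F. c S * (if inv g \<otimes> x \<in> S then 1 else 0))"
    proof -
      have "S \<in> J \<and> S \<subseteq> P" if "S \<in> F" for S using JJ_J J_subset F(2) that by blast
      then have sub: "S \<in> J" "inv g \<otimes> x \<in> S ==> inv g \<otimes> x \<in> P" if "S \<in> F" for S using that by blast+
      show ?thesis
      proof (cases "inv g \<otimes> x \<in> P")
        case True
        then show ?thesis using sub(1) F(3)[OF point_JH[OF True]] by (auto simp: point_def intro!: sum.cong)
      next
        case False
        then have "(\<Sum>S\<in>F. c S * (if inv g \<otimes> x \<in> S then 1 else 0)) = 0" using sub(2) by (intro sum.neutral) auto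
        then show ?thesis using False by (simp only: if_False)
      qed
    qed
    show ?thesis unfolding 1 2 using mem by (intro sum.cong) auto
  qed
  ultimately show ?thesis by blast
qed

subsection \<open>The function algebra on the boundary\<close>

abbreviation "CB \<equiv> C_boundary_alg G P"
abbreviation "BI \<equiv> boundary_ideal G P"
abbreviation "BA \<equiv> boundary_action G P"

lemma CB_carrier: "f \<in> carrier CB \<longleftrightarrow> continuous_on Bd f \<and> (\<forall>\<eta>. \<eta> \<notin> Bd \<longrightarrow> f \<eta> = 0)"
  by (simp add: C_boundary_alg_def fun_star_alg_def C_boundary_def boundary_eq_Bd)

lemma CB_ops:
  "mult CB a b = (\<lambda>\<eta>. a \<eta> * b \<eta>)" "add CB a b = (\<lambda>\<eta>. a \<eta> + b \<eta>)" "one CB = indicator Bd"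
  "zero CB = (\<lambda>_. 0)" "smult CB c a = (\<lambda>\<eta>. c * a \<eta>)" "star CB a = (\<lambda>\<eta>. cnj (a \<eta>))"
  by (simp_all add: C_boundary_alg_def fun_star_alg_def boundary_eq_Bd)

lemma indicator_Bd_carrier: "(indicator Bd :: _ => complex) \<in> carrier CB"
  unfolding CB_carrier by (auto intro!: continuous_on_eq[OF continuous_on_const[of Bd 1]])

lemma star_algebra_CB: "star_algebra CB"
  by (rule star_algebraI)
    (auto simp: CB_carrier CB_ops algebra_simps fun_eq_iff indicator_Bd_carrier[unfolded CB_carrier] indicator_def
      intro!: continuous_intros)

lemma CB_BI: "carrier CB = BI \<one>"
  by (simp add: boundary_ideal_one C_boundary_alg_def fun_star_alg_def)

lemma BI_iff: "a \<in> BI g \<longleftrightarrow> a \<in> carrier CB \<and> (\<forall>\<eta>. \<eta> \<notin> V g \<longrightarrow> a \<eta> = 0)"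
proof -
  have "a \<in> BI g \<longleftrightarrow> a \<in> carrier CB \<and> (\<forall>\<eta>. \<eta> \<notin> hat_domain G P g \<longrightarrow> a \<eta> = 0)"
    by (simp add: boundary_ideal_def C_boundary_alg_def fun_star_alg_def)
  also have "\<dots> \<longleftrightarrow> a \<in> carrier CB \<and> (\<forall>\<eta>. \<eta> \<notin> V g \<longrightarrow> a \<eta> = 0)"
    using V_hat V_Bd unfolding CB_carrier by blast
  finally show ?thesis .
qed

lemma BI_V: "[|a \<in> BI g; \<eta> \<notin> V g|] ==> a \<eta> = 0"
  by (simp add: BI_iff)

lemma BI_Bd: "[|a \<in> BI g; \<eta> \<notin> Bd|] ==> a \<eta> = 0"
  by (auto simp: BI_iff CB_carrier)

lemma BI_zero: "(\<lambda>_. 0) \<in> BI g"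
  by (simp add: BI_iff CB_carrier)

lemma BI_add: "[|a \<in> BI g; b \<in> BI g|] ==> (\<lambda>\<eta>. a \<eta> + b \<eta>) \<in> BI g"
  and BI_smult: "a \<in> BI g ==> (\<lambda>\<eta>. c * a \<eta>) \<in> BI g"
  and BI_cnj: "a \<in> BI g ==> (\<lambda>\<eta>. cnj (a \<eta>)) \<in> BI g"
  by (auto simp: BI_iff CB_carrier intro!: continuous_intros)

lemma BI_mult: "[|a \<in> BI g; b \<in> carrier CB|] ==> (\<lambda>\<eta>. a \<eta> * b \<eta>) \<in> BI g"
  by (auto simp: BI_iff CB_carrier intro!: continuous_intros)

lemma BI_sum: "(\<And>i. i \<in> I ==> a i \<in> BI g) ==> (\<lambda>\<eta>. \<Sum>i\<in>I. a i \<eta>) \<in> BI g"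
  by (induction I rule: infinite_finite_induct) (auto simp: BI_zero BI_add)

lemma BI_approx: "[|a \<in> BI g; e > 0|] ==> \<exists>s\<in>SF (JJ g). \<forall>\<eta>\<in>Bd. cmod (a \<eta> - s \<eta>) \<le> e"
  using boundary_ideal_iff[of a g] by blast

lemma BI_I: "[|\<And>\<eta>. \<eta> \<notin> Bd ==> a \<eta> = 0; \<And>e. e > 0 ==> \<exists>s\<in>SF (JJ g). \<forall>\<eta>\<in>Bd. cmod (a \<eta> - s \<eta>) \<le> e|] ==> a \<in> BI g"
  using boundary_ideal_iff[of a g] by blast

lemma SF_BI: "s \<in> SF (JJ g) ==> (\<lambda>\<eta>. if \<eta> \<in> Bd then s \<eta> else 0) \<in> BI g"
  by (rule BI_I) (auto intro!: bexI[of _ s])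

lemma BA_eq: "BA g a \<eta> = (if \<eta> \<in> V g then a (act (inv g) \<eta>) else 0)"
  using V_hat[of \<eta> g] V_Bd[of \<eta> g] by (auto simp: boundary_action_def boundary_eq_Bd)

text \<open>The moved function is approximated by the translates of approximants, which makes it
  continuous without an appeal to continuity of the partial homeomorphism.\<close>

lemma BA_BI:
  assumes g: "g \<in> carrier G" and a: "a \<in> BI (inv g)"
  shows "BA g a \<in> BI g"
proof (rule BI_I)
  show "BA g a \<eta> = 0" if "\<eta> \<notin> Bd" for \<eta> using that V_Bd by (auto simp: BA_eq)
  fix e :: real assume e: "e > 0"
  obtain s where s: "s \<in> SF (JJ (inv g))" "\<And>\<eta>. \<eta> \<in> Bd ==> cmod (a \<eta> - s \<eta>) \<le> e"
    using BI_approx[OF a e] by blast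
  obtain t where t: "t \<in> SF (JJ g)" "\<And>\<eta>. \<eta> \<in> Bd ==> t \<eta> = (if \<eta> \<in> V g then s (act (inv g) \<eta>) else 0)"
    using SF_translate[OF g s(1)] by blast
  have "cmod (BA g a \<eta> - t \<eta>) \<le> e" if "\<eta> \<in> Bd" for \<eta>
    using t(2)[OF that] s(2)[OF V_Bd[OF act_inv_V[OF g]], of \<eta>] e by (auto simp: BA_eq)
  then show "\<exists>s\<in>SF (JJ g). \<forall>\<eta>\<in>Bd. cmod (BA g a \<eta> - s \<eta>) \<le> e" using t(1) by blast
qed

lemma finsum_CB:
  assumes "finite I" "\<And>i. i \<in> I ==> a i \<in> carrier CB"
  shows "finsum CB a I = (\<lambda>\<eta>. \<Sum>i\<in>I. a i \<eta>)"
proof -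
  interpret CB: star_algebra CB by (rule star_algebra_CB)
  show ?thesis
    using assms
  proof (induction I)
    case empty
    then show ?case by (simp add: CB_ops)
  next
    case (insert i I)
    then have "finsum CB a (insert i I) = a i \<oplus>\<^bsub>CB\<^esub> finsum CB a I"
      by (intro CB.alg_finsum_insert) auto
    then show ?case using insert by (simp add: CB_ops)
  qed
qed

subsection \<open>The algebra of finitely supported sections\<close>

abbreviation "PS \<equiv> partial_sections G CB BI BA"

definition supp :: "('g => ('g set => nat) => complex) => 'g set" where
  "supp f = {g \<in> carrier G. f g \<noteq> (\<lambda>_. 0)}"

lemma PS_carrier: "f \<in> carrier PS \<longleftrightarrow>
    finite (supp f) \<and> (\<forall>g\<in>carrier G. f g \<in> BI g) \<and> (\<forall>g. g \<notin> carrier G \<longrightarrow> f g = (\<lambda>_. 0))"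
proof -
  have "{g. f g \<noteq> (\<lambda>_. 0)} = supp f" if "\<forall>g. g \<notin> carrier G \<longrightarrow> f g = (\<lambda>_. 0)"
    using that by (auto simp: supp_def)
  then show ?thesis by (auto simp: partial_sections_def CB_ops)
qed

lemma PS_BI: "[|f \<in> carrier PS; g \<in> carrier G|] ==> f g \<in> BI g"
  and PS_supp: "f \<in> carrier PS ==> finite (supp f)"
  and PS_off: "[|f \<in> carrier PS; g \<notin> carrier G|] ==> f g = (\<lambda>_. 0)"
  by (simp_all add: PS_carrier)

lemma PS_CB: "f \<in> carrier PS ==> f g \<in> carrier CB"
proof (cases "g \<in> carrier G")
  case True
  assume "f \<in> carrier PS"
  then show ?thesis using PS_BI[of f g] True unfolding BI_iff by blast
next
  case False
  assume "f \<in> carrier PS"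
  then have "f g = (\<lambda>_. 0)" using PS_off False by blast
  then show ?thesis by (simp add: CB_carrier)
qed

lemma PS_V: "[|f \<in> carrier PS; \<eta> \<notin> V g|] ==> f g \<eta> = 0"
  using PS_BI[of f g] PS_off[of f g] BI_V by (cases "g \<in> carrier G") auto

lemma supp_carrier: "supp f \<subseteq> carrier G"
  by (auto simp: supp_def)

lemma not_supp: "[|f \<in> carrier PS; g \<notin> supp f|] ==> f g = (\<lambda>_. 0)"
  by (auto simp: supp_def PS_carrier)

lemma PS_I:
  assumes "finite X" "\<And>g. g \<notin> X ==> f g = (\<lambda>_. 0)" "\<And>g. g \<in> carrier G ==> f g \<in> BI g"
    "\<And>g. g \<notin> carrier G ==> f g = (\<lambda>_. 0)"
  shows "f \<in> carrier PS"
proof -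
  have "supp f \<subseteq> X" using assms(2) by (auto simp: supp_def)
  then show ?thesis using assms by (auto simp: PS_carrier finite_subset)
qed

lemma PS_ops:
  "one PS = delta_section CB (indicator Bd) \<one>" "zero PS = (\<lambda>_ _. 0)"
  "add PS f h = (\<lambda>g \<eta>. f g \<eta> + h g \<eta>)" "smult PS c f = (\<lambda>g \<eta>. c * f g \<eta>)"
  by (simp_all add: partial_sections_def CB_ops)

lemma PS_star: "star PS f = (\<lambda>g \<eta>. if g \<in> carrier G \<and> \<eta> \<in> V g then cnj (f (inv g) (act (inv g) \<eta>)) else 0)"
  by (rule ext)+ (auto simp: partial_sections_def CB_ops BA_eq)

text \<open>The Fell bundle product in pointwise form. Where \<eta> is outside \<open>V g\<close>,
  the point \<open>act (inv g) \<eta>\<close> has no meaning, but then \<open>f g \<eta>\<close> is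
  0. The set X may exceed the support, so that several products can be summed over a common index
  set.\<close>

lemma PS_mult:
  assumes f: "f \<in> carrier PS" and h: "h \<in> carrier PS"
    and X: "finite X" "supp f \<subseteq> X" "X \<subseteq> carrier G"
  shows "mult PS f h = (\<lambda>k \<eta>. if k \<in> carrier G then \<Sum>g\<in>X. f g \<eta> * h (inv g \<otimes> k) (act (inv g) \<eta>) else 0)"
proof (rule ext, rule ext)
  fix k \<eta>
  show "mult PS f h k \<eta> = (if k \<in> carrier G then \<Sum>g\<in>X. f g \<eta> * h (inv g \<otimes> k) (act (inv g) \<eta>) else 0)"
  proof (cases "k \<in> carrier G")
    case False
    then show ?thesis by (simp add: partial_sections_def CB_ops)
  next
    case True
    define trm where "trm g = BA g (BA (inv g) (f g) \<otimes>\<^bsub>CB\<^esub> h (inv g \<otimes> k))" for g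
    have "mult PS f h k = finsum CB trm (supp f)"
      using True by (simp add: partial_sections_def trm_def[abs_def] supp_def CB_ops)
    also have "\<dots> = (\<lambda>\<eta>. \<Sum>g\<in>supp f. trm g \<eta>)"
    proof (rule finsum_CB[OF PS_supp[OF f]])
      fix g assume "g \<in> supp f"
      then have g: "g \<in> carrier G" using supp_carrier by blast
      then have "BA (inv g) (f g) \<in> BI (inv g)" using BA_BI[of "inv g" "f g"] PS_BI[OF f g] by simp
      then have "trm g \<in> BI g"
        unfolding trm_def CB_ops by (intro BA_BI[OF g] BI_mult PS_CB[OF h])
      then show "trm g \<in> carrier CB" by (simp add: BI_iff)
    qed
    finally have "mult PS f h k \<eta> = (\<Sum>g\<in>supp f. trm g \<eta>)" by simp
    also have "\<dots> = (\<Sum>g\<in>supp f. f g \<eta> * h (inv g \<otimes> k) (act (inv g) \<eta>))"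
    proof (rule sum.cong[OF refl])
      fix g assume "g \<in> supp f"
      then have g: "g \<in> carrier G" using supp_carrier by blast
      show "trm g \<eta> = f g \<eta> * h (inv g \<otimes> k) (act (inv g) \<eta>)"
        using g PS_V[OF f, of \<eta> g] act_inv_V[OF g, of \<eta>] act_act_inv[OF g, of \<eta>]
        by (auto simp: trm_def CB_ops BA_eq)
    qed
    also have "\<dots> = (\<Sum>g\<in>X. f g \<eta> * h (inv g \<otimes> k) (act (inv g) \<eta>))"
      using X not_supp[OF f] by (intro sum.mono_neutral_left) auto
    finally show ?thesis using True by simp
  qed
qed

lemma PS_mult_supp:
  assumes "f \<in> carrier PS" "h \<in> carrier PS"
  shows "mult PS f h = (\<lambda>k \<eta>. if k \<in> carrier G then \<Sum>g\<in>supp f. f g \<eta> * h (inv g \<otimes> k) (act (inv g) \<eta>) else 0)"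
  by (rule PS_mult[OF assms PS_supp[OF assms(1)] order_refl supp_carrier])

text \<open>The function is \<open>BA g\<close> applied to the product of
  \<open>BA (inv g) a\<close> and b, hence continuous and supported in \<open>V g\<close>; the
  support of b confines it to \<open>V k\<close>.\<close>

lemma BI_shift:
  assumes g: "g \<in> carrier G" and k: "k \<in> carrier G" and a: "a \<in> BI g" and b: "b \<in> BI (inv g \<otimes> k)"
  shows "(\<lambda>\<eta>. a \<eta> * b (act (inv g) \<eta>)) \<in> BI k" "(\<lambda>\<eta>. a \<eta> * b (act (inv g) \<eta>)) \<in> BI g"
proof -
  have "BA (inv g) a \<in> BI (inv g)" using BA_BI[of "inv g" a] a g by simp
  then have "BA g (\<lambda>\<eta>. BA (inv g) a \<eta> * b \<eta>) \<in> BI g"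
    using b by (intro BA_BI[OF g] BI_mult) (auto simp: BI_iff)
  moreover have "BA g (\<lambda>\<eta>. BA (inv g) a \<eta> * b \<eta>) = (\<lambda>\<eta>. a \<eta> * b (act (inv g) \<eta>))"
    using g BI_V[OF a] act_inv_V[OF g] act_act_inv[OF g] by (auto simp: BA_eq)
  ultimately show 1: "(\<lambda>\<eta>. a \<eta> * b (act (inv g) \<eta>)) \<in> BI g" by simp
  have "a \<eta> * b (act (inv g) \<eta>) = 0" if \<eta>: "\<eta> \<notin> V k" for \<eta>
    using BI_V[OF a, of \<eta>] BI_V[OF b, of "act (inv g) \<eta>"] act_inv_V_iff[OF g k, of \<eta>] \<eta> by auto
  then show "(\<lambda>\<eta>. a \<eta> * b (act (inv g) \<eta>)) \<in> BI k" using 1 by (simp add: BI_iff)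
qed

lemma PS_mult_closed:
  assumes f: "f \<in> carrier PS" and h: "h \<in> carrier PS"
  shows "mult PS f h \<in> carrier PS"
proof (rule PS_I)
  let ?Z = "(\<lambda>(g, b). g \<otimes> b) ` (supp f \<times> supp h)"
  show "finite ?Z" using PS_supp[OF f] PS_supp[OF h] by simp
  show "mult PS f h k = (\<lambda>_. 0)" if k: "k \<notin> ?Z" for k
  proof (cases "k \<in> carrier G")
    case True
    have "h (inv g \<otimes> k) = (\<lambda>_. 0)" if g: "g \<in> supp f" for g
    proof (rule not_supp[OF h])
      show "inv g \<otimes> k \<notin> supp h"
      proof
        assume "inv g \<otimes> k \<in> supp h"
        moreover have "k = g \<otimes> (inv g \<otimes> k)" using True g supp_carrier[of f] by auto
        ultimately have "k \<in> ?Z" using g by (intro image_eqI[of _ _ "(g, inv g \<otimes> k)"]) auto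
        then show False using k by blast
      qed
    qed
    then show ?thesis unfolding PS_mult_supp[OF f h] by (auto intro!: sum.neutral)
  qed (simp add: PS_mult_supp[OF f h])
  show "mult PS f h k \<in> BI k" if k: "k \<in> carrier G" for k
  proof -
    have "(\<lambda>\<eta>. \<Sum>g\<in>supp f. f g \<eta> * h (inv g \<otimes> k) (act (inv g) \<eta>)) \<in> BI k"
      using supp_carrier[of f] k by (intro BI_sum BI_shift(1) PS_BI[OF f] PS_BI[OF h]) auto
    then show ?thesis using k by (simp add: PS_mult_supp[OF f h])
  qed
  show "mult PS f h k = (\<lambda>_. 0)" if "k \<notin> carrier G" for k
    using that by (simp add: PS_mult_supp[OF f h])
qed

lemma PS_star_closed:
  assumes f: "f \<in> carrier PS"
  shows "star PS f \<in> carrier PS"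
proof (rule PS_I)
  show "finite ((\<lambda>g. inv g) ` supp f)" using PS_supp[OF f] by simp
  show "star PS f g = (\<lambda>_. 0)" if g: "g \<notin> (\<lambda>g. inv g) ` supp f" for g
  proof (cases "g \<in> carrier G")
    case True
    have "inv g \<notin> supp f" using g True by (metis imageI inv_inv)
    then show ?thesis using not_supp[OF f, of "inv g"] by (auto simp: PS_star)
  qed (auto simp: PS_star)
  show "star PS f g \<in> BI g" if g: "g \<in> carrier G" for g
  proof -
    have "BA g (\<lambda>\<eta>. cnj (f (inv g) \<eta>)) \<in> BI g" using g by (intro BA_BI BI_cnj PS_BI[OF f]) auto
    moreover have "BA g (\<lambda>\<eta>. cnj (f (inv g) \<eta>)) = star PS f g" using g by (auto simp: PS_star BA_eq)
    ultimately show ?thesis by simp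
  qed
qed (simp add: PS_star)

lemma delta_apply: "delta_section CB a g k = (if k = g then a else (\<lambda>_. 0))"
  by (simp add: delta_section_def CB_ops)

lemma delta_closed: "[|g \<in> carrier G; a \<in> BI g|] ==> delta_section CB a g \<in> carrier PS"
  by (rule PS_I[of "{g}"]) (auto simp: delta_apply BI_zero)

lemma delta_mult:
  assumes g: "g \<in> carrier G" and h: "h \<in> carrier G" and a: "a \<in> BI g" and b: "b \<in> BI h"
  shows "mult PS (delta_section CB a g) (delta_section CB b h) =
    delta_section CB (\<lambda>\<eta>. a \<eta> * b (act (inv g) \<eta>)) (g \<otimes> h)"
proof -
  have s: "supp (delta_section CB a g) \<subseteq> {g}" by (auto simp: supp_def delta_apply)
  have eq: "inv g \<otimes> k = h \<longleftrightarrow> k = g \<otimes> h" if "k \<in> carrier G" for k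
    using that g h by auto
  have "mult PS (delta_section CB a g) (delta_section CB b h) = (\<lambda>k \<eta>. if k \<in> carrier G then
      \<Sum>g'\<in>{g}. delta_section CB a g g' \<eta> * delta_section CB b h (inv g' \<otimes> k) (act (inv g') \<eta>) else 0)"
    by (rule PS_mult) (use s g h a b delta_closed in auto)
  then show ?thesis using eq g h by (auto simp: delta_apply fun_eq_iff)
qed

lemma delta_star:
  assumes g: "g \<in> carrier G"
  shows "star PS (delta_section CB a g) =
    delta_section CB (\<lambda>\<eta>. if \<eta> \<in> V (inv g) then cnj (a (act g \<eta>)) else 0) (inv g)"
proof -
  have "inv k = g \<longleftrightarrow> k = inv g" if "k \<in> carrier G" for k using that g by auto
  then show ?thesis using g by (auto simp: PS_star delta_apply fun_eq_iff)
qed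

lemma PS_smult_closed: "f \<in> carrier PS ==> c \<odot>\<^bsub>PS\<^esub> f \<in> carrier PS"
proof -
  assume f: "f \<in> carrier PS"
  show ?thesis
    unfolding PS_ops
  proof (rule PS_I[OF PS_supp[OF f]])
    show "(\<lambda>\<eta>. c * f g \<eta>) = (\<lambda>_. 0)" if "g \<notin> supp f" for g using not_supp[OF f that] by simp
    show "(\<lambda>\<eta>. c * f g \<eta>) \<in> BI g" if "g \<in> carrier G" for g by (rule BI_smult[OF PS_BI[OF f that]])
    show "(\<lambda>\<eta>. c * f g \<eta>) = (\<lambda>_. 0)" if "g \<notin> carrier G" for g using PS_off[OF f that] by simp
  qed
qed

lemma PS_add_closed: "[|f \<in> carrier PS; h \<in> carrier PS|] ==> f \<oplus>\<^bsub>PS\<^esub> h \<in> carrier PS"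
proof -
  assume f: "f \<in> carrier PS" and h: "h \<in> carrier PS"
  have "finite (supp f \<union> supp h)" using PS_supp[OF f] PS_supp[OF h] by simp
  then show ?thesis
    unfolding PS_ops
  proof (rule PS_I)
    show "(\<lambda>\<eta>. f g \<eta> + h g \<eta>) = (\<lambda>_. 0)" if "g \<notin> supp f \<union> supp h" for g
      using not_supp[OF f, of g] not_supp[OF h, of g] that by simp
    show "(\<lambda>\<eta>. f g \<eta> + h g \<eta>) \<in> BI g" if "g \<in> carrier G" for g by (rule BI_add[OF PS_BI[OF f that] PS_BI[OF h that]])
    show "(\<lambda>\<eta>. f g \<eta> + h g \<eta>) = (\<lambda>_. 0)" if "g \<notin> carrier G" for g
      using PS_off[OF f that] PS_off[OF h that] by simp
  qed
qed

lemma star_algebra_PS: "star_algebra PS"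
proof (rule star_algebraI)
  have one: "indicator Bd \<in> BI \<one>" using indicator_Bd_carrier CB_BI by blast
  show one_c: "\<one>\<^bsub>PS\<^esub> \<in> carrier PS" unfolding PS_ops by (rule delta_closed[OF one_closed one])
  show "\<zero>\<^bsub>PS\<^esub> \<in> carrier PS" unfolding PS_ops by (rule PS_I[of "{}"]) (auto simp: BI_zero)
  fix x y z assume x: "x \<in> carrier PS"
  show "c \<odot>\<^bsub>PS\<^esub> x \<in> carrier PS" for c by (rule PS_smult_closed[OF x])
  show "star PS x \<in> carrier PS" by (rule PS_star_closed[OF x])
  show "\<zero>\<^bsub>PS\<^esub> \<oplus>\<^bsub>PS\<^esub> x = x" "- 1 \<odot>\<^bsub>PS\<^esub> x \<oplus>\<^bsub>PS\<^esub> x = \<zero>\<^bsub>PS\<^esub>" "1 \<odot>\<^bsub>PS\<^esub> x = x"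
    "\<And>a b. (a + b) \<odot>\<^bsub>PS\<^esub> x = a \<odot>\<^bsub>PS\<^esub> x \<oplus>\<^bsub>PS\<^esub> b \<odot>\<^bsub>PS\<^esub> x"
    "\<And>a b. (a * b) \<odot>\<^bsub>PS\<^esub> x = a \<odot>\<^bsub>PS\<^esub> (b \<odot>\<^bsub>PS\<^esub> x)"
    by (simp_all add: PS_ops algebra_simps)
  show "star PS (star PS x) = x"
  proof (intro ext)
    fix g \<eta>
    show "star PS (star PS x) g \<eta> = x g \<eta>"
      using PS_V[OF x, of \<eta> g] PS_off[OF x, of g] act_inv_V[of g \<eta>] act_act_inv[of g \<eta>] by (auto simp: PS_star)
  qed
  show "star PS (c \<odot>\<^bsub>PS\<^esub> x) = cnj c \<odot>\<^bsub>PS\<^esub> star PS x" for c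
    by (intro ext) (simp add: PS_star PS_ops)
  show "\<one>\<^bsub>PS\<^esub> \<otimes>\<^bsub>PS\<^esub> x = x"
  proof (intro ext)
    fix k \<eta>
    have s1: "supp \<one>\<^bsub>PS\<^esub> \<subseteq> {\<one>}" by (auto simp: supp_def PS_ops delta_apply)
    have o1: "\<one>\<^bsub>PS\<^esub> \<one> \<eta> = indicator Bd \<eta>" by (simp add: PS_ops delta_apply)
    have "(\<one>\<^bsub>PS\<^esub> \<otimes>\<^bsub>PS\<^esub> x) k \<eta> = (if k \<in> carrier G then \<one>\<^bsub>PS\<^esub> \<one> \<eta> * x k (act \<one> \<eta>) else 0)"
      by (subst PS_mult[OF one_c x _ s1]) simp_all
    then have "(\<one>\<^bsub>PS\<^esub> \<otimes>\<^bsub>PS\<^esub> x) k \<eta> = (if k \<in> carrier G then indicator Bd \<eta> * x k (act \<one> \<eta>) else 0)"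
      by (simp only: o1)
    then show "(\<one>\<^bsub>PS\<^esub> \<otimes>\<^bsub>PS\<^esub> x) k \<eta> = x k \<eta>"
      using act_one[of \<eta>] PS_off[OF x, of k] BI_Bd[OF PS_BI[OF x], of k \<eta>] by (auto simp: indicator_def)
  qed
  show "x \<otimes>\<^bsub>PS\<^esub> \<one>\<^bsub>PS\<^esub> = x"
  proof (intro ext)
    fix k \<eta>
    show "(x \<otimes>\<^bsub>PS\<^esub> \<one>\<^bsub>PS\<^esub>) k \<eta> = x k \<eta>"
    proof (cases "k \<in> carrier G")
      case k: True
      have eq: "inv g \<otimes> k = \<one> \<longleftrightarrow> g = k" if "g \<in> supp x" for g
        using that k supp_carrier[of x] by (metis inv_closed inv_inv l_inv inv_equality subsetD)
      have "(x \<otimes>\<^bsub>PS\<^esub> \<one>\<^bsub>PS\<^esub>) k \<eta> = (\<Sum>g\<in>supp x. x g \<eta> * \<one>\<^bsub>PS\<^esub> (inv g \<otimes> k) (act (inv g) \<eta>))"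
        using k by (simp add: PS_mult_supp[OF x one_c])
      also have "\<dots> = (\<Sum>g\<in>supp x. if g = k then x k \<eta> else 0)"
      proof (rule sum.cong[OF refl])
        fix g assume g: "g \<in> supp x"
        have "x k \<eta> * indicator Bd (act (inv k) \<eta>) = x k \<eta>"
          using PS_V[OF x, of \<eta> k] V_Bd[OF act_inv_V[OF k, of \<eta>]] by (auto simp: indicator_def)
        then show "x g \<eta> * \<one>\<^bsub>PS\<^esub> (inv g \<otimes> k) (act (inv g) \<eta>) = (if g = k then x k \<eta> else 0)"
          using eq[OF g] by (auto simp: PS_ops delta_apply)
      qed
      also have "\<dots> = x k \<eta>" using PS_supp[OF x] not_supp[OF x, of k] by (auto simp: sum.delta)
      finally show ?thesis .
    qed (simp add: PS_mult_supp[OF x one_c] PS_off[OF x])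
  qed
  assume y: "y \<in> carrier PS"
  have sub: "finite (supp x \<union> supp y)" "supp x \<union> supp y \<subseteq> carrier G"
    using PS_supp[OF x] PS_supp[OF y] supp_carrier by auto
  show xy: "x \<oplus>\<^bsub>PS\<^esub> y \<in> carrier PS" by (rule PS_add_closed[OF x y])
  show "x \<otimes>\<^bsub>PS\<^esub> y \<in> carrier PS" by (rule PS_mult_closed[OF x y])
  show "x \<oplus>\<^bsub>PS\<^esub> y = y \<oplus>\<^bsub>PS\<^esub> x" "\<And>a. a \<odot>\<^bsub>PS\<^esub> (x \<oplus>\<^bsub>PS\<^esub> y) = a \<odot>\<^bsub>PS\<^esub> x \<oplus>\<^bsub>PS\<^esub> a \<odot>\<^bsub>PS\<^esub> y"
    by (simp_all add: PS_ops algebra_simps)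
  show "star PS (x \<oplus>\<^bsub>PS\<^esub> y) = star PS x \<oplus>\<^bsub>PS\<^esub> star PS y" by (intro ext) (simp add: PS_star PS_ops)
  show "c \<odot>\<^bsub>PS\<^esub> x \<otimes>\<^bsub>PS\<^esub> y = c \<odot>\<^bsub>PS\<^esub> (x \<otimes>\<^bsub>PS\<^esub> y)" for c
  proof -
    have "supp (c \<odot>\<^bsub>PS\<^esub> x) \<subseteq> supp x" by (auto simp: supp_def PS_ops)
    from PS_mult[OF PS_smult_closed[OF x] y PS_supp[OF x] this supp_carrier] show ?thesis
      unfolding PS_mult_supp[OF x y]
      by (simp only:) (intro ext, simp add: PS_ops sum_distrib_left mult.assoc)
  qed
  show "x \<otimes>\<^bsub>PS\<^esub> (c \<odot>\<^bsub>PS\<^esub> y) = c \<odot>\<^bsub>PS\<^esub> (x \<otimes>\<^bsub>PS\<^esub> y)" for c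
    unfolding PS_mult_supp[OF x PS_smult_closed[OF y]] PS_mult_supp[OF x y]
    by (intro ext) (simp add: PS_ops sum_distrib_left mult_ac)
  show "star PS (x \<otimes>\<^bsub>PS\<^esub> y) = star PS y \<otimes>\<^bsub>PS\<^esub> star PS x"
  proof (intro ext)
    fix k \<eta>
    show "star PS (x \<otimes>\<^bsub>PS\<^esub> y) k \<eta> = (star PS y \<otimes>\<^bsub>PS\<^esub> star PS x) k \<eta>"
    proof (cases "k \<in> carrier G")
      case False
      then show ?thesis
        using PS_off[OF PS_star_closed[OF PS_mult_closed[OF x y]]]
          PS_off[OF PS_mult_closed[OF PS_star_closed[OF y] PS_star_closed[OF x]]] by simp
    next
      case k: True
      \<comment> \<open>Substituting m = k g turns the convolution of the adjoints into a sum over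
        the support of x; the indices outside \<open>?kx\<close> contribute 0.\<close>
      let ?kx = "(\<lambda>g. k \<otimes> g) ` supp x"
      let ?X = "supp (star PS y) \<union> ?kx"
      define t where "t m = star PS y m \<eta> * star PS x (inv m \<otimes> k) (act (inv m) \<eta>)" for m
      have X: "finite ?X" "?X \<subseteq> carrier G"
        using PS_supp[OF PS_star_closed[OF y]] PS_supp[OF x] supp_carrier k by auto
      have t0: "t m = 0" if m: "m \<in> ?X - ?kx" for m
      proof -
        have mc: "m \<in> carrier G" using m X by blast
        have "inv k \<otimes> m \<notin> supp x"
        proof
          assume "inv k \<otimes> m \<in> supp x"
          then have "k \<otimes> (inv k \<otimes> m) \<in> ?kx" by blast
          then show False using m mc k by simp
        qed
        then have "x (inv (inv m \<otimes> k)) = (\<lambda>_. 0)" using not_supp[OF x] mc k by (simp add: inv_mult_group)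
        then show ?thesis by (simp add: t_def PS_star)
      qed
      have "(star PS y \<otimes>\<^bsub>PS\<^esub> star PS x) k \<eta> = (\<Sum>m\<in>?X. t m)"
        using k by (subst PS_mult[OF PS_star_closed[OF y] PS_star_closed[OF x] X(1) _ X(2)]) (auto simp: t_def)
      also have "\<dots> = (\<Sum>m\<in>?kx. t m)" using X t0 by (intro sum.mono_neutral_right) auto
      also have "\<dots> = (\<Sum>g\<in>supp x. t (k \<otimes> g))"
        using k supp_carrier[of x] by (subst sum.reindex) (auto simp: inj_on_def subset_iff)
      also have "\<dots> = (\<Sum>g\<in>supp x. if \<eta> \<in> V k then
          cnj (x g (act (inv k) \<eta>) * y (inv g \<otimes> inv k) (act (inv g) (act (inv k) \<eta>))) else 0)"
      proof (rule sum.cong[OF refl])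
        fix g assume "g \<in> supp x"
        then have g: "g \<in> carrier G" using supp_carrier by blast
        have kg: "k \<otimes> g \<in> carrier G" using k g by simp
        have inv1: "inv (k \<otimes> g) = inv g \<otimes> inv k" using k g by (simp add: inv_mult_group)
        have inv2: "inv (k \<otimes> g) \<otimes> k = inv g" using k g by (simp add: inv1 m_assoc)
        have inv3: "inv g \<otimes> inv k \<otimes> k = inv g" using k g by (simp add: m_assoc)
        \<comment> \<open>The composition law of the partial action is available only on its domain;
          off the domain both sides vanish because of the supports of the coefficients.\<close>
        show "t (k \<otimes> g) = (if \<eta> \<in> V k then
          cnj (x g (act (inv k) \<eta>) * y (inv g \<otimes> inv k) (act (inv g) (act (inv k) \<eta>))) else 0)"
        proof (cases "\<eta> \<in> V (k \<otimes> g)")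
          case Vkg: True
          let ?z = "act (inv (k \<otimes> g)) \<eta>"
          show ?thesis
          proof (cases "\<eta> \<in> V k")
            case Vk: True
            have Vg: "act (inv k) \<eta> \<in> V g" using act_inv_V_iff[OF k kg Vk] Vkg k g by simp
            have z: "act (inv g) (act (inv k) \<eta>) = ?z" using act_inv_comp(2)[OF k g Vk Vg] .
            have "?z \<in> V (inv g)" using act_inv_V[OF g Vg] z by simp
            moreover have "act g ?z = act (inv k) \<eta>" using act_act_inv[OF g Vg] z by simp
            ultimately show ?thesis
              using Vkg Vk kg g z by (simp add: t_def PS_star inv1 inv2 inv3)
          next
            case Vk: False
            have "?z \<notin> V (inv g)" using act_inv_V_iff[OF kg k Vkg] Vk by (simp add: inv2)
            then show ?thesis using Vk g by (simp add: t_def PS_star inv2)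
          qed
        next
          case Vkg: False
          have "x g (act (inv k) \<eta>) = 0" if Vk: "\<eta> \<in> V k"
          proof (rule PS_V[OF x])
            show "act (inv k) \<eta> \<notin> V g" using act_inv_comp(1)[OF k g Vk] Vkg by blast
          qed
          then show ?thesis using Vkg by (simp add: t_def PS_star)
        qed
      qed
      also have "\<dots> = star PS (x \<otimes>\<^bsub>PS\<^esub> y) k \<eta>"
        using k by (simp add: PS_star PS_mult_supp[OF x y])
      finally show ?thesis by simp
    qed
  qed
  assume z: "z \<in> carrier PS"
  show "x \<oplus>\<^bsub>PS\<^esub> y \<oplus>\<^bsub>PS\<^esub> z = x \<oplus>\<^bsub>PS\<^esub> (y \<oplus>\<^bsub>PS\<^esub> z)" by (simp add: PS_ops algebra_simps)
  show "(x \<oplus>\<^bsub>PS\<^esub> y) \<otimes>\<^bsub>PS\<^esub> z = x \<otimes>\<^bsub>PS\<^esub> z \<oplus>\<^bsub>PS\<^esub> y \<otimes>\<^bsub>PS\<^esub> z"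
  proof -
    have "supp (x \<oplus>\<^bsub>PS\<^esub> y) \<subseteq> supp x \<union> supp y" by (auto simp: supp_def PS_ops)
    from PS_mult[OF xy z sub(1) this sub(2)] show ?thesis
      unfolding PS_mult[OF x z sub(1) Un_upper1 sub(2)] PS_mult[OF y z sub(1) Un_upper2 sub(2)]
      by (simp only:) (intro ext, simp add: PS_ops sum.distrib distrib_right)
  qed
  show "z \<otimes>\<^bsub>PS\<^esub> (x \<oplus>\<^bsub>PS\<^esub> y) = z \<otimes>\<^bsub>PS\<^esub> x \<oplus>\<^bsub>PS\<^esub> z \<otimes>\<^bsub>PS\<^esub> y"
    unfolding PS_mult_supp[OF z xy] PS_mult_supp[OF z x] PS_mult_supp[OF z y]
    by (intro ext) (simp add: PS_ops sum.distrib distrib_left)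
  show "x \<otimes>\<^bsub>PS\<^esub> y \<otimes>\<^bsub>PS\<^esub> z = x \<otimes>\<^bsub>PS\<^esub> (y \<otimes>\<^bsub>PS\<^esub> z)"
  proof (intro ext)
    fix k \<eta>
    have xyc: "x \<otimes>\<^bsub>PS\<^esub> y \<in> carrier PS" and yzc: "y \<otimes>\<^bsub>PS\<^esub> z \<in> carrier PS"
      using PS_mult_closed x y z by auto
    show "(x \<otimes>\<^bsub>PS\<^esub> y \<otimes>\<^bsub>PS\<^esub> z) k \<eta> = (x \<otimes>\<^bsub>PS\<^esub> (y \<otimes>\<^bsub>PS\<^esub> z)) k \<eta>"
    proof (cases "k \<in> carrier G")
      case False
      then show ?thesis using PS_off[OF PS_mult_closed[OF xyc z]] PS_off[OF PS_mult_closed[OF x yzc]] by simp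
    next
      case k: True
      \<comment> \<open>All products of a support element of x with one of y. The double sum over
        \<open>?Z\<close> and the support of x is reindexed by m = g b for fixed g.\<close>
      let ?Z = "(\<lambda>(g, b). g \<otimes> b) ` (supp x \<times> supp y)"
      have Z: "finite ?Z" "?Z \<subseteq> carrier G"
        using PS_supp[OF x] PS_supp[OF y] supp_carrier by (auto simp: subset_iff)
      have sZ: "supp (x \<otimes>\<^bsub>PS\<^esub> y) \<subseteq> ?Z"
      proof
        fix m assume m: "m \<in> supp (x \<otimes>\<^bsub>PS\<^esub> y)"
        then have mc: "m \<in> carrier G" using supp_carrier by blast
        show "m \<in> ?Z"
        proof (rule ccontr)
          assume mZ: "m \<notin> ?Z"
          have "y (inv g \<otimes> m) = (\<lambda>_. 0)" if g: "g \<in> supp x" for g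
          proof (rule not_supp[OF y], rule notI)
            assume "inv g \<otimes> m \<in> supp y"
            moreover have "m = g \<otimes> (inv g \<otimes> m)" using mc g supp_carrier[of x] by auto
            ultimately have "m \<in> ?Z" using g by (intro image_eqI[of _ _ "(g, inv g \<otimes> m)"]) auto
            then show False using mZ by blast
          qed
          then have "(x \<otimes>\<^bsub>PS\<^esub> y) m = (\<lambda>_. 0)"
            unfolding PS_mult_supp[OF x y] by (auto intro!: sum.neutral)
          then show False using m by (simp add: supp_def)
        qed
      qed
      have "(x \<otimes>\<^bsub>PS\<^esub> y \<otimes>\<^bsub>PS\<^esub> z) k \<eta> =
          (\<Sum>m\<in>?Z. (x \<otimes>\<^bsub>PS\<^esub> y) m \<eta> * z (inv m \<otimes> k) (act (inv m) \<eta>))"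
        using k by (subst PS_mult[OF xyc z Z(1) sZ Z(2)]) simp
      also have "\<dots> = (\<Sum>m\<in>?Z. \<Sum>g\<in>supp x. x g \<eta> * y (inv g \<otimes> m) (act (inv g) \<eta>) * z (inv m \<otimes> k) (act (inv m) \<eta>))"
        using Z(2) by (intro sum.cong) (auto simp: PS_mult_supp[OF x y] sum_distrib_right)
      also have "\<dots> = (\<Sum>g\<in>supp x. \<Sum>m\<in>?Z. x g \<eta> * y (inv g \<otimes> m) (act (inv g) \<eta>) * z (inv m \<otimes> k) (act (inv m) \<eta>))"
        by (rule sum.swap)
      also have "\<dots> = (\<Sum>g\<in>supp x. x g \<eta> * (y \<otimes>\<^bsub>PS\<^esub> z) (inv g \<otimes> k) (act (inv g) \<eta>))"
      proof (rule sum.cong[OF refl])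
        fix g assume gs: "g \<in> supp x"
        then have g: "g \<in> carrier G" using supp_carrier by blast
        let ?gy = "(\<lambda>b. g \<otimes> b) ` supp y"
        have gy: "?gy \<subseteq> ?Z" using gs by auto
        define t where "t m = x g \<eta> * y (inv g \<otimes> m) (act (inv g) \<eta>) * z (inv m \<otimes> k) (act (inv m) \<eta>)" for m
        have t0: "t m = 0" if m: "m \<in> ?Z - ?gy" for m
        proof -
          have mc: "m \<in> carrier G" using m Z by blast
          have "inv g \<otimes> m \<notin> supp y"
          proof
            assume "inv g \<otimes> m \<in> supp y"
            then have "g \<otimes> (inv g \<otimes> m) \<in> ?gy" by blast
            then show False using m mc g by simp
          qed
          then show ?thesis using not_supp[OF y] by (simp add: t_def)
        qed
        have "(\<Sum>m\<in>?Z. t m) = (\<Sum>m\<in>?gy. t m)" using Z gy t0 by (intro sum.mono_neutral_right) auto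
        also have "\<dots> = (\<Sum>b\<in>supp y. t (g \<otimes> b))"
          using g supp_carrier[of y] by (subst sum.reindex) (auto simp: inj_on_def subset_iff)
        also have "\<dots> = (\<Sum>b\<in>supp y. x g \<eta> * (y b (act (inv g) \<eta>) * z (inv b \<otimes> (inv g \<otimes> k)) (act (inv b) (act (inv g) \<eta>))))"
        proof (rule sum.cong[OF refl])
          fix b assume "b \<in> supp y"
          then have b: "b \<in> carrier G" using supp_carrier by blast
          have e: "inv (g \<otimes> b) \<otimes> k = inv b \<otimes> (inv g \<otimes> k)" using g b k by (simp add: inv_mult_group m_assoc)
          show "t (g \<otimes> b) = x g \<eta> * (y b (act (inv g) \<eta>) * z (inv b \<otimes> (inv g \<otimes> k)) (act (inv b) (act (inv g) \<eta>)))"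
          proof (cases "\<eta> \<in> V g \<and> act (inv g) \<eta> \<in> V b")
            case True
            then have "act (inv b) (act (inv g) \<eta>) = act (inv (g \<otimes> b)) \<eta>" using act_inv_comp(2)[OF g b] by blast
            then show ?thesis using g b by (simp add: t_def e)
          next
            case False
            then have "x g \<eta> = 0 \<or> y b (act (inv g) \<eta>) = 0" using PS_V[OF x] PS_V[OF y] by blast
            then show ?thesis using g b by (auto simp: t_def)
          qed
        qed
        also have "\<dots> = x g \<eta> * (y \<otimes>\<^bsub>PS\<^esub> z) (inv g \<otimes> k) (act (inv g) \<eta>)"
          using g k by (simp add: PS_mult_supp[OF y z] sum_distrib_left)
        finally show "(\<Sum>m\<in>?Z. x g \<eta> * y (inv g \<otimes> m) (act (inv g) \<eta>) * z (inv m \<otimes> k) (act (inv m) \<eta>)) =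
            x g \<eta> * (y \<otimes>\<^bsub>PS\<^esub> z) (inv g \<otimes> k) (act (inv g) \<eta>)" by (simp add: t_def)
      qed
      also have "\<dots> = (x \<otimes>\<^bsub>PS\<^esub> (y \<otimes>\<^bsub>PS\<^esub> z)) k \<eta>"
        using k by (simp add: PS_mult_supp[OF x yzc])
      finally show ?thesis .
    qed
  qed
qed

end

context submonoid_of_group
begin

abbreviation "FA \<equiv> free_star_alg P"

lemma Bd_nonempty: "Bd \<noteq> {}"
  using maximal_above_principal[OF P_one] MX_Bd by blast

section \<open>Sup norm of a coefficient and l1-norm of a section\<close>

definition supn :: "(('g set => nat) => complex) => real" where
  "supn a = (SUP \<eta>\<in>Bd. cmod (a \<eta>))"

lemma supn_upper: "[|a \<in> carrier CB; \<eta> \<in> Bd|] ==> cmod (a \<eta>) \<le> supn a"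
proof -
  assume a: "a \<in> carrier CB" and \<eta>: "\<eta> \<in> Bd"
  have "compact ((\<lambda>\<eta>. cmod (a \<eta>)) ` Bd)"
    using a by (intro compact_continuous_image compact_Bd continuous_on_norm) (simp add: CB_carrier)
  then have "bdd_above ((\<lambda>\<eta>. cmod (a \<eta>)) ` Bd)" by (intro bounded_imp_bdd_above compact_imp_bounded)
  then show ?thesis unfolding supn_def by (rule cSUP_upper[OF \<eta>])
qed

lemma supn_le: "(\<And>\<eta>. \<eta> \<in> Bd ==> cmod (a \<eta>) \<le> M) ==> supn a \<le> M"
  unfolding supn_def by (rule cSUP_least[OF Bd_nonempty])

lemma supn_nonneg: "a \<in> carrier CB ==> 0 \<le> supn a"
  using supn_upper[of a] Bd_nonempty norm_ge_zero order_trans by (metis ex_in_conv)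

lemma supn_zero [simp]: "supn (\<lambda>_. 0) = 0"
  using Bd_nonempty by (simp add: supn_def)

lemma supn_add: "[|a \<in> carrier CB; b \<in> carrier CB|] ==> supn (\<lambda>\<eta>. a \<eta> + b \<eta>) \<le> supn a + supn b"
  by (rule supn_le) (meson add_mono norm_triangle_ineq order_trans supn_upper)

lemma supn_smult:
  assumes a: "a \<in> carrier CB"
  shows "supn (\<lambda>\<eta>. c * a \<eta>) = cmod c * supn a"
proof (cases "c = 0")
  case False
  have le: "supn (\<lambda>\<eta>. c * a \<eta>) \<le> cmod c * supn a" if "a \<in> carrier CB" for a c
    using supn_upper[OF that] by (intro supn_le) (simp add: norm_mult mult_left_mono)
  have ca: "(\<lambda>\<eta>. c * a \<eta>) \<in> carrier CB" using BI_smult[of a \<one> c] a CB_BI by simp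
  have "supn a = supn (\<lambda>\<eta>. inverse c * (c * a \<eta>))" using False by (simp add: mult.assoc[symmetric])
  also have "\<dots> \<le> cmod (inverse c) * supn (\<lambda>\<eta>. c * a \<eta>)" by (rule le[OF ca])
  finally have "cmod c * supn a \<le> cmod c * (cmod (inverse c) * supn (\<lambda>\<eta>. c * a \<eta>))"
    by (intro mult_left_mono) auto
  also have "\<dots> = supn (\<lambda>\<eta>. c * a \<eta>)"
    using False by (simp only: mult.assoc[symmetric] norm_mult[symmetric]) simp
  finally have "cmod c * supn a \<le> supn (\<lambda>\<eta>. c * a \<eta>)" .
  then show ?thesis using le[OF a, of c] by simp
qed simp

definition N1 :: "('g => ('g set => nat) => complex) => real" where
  "N1 f = (\<Sum>g\<in>supp f. supn (f g))"

lemma N1_superset: "[|f \<in> carrier PS; finite X; supp f \<subseteq> X|] ==> N1 f = (\<Sum>g\<in>X. supn (f g))"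
  unfolding N1_def by (intro sum.mono_neutral_left) (auto simp: not_supp)

lemma N1_finite_sum_le: "[|f \<in> carrier PS; finite X|] ==> (\<Sum>g\<in>X. supn (f g)) \<le> N1 f"
proof -
  assume f: "f \<in> carrier PS" and X: "finite X"
  have "(\<Sum>g\<in>X. supn (f g)) \<le> (\<Sum>g\<in>X \<union> supp f. supn (f g))"
    using X PS_supp[OF f] by (intro sum_mono2) (auto simp: supn_nonneg PS_CB[OF f])
  also have "\<dots> = N1 f" using N1_superset[OF f, of "X \<union> supp f"] X PS_supp[OF f] by simp
  finally show ?thesis .
qed

lemma N1_delta: "[|g \<in> carrier G; a \<in> BI g|] ==> N1 (delta_section CB a g) = supn a"
proof -
  assume g: "g \<in> carrier G" and a: "a \<in> BI g"
  have sub: "supp (delta_section CB a g) \<subseteq> {g}"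
    unfolding supp_def delta_apply by auto
  have "N1 (delta_section CB a g) = (\<Sum>h\<in>{g}. supn (delta_section CB a g h))"
    by (rule N1_superset[OF delta_closed[OF g a] _ sub]) simp
  then show ?thesis by (simp add: delta_apply)
qed

text \<open>The partial action only moves the points at which coefficients are evaluated, so
  convolution and involution are estimated as in the l1-algebra of a group.\<close>

lemma continuous_norm_N1: "continuous_norm PS N1"
proof -
  interpret PS: star_algebra PS by (rule star_algebra_PS)
  show ?thesis
    unfolding continuous_norm_def
  proof (intro conjI ballI allI)
    fix x assume x: "x \<in> carrier PS"
    show "0 \<le> N1 x" unfolding N1_def using PS_CB[OF x] by (intro sum_nonneg supn_nonneg)
    show "N1 (c \<odot>\<^bsub>PS\<^esub> x) = cmod c * N1 x" for c
    proof -
      have "supp (c \<odot>\<^bsub>PS\<^esub> x) \<subseteq> supp x" by (auto simp: supp_def PS_ops)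
      from N1_superset[OF PS.smult_closed'[OF x] PS_supp[OF x] this] show ?thesis
        using supn_smult[OF PS_CB[OF x]] by (simp add: PS_ops N1_def sum_distrib_left)
    qed
    show "N1 (star PS x) \<le> N1 x"
    proof -
      have sub: "supp (star PS x) \<subseteq> (\<lambda>g. inv g) ` supp x"
      proof
        fix g assume g: "g \<in> supp (star PS x)"
        then have gc: "g \<in> carrier G" using supp_carrier by blast
        have "inv g \<in> supp x"
        proof (rule ccontr)
          assume "inv g \<notin> supp x"
          then have "star PS x g = (\<lambda>_. 0)" using not_supp[OF x] by (auto simp: PS_star)
          then show False using g by (simp add: supp_def)
        qed
        then show "g \<in> (\<lambda>g. inv g) ` supp x" using gc by (metis imageI inv_inv)
      qed
      have "N1 (star PS x) = (\<Sum>g\<in>(\<lambda>g. inv g) ` supp x. supn (star PS x g))"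
        by (rule N1_superset[OF PS_star_closed[OF x] _ sub]) (simp add: PS_supp[OF x])
      also have "\<dots> = (\<Sum>g\<in>supp x. supn (star PS x (inv g)))"
        using supp_carrier[of x] by (subst sum.reindex) (auto intro!: inj_onI simp: subset_iff)
      also have "\<dots> \<le> (\<Sum>g\<in>supp x. supn (x g))"
      proof (intro sum_mono supn_le)
        fix g \<eta> assume "g \<in> supp x"
        then have g: "g \<in> carrier G" using supp_carrier by blast
        show "cmod (star PS x (inv g) \<eta>) \<le> supn (x g)"
          using g supn_upper[OF PS_CB[OF x] V_Bd[OF act_V[OF g]], of \<eta> g] supn_nonneg[OF PS_CB[OF x], of g]
          by (auto simp: PS_star)
      qed
      finally show ?thesis by (simp add: N1_def)
    qed
    fix y assume y: "y \<in> carrier PS"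
    let ?X = "supp x \<union> supp y"
    have X: "finite ?X" using PS_supp[OF x] PS_supp[OF y] by simp
    show "N1 (x \<oplus>\<^bsub>PS\<^esub> y) \<le> N1 x + N1 y"
    proof -
      have "supp (x \<oplus>\<^bsub>PS\<^esub> y) \<subseteq> ?X" by (auto simp: supp_def PS_ops)
      from N1_superset[OF PS.alg_a_closed[OF x y] X this]
      have "N1 (x \<oplus>\<^bsub>PS\<^esub> y) \<le> (\<Sum>g\<in>?X. supn (x g) + supn (y g))"
        using supn_add[OF PS_CB[OF x] PS_CB[OF y]] by (simp add: PS_ops sum_mono)
      then show ?thesis
        using N1_superset[OF x X] N1_superset[OF y X] by (simp add: sum.distrib)
    qed
    show "N1 (x \<otimes>\<^bsub>PS\<^esub> y) \<le> N1 x * N1 y"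
    proof -
      let ?m = "x \<otimes>\<^bsub>PS\<^esub> y"
      have m: "?m \<in> carrier PS" by (rule PS_mult_closed[OF x y])
      have "N1 ?m \<le> (\<Sum>k\<in>supp ?m. \<Sum>g\<in>supp x. supn (x g) * supn (y (inv g \<otimes> k)))"
        unfolding N1_def
      proof (intro sum_mono supn_le)
        fix k \<eta> assume "k \<in> supp ?m" and \<eta>: "\<eta> \<in> Bd"
        then have k: "k \<in> carrier G" using supp_carrier by blast
        have "cmod (?m k \<eta>) \<le> (\<Sum>g\<in>supp x. cmod (x g \<eta> * y (inv g \<otimes> k) (act (inv g) \<eta>)))"
          using k by (simp add: PS_mult_supp[OF x y] norm_sum)
        also have "\<dots> \<le> (\<Sum>g\<in>supp x. supn (x g) * supn (y (inv g \<otimes> k)))"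
        proof (rule sum_mono)
          fix g assume "g \<in> supp x"
          then have g: "g \<in> carrier G" using supp_carrier by blast
          show "cmod (x g \<eta> * y (inv g \<otimes> k) (act (inv g) \<eta>)) \<le> supn (x g) * supn (y (inv g \<otimes> k))"
          proof (cases "\<eta> \<in> V g")
            case True
            have "act (inv g) \<eta> \<in> Bd" using V_Bd[OF act_inv_V[OF g True]] .
            then show ?thesis unfolding norm_mult
              by (intro mult_mono supn_upper PS_CB[OF x] PS_CB[OF y] \<eta> supn_nonneg) auto
          next
            case False
            then show ?thesis using PS_V[OF x] supn_nonneg[OF PS_CB[OF x]] supn_nonneg[OF PS_CB[OF y]] by simp
          qed
        qed
        finally show "cmod (?m k \<eta>) \<le> (\<Sum>g\<in>supp x. supn (x g) * supn (y (inv g \<otimes> k)))" .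
      qed
      also have "\<dots> = (\<Sum>g\<in>supp x. supn (x g) * (\<Sum>k\<in>supp ?m. supn (y (inv g \<otimes> k))))"
        by (subst sum.swap) (simp add: sum_distrib_left)
      also have "\<dots> \<le> (\<Sum>g\<in>supp x. supn (x g) * N1 y)"
      proof (intro sum_mono mult_left_mono supn_nonneg PS_CB[OF x])
        fix g assume "g \<in> supp x"
        then have g: "g \<in> carrier G" using supp_carrier by blast
        have "inj_on (\<lambda>k. inv g \<otimes> k) (supp ?m)"
          using g supp_carrier[of ?m] by (auto simp: inj_on_def subset_iff)
        then have "(\<Sum>k\<in>supp ?m. supn (y (inv g \<otimes> k))) = (\<Sum>h\<in>(\<lambda>k. inv g \<otimes> k) ` supp ?m. supn (y h))"
          by (simp add: sum.reindex)
        also have "\<dots> \<le> N1 y" using PS_supp[OF m] by (intro N1_finite_sum_le[OF y]) simp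
        finally show "(\<Sum>k\<in>supp ?m. supn (y (inv g \<otimes> k))) \<le> N1 y" .
      qed
      also have "\<dots> = N1 x * N1 y" by (simp add: N1_def sum_distrib_right)
      finally show ?thesis .
    qed
  qed
qed

text \<open>One fibre is removed at a time. It lies outside the support of the remaining section,
  hence the additivity of \<open>N1\<close> that the induction step receives as a premise.\<close>

lemma PS_induct [consumes 1, case_names zero add]:
  assumes x: "x \<in> carrier PS"
    and zero: "Q \<zero>\<^bsub>PS\<^esub>"
    and add: "\<And>x a g. [|x \<in> carrier PS; g \<in> carrier G; a \<in> BI g; Q x|] ==>
      N1 (x \<oplus>\<^bsub>PS\<^esub> delta_section CB a g) = N1 x + supn a ==> Q (x \<oplus>\<^bsub>PS\<^esub> delta_section CB a g)"
  shows "Q x"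
proof -
  have "Q x" if "finite X" "supp x = X" "x \<in> carrier PS" for X x
    using that
  proof (induction X arbitrary: x)
    case empty
    have "x g = (\<lambda>_. 0)" for g using not_supp[OF empty(2), of g] empty(1) by simp
    then have "x = \<zero>\<^bsub>PS\<^esub>" by (simp add: PS_ops fun_eq_iff)
    then show ?case using zero by simp
  next
    case (insert g X)
    let ?y = "x(g := (\<lambda>_. 0))"
    have g: "g \<in> carrier G" using insert.prems(1) supp_carrier by blast
    have supp_y: "supp ?y = X" using insert.hyps insert.prems(1) by (auto simp: supp_def)
    have y: "?y \<in> carrier PS"
    proof (rule PS_I[of X])
      fix h
      show "?y h = (\<lambda>_. 0)" if "h \<notin> X" using not_supp[OF insert.prems(2), of h] insert.prems(1) that by auto
      show "?y h \<in> BI h" if "h \<in> carrier G" using PS_BI[OF insert.prems(2) that] BI_zero by auto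
      show "?y h = (\<lambda>_. 0)" if "h \<notin> carrier G" using PS_off[OF insert.prems(2) that] by auto
    qed (use insert in auto)
    have eq: "x = ?y \<oplus>\<^bsub>PS\<^esub> delta_section CB (x g) g"
      by (auto simp: PS_ops delta_apply fun_eq_iff)
    have "N1 x = N1 ?y + supn (x g)"
      using insert.hyps unfolding N1_def supp_y insert.prems(1) by (auto simp: sum.insert intro!: sum.cong)
    then have "N1 (?y \<oplus>\<^bsub>PS\<^esub> delta_section CB (x g) g) = N1 ?y + supn (x g)" by (simp only: eq[symmetric])
    from add[OF y g PS_BI[OF insert.prems(2) g] insert.IH[OF supp_y y] this]
    show ?case by (simp only: eq[symmetric])
  qed
  then show ?thesis using x PS_supp by blast
qed

lemma delta_one_mult:
  assumes "a \<in> carrier CB" "b \<in> carrier CB"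
  shows "delta_section CB a \<one> \<otimes>\<^bsub>PS\<^esub> delta_section CB b \<one> = delta_section CB (\<lambda>\<eta>. a \<eta> * b \<eta>) \<one>"
proof -
  have "(\<lambda>\<eta>. a \<eta> * b (act (inv \<one>) \<eta>)) = (\<lambda>\<eta>. a \<eta> * b \<eta>)"
  proof
    fix \<eta> show "a \<eta> * b (act (inv \<one>) \<eta>) = a \<eta> * b \<eta>"
      using assms act_one[of \<eta>] by (cases "\<eta> \<in> Bd") (auto simp: CB_carrier)
  qed
  then show ?thesis using delta_mult[OF one_closed one_closed, of a b] assms CB_BI by simp
qed

lemma delta_one_star:
  assumes "a \<in> carrier CB"
  shows "star PS (delta_section CB a \<one>) = delta_section CB (\<lambda>\<eta>. cnj (a \<eta>)) \<one>"
proof -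
  have "(\<lambda>\<eta>. if \<eta> \<in> V (inv \<one>) then cnj (a (act \<one> \<eta>)) else 0) = (\<lambda>\<eta>. cnj (a \<eta>))"
  proof
    fix \<eta> show "(if \<eta> \<in> V (inv \<one>) then cnj (a (act \<one> \<eta>)) else 0) = cnj (a \<eta>)"
    proof (cases "\<eta> \<in> Bd")
      case True
      then have "act \<one> \<eta> = \<eta>" by (rule act_one)
      then show ?thesis using True V_one by simp
    next
      case False
      then show ?thesis using assms V_one by (simp add: CB_carrier)
    qed
  qed
  then show ?thesis using delta_star[OF one_closed, of a] by simp
qed

lemma delta_smult: "c \<odot>\<^bsub>PS\<^esub> delta_section CB a g = delta_section CB (\<lambda>\<eta>. c * a \<eta>) g"
  and delta_add: "delta_section CB a g \<oplus>\<^bsub>PS\<^esub> delta_section CB b g = delta_section CB (\<lambda>\<eta>. a \<eta> + b \<eta>) g"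
  by (auto simp: PS_ops delta_apply fun_eq_iff)

lemma delta_mult_star:
  assumes g: "g \<in> carrier G" and a: "a \<in> BI g"
  shows "delta_section CB a g \<otimes>\<^bsub>PS\<^esub> star PS (delta_section CB a g) = delta_section CB (\<lambda>\<eta>. a \<eta> * cnj (a \<eta>)) \<one>"
proof -
  let ?b = "\<lambda>\<eta>. if \<eta> \<in> V (inv g) then cnj (a (act g \<eta>)) else 0"
  have "?b = BA (inv g) (\<lambda>\<eta>. cnj (a \<eta>))" using g by (auto simp: BA_eq fun_eq_iff)
  then have b: "?b \<in> BI (inv g)" using BA_BI[of "inv g" "\<lambda>\<eta>. cnj (a \<eta>)"] BI_cnj[OF a] g by simp
  have "a \<eta> * ?b (act (inv g) \<eta>) = a \<eta> * cnj (a \<eta>)" for \<eta>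
    using BI_V[OF a, of \<eta>] act_inv_V[OF g, of \<eta>] act_act_inv[OF g, of \<eta>] by (cases "\<eta> \<in> V g") auto
  then have eq: "(\<lambda>\<eta>. a \<eta> * ?b (act (inv g) \<eta>)) = (\<lambda>\<eta>. a \<eta> * cnj (a \<eta>))" by (rule ext)
  show ?thesis unfolding delta_star[OF g] delta_mult[OF g inv_closed[OF g] a b] eq using g by simp
qed

text \<open>A function \<open>r\<close> with values in \<open>[0, 1]\<close> is the real part of the unitary \<open>r + \<i> sqrt (1 - r\<^sup>2)\<close>,
  so every C*-seminorm is at most 1 on it.\<close>

lemma cstar_seminorm_le_N1:
  assumes q: "cstar_seminorm PS q" and x: "x \<in> carrier PS"
  shows "q x \<le> N1 x"
proof -
  interpret q: cstar_seminormed PS q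
    by (intro cstar_seminormed.intro cstar_seminormed_axioms.intro star_algebra_PS q)
  have dc: "delta_section CB a \<one> \<in> carrier PS" if "a \<in> carrier CB" for a
    using that CB_BI delta_closed by blast
  have 1: "q (delta_section CB (\<lambda>\<eta>. of_real (r \<eta>)) \<one>) \<le> 1"
    if r: "(\<lambda>\<eta>. of_real (r \<eta>)) \<in> carrier CB" and b: "\<And>\<eta>. 0 \<le> r \<eta> \<and> r \<eta> \<le> 1" for r
  proof -
    define u where "u \<eta> = (if \<eta> \<in> Bd then of_real (r \<eta>) + \<i> * of_real (sqrt (1 - (r \<eta>)\<^sup>2)) else 0)" for \<eta>
    have rc: "continuous_on Bd r"
      using r by (simp add: CB_carrier)
    have "continuous_on Bd (\<lambda>\<eta>. of_real (r \<eta>) + \<i> * of_real (sqrt (1 - (r \<eta>)\<^sup>2)))"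
      by (intro continuous_intros rc)
    then have u: "u \<in> carrier CB" unfolding CB_carrier u_def by (auto cong: continuous_on_cong)
    then have uc: "(\<lambda>\<eta>. cnj (u \<eta>)) \<in> carrier CB" using BI_cnj CB_BI by blast
    have uu: "cnj (u \<eta>) * u \<eta> = indicator Bd \<eta>" for \<eta>
    proof (cases "\<eta> \<in> Bd")
      case True
      have "(r \<eta>)\<^sup>2 \<le> 1" using b by (simp add: abs_square_le_1)
      then have "cnj (u \<eta>) * u \<eta> = of_real ((r \<eta>)\<^sup>2 + (sqrt (1 - (r \<eta>)\<^sup>2))\<^sup>2)"
        using True by (simp add: u_def complex_eq_iff power2_eq_square algebra_simps)
      then show ?thesis using True \<open>(r \<eta>)\<^sup>2 \<le> 1\<close> by simp
    qed (simp add: u_def)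
    have "star PS (delta_section CB u \<one>) \<otimes>\<^bsub>PS\<^esub> delta_section CB u \<one> = \<one>\<^bsub>PS\<^esub>"
      by (simp add: delta_one_star[OF u] delta_one_mult[OF uc u] uu PS_ops)
    then have qu: "q (delta_section CB u \<one>) \<le> 1"
      using q.p_isometry_le[OF dc[OF u]] q.p_one_le by simp
    then have quc: "q (delta_section CB (\<lambda>\<eta>. cnj (u \<eta>)) \<one>) \<le> 1"
      using q.p_star[OF dc[OF u]] by (simp add: delta_one_star[OF u])
    have half: "(1/2) * (u \<eta> + cnj (u \<eta>)) = of_real (r \<eta>)" for \<eta>
    proof (cases "\<eta> \<in> Bd")
      case False
      then have "of_real (r \<eta>) = (0 :: complex)" using r unfolding CB_carrier by blast
      then show ?thesis using False by (simp add: u_def)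
    qed (simp add: u_def complex_eq_iff)
    have "delta_section CB (\<lambda>\<eta>. of_real (r \<eta>)) \<one> =
        (1/2) \<odot>\<^bsub>PS\<^esub> (delta_section CB u \<one> \<oplus>\<^bsub>PS\<^esub> delta_section CB (\<lambda>\<eta>. cnj (u \<eta>)) \<one>)"
      unfolding delta_add delta_smult half by simp
    then show ?thesis
      using q.p_triangle[OF dc[OF u] dc[OF uc]] qu quc
        q.p_smult[OF q.alg_a_closed[OF dc[OF u] dc[OF uc]], of "1/2"] by simp
  qed
  \<comment> \<open>The C*-identity leads from the fibre over g to the fibre over \<one>, where the
    squared modulus of a is a positive multiple of a function with values in [0, 1], unless a
    vanishes.\<close>
  have 2: "q (delta_section CB a g) \<le> supn a" if g: "g \<in> carrier G" and a: "a \<in> BI g" for a g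
  proof -
    let ?d = "delta_section CB a g"
    have d: "?d \<in> carrier PS" by (rule delta_closed[OF g a])
    have aC: "a \<in> carrier CB" using a BI_iff by blast
    define M where "M = supn a"
    have M0: "M \<ge> 0" using supn_nonneg[OF aC] by (simp add: M_def)
    show ?thesis
    proof (cases "M = 0")
      case True
      have "a \<eta> = 0" for \<eta> using supn_upper[OF aC, of \<eta>] BI_Bd[OF a, of \<eta>] True by (cases "\<eta> \<in> Bd") (auto simp: M_def)
      then have "?d = \<zero>\<^bsub>PS\<^esub>" by (auto simp: PS_ops delta_apply fun_eq_iff)
      then show ?thesis using M0 by (simp add: M_def)
    next
      case False
      then have M: "M > 0" using M0 by simp
      define r where "r \<eta> = (cmod (a \<eta>) / M)\<^sup>2" for \<eta>
      have aa: "a \<eta> * cnj (a \<eta>) = of_real (M\<^sup>2) * of_real (r \<eta>)" for \<eta>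
      proof -
        have "M\<^sup>2 * r \<eta> = (cmod (a \<eta>))\<^sup>2" using M by (simp add: r_def power_divide)
        then show ?thesis by (simp only: complex_norm_square of_real_mult[symmetric] of_real_power[symmetric])
      qed
      have rb: "0 \<le> r \<eta> \<and> r \<eta> \<le> 1" for \<eta>
      proof -
        have "cmod (a \<eta>) \<le> M" using supn_upper[OF aC, of \<eta>] BI_Bd[OF a, of \<eta>] M0 by (cases "\<eta> \<in> Bd") (auto simp: M_def)
        then show ?thesis using M by (simp add: r_def power_le_one)
      qed
      have "(\<lambda>\<eta>. of_real (inverse (M\<^sup>2)) * (a \<eta> * cnj (a \<eta>))) \<in> carrier CB"
        using BI_smult[OF BI_mult[of a \<one> "\<lambda>\<eta>. cnj (a \<eta>)"]] BI_cnj[of a \<one>] aC unfolding CB_BI by blast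
      moreover have "of_real (inverse (M\<^sup>2)) * (a \<eta> * cnj (a \<eta>)) = of_real (r \<eta>)" for \<eta>
        unfolding aa using M by (simp flip: of_real_mult)
      ultimately have rC: "(\<lambda>\<eta>. of_real (r \<eta>)) \<in> carrier CB" by simp
      have "(q ?d)\<^sup>2 = q (?d \<otimes>\<^bsub>PS\<^esub> star PS ?d)"
        using q.p_cstar[OF q.star_closed[OF d]] d by (simp add: q.star_star)
      also have "\<dots> = q (of_real (M\<^sup>2) \<odot>\<^bsub>PS\<^esub> delta_section CB (\<lambda>\<eta>. of_real (r \<eta>)) \<one>)"
        unfolding delta_mult_star[OF g a] delta_smult aa ..
      also have "\<dots> \<le> M\<^sup>2 * 1"
        using 1[OF rC rb] q.p_smult[OF dc[OF rC]] M by (simp add: norm_power norm_mult power2_eq_square mult_left_le)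
      finally have "(q ?d)\<^sup>2 \<le> M\<^sup>2" by simp
      then show ?thesis using M0 by (simp add: M_def power2_le_iff_abs_le q.p_nonneg[OF d])
    qed
  qed
  show ?thesis using x
  proof (induction rule: PS_induct)
    case zero
    have "N1 \<zero>\<^bsub>PS\<^esub> = 0" by (simp add: N1_def supp_def PS_ops)
    then show ?case by (simp add: q.p_zero)
  next
    case (add x a g)
    then show ?case
      using q.p_triangle[OF add.hyps(1) delta_closed[OF add.hyps(2,3)]] 2[OF add.hyps(2,3)] by linarith
  qed
qed

subsection \<open>The generators of the crossed product\<close>

text \<open>The continuous function on the boundary that corresponds to the indicator function of
  S.\<close>

definition eps :: "'g set => ('g set => nat) => complex" where
  "eps S = (\<lambda>\<eta>. if \<eta> \<in> Bd then of_nat (\<eta> S) else 0)"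

definition gen :: "'g => 'g => ('g set => nat) => complex" where
  "gen p = delta_section CB (eps (p <# P)) p"

text \<open>The value of a word at the generators: \<alpha> acts as the partial translation by
  \<open>dot \<alpha>\<close>, and \<open>KK (rev \<alpha>)\<close> is the range of this
  translation.\<close>

definition DD :: "'g list => 'g => ('g set => nat) => complex" where
  "DD \<alpha> = delta_section CB (eps (KK (rev \<alpha>))) (dot \<alpha>)"

lemma eps_BI: "S \<in> JJ g ==> eps S \<in> BI g"
  unfolding eps_def by (intro SF_BI SF_ind)

lemma K_rev_JJ: "\<alpha> \<in> W ==> KK (rev \<alpha>) \<in> JJ (dot \<alpha>)"
  unfolding JJ_def by (auto simp: dot_rev intro!: exI[of _ "rev \<alpha>"])

lemma DD_closed: "\<alpha> \<in> W ==> DD \<alpha> \<in> carrier PS"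
  unfolding DD_def by (intro delta_closed dot_closed eps_BI K_rev_JJ)

lemma DD_Nil: "DD [] = \<one>\<^bsub>PS\<^esub>"
proof -
  have "eps P = indicator Bd" using JH_P[OF Bd_JH] by (auto simp: eps_def indicator_def fun_eq_iff)
  then show ?thesis by (simp add: DD_def PS_ops)
qed

text \<open>The product of the two coefficient functions is the function of the range of the
  composite translation, which is the ideal of the reversed concatenation.\<close>

lemma DD_mult:
  assumes \<alpha>: "\<alpha> \<in> W" and \<beta>: "\<beta> \<in> W"
  shows "DD \<alpha> \<otimes>\<^bsub>PS\<^esub> DD \<beta> = DD (\<alpha> @ \<beta>)"
proof -
  let ?g = "dot \<alpha>" and ?S = "KK (rev \<alpha>)" and ?R = "KK (rev \<beta>)"
  have g: "?g \<in> carrier G" using \<alpha> by simp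
  have "eps ?S \<eta> * eps ?R (act (inv ?g) \<eta>) = eps (KK (rev (\<alpha> @ \<beta>))) \<eta>" for \<eta>
  proof (cases "\<eta> \<in> Bd")
    case \<eta>: True
    note \<eta>J = Bd_JH[OF \<eta>]
    have K: "KK (rev (\<alpha> @ \<beta>)) = pre (inv ?g) ?S ?R"
      using \<alpha> \<beta> by (simp add: K_append pre_def dot_rev)
    have J: "KK (rev (\<alpha> @ \<beta>)) \<in> J" using \<alpha> \<beta> by (intro K_J) simp
    show ?thesis
    proof (cases "\<eta> ?S = 1")
      case True
      have V: "\<eta> \<in> V ?g" by (rule VI[OF \<eta> K_rev_JJ[OF \<alpha>] True])
      have a: "act (inv ?g) \<eta> \<in> Bd" using V_Bd[OF act_inv_V[OF g V]] .
      have "?S \<in> JJ (inv (inv ?g))" using K_rev_JJ[OF \<alpha>] g by simp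
      from act_one_iff[OF inv_closed[OF g] \<eta>J this True, of ?R]
      have "act (inv ?g) \<eta> ?R = 1 \<longleftrightarrow> \<eta> (KK (rev (\<alpha> @ \<beta>))) = 1" using K \<beta> by simp
      then have "act (inv ?g) \<eta> ?R = \<eta> (KK (rev (\<alpha> @ \<beta>)))"
        using act_cases[of "inv ?g" \<eta> ?R] JH_cases[OF \<eta>J, of "KK (rev (\<alpha> @ \<beta>))"] by metis
      then show ?thesis using True \<eta> a by (simp add: eps_def)
    next
      case False
      have "KK (rev (\<alpha> @ \<beta>)) \<subseteq> ?S" unfolding K by (auto simp: pre_def)
      then have "\<eta> (KK (rev (\<alpha> @ \<beta>))) \<noteq> 1" using JH_mono[OF \<eta>J, of "KK (rev (\<alpha> @ \<beta>))" ?S] False \<alpha> by auto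
      then show ?thesis using False JH_cases[OF \<eta>J, of ?S] JH_cases[OF \<eta>J, of "KK (rev (\<alpha> @ \<beta>))"] \<eta>
        by (simp add: eps_def)
    qed
  qed (simp add: eps_def)
  then show ?thesis
    unfolding DD_def using delta_mult[OF g dot_closed[OF \<beta>] eps_BI[OF K_rev_JJ[OF \<alpha>]] eps_BI[OF K_rev_JJ[OF \<beta>]]]
    by (simp add: dot_append[OF \<alpha> \<beta>])
qed

lemma DD_star:
  assumes \<alpha>: "\<alpha> \<in> W"
  shows "star PS (DD \<alpha>) = DD (rev \<alpha>)"
proof -
  let ?g = "dot \<alpha>" and ?S = "KK (rev \<alpha>)"
  have g: "?g \<in> carrier G" using \<alpha> by simp
  have S: "inv ?g <# ?S = KK \<alpha>" using K_rev[of "rev \<alpha>"] \<alpha> by (simp add: dot_rev)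
  have "(if \<eta> \<in> V (inv ?g) then cnj (eps ?S (act ?g \<eta>)) else 0) = eps (KK \<alpha>) \<eta>" for \<eta>
  proof (cases "\<eta> \<in> V (inv ?g)")
    case True
    have "?S \<in> JJ (inv (inv ?g))" using K_rev_JJ[OF \<alpha>] g by simp
    from act_value[OF inv_closed[OF g] True this] have "act ?g \<eta> ?S = \<eta> (KK \<alpha>)" using S g by simp
    then show ?thesis using True act_Bd[OF g True] V_Bd[OF True] by (simp add: eps_def)
  next
    case False
    have "KK \<alpha> \<in> JJ (inv ?g)" using K_rev_JJ[of "rev \<alpha>"] \<alpha> by (simp add: dot_rev)
    then have "\<eta> (KK \<alpha>) = 0" if "\<eta> \<in> Bd" using VI[OF that, of "KK \<alpha>"] False JH_cases[OF Bd_JH[OF that]] by blast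
    then show ?thesis using False by (auto simp: eps_def)
  qed
  then show ?thesis unfolding DD_def delta_star[OF g] by (simp add: dot_rev[OF \<alpha>])
qed

lemma gen_DD: "p \<in> P ==> gen p = DD [\<one>, p]"
  by (simp add: gen_def DD_def K_principal)

lemma gen_closed: "gen \<in> P \<rightarrow> carrier PS"
  using DD_closed by (auto simp: gen_DD)

lemma letters_val_gen: "fst ` set u \<subseteq> P ==> letters_val PS gen u = DD (alternate u)"
proof (induction u)
  case (Cons a u)
  obtain p s where a: "a = (p, s)" by force
  have "star PS (DD [\<one>, p]) = DD [p, \<one>]" using Cons a DD_star[of "[\<one>, p]"] by simp
  then show ?case
    using Cons a DD_mult[of "[p, \<one>]" "alternate u"] DD_mult[of "[\<one>, p]" "alternate u"] by (simp add: gen_DD)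
qed (simp add: DD_Nil)

definition ev :: "(('g \<times> bool) list => complex) => 'g => ('g set => nat) => complex" where
  "ev = free_eval PS gen"

lemma ev_star_hom: "ev \<in> star_hom FA PS"
  unfolding ev_def by (rule free_eval_star_hom[OF star_algebra_PS gen_closed])

lemma ev_gen: "p \<in> P ==> ev (free_gen p) = gen p"
  unfolding ev_def by (rule free_eval_gen[OF star_algebra_PS gen_closed])

lemma ev_mono: "fst ` set u \<subseteq> P ==> ev (free_mono u) = DD (alternate u)"
  unfolding ev_def using free_eval_mono[OF star_algebra_PS gen_closed] letters_val_gen by simp

text \<open>Through the padded word, which has the same group value and the same ideal as
  \<alpha>.\<close>

lemma word_val_gen:
  assumes \<alpha>: "\<alpha> \<in> W"
  shows "word_val PS gen \<alpha> = DD \<alpha>"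
  using word_val_letters[OF star_algebra_PS gen_closed \<alpha>] letters_val_gen[OF letters_P[OF \<alpha>]]
    letters_P[OF \<alpha>]
    K_alternate_letters[of "rev (alternate (letters \<alpha>))"]
    K_alternate_letters[OF \<alpha>] dot_alternate_letters[OF \<alpha>] K_rev[OF alternate_W[OF letters_P[OF \<alpha>]]] K_rev[OF \<alpha>]
  by (simp add: DD_def)

lemma finsum_PS:
  assumes "finite I" "\<And>i. i \<in> I ==> a i \<in> carrier PS"
  shows "finsum PS a I = (\<lambda>g \<eta>. \<Sum>i\<in>I. a i g \<eta>)"
proof -
  interpret PS: star_algebra PS by (rule star_algebra_PS)
  show ?thesis
    using assms
  proof (induction I)
    case empty
    then show ?case by (simp add: PS_ops)
  next
    case (insert i I)
    then have "finsum PS a (insert i I) = a i \<oplus>\<^bsub>PS\<^esub> finsum PS a I"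
      by (intro PS.alg_finsum_insert) auto
    then show ?case using insert by (simp add: PS_ops)
  qed
qed

lemma ev_apply:
  assumes x: "x \<in> carrier FA"
  shows "ev x g \<eta> = (\<Sum>u\<in>{u. x u \<noteq> 0}. x u * (if dot (alternate u) = g then eps (KK (rev (alternate u))) \<eta> else 0))"
proof -
  interpret PS: star_algebra PS by (rule star_algebra_PS)
  have fin: "finite {u. x u \<noteq> 0}" and P: "\<And>u. x u \<noteq> 0 ==> fst ` set u \<subseteq> P"
    using x by (auto simp: free_carrier)
  have "ev x = finsum PS (\<lambda>u. x u \<odot>\<^bsub>PS\<^esub> letters_val PS gen u) {u. x u \<noteq> 0}"
    by (simp add: ev_def free_eval_def)
  also have "\<dots> = (\<lambda>g \<eta>. \<Sum>u\<in>{u. x u \<noteq> 0}. (x u \<odot>\<^bsub>PS\<^esub> letters_val PS gen u) g \<eta>)"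
    by (rule finsum_PS[OF fin]) (auto simp: letters_val_gen P DD_closed)
  finally show ?thesis
    by (auto simp: letters_val_gen P PS_ops DD_def delta_apply intro!: sum.cong)
qed

text \<open>A coefficient over g is approximated by combinations of \<open>eps S\<close> with S in
  \<open>JJ g\<close>, and each \<open>eps S\<close>, placed over g, is the image of a single
  monomial.\<close>

lemma ev_dense:
  assumes s: "s \<in> carrier PS" and e: "e > 0"
  shows "\<exists>x\<in>carrier FA. N1 (s \<ominus>\<^bsub>PS\<^esub> ev x) < e"
proof -
  interpret PS: star_algebra PS by (rule star_algebra_PS)
  interpret F: star_algebra "FA" by (rule star_algebra_free)
  note evD = star_homD[OF ev_star_hom]
  have tri: "N1 (x \<oplus>\<^bsub>PS\<^esub> y) \<le> N1 x + N1 y" if "x \<in> carrier PS" "y \<in> carrier PS" for x y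
    using continuous_norm_N1 that by (simp add: continuous_norm_def)
  have delta: "\<exists>x\<in>carrier FA. N1 (delta_section CB a g \<ominus>\<^bsub>PS\<^esub> ev x) < e"
    if g: "g \<in> carrier G" and a: "a \<in> BI g" and e: "e > 0" for a g e
  proof -
    obtain t where t: "t \<in> SF (JJ g)" "\<And>\<eta>. \<eta> \<in> Bd ==> cmod (a \<eta> - t \<eta>) \<le> e/2"
      using BI_approx[OF a, of "e/2"] e by auto
    obtain F c where F: "finite F" "F \<subseteq> JJ g" "\<And>\<eta>. \<eta> \<in> JH ==> t \<eta> = (\<Sum>S\<in>F. c S * of_nat (\<eta> S))"
      using t(1) by (rule SF_E) blast
    have "\<exists>x\<in>carrier FA. ev x = delta_section CB (\<lambda>\<eta>. \<Sum>S\<in>F. c S * eps S \<eta>) g"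
      using F(1,2)
    proof (induction F)
      case empty
      have "ev \<zero>\<^bsub>FA\<^esub> = delta_section CB (\<lambda>_. 0) g"
        using star_hom_zero[OF ev_star_hom star_algebra_free star_algebra_PS] by (auto simp: PS_ops delta_apply fun_eq_iff)
      then show ?case using F.alg_zero_closed by auto
    next
      case (insert S F)
      then obtain x where x: "x \<in> carrier FA" "ev x = delta_section CB (\<lambda>\<eta>. \<Sum>S\<in>F. c S * eps S \<eta>) g" by auto
      obtain \<alpha> where \<alpha>: "\<alpha> \<in> W" "dot \<alpha> = inv g" "S = KK \<alpha>" using insert.prems by (auto simp: JJ_def)
      let ?u = "letters (rev \<alpha>)"
      have u: "fst ` set ?u \<subseteq> P" using \<alpha> by (intro letters_P) simp
      have "ev (free_mono ?u) = word_val PS gen (rev \<alpha>)"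
        using ev_mono[OF u] letters_val_gen[OF u] word_val_letters[OF star_algebra_PS gen_closed, of "rev \<alpha>"] \<alpha> by simp
      also have "\<dots> = delta_section CB (eps S) g"
        using word_val_gen[of "rev \<alpha>"] \<alpha> g by (simp add: DD_def dot_rev)
      finally have m: "ev (free_mono ?u) = delta_section CB (eps S) g" .
      let ?y = "x \<oplus>\<^bsub>FA\<^esub> c S \<odot>\<^bsub>FA\<^esub> free_mono ?u"
      have "ev ?y = delta_section CB (\<lambda>\<eta>. \<Sum>S\<in>insert S F. c S * eps S \<eta>) g"
        using x insert free_mono_carrier[OF u] by (simp add: evD F.smult_closed' m delta_smult delta_add add.commute)
      then show ?case using x free_mono_carrier[OF u] by (intro bexI[of _ ?y]) (auto simp: F.alg_a_closed)
    qed
    then obtain x where x: "x \<in> carrier FA" "ev x = delta_section CB (\<lambda>\<eta>. \<Sum>S\<in>F. c S * eps S \<eta>) g" by blast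
    have b: "(\<lambda>\<eta>. \<Sum>S\<in>F. c S * eps S \<eta>) \<in> BI g" using F(2) by (intro BI_sum BI_smult eps_BI) auto
    have d: "(\<lambda>\<eta>. a \<eta> + (- 1) * (\<Sum>S\<in>F. c S * eps S \<eta>)) \<in> BI g" by (intro BI_add a BI_smult b)
    have "delta_section CB a g \<ominus>\<^bsub>PS\<^esub> ev x = delta_section CB (\<lambda>\<eta>. a \<eta> + (- 1) * (\<Sum>S\<in>F. c S * eps S \<eta>)) g"
      unfolding x(2) using PS.diff_eq_smult[OF delta_closed[OF g a] delta_closed[OF g b]] by (simp add: delta_smult delta_add)
    then have "N1 (delta_section CB a g \<ominus>\<^bsub>PS\<^esub> ev x) = supn (\<lambda>\<eta>. a \<eta> + (- 1) * (\<Sum>S\<in>F. c S * eps S \<eta>))"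
      using N1_delta[OF g d] by simp
    also have "\<dots> \<le> e/2"
      using t(2) F(3)[OF Bd_JH] by (intro supn_le) (simp add: eps_def)
    finally show ?thesis using x e by (intro bexI[of _ x]) auto
  qed
  show ?thesis using s e
  proof (induction arbitrary: e rule: PS_induct)
    case zero
    have "\<zero>\<^bsub>PS\<^esub> \<ominus>\<^bsub>PS\<^esub> ev \<zero>\<^bsub>FA\<^esub> = \<zero>\<^bsub>PS\<^esub>"
      using star_hom_zero[OF ev_star_hom star_algebra_free star_algebra_PS] by (simp add: PS.alg_zero_closed)
    moreover have "N1 \<zero>\<^bsub>PS\<^esub> = 0" by (simp add: N1_def supp_def PS_ops)
    ultimately show ?case using zero F.alg_zero_closed by (intro bexI[of _ "\<zero>\<^bsub>FA\<^esub>"]) auto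
  next
    case (add x a g)
    have "e/2 > 0" using add.prems by simp
    obtain y where y: "y \<in> carrier FA" "N1 (x \<ominus>\<^bsub>PS\<^esub> ev y) < e/2" using add.IH[OF \<open>e/2 > 0\<close>] by blast
    obtain z where z: "z \<in> carrier FA" "N1 (delta_section CB a g \<ominus>\<^bsub>PS\<^esub> ev z) < e/2"
      using delta[OF add.hyps(2,3) \<open>e/2 > 0\<close>] by blast
    note c = add.hyps(1) delta_closed[OF add.hyps(2,3)] evD(1)[OF y(1)] evD(1)[OF z(1)]
    have "N1 (x \<oplus>\<^bsub>PS\<^esub> delta_section CB a g \<ominus>\<^bsub>PS\<^esub> ev (y \<oplus>\<^bsub>FA\<^esub> z)) < e"
      using tri[of "x \<ominus>\<^bsub>PS\<^esub> ev y" "delta_section CB a g \<ominus>\<^bsub>PS\<^esub> ev z"] y z c by (simp add: evD PS.diff_add_swap)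
    then show ?case using y z by (intro bexI[of _ "y \<oplus>\<^bsub>FA\<^esub> z"]) (auto simp: F.alg_a_closed)
  qed
qed

end

section \<open>Families satisfying the relations\<close>

context star_algebra
begin

section \<open>Products of commuting idempotents and sums of partial isometries\<close>

lemma foldr_mult_closed:
  "[|\<And>a. a \<in> set l ==> d a \<in> carrier A; z \<in> carrier A|] ==> foldr (\<lambda>a y. d a \<otimes> y) l z \<in> carrier A"
  by (induction l) (auto intro: alg_m_closed)

lemma foldr_mult_right:
  assumes "\<And>a. a \<in> set l ==> d a \<in> carrier A" "z \<in> carrier A"
  shows "foldr (\<lambda>a y. d a \<otimes> y) l z = foldr (\<lambda>a y. d a \<otimes> y) l \<one> \<otimes> z"
  using assms
proof (induction l)
  case (Cons a l)
  then show ?case using foldr_mult_closed[of l d \<one>] by (simp add: alg_one_closed alg_m_assoc)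
qed (simp add: alg_l_one)

lemma foldr_mult_absorb:
  assumes "\<And>a. a \<in> set l ==> d a \<in> carrier A" "z \<in> carrier A"
    and comm: "\<And>a b. [|a \<in> set l; b \<in> set l|] ==> d a \<otimes> d b = d b \<otimes> d a"
    and idem: "\<And>a. a \<in> set l ==> d a \<otimes> d a = d a"
    and a: "a \<in> set l"
  shows "d a \<otimes> foldr (\<lambda>a y. d a \<otimes> y) l z = foldr (\<lambda>a y. d a \<otimes> y) l z"
  using assms
proof (induction l)
  case (Cons b l)
  let ?y = "foldr (\<lambda>a y. d a \<otimes> y) l z"
  have y: "?y \<in> carrier A" using Cons.prems by (intro foldr_mult_closed) auto
  have ab: "d a \<in> carrier A" "d b \<in> carrier A" using Cons.prems by auto
  show ?case
  proof (cases "a = b")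
    case True
    then show ?thesis using Cons.prems(4)[of b] y ab by (simp add: alg_m_assoc[symmetric])
  next
    case False
    then have "d a \<otimes> ?y = ?y" using Cons by auto
    moreover have "d a \<otimes> (d b \<otimes> ?y) = d b \<otimes> (d a \<otimes> ?y)"
      using Cons.prems(3)[of a b] Cons.prems(5) y ab by (simp add: alg_m_assoc[symmetric])
    ultimately show ?thesis by simp
  qed
qed simp

text \<open>The relations are imposed for lists of distinct words, whereas cutting several ideals
  down to X may yield the same word repeatedly; commuting idempotents absorb the
  repetitions.\<close>

lemma foldr_mult_remdups:
  assumes "\<And>a. a \<in> set l ==> d a \<in> carrier A" "z \<in> carrier A"
    and comm: "\<And>a b. [|a \<in> set l; b \<in> set l|] ==> d a \<otimes> d b = d b \<otimes> d a"
    and idem: "\<And>a. a \<in> set l ==> d a \<otimes> d a = d a"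
  shows "foldr (\<lambda>a y. d a \<otimes> y) (remdups l) z = foldr (\<lambda>a y. d a \<otimes> y) l z"
  using assms
proof (induction l)
  case (Cons b l)
  have IH: "foldr (\<lambda>a y. d a \<otimes> y) (remdups l) z = foldr (\<lambda>a y. d a \<otimes> y) l z"
    using Cons.prems by (intro Cons.IH) auto
  show ?case
  proof (cases "b \<in> set l")
    case True
    then show ?thesis using IH foldr_mult_absorb[of l d z b] Cons.prems by simp
  qed (simp add: IH)
qed simp

text \<open>Since \<open>u1\<close> and \<open>u2\<close> are fixed by the orthogonal self-adjoint
  elements \<open>q1\<close> and \<open>q2\<close>, all cross terms vanish. This glues solutions on
  two complementary pieces.\<close>

lemma partial_isometry_sum:
  assumes c: "q1 \<in> carrier A" "q2 \<in> carrier A" "u1 \<in> carrier A" "u2 \<in> carrier A"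
    and q: "star A q1 = q1" "star A q2 = q2" "q1 \<otimes> q2 = \<zero>"
    and u: "star A u1 \<otimes> u1 = q1" "star A u2 \<otimes> u2 = q2" "q1 \<otimes> u1 = u1" "q2 \<otimes> u2 = u2"
  shows "star A (u1 \<oplus> u2) \<otimes> (u1 \<oplus> u2) = q1 \<oplus> q2" "(q1 \<oplus> q2) \<otimes> (u1 \<oplus> u2) = u1 \<oplus> u2"
proof -
  have q21: "q2 \<otimes> q1 = \<zero>" using star_mult[OF c(1,2)] q by simp
  have "q1 \<otimes> u2 = (q1 \<otimes> q2) \<otimes> u2" "q2 \<otimes> u1 = (q2 \<otimes> q1) \<otimes> u1" using c u(3,4) by (simp_all add: alg_m_assoc)
  then have z: "q1 \<otimes> u2 = \<zero>" "q2 \<otimes> u1 = \<zero>" using c q q21 by (simp_all add: alg_l_null)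
  have "star A u1 = star A u1 \<otimes> q1" using star_mult[OF c(1,3)] u(3) q(1) by simp
  then have "star A u1 \<otimes> u2 = star A u1 \<otimes> (q1 \<otimes> u2)" using c by (metis alg_m_assoc star_closed)
  then have z1: "star A u1 \<otimes> u2 = \<zero>" using c z by (simp add: alg_r_null star_closed)
  have "star A u2 = star A u2 \<otimes> q2" using star_mult[OF c(2,4)] u(4) q(2) by simp
  then have "star A u2 \<otimes> u1 = star A u2 \<otimes> (q2 \<otimes> u1)" using c by (metis alg_m_assoc star_closed)
  then have z2: "star A u2 \<otimes> u1 = \<zero>" using c z by (simp add: alg_r_null star_closed)
  show "star A (u1 \<oplus> u2) \<otimes> (u1 \<oplus> u2) = q1 \<oplus> q2"
    using c u z1 z2 by (simp add: star_add alg_l_distr alg_r_distr star_closed alg_a_closed alg_l_zero alg_r_zero)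
  show "(q1 \<oplus> q2) \<otimes> (u1 \<oplus> u2) = u1 \<oplus> u2"
    using c u z by (simp add: alg_l_distr alg_r_distr alg_a_closed alg_l_zero alg_r_zero)
qed

lemma finsum_foldr:
  "[|distinct us; \<And>u. u \<in> set us ==> f u \<in> carrier A|] ==> finsum A f (set us) = foldr (\<lambda>u y. f u \<oplus> y) us \<zero>"
proof (induction us)
  case (Cons u us)
  then show ?case by (simp add: alg_finsum_insert)
qed simp

end

text \<open>For d different from 0, d is the midpoint of the chord of the unit circle through d
  perpendicular to its radius; s is half the length of this chord.\<close>

lemma complex_unit_average:
  assumes "cmod d \<le> 1"
  obtains a b where "d = (a + b) / 2" "cmod a = 1" "cmod b = 1"
proof (cases "d = 0")
  case True
  then show ?thesis using that[of 1 "-1"] by simp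
next
  case False
  define r s where "r = cmod d" and "s = sqrt (1 - (cmod d)\<^sup>2)"
  have rs: "r\<^sup>2 + s\<^sup>2 = 1" using assms by (simp add: r_def s_def abs_square_le_1)
  have m: "cmod (Complex r s) = 1" "cmod (Complex r (- s)) = 1" using rs by (simp_all add: cmod_def)
  have "sgn d * Complex r s + sgn d * Complex r (- s) = sgn d * of_real (2 * r)"
    by (simp add: complex_eq_iff algebra_simps)
  also have "\<dots> = 2 * d" using False by (simp add: r_def sgn_eq)
  finally have "d = (sgn d * Complex r s + sgn d * Complex r (- s)) / 2" by simp
  then show ?thesis using that False m by (simp add: norm_mult norm_sgn)
qed

context submonoid_of_group
begin

context
  fixes B :: "('b, 'm) cstar_alg_scheme" and w :: "'g => 'b"
  assumes B: "cstar_algebra B" and w: "w \<in> P \<rightarrow> carrier B" and fam: "foundation_family G P B w"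
begin

interpretation B: cstar_seminormed B "nrm B" by (rule cstar_algebra_seminormed[OF B])

abbreviation wval where "wval \<equiv> word_val B w"

lemma w_one: "w \<one> = \<one>\<^bsub>B\<^esub>"
  and E_cong: "[|\<alpha> \<in> NW; \<beta> \<in> NW; KK \<alpha> = KK \<beta>|] ==> wval \<alpha> = wval \<beta>"
  and E_foundation: "[|\<alpha> \<in> NW; distinct \<beta>s; set \<beta>s \<subseteq> NW; foundation_set G P (KK \<alpha>) (KK ` set \<beta>s)|] ==>
    diff_prod B w \<alpha> \<beta>s = \<zero>\<^bsub>B\<^esub>"
  using fam unfolding foundation_family_def T1_def T2_def T3_def foundation_relations_def by blast+

lemma w_closed: "p \<in> P ==> w p \<in> carrier B"
  using w by blast

lemma E_closed: "\<alpha> \<in> W ==> wval \<alpha> \<in> carrier B"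
  by (rule word_val_closed[OF B.star_algebra_axioms w])

lemma E_append: "[|\<alpha> \<in> W; \<beta> \<in> W|] ==> wval (\<alpha> @ \<beta>) = wval \<alpha> \<otimes>\<^bsub>B\<^esub> wval \<beta>"
  by (rule word_val_append[OF B.star_algebra_axioms w])

lemma E_rev: "\<alpha> \<in> W ==> wval (rev \<alpha>) = star B (wval \<alpha>)"
  by (rule word_val_rev[OF B.star_algebra_axioms w])

text \<open>By (T3) the value of the family does not depend on the choice, so \<open>idemp\<close>
  is a function of the ideal.\<close>

definition word_of :: "'g set => 'g list" where
  "word_of S = (SOME \<alpha>. \<alpha> \<in> NW \<and> KK \<alpha> = S)"

lemma word_of: "S \<in> J ==> word_of S \<in> NW \<and> KK (word_of S) = S"
proof -
  assume "S \<in> J"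
  then obtain \<alpha> where "\<alpha> \<in> NW \<and> KK \<alpha> = S" using J_neutral by metis
  then show ?thesis unfolding word_of_def by (rule someI)
qed

definition idemp :: "'g set => 'b" where "idemp S = wval (word_of S)"

lemma e_K: "\<alpha> \<in> NW ==> idemp (KK \<alpha>) = wval \<alpha>"
  unfolding idemp_def using word_of[of "KK \<alpha>"] by (intro E_cong) (auto simp: NW_W)

lemma e_closed: "S \<in> J ==> idemp S \<in> carrier B"
  unfolding idemp_def using word_of NW_W by (intro E_closed) blast

text \<open>Concatenation of neutral words intersects their ideals. Together with invariance under
  reversal this makes the diagonal values commuting projections.\<close>

lemma e_Int: "[|R \<in> J; S \<in> J|] ==> idemp (R \<inter> S) = idemp R \<otimes>\<^bsub>B\<^esub> idemp S"
proof -
  assume R: "R \<in> J" and S: "S \<in> J"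
  let ?a = "word_of R" and ?b = "word_of S"
  have a: "?a \<in> NW" "KK ?a = R" and b: "?b \<in> NW" "KK ?b = S" using word_of R S by auto
  have "KK (?a @ ?b) = R \<inter> S" using K_append_neutral[of ?a ?b] a b NW_W by simp
  then have "idemp (R \<inter> S) = wval (?a @ ?b)" using e_K[OF NW_append[OF a(1) b(1)]] by simp
  then show ?thesis using E_append[of ?a ?b] a b NW_W by (simp add: idemp_def)
qed

lemma e_star: "S \<in> J ==> star B (idemp S) = idemp S"
proof -
  assume S: "S \<in> J"
  let ?a = "word_of S"
  have a: "?a \<in> NW" "KK ?a = S" using word_of S by auto
  have "idemp S = wval (rev ?a)" using e_K[OF NW_rev[OF a(1)]] K_rev_neutral[OF a(1)] a(2) by simp
  then show ?thesis using E_rev[of ?a] a NW_W by (simp add: idemp_def B.star_star E_closed)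
qed

lemma e_P: "idemp P = \<one>\<^bsub>B\<^esub>"
  using e_K[of "[]"] by (simp add: NW_iff)

lemma e_comm: "[|R \<in> J; S \<in> J|] ==> idemp R \<otimes>\<^bsub>B\<^esub> idemp S = idemp S \<otimes>\<^bsub>B\<^esub> idemp R"
  using e_Int by (metis Int_commute)

lemma e_idem: "S \<in> J ==> idemp S \<otimes>\<^bsub>B\<^esub> idemp S = idemp S"
  using e_Int[of S S] by simp

lemma e_diff_mult:
  assumes "X \<in> J" "R \<in> J" "S \<in> J" "R \<subseteq> X" "S \<subseteq> X"
  shows "(idemp X \<ominus>\<^bsub>B\<^esub> idemp R) \<otimes>\<^bsub>B\<^esub> (idemp X \<ominus>\<^bsub>B\<^esub> idemp S) = idemp X \<oplus>\<^bsub>B\<^esub> (\<ominus>\<^bsub>B\<^esub> idemp R \<oplus>\<^bsub>B\<^esub> (\<ominus>\<^bsub>B\<^esub> idemp S \<oplus>\<^bsub>B\<^esub> idemp (R \<inter> S)))"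
proof -
  have "X \<inter> S = S" "R \<inter> X = R" using assms by auto
  then have "idemp X \<otimes>\<^bsub>B\<^esub> idemp S = idemp S" "idemp R \<otimes>\<^bsub>B\<^esub> idemp X = idemp R" using e_Int assms by metis+
  then show ?thesis
    using assms e_closed
    by (simp add: B.alg_minus_eq B.alg_l_distr B.alg_r_distr B.alg_l_minus B.alg_r_minus B.alg_a_ac
        B.alg_a_inv_closed B.alg_a_closed B.alg_m_closed e_idem e_Int B.alg_minus_minus B.alg_minus_add)
qed

lemma e_diff_comm:
  assumes "X \<in> J" "R \<in> J" "S \<in> J" "R \<subseteq> X" "S \<subseteq> X"
  shows "(idemp X \<ominus>\<^bsub>B\<^esub> idemp R) \<otimes>\<^bsub>B\<^esub> (idemp X \<ominus>\<^bsub>B\<^esub> idemp S) = (idemp X \<ominus>\<^bsub>B\<^esub> idemp S) \<otimes>\<^bsub>B\<^esub> (idemp X \<ominus>\<^bsub>B\<^esub> idemp R)"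
proof -
  have "R \<inter> S \<in> J" using assms by auto
  then show ?thesis
    unfolding e_diff_mult[OF assms] e_diff_mult[OF assms(1,3,2,5,4)] Int_commute[of S R]
    using assms e_closed by (simp add: B.alg_a_ac B.alg_a_inv_closed B.alg_a_closed)
qed

lemma e_diff_idem:
  assumes "X \<in> J" "R \<in> J" "R \<subseteq> X"
  shows "(idemp X \<ominus>\<^bsub>B\<^esub> idemp R) \<otimes>\<^bsub>B\<^esub> (idemp X \<ominus>\<^bsub>B\<^esub> idemp R) = idemp X \<ominus>\<^bsub>B\<^esub> idemp R"
  unfolding e_diff_mult[OF assms(1,2,2,3,3)]
  using assms e_closed by (simp add: B.alg_l_neg B.alg_r_zero B.alg_a_inv_closed B.alg_minus_eq)

text \<open>The projection that stands for the points of X outside all members of \<open>Rs\<close>.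
  Each R is cut down to X, since the members of a foundation set for X are contained in X.\<close>

definition atom :: "'g set => 'g set list => 'b" where
  "atom X Rs = foldr (\<lambda>R y. (idemp X \<ominus>\<^bsub>B\<^esub> idemp (R \<inter> X)) \<otimes>\<^bsub>B\<^esub> y) Rs (idemp X)"

lemma atom_simps [simp]:
  "atom X [] = idemp X" "atom X (R # Rs) = (idemp X \<ominus>\<^bsub>B\<^esub> idemp (R \<inter> X)) \<otimes>\<^bsub>B\<^esub> atom X Rs"
  by (simp_all add: atom_def)

lemma atom_closed: "[|X \<in> J; set Rs \<subseteq> J|] ==> atom X Rs \<in> carrier B"
  unfolding atom_def by (rule B.foldr_mult_closed) (auto intro!: B.diff_closed e_closed J_Int)

text \<open>The relation for the foundation set, after removal of repeated words. For an empty list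
  X is empty, and the convention on empty products says that its projection is zero.\<close>

lemma atom_zero:
  assumes X: "X \<in> J" and Rs: "set Rs \<subseteq> J" and F: "foundation_set G P X ((\<lambda>R. R \<inter> X) ` set Rs)"
  shows "atom X Rs = \<zero>\<^bsub>B\<^esub>"
proof -
  let ?ws = "map (\<lambda>R. word_of (R \<inter> X)) Rs"
  define d where "d \<alpha> = idemp X \<ominus>\<^bsub>B\<^esub> wval \<alpha>" for \<alpha>
  have RX: "R \<inter> X \<in> J" if "R \<in> set Rs" for R using that Rs X by auto
  have ws: "\<alpha> \<in> NW \<and> KK \<alpha> \<subseteq> X \<and> KK \<alpha> \<in> J" if "\<alpha> \<in> set ?ws" for \<alpha>
    using that word_of[OF RX] RX by auto
  have d_eq: "d \<alpha> = idemp X \<ominus>\<^bsub>B\<^esub> idemp (KK \<alpha>)" if "\<alpha> \<in> set ?ws" for \<alpha>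
    using ws[OF that] e_K[of \<alpha>] by (simp add: d_def)
  have dc: "d \<alpha> \<in> carrier B" if "\<alpha> \<in> set ?ws" for \<alpha>
    using d_eq[OF that] ws[OF that] X e_closed by simp
  have comm: "d \<alpha> \<otimes>\<^bsub>B\<^esub> d \<beta> = d \<beta> \<otimes>\<^bsub>B\<^esub> d \<alpha>" if "\<alpha> \<in> set ?ws" "\<beta> \<in> set ?ws" for \<alpha> \<beta>
    using d_eq that ws e_diff_comm[OF X, of "KK \<alpha>" "KK \<beta>"] by metis
  have idem: "d \<alpha> \<otimes>\<^bsub>B\<^esub> d \<alpha> = d \<alpha>" if "\<alpha> \<in> set ?ws" for \<alpha>
    using d_eq that ws e_diff_idem[OF X, of "KK \<alpha>"] by metis
  have "atom X Rs = foldr (\<lambda>\<alpha> y. d \<alpha> \<otimes>\<^bsub>B\<^esub> y) ?ws (idemp X)"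
  proof -
    have "idemp (R \<inter> X) = wval (word_of (R \<inter> X))" for R by (simp add: idemp_def)
    then show ?thesis by (simp add: atom_def d_def foldr_map o_def)
  qed
  also have "\<dots> = foldr (\<lambda>\<alpha> y. d \<alpha> \<otimes>\<^bsub>B\<^esub> y) (remdups ?ws) (idemp X)"
    by (rule B.foldr_mult_remdups[symmetric]) (use dc comm idem e_closed[OF X] in auto)
  also have "\<dots> = \<zero>\<^bsub>B\<^esub>"
  proof -
    have wX: "word_of X \<in> NW" "KK (word_of X) = X" using word_of[OF X] by auto
    have "KK ` set ?ws = (\<lambda>R. R \<inter> X) ` set Rs" using word_of[OF RX] by (simp add: image_image)
    then have 0: "diff_prod B w (word_of X) (remdups ?ws) = \<zero>\<^bsub>B\<^esub>"
      using F wX ws by (intro E_foundation) auto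
    show ?thesis
    proof (cases "Rs = []")
      case True
      then show ?thesis using 0 by (simp add: diff_prod_def idemp_def)
    next
      case False
      then have "remdups ?ws \<noteq> []" by simp
      then have "foldr (\<lambda>\<alpha> y. d \<alpha> \<otimes>\<^bsub>B\<^esub> y) (remdups ?ws) \<one>\<^bsub>B\<^esub> = \<zero>\<^bsub>B\<^esub>"
        using 0 unfolding diff_prod_def d_def idemp_def by (simp only: if_False)
      then show ?thesis
        using B.foldr_mult_right[of "remdups ?ws" d "idemp X"] dc e_closed[OF X] by (simp add: B.alg_l_null)
    qed
  qed
  finally show ?thesis .
qed

lemma e_diff_e:
  assumes "X \<in> J" "R \<in> J" "S \<in> J"
  shows "(idemp X \<ominus>\<^bsub>B\<^esub> idemp R) \<otimes>\<^bsub>B\<^esub> idemp S = idemp S \<otimes>\<^bsub>B\<^esub> (idemp X \<ominus>\<^bsub>B\<^esub> idemp R)"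
  using assms e_closed e_comm
  by (simp add: B.alg_minus_eq B.alg_l_distr B.alg_r_distr B.alg_l_minus B.alg_r_minus B.alg_a_inv_closed)

lemma atom_comm: "[|X \<in> J; set Rs \<subseteq> J; S \<in> J|] ==> idemp S \<otimes>\<^bsub>B\<^esub> atom X Rs = atom X Rs \<otimes>\<^bsub>B\<^esub> idemp S"
proof (induction Rs)
  case (Cons R Rs)
  let ?d = "idemp X \<ominus>\<^bsub>B\<^esub> idemp (R \<inter> X)"
  have RX: "R \<inter> X \<in> J" using Cons by auto
  have c: "?d \<in> carrier B" "idemp S \<in> carrier B" "atom X Rs \<in> carrier B"
    using Cons RX by (auto intro!: B.diff_closed e_closed atom_closed)
  have "idemp S \<otimes>\<^bsub>B\<^esub> (?d \<otimes>\<^bsub>B\<^esub> atom X Rs) = ?d \<otimes>\<^bsub>B\<^esub> (idemp S \<otimes>\<^bsub>B\<^esub> atom X Rs)"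
    using e_diff_e[OF Cons.prems(1) RX Cons.prems(3)] c by (simp add: B.alg_m_assoc[symmetric])
  then show ?case using Cons c by (simp add: B.alg_m_assoc)
qed (simp add: e_comm)

lemma atom_absorb: "[|X \<in> J; set Rs \<subseteq> J|] ==> idemp X \<otimes>\<^bsub>B\<^esub> atom X Rs = atom X Rs"
proof (induction Rs)
  case (Cons R Rs)
  let ?d = "idemp X \<ominus>\<^bsub>B\<^esub> idemp (R \<inter> X)"
  have RX: "R \<inter> X \<in> J" using Cons by auto
  have c: "?d \<in> carrier B" "idemp X \<in> carrier B" "atom X Rs \<in> carrier B"
    using Cons RX by (auto intro!: B.diff_closed e_closed atom_closed)
  have "idemp X \<otimes>\<^bsub>B\<^esub> (?d \<otimes>\<^bsub>B\<^esub> atom X Rs) = ?d \<otimes>\<^bsub>B\<^esub> (idemp X \<otimes>\<^bsub>B\<^esub> atom X Rs)"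
    using e_diff_e[OF Cons.prems(1) RX Cons.prems(1)] c by (simp add: B.alg_m_assoc[symmetric])
  then show ?case using Cons by simp
qed (simp add: e_idem)

lemma atom_Cons:
  assumes "X \<in> J" "set Rs \<subseteq> J" "S \<in> J"
  shows "atom X (S # Rs) = atom X Rs \<ominus>\<^bsub>B\<^esub> atom X Rs \<otimes>\<^bsub>B\<^esub> idemp S"
proof -
  have c: "idemp X \<in> carrier B" "idemp S \<in> carrier B" "atom X Rs \<in> carrier B"
    using assms by (auto intro!: e_closed atom_closed)
  have "idemp (S \<inter> X) \<otimes>\<^bsub>B\<^esub> atom X Rs = atom X Rs \<otimes>\<^bsub>B\<^esub> idemp S"
    using e_Int[OF assms(3,1)] atom_absorb[OF assms(1,2)] atom_comm[OF assms] c by (simp add: B.alg_m_assoc)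
  then show ?thesis
    using atom_absorb[OF assms(1,2)] c assms e_closed[OF J_Int[OF assms(3,1)]]
    by (simp add: B.alg_minus_eq B.alg_l_distr B.alg_l_minus B.alg_a_inv_closed)
qed

text \<open>Together with \<open>atom_Cons\<close> this splits an atom along S into the part inside
  S and the part outside.\<close>

lemma atom_Int:
  "[|X \<in> J; set Rs \<subseteq> J; S \<in> J|] ==> atom (X \<inter> S) Rs = atom X Rs \<otimes>\<^bsub>B\<^esub> idemp S"
proof (induction Rs)
  case (Cons R Rs)
  let ?q = "atom X Rs"
  have XS: "X \<inter> S \<in> J" using Cons by auto
  have c: "idemp R \<in> carrier B" "idemp S \<in> carrier B" "?q \<in> carrier B"
    using Cons by (auto intro!: e_closed atom_closed)
  have IH: "atom (X \<inter> S) Rs = ?q \<otimes>\<^bsub>B\<^esub> idemp S" using Cons by simp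
  have "atom (X \<inter> S) (R # Rs) = ?q \<otimes>\<^bsub>B\<^esub> idemp S \<ominus>\<^bsub>B\<^esub> (?q \<otimes>\<^bsub>B\<^esub> idemp S) \<otimes>\<^bsub>B\<^esub> idemp R"
    using atom_Cons[OF XS, of Rs R] Cons.prems IH by simp
  also have "(?q \<otimes>\<^bsub>B\<^esub> idemp S) \<otimes>\<^bsub>B\<^esub> idemp R = (?q \<otimes>\<^bsub>B\<^esub> idemp R) \<otimes>\<^bsub>B\<^esub> idemp S"
    using c e_comm[of S R] Cons.prems by (simp add: B.alg_m_assoc)
  also have "?q \<otimes>\<^bsub>B\<^esub> idemp S \<ominus>\<^bsub>B\<^esub> (?q \<otimes>\<^bsub>B\<^esub> idemp R) \<otimes>\<^bsub>B\<^esub> idemp S = (?q \<ominus>\<^bsub>B\<^esub> ?q \<otimes>\<^bsub>B\<^esub> idemp R) \<otimes>\<^bsub>B\<^esub> idemp S"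
    using c by (simp add: B.alg_minus_eq B.alg_l_distr B.alg_l_minus B.alg_a_inv_closed B.alg_m_closed)
  also have "\<dots> = atom X (R # Rs) \<otimes>\<^bsub>B\<^esub> idemp S" using atom_Cons[of X Rs R] Cons.prems by simp
  finally show ?case .
qed (simp add: e_Int)

lemma atom_star: "[|X \<in> J; set Rs \<subseteq> J|] ==> star B (atom X Rs) = atom X Rs"
proof (induction Rs)
  case (Cons R Rs)
  have R: "R \<in> J" "set Rs \<subseteq> J" using Cons.prems by auto
  have c: "idemp R \<in> carrier B" "atom X Rs \<in> carrier B" using Cons.prems R by (auto intro!: e_closed atom_closed)
  have "star B (atom X Rs \<ominus>\<^bsub>B\<^esub> atom X Rs \<otimes>\<^bsub>B\<^esub> idemp R) = atom X Rs \<ominus>\<^bsub>B\<^esub> atom X Rs \<otimes>\<^bsub>B\<^esub> idemp R"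
    using Cons c R atom_comm[OF Cons.prems(1) R(2,1)]
    by (simp add: B.star_diff B.star_mult e_star B.alg_m_closed)
  then show ?case using atom_Cons[OF Cons.prems(1) R(2,1)] by (simp del: atom_simps)
qed (simp add: e_star)

section \<open>Norms of combinations of diagonal projections\<close>

definition lin :: "(complex \<times> 'g set) list => 'b" where
  "lin cs = foldr (\<lambda>(c, S) y. c \<odot>\<^bsub>B\<^esub> idemp S \<oplus>\<^bsub>B\<^esub> y) cs \<zero>\<^bsub>B\<^esub>"

definition lin_val :: "(complex \<times> 'g set) list => ('g set => nat) => complex" where
  "lin_val cs \<xi> = (\<Sum>(c, S)\<leftarrow>cs. c * of_nat (\<xi> S))"

lemma lin_closed: "snd ` set cs \<subseteq> J ==> lin cs \<in> carrier B"
  by (induction cs) (auto simp: lin_def B.alg_zero_closed intro!: B.alg_a_closed e_closed)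

text \<open>Cutting with \<open>idemp S\<close> and its complement for one term after the other reduces to atoms on which the
  sum acts as a scalar, a mean of two scalars of modulus 1; an atom without a point of the boundary is
  zero by the relations.\<close>

lemma lin_unitary_average:
  assumes "X \<in> J" "set Rs \<subseteq> J" "snd ` set cs \<subseteq> J"
    "\<And>\<xi>. [|\<xi> \<in> Bd; \<xi> X = 1; \<forall>R\<in>set Rs. \<xi> R \<noteq> 1|] ==> cmod (d + lin_val cs \<xi>) \<le> 1"
  shows "\<exists>u\<in>carrier B. \<exists>v\<in>carrier B. star B u \<otimes>\<^bsub>B\<^esub> u = atom X Rs \<and> star B v \<otimes>\<^bsub>B\<^esub> v = atom X Rs \<and>
    atom X Rs \<otimes>\<^bsub>B\<^esub> u = u \<and> atom X Rs \<otimes>\<^bsub>B\<^esub> v = v \<and>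
    (d \<odot>\<^bsub>B\<^esub> \<one>\<^bsub>B\<^esub> \<oplus>\<^bsub>B\<^esub> lin cs) \<otimes>\<^bsub>B\<^esub> atom X Rs = (1/2) \<odot>\<^bsub>B\<^esub> (u \<oplus>\<^bsub>B\<^esub> v)"
  using assms
proof (induction cs arbitrary: X Rs d)
  case Nil
  \<comment> \<open>No term is left, so the sum acts on the atom as the scalar d.\<close>
  let ?q = "atom X Rs"
  have qc: "?q \<in> carrier B" using Nil by (intro atom_closed)
  have qq: "?q \<otimes>\<^bsub>B\<^esub> ?q = ?q"
    using Nil.prems(2)
  proof (induction Rs)
    case Nil then show ?case using e_idem[OF \<open>X \<in> J\<close>] by simp
  next
    case (Cons R Rs)
    have R: "R \<in> J" "set Rs \<subseteq> J" using Cons by auto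
    let ?p = "atom X Rs"
    have c: "idemp R \<in> carrier B" "?p \<in> carrier B" using \<open>X \<in> J\<close> R by (auto intro!: e_closed atom_closed)
    have pe: "?p \<otimes>\<^bsub>B\<^esub> (?p \<otimes>\<^bsub>B\<^esub> idemp R) = ?p \<otimes>\<^bsub>B\<^esub> idemp R" using Cons c by (simp add: B.alg_m_assoc[symmetric])
    have ep: "?p \<otimes>\<^bsub>B\<^esub> idemp R \<otimes>\<^bsub>B\<^esub> ?p = ?p \<otimes>\<^bsub>B\<^esub> idemp R"
      using pe atom_comm[OF \<open>X \<in> J\<close> R(2,1)] c by (simp add: B.alg_m_assoc)
    have epe: "?p \<otimes>\<^bsub>B\<^esub> idemp R \<otimes>\<^bsub>B\<^esub> (?p \<otimes>\<^bsub>B\<^esub> idemp R) = ?p \<otimes>\<^bsub>B\<^esub> idemp R"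
    proof -
      have "?p \<otimes>\<^bsub>B\<^esub> idemp R \<otimes>\<^bsub>B\<^esub> (?p \<otimes>\<^bsub>B\<^esub> idemp R) = (?p \<otimes>\<^bsub>B\<^esub> idemp R \<otimes>\<^bsub>B\<^esub> ?p) \<otimes>\<^bsub>B\<^esub> idemp R"
        using c by (simp add: B.alg_m_assoc B.alg_m_closed)
      also have "\<dots> = ?p \<otimes>\<^bsub>B\<^esub> (idemp R \<otimes>\<^bsub>B\<^esub> idemp R)" unfolding ep using c by (simp add: B.alg_m_assoc)
      finally show ?thesis using e_idem[OF R(1)] by simp
    qed
    have "(?p \<ominus>\<^bsub>B\<^esub> ?p \<otimes>\<^bsub>B\<^esub> idemp R) \<otimes>\<^bsub>B\<^esub> (?p \<ominus>\<^bsub>B\<^esub> ?p \<otimes>\<^bsub>B\<^esub> idemp R) = ?p \<ominus>\<^bsub>B\<^esub> ?p \<otimes>\<^bsub>B\<^esub> idemp R"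
      using Cons.IH[OF R(2)] c pe ep epe
      by (simp add: B.alg_minus_eq B.alg_l_distr B.alg_r_distr B.alg_l_minus B.alg_r_minus
          B.alg_a_inv_closed B.alg_m_closed B.alg_a_closed B.alg_r_neg B.alg_minus_minus B.alg_a_assoc B.alg_l_neg B.alg_r_zero)
    then show ?case using atom_Cons[OF \<open>X \<in> J\<close> R(2,1)] by (simp del: atom_simps)
  qed
  show ?case
  proof (cases "\<exists>\<xi>\<in>Bd. \<xi> X = 1 \<and> (\<forall>R\<in>set Rs. \<xi> R \<noteq> 1)")
    case True
    then have "cmod d \<le> 1" using Nil.prems(4) by (auto simp: lin_val_def)
    then obtain a b where ab: "d = (a + b) / 2" "cmod a = 1" "cmod b = 1" by (rule complex_unit_average)
    have "cnj a * a = 1" "cnj b * b = 1"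
      using ab complex_norm_square[of a] complex_norm_square[of b] by (simp_all add: mult.commute)
    note ab' = this
    show ?thesis
      by (rule bexI[of _ "a \<odot>\<^bsub>B\<^esub> ?q"], rule bexI[of _ "b \<odot>\<^bsub>B\<^esub> ?q"])
        (use ab' qc qq atom_star[OF Nil.prems(1,2)] ab(1)[symmetric] in \<open>simp_all add: B.star_smult B.smult_mult_left
          B.smult_mult_right B.smult_assoc[symmetric] lin_def B.alg_r_zero B.alg_one_closed B.alg_l_one
          B.smult_l_distr'[symmetric] algebra_simps\<close>)
  next
    case False
    \<comment> \<open>Suppose the atom has no boundary point. For p in X a maximal character above
      pP has value 1 at X, hence at some R; therefore pP meets R.\<close>
    have "foundation_set G P X ((\<lambda>R. R \<inter> X) ` set Rs)"
      unfolding foundation_set_Int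
    proof (intro conjI ballI)
      fix p assume p: "p \<in> X"
      have pP: "p \<in> P" using p J_subset[OF Nil.prems(1)] by blast
      obtain \<xi> where \<xi>: "\<xi> \<in> MX" "\<xi> (p <# P) = 1" using maximal_above_principal[OF pP] by blast
      note b = MX_Bd[OF \<xi>(1)]
      have "\<xi> X = 1" using JH_mono[OF Bd_JH[OF b] \<xi>(2) principal_subset[OF Nil.prems(1) p] Nil.prems(1)] .
      then obtain R where R: "R \<in> set Rs" "\<xi> R = 1" using False b by blast
      then have "\<xi> ((p <# P) \<inter> R) = 1"
        using JH_Int_iff[OF Bd_JH[OF b], of "p <# P" R] \<xi>(2) JH_one_J[OF Bd_JH[OF b]] by blast
      then have "(p <# P) \<inter> R \<noteq> {}" using JH_empty[OF Bd_JH[OF b]] by metis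
      moreover have "p <# P \<subseteq> X" by (rule principal_subset[OF Nil.prems(1) p])
      ultimately have "(p <# P) \<inter> (R \<inter> X) \<noteq> {}" by (metis inf.absorb_iff1 inf.assoc inf.commute)
      then show "\<exists>R\<in>(\<lambda>R. R \<inter> X) ` set Rs. (p <# P) \<inter> R \<noteq> {}"
        using imageI[OF R(1), of "\<lambda>R. R \<inter> X"] by (rule bexI)
    qed (use Nil.prems in auto)
    then have "?q = \<zero>\<^bsub>B\<^esub>" by (rule atom_zero[OF Nil.prems(1,2)])
    then show ?thesis
      by (intro bexI[of _ "\<zero>\<^bsub>B\<^esub>"] conjI)
        (simp_all add: B.alg_zero_closed B.alg_r_null B.alg_l_zero lin_def B.alg_r_zero B.alg_one_closed)
  qed
next
  case (Cons cS cs)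
  obtain c S where cS: "cS = (c, S)" by force
  have S: "S \<in> J" and cs: "snd ` set cs \<subseteq> J" using Cons.prems cS by auto
  note X = Cons.prems(1) and Rs = Cons.prems(2)
  let ?q = "atom X Rs" and ?q1 = "atom (X \<inter> S) Rs" and ?q2 = "atom X (S # Rs)"
  have XS: "X \<inter> S \<in> J" using X S by auto
  have SRs: "set (S # Rs) \<subseteq> J" using S Rs by simp
  have q1: "?q1 = ?q \<otimes>\<^bsub>B\<^esub> idemp S" by (rule atom_Int[OF X Rs S])
  have q2: "?q2 = ?q \<ominus>\<^bsub>B\<^esub> ?q1" using atom_Cons[OF X Rs S] q1 by simp
  have c_: "?q \<in> carrier B" "?q1 \<in> carrier B" "?q2 \<in> carrier B" "idemp S \<in> carrier B" "lin cs \<in> carrier B"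
    using X Rs S XS SRs cs by (auto intro!: atom_closed e_closed lin_closed simp del: atom_simps)
  have q12: "?q1 \<oplus>\<^bsub>B\<^esub> ?q2 = ?q"
    using c_ unfolding q2 by (simp add: B.alg_minus_eq B.alg_a_ac B.alg_r_neg1 B.alg_r_neg B.alg_a_inv_closed B.alg_r_zero
        B.alg_r_neg2 del: atom_simps)
  \<comment> \<open>Inside S the current term adds its coefficient c to the scalar; outside S it
    contributes nothing, and d is kept.\<close>
  have v1: "cmod (d + c + lin_val cs \<xi>) \<le> 1" if \<xi>: "\<xi> \<in> Bd" "\<xi> (X \<inter> S) = 1" "\<forall>R\<in>set Rs. \<xi> R \<noteq> 1" for \<xi>
  proof -
    have "\<xi> X = 1" "\<xi> S = 1" using JH_Int_iff[OF Bd_JH[OF \<xi>(1)] X S] \<xi>(2) by auto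
    then show ?thesis using Cons.prems(4)[OF \<xi>(1) _ \<xi>(3)] cS by (simp add: lin_val_def add.assoc)
  qed
  have v2: "cmod (d + lin_val cs \<xi>) \<le> 1" if \<xi>: "\<xi> \<in> Bd" "\<xi> X = 1" "\<forall>R\<in>set (S # Rs). \<xi> R \<noteq> 1" for \<xi>
  proof -
    have "\<xi> S = 0" using JH_cases[OF Bd_JH[OF \<xi>(1)], of S] \<xi>(3) by simp
    then show ?thesis using Cons.prems(4)[OF \<xi>(1,2)] \<xi>(3) cS by (simp add: lin_val_def)
  qed
  obtain u1 v1 where u1: "u1 \<in> carrier B" "v1 \<in> carrier B" "star B u1 \<otimes>\<^bsub>B\<^esub> u1 = ?q1" "star B v1 \<otimes>\<^bsub>B\<^esub> v1 = ?q1"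
    "?q1 \<otimes>\<^bsub>B\<^esub> u1 = u1" "?q1 \<otimes>\<^bsub>B\<^esub> v1 = v1"
    "((d + c) \<odot>\<^bsub>B\<^esub> \<one>\<^bsub>B\<^esub> \<oplus>\<^bsub>B\<^esub> lin cs) \<otimes>\<^bsub>B\<^esub> ?q1 = (1/2) \<odot>\<^bsub>B\<^esub> (u1 \<oplus>\<^bsub>B\<^esub> v1)"
    using Cons.IH[OF XS Rs cs v1] by blast
  obtain u2 v2 where u2: "u2 \<in> carrier B" "v2 \<in> carrier B" "star B u2 \<otimes>\<^bsub>B\<^esub> u2 = ?q2" "star B v2 \<otimes>\<^bsub>B\<^esub> v2 = ?q2"
    "?q2 \<otimes>\<^bsub>B\<^esub> u2 = u2" "?q2 \<otimes>\<^bsub>B\<^esub> v2 = v2"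
    "(d \<odot>\<^bsub>B\<^esub> \<one>\<^bsub>B\<^esub> \<oplus>\<^bsub>B\<^esub> lin cs) \<otimes>\<^bsub>B\<^esub> ?q2 = (1/2) \<odot>\<^bsub>B\<^esub> (u2 \<oplus>\<^bsub>B\<^esub> v2)"
    using Cons.IH[OF X SRs cs v2] by blast
  have eq1: "idemp S \<otimes>\<^bsub>B\<^esub> ?q1 = ?q1"
    unfolding q1 using atom_comm[OF X Rs S] c_ e_idem[OF S] by (simp add: B.alg_m_assoc[symmetric]) (simp add: B.alg_m_assoc)
  have eq2: "idemp S \<otimes>\<^bsub>B\<^esub> ?q2 = \<zero>\<^bsub>B\<^esub>"
    unfolding q2 using atom_comm[OF X Rs S] eq1 c_ q1
    by (simp add: B.alg_minus_eq B.alg_r_distr B.alg_r_minus B.alg_a_inv_closed B.alg_r_neg del: atom_simps)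
  have q1q2: "?q1 \<otimes>\<^bsub>B\<^esub> ?q2 = \<zero>\<^bsub>B\<^esub>"
    using eq2 c_ unfolding q1 by (simp add: B.alg_m_assoc B.alg_r_null del: atom_simps)
  note s12 = atom_star[OF XS Rs] atom_star[OF X SRs]
  note PU = B.partial_isometry_sum[OF c_(2,3) u1(1) u2(1) s12 q1q2 u1(3) u2(3) u1(5) u2(5), unfolded q12]
  note PV = B.partial_isometry_sum[OF c_(2,3) u1(2) u2(2) s12 q1q2 u1(4) u2(4) u1(6) u2(6), unfolded q12]
  let ?L = "d \<odot>\<^bsub>B\<^esub> \<one>\<^bsub>B\<^esub> \<oplus>\<^bsub>B\<^esub> lin (cS # cs)"
  have lin: "lin (cS # cs) = c \<odot>\<^bsub>B\<^esub> idemp S \<oplus>\<^bsub>B\<^esub> lin cs" by (simp add: lin_def cS)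
  have one: "\<one>\<^bsub>B\<^esub> \<in> carrier B" by (rule B.alg_one_closed)
  have L1: "?L \<otimes>\<^bsub>B\<^esub> ?q1 = (1/2) \<odot>\<^bsub>B\<^esub> (u1 \<oplus>\<^bsub>B\<^esub> v1)"
    unfolding lin using c_ one eq1 u1(7)
    by (simp add: B.alg_l_distr B.alg_a_closed B.smult_mult_left B.alg_l_one B.smult_l_distr' B.alg_a_assoc B.alg_m_closed
        del: atom_simps)
  have L2: "?L \<otimes>\<^bsub>B\<^esub> ?q2 = (1/2) \<odot>\<^bsub>B\<^esub> (u2 \<oplus>\<^bsub>B\<^esub> v2)"
    unfolding lin using c_ one eq2 u2(7)
    by (simp add: B.alg_l_distr B.alg_a_closed B.smult_mult_left B.alg_l_one B.alg_l_zero B.alg_m_closed del: atom_simps)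
  have Lc: "?L \<in> carrier B" unfolding lin using c_ one by (intro B.alg_a_closed B.smult_closed')
  have "?L \<otimes>\<^bsub>B\<^esub> ?q = ?L \<otimes>\<^bsub>B\<^esub> ?q1 \<oplus>\<^bsub>B\<^esub> ?L \<otimes>\<^bsub>B\<^esub> ?q2"
    using B.alg_r_distr[OF c_(2,3) Lc] q12 by simp
  also have "\<dots> = (1/2) \<odot>\<^bsub>B\<^esub> ((u1 \<oplus>\<^bsub>B\<^esub> u2) \<oplus>\<^bsub>B\<^esub> (v1 \<oplus>\<^bsub>B\<^esub> v2))"
    unfolding L1 L2 using u1(1,2) u2(1,2) by (simp add: B.smult_r_distr' B.alg_a_closed B.alg_a_ac)
  finally have "?L \<otimes>\<^bsub>B\<^esub> ?q = (1/2) \<odot>\<^bsub>B\<^esub> ((u1 \<oplus>\<^bsub>B\<^esub> u2) \<oplus>\<^bsub>B\<^esub> (v1 \<oplus>\<^bsub>B\<^esub> v2))" .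
  then show ?case
    using PU PV u1(1,2) u2(1,2)
    by (intro bexI[of _ "u1 \<oplus>\<^bsub>B\<^esub> u2"] bexI[of _ "v1 \<oplus>\<^bsub>B\<^esub> v2"] conjI) (auto intro!: B.alg_a_closed)
qed

text \<open>The atom of P without further cuts is the unit, so the combination is a mean of two
  isometries.\<close>

lemma lin_norm_le:
  assumes cs: "snd ` set cs \<subseteq> J" and b: "\<And>\<xi>. \<xi> \<in> Bd ==> cmod (lin_val cs \<xi>) \<le> 1"
  shows "nrm B (lin cs) \<le> 1"
proof -
  have lc: "lin cs \<in> carrier B" by (rule lin_closed[OF cs])
  obtain u v where uv: "u \<in> carrier B" "v \<in> carrier B" "star B u \<otimes>\<^bsub>B\<^esub> u = \<one>\<^bsub>B\<^esub>" "star B v \<otimes>\<^bsub>B\<^esub> v = \<one>\<^bsub>B\<^esub>"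
    "lin cs = (1/2) \<odot>\<^bsub>B\<^esub> (u \<oplus>\<^bsub>B\<^esub> v)"
    using lin_unitary_average[OF P_J, of "[]" cs 0] cs b lc
    by (auto simp: e_P B.alg_one_closed B.alg_l_zero B.alg_r_one)
  have "nrm B u \<le> 1" "nrm B v \<le> 1" using B.p_isometry_le uv B.p_one_le by auto
  then show ?thesis
    using B.p_triangle[OF uv(1,2)] B.p_smult[of "u \<oplus>\<^bsub>B\<^esub> v" "1/2"] uv by (simp add: B.alg_a_closed)
qed

section \<open>From the diagonal estimate to the l1-norm\<close>

lemma letters_val_E: "fst ` set u \<subseteq> P ==> letters_val B w u = wval (alternate u)"
proof (induction u)
  case (Cons a u)
  obtain p s where a: "a = (p, s)" by force
  then show ?case
    using Cons w_closed[of p] E_closed[of "alternate u"]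
    by (simp add: w_one B.alg_l_one B.alg_r_one B.star_closed)
qed simp

text \<open>Monomials of trivial group value evaluate to diagonal projections, so after division by
  M the estimate for their combinations applies.\<close>

lemma free_eval_neutral_le:
  assumes z: "z \<in> carrier FA" and neutral: "\<And>u. z u \<noteq> 0 ==> dot (alternate u) = \<one>"
    and M: "M > 0" and b: "\<And>\<xi>. \<xi> \<in> Bd ==> cmod (ev z \<one> \<xi>) \<le> M"
  shows "nrm B (free_eval B w z) \<le> M"
proof -
  have fin: "finite {u. z u \<noteq> 0}" and zP: "\<And>u. z u \<noteq> 0 ==> fst ` set u \<subseteq> P"
    using z by (auto simp: free_carrier)
  obtain us where us: "set us = {u. z u \<noteq> 0}" "distinct us" using finite_distinct_list[OF fin] by blast
  have usNW: "alternate u \<in> NW" if "u \<in> set us" for u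
    using that us zP neutral by (auto simp: NW_iff)
  let ?cs = "map (\<lambda>u. (z u / M, KK (alternate u))) us"
  have "lin (map (\<lambda>u. (z u / M, KK (alternate u))) vs) = (1 / M) \<odot>\<^bsub>B\<^esub> foldr (\<lambda>u y. z u \<odot>\<^bsub>B\<^esub> letters_val B w u \<oplus>\<^bsub>B\<^esub> y) vs \<zero>\<^bsub>B\<^esub> \<and>
      foldr (\<lambda>u y. z u \<odot>\<^bsub>B\<^esub> letters_val B w u \<oplus>\<^bsub>B\<^esub> y) vs \<zero>\<^bsub>B\<^esub> \<in> carrier B"
    if "set vs \<subseteq> set us" for vs
    using that
  proof (induction vs)
    case (Cons u vs)
    have u: "u \<in> set us" using Cons.prems by simp
    then have "letters_val B w u = idemp (KK (alternate u))" "letters_val B w u \<in> carrier B"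
      using letters_val_E[of u] e_K[OF usNW[OF u]] zP[of u] us(1) E_closed[OF NW_W[OF usNW[OF u]]] by auto
    then show ?case
      using Cons by (auto simp: lin_def B.smult_r_distr' B.smult_assoc[symmetric] B.alg_a_closed)
  qed (simp add: lin_def B.alg_zero_closed)
  moreover have "finsum B (\<lambda>u. z u \<odot>\<^bsub>B\<^esub> letters_val B w u) (set us) =
      foldr (\<lambda>u y. z u \<odot>\<^bsub>B\<^esub> letters_val B w u \<oplus>\<^bsub>B\<^esub> y) us \<zero>\<^bsub>B\<^esub>"
    using letters_val_closed[OF B.star_algebra_axioms w zP] us by (intro B.finsum_foldr) auto
  ultimately have "lin ?cs = (1 / M) \<odot>\<^bsub>B\<^esub> free_eval B w z" by (simp add: free_eval_def us(1))
  moreover have "nrm B (lin ?cs) \<le> 1"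
  proof (rule lin_norm_le)
    show "snd ` set ?cs \<subseteq> J" using usNW NW_W by auto
    fix \<xi> assume \<xi>: "\<xi> \<in> Bd"
    have "lin_val ?cs \<xi> = (\<Sum>u\<in>set us. z u / M * of_nat (\<xi> (KK (alternate u))))"
      by (simp add: lin_val_def o_def sum_list_distinct_conv_sum_set[OF us(2)])
    also have "\<dots> = ev z \<one> \<xi> / M"
      unfolding ev_apply[OF z] sum_divide_distrib us(1)[symmetric]
      using neutral us(1) usNW K_rev_neutral \<xi> by (intro sum.cong) (auto simp: eps_def)
    finally show "cmod (lin_val ?cs \<xi>) \<le> 1" using b[OF \<xi>] M by (simp add: norm_divide)
  qed
  ultimately show ?thesis
    using B.p_smult[OF free_eval_closed[OF B.star_algebra_axioms w z], of "1 / M"] M by (simp add: norm_divide)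
qed

text \<open>The product of y with its adjoint involves only monomials of trivial value, and its
  coefficient over \<one> is the squared modulus of the coefficient of y over g.\<close>

lemma free_eval_homogeneous_le:
  assumes y: "y \<in> carrier FA" and hom: "\<And>u. y u \<noteq> 0 ==> dot (alternate u) = g"
    and g: "g \<in> carrier G"
  shows "nrm B (free_eval B w y) \<le> supn (ev y g)"
proof -
  let ?F = "FA"
  interpret F: star_algebra ?F by (rule star_algebra_free)
  note hB = star_homD[OF free_eval_star_hom[OF B.star_algebra_axioms w]]
  note hE = star_homD[OF ev_star_hom]
  let ?z = "y \<otimes>\<^bsub>?F\<^esub> star ?F y"
  have z: "?z \<in> carrier ?F" using y by (intro F.alg_m_closed F.star_closed)
  have zn: "dot (alternate u) = \<one>" if "?z u \<noteq> 0" for u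
  proof -
    have "(\<Sum>i\<le>length u. y (take i u) * star ?F y (drop i u)) \<noteq> 0" using that by (simp add: free_ops)
    from free_mult_support[OF this] obtain a b where ab: "u = a @ b" "y a \<noteq> 0" "y (inv_word b) \<noteq> 0"
      by (auto simp: free_ops)
    have "fst ` set a \<subseteq> P" "fst ` set (inv_word b) \<subseteq> P" using ab(2,3) y by (simp_all add: free_carrier del: inv_word_simps)
    then have P: "fst ` set a \<subseteq> P" "fst ` set b \<subseteq> P" by simp_all
    have "dot (alternate b) = inv (dot (alternate (inv_word b)))"
      using P dot_rev[of "alternate b"] by (simp add: alternate_inv_word)
    then show ?thesis using hom[OF ab(2)] hom[OF ab(3)] P g by (simp add: ab(1) dot_append)
  qed
  have evy: "ev y \<in> carrier PS" using hE(1)[OF y] .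
  have supp: "supp (ev y) \<subseteq> {g}"
  proof
    fix h assume h: "h \<in> supp (ev y)"
    show "h \<in> {g}"
    proof (rule ccontr)
      assume "h \<notin> {g}"
      then have "ev y h \<eta> = 0" for \<eta> unfolding ev_apply[OF y] using hom by (intro sum.neutral) auto
      then show False using h by (auto simp: supp_def)
    qed
  qed
  have val: "cmod (ev ?z \<one> \<xi>) \<le> (supn (ev y g))\<^sup>2" if \<xi>: "\<xi> \<in> Bd" for \<xi>
  proof -
    have "ev ?z = ev y \<otimes>\<^bsub>PS\<^esub> star PS (ev y)" using y by (simp add: hE F.star_closed)
    then have "ev ?z \<one> \<xi> = ev y g \<xi> * star PS (ev y) (inv g \<otimes> \<one>) (act (inv g) \<xi>)"
      using PS_mult[OF evy PS_star_closed[OF evy] _ supp] g by simp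
    also have "\<dots> = ev y g \<xi> * cnj (ev y g \<xi>)"
      using PS_V[OF evy, of \<xi> g] act_inv_V[OF g, of \<xi>] act_act_inv[OF g, of \<xi>] g by (cases "\<xi> \<in> V g") (auto simp: PS_star)
    finally have "cmod (ev ?z \<one> \<xi>) = (cmod (ev y g \<xi>))\<^sup>2" by (simp add: norm_mult power2_eq_square)
    then show ?thesis using supn_upper[OF PS_CB[OF evy] \<xi>, of g] by (simp add: power_mono)
  qed
  have "(nrm B (free_eval B w y))\<^sup>2 = nrm B (free_eval B w ?z)"
    using B.p_cstar[OF B.star_closed[OF hB(1)[OF y]]] hB(1)[OF y] y by (simp add: hB F.star_closed B.star_star)
  also have "\<dots> \<le> (supn (ev y g))\<^sup>2"
  proof (rule field_le_epsilon)
    \<comment> \<open>The supremum may be 0, while the estimate for neutral monomials asks for a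
      positive bound.\<close>
    fix d :: real assume "d > 0"
    then have "cmod (ev ?z \<one> \<xi>) \<le> (supn (ev y g))\<^sup>2 + d" if "\<xi> \<in> Bd" for \<xi> using val[OF that] by linarith
    then show "nrm B (free_eval B w ?z) \<le> (supn (ev y g))\<^sup>2 + d"
      using \<open>d > 0\<close> by (intro free_eval_neutral_le[OF z zn]) (auto intro: add_nonneg_pos)
  qed
  finally show ?thesis
    using supn_nonneg[OF PS_CB[OF evy], of g] by (simp add: power2_le_iff_abs_le hB(1)[OF y])
qed

text \<open>The monomials of x are grouped by their values in G, and the homogeneous estimates are
  added; \<open>res H\<close> keeps the monomials with value in H.\<close>

lemma free_eval_le_N1:
  assumes x: "x \<in> carrier FA"
  shows "nrm B (free_eval B w x) \<le> N1 (ev x)"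
proof -
  let ?F = "FA"
  interpret F: star_algebra ?F by (rule star_algebra_free)
  note hB = star_homD[OF free_eval_star_hom[OF B.star_algebra_axioms w]]
  note hE = star_homD[OF ev_star_hom]
  define res where "res H u = (if dot (alternate u) \<in> H then x u else 0)" for H u
  have res: "res H \<in> carrier ?F" for H
  proof -
    have "finite {u. res H u \<noteq> 0}" by (rule finite_subset[of _ "{u. x u \<noteq> 0}"]) (use x in \<open>auto simp: res_def free_carrier\<close>)
    then show ?thesis using x by (auto simp: free_carrier res_def split: if_splits)
  qed
  have one: "nrm B (free_eval B w (res {g})) \<le> supn (ev x g)" if g: "g \<in> carrier G" for g
  proof -
    have "nrm B (free_eval B w (res {g})) \<le> supn (ev (res {g}) g)"
      by (rule free_eval_homogeneous_le[OF res _ g]) (auto simp: res_def split: if_splits)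
    also have "ev (res {g}) g = ev x g"
    proof
      fix \<eta>
      have "ev (res {g}) g \<eta> = (\<Sum>u\<in>{u. x u \<noteq> 0}. res {g} u * (if dot (alternate u) = g then eps (KK (rev (alternate u))) \<eta> else 0))"
        unfolding ev_apply[OF res] using x by (intro sum.mono_neutral_left) (auto simp: res_def free_carrier split: if_splits)
      also have "\<dots> = ev x g \<eta>" unfolding ev_apply[OF x] by (intro sum.cong) (auto simp: res_def)
      finally show "ev (res {g}) g \<eta> = ev x g \<eta>" .
    qed
    finally show ?thesis .
  qed
  have sum: "nrm B (free_eval B w (res H)) \<le> (\<Sum>g\<in>H. supn (ev x g))" if "finite H" "H \<subseteq> carrier G" for H
    using that
  proof (induction H)
    case empty
    have "res {} = \<zero>\<^bsub>?F\<^esub>" by (auto simp: res_def free_ops)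
    then show ?case using star_hom_zero[OF free_eval_star_hom[OF B.star_algebra_axioms w] star_algebra_free B.star_algebra_axioms] by simp
  next
    case (insert g H)
    have "res (insert g H) = res {g} \<oplus>\<^bsub>?F\<^esub> res H" using insert by (auto simp: res_def free_ops fun_eq_iff)
    then have "nrm B (free_eval B w (res (insert g H))) \<le> nrm B (free_eval B w (res {g})) + nrm B (free_eval B w (res H))"
      using B.p_triangle[OF hB(1)[OF res] hB(1)[OF res]] hB(3)[OF res res] by simp
    then show ?case using one[of g] insert by auto
  qed
  let ?H = "(\<lambda>u. dot (alternate u)) ` {u. x u \<noteq> 0}"
  have H: "finite ?H" "?H \<subseteq> carrier G" using x by (auto simp: free_carrier intro!: dot_closed alternate_W)
  have "res ?H = x" by (auto simp: res_def fun_eq_iff)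
  then show ?thesis using sum[OF H] N1_finite_sum_le[OF hE(1)[OF x] H(1)] by simp
qed

text \<open>(T3) contains multiplicativity: the neutral words (p, p) and (pq, p, 1, q) have ideal P,
  like the empty word. For x = w(pq) and y = w(p) w(q) this makes star(x) x, star(x) y, star(y) x
  and star(y) y all equal to 1, so star(x - y) (x - y) = 0.\<close>

lemma family_isometric_rep: "isometric_rep G P B w"
  unfolding isometric_rep_def
proof (intro conjI ballI)
  show "w \<in> P \<rightarrow> carrier B" by (rule w)
  show "w \<one> = \<one>\<^bsub>B\<^esub>" by (rule w_one)
  have iso: "star B (w p) \<otimes>\<^bsub>B\<^esub> w p = \<one>\<^bsub>B\<^esub>" if p: "p \<in> P" for p
  proof -
    have "KK [p, p] = P" using p by (auto simp: K_Cons)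
    then have "wval [p, p] = wval []" using p by (intro E_cong) (auto simp: NW_iff)
    then show ?thesis using w_closed[OF p] by (simp add: B.alg_r_one B.alg_m_closed B.star_closed)
  qed
  then show "star B (w p) \<otimes>\<^bsub>B\<^esub> w p = \<one>\<^bsub>B\<^esub>" if "p \<in> P" for p using that .
  fix p q assume p: "p \<in> P" and q: "q \<in> P"
  let ?r = "p \<otimes> q"
  have r: "?r \<in> P" using p q by simp
  let ?a = "[?r, p, \<one>, q]"
  have dot: "inv ?r \<otimes> p \<otimes> (\<one> \<otimes> q) = \<one>" using p q by (simp add: inv_mult_group m_assoc)
  have a: "?a \<in> NW" using p q r dot by (simp add: NW_iff)
  have "KK ?a = P"
    using p q r dot by (auto simp: K_Cons)
  then have "wval ?a = wval []" using a by (intro E_cong) (auto simp: NW_iff)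
  then have 1: "star B (w ?r) \<otimes>\<^bsub>B\<^esub> (w p \<otimes>\<^bsub>B\<^esub> w q) = \<one>\<^bsub>B\<^esub>"
    using w_closed p q r by (simp add: w_one B.alg_r_one B.alg_l_one B.alg_m_closed B.star_closed B.alg_m_assoc)
  let ?x = "w ?r" and ?y = "w p \<otimes>\<^bsub>B\<^esub> w q"
  have c: "?x \<in> carrier B" "?y \<in> carrier B" using w_closed p q r B.alg_m_closed by auto
  have 2: "star B ?y \<otimes>\<^bsub>B\<^esub> ?x = \<one>\<^bsub>B\<^esub>"
    using arg_cong[OF 1, of "star B"] c by (simp add: B.star_mult B.star_closed B.star_star)
  have "star B ?y \<otimes>\<^bsub>B\<^esub> ?y = star B (w q) \<otimes>\<^bsub>B\<^esub> ((star B (w p) \<otimes>\<^bsub>B\<^esub> w p) \<otimes>\<^bsub>B\<^esub> w q)"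
    using w_closed p q by (simp add: B.star_mult B.alg_m_assoc B.star_closed B.alg_m_closed)
  then have 3: "star B ?y \<otimes>\<^bsub>B\<^esub> ?y = \<one>\<^bsub>B\<^esub>" using iso p q w_closed by (simp add: B.alg_l_one)
  have "star B (?x \<ominus>\<^bsub>B\<^esub> ?y) \<otimes>\<^bsub>B\<^esub> (?x \<ominus>\<^bsub>B\<^esub> ?y) = \<zero>\<^bsub>B\<^esub>"
    unfolding B.star_diff[OF c] using c 1 2 3 iso[OF r]
    by (simp add: B.alg_minus_eq B.alg_l_distr B.alg_r_distr B.alg_l_minus B.alg_r_minus B.star_closed
        B.alg_a_inv_closed B.alg_m_closed B.alg_a_closed B.alg_one_closed B.alg_minus_minus B.alg_r_neg B.alg_l_neg
        B.alg_r_zero B.alg_zero_closed)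
  then have "nrm B (?x \<ominus>\<^bsub>B\<^esub> ?y) = 0" using B.p_cstar[of "?x \<ominus>\<^bsub>B\<^esub> ?y"] c by simp
  then have "?x \<ominus>\<^bsub>B\<^esub> ?y = \<zero>\<^bsub>B\<^esub>" using cstar_algebra.nrm_definite[OF B B.diff_closed[OF c]] by simp
  then show "?y = ?x" using B.diff_eq_zeroD[OF c] by simp
qed

text \<open>A family integrates to the sections: by the l1-estimate the evaluation at w factors
  through \<open>ev\<close> and extends from its dense image.\<close>

lemma family_star_hom:
  obtains \<pi> where "\<pi> \<in> star_hom PS B" "\<And>x. x \<in> carrier FA ==> \<pi> (ev x) = free_eval B w x"
proof (rule star_hom_extension[OF star_algebra_free star_algebra_PS B ev_star_hom
      free_eval_star_hom[OF B.star_algebra_axioms w] continuous_norm_N1])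
  fix a assume "a \<in> carrier FA"
  then show "nrm B (free_eval B w a) \<le> N1 (ev a)" by (rule free_eval_le_N1)
next
  fix s and e :: real assume "s \<in> carrier PS" "e > 0"
  then show "\<exists>a\<in>carrier FA. N1 (s \<ominus>\<^bsub>PS\<^esub> ev a) < e" by (rule ev_dense)
qed (rule that)

end

end

section \<open>The diagonal algebra and the boundary quotient\<close>

text \<open>The rate passes to the limit, so limits taken pointwise with a common rate are
  uniform.\<close>

lemma summable_limit_bound:
  fixes a :: "nat => complex"
  assumes "\<And>n m. n \<le> m ==> cmod (a m - a n) \<le> r n" "r \<longlonglongrightarrow> 0"
  shows "\<exists>l. \<forall>n. cmod (l - a n) \<le> r n"
proof -
  have "Cauchy a"
  proof (rule metric_CauchyI)
    fix d :: real assume "d > 0"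
    then have "d / 2 > 0" by simp
    then have "eventually (\<lambda>n. r n < d / 2) sequentially" by (rule order_tendstoD(2)[OF assms(2)])
    then obtain N where N: "r N < d / 2" unfolding eventually_sequentially by blast
    have "dist (a m) (a n) < d" if "m \<ge> N" "n \<ge> N" for m n
      using norm_triangle_ineq4[of "a m - a N" "a n - a N"] assms(1)[OF that(1)] assms(1)[OF that(2)] N
      by (simp add: dist_norm)
    then show "\<exists>M. \<forall>m\<ge>M. \<forall>n\<ge>M. dist (a m) (a n) < d" by blast
  qed
  then obtain l where l: "a \<longlonglongrightarrow> l" using Cauchy_convergent_iff convergent_def by blast
  have "cmod (l - a n) \<le> r n" for n
  proof (rule Lim_bounded[of "\<lambda>m. cmod (a m - a n)"])
    show "(\<lambda>m. cmod (a m - a n)) \<longlonglongrightarrow> cmod (l - a n)" by (intro tendsto_intros l)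
  qed (use assms(1) in auto)
  then show ?thesis by blast
qed

lemma star_hom_finsum:
  assumes h: "h \<in> star_hom A B" and A: "star_algebra A" and B: "star_algebra B"
    and "finite I" "\<And>i. i \<in> I ==> f i \<in> carrier A"
  shows "h (finsum A f I) = finsum B (\<lambda>i. h (f i)) I"
proof -
  interpret A: star_algebra A by fact
  interpret B: star_algebra B by fact
  show ?thesis using assms(4,5)
  proof (induction I)
    case (insert i I)
    have "finsum A f (insert i I) = f i \<oplus>\<^bsub>A\<^esub> finsum A f I"
      using insert by (intro A.alg_finsum_insert) auto
    moreover have "finsum B (\<lambda>i. h (f i)) (insert i I) = h (f i) \<oplus>\<^bsub>B\<^esub> finsum B (\<lambda>i. h (f i)) I"
      using insert star_homD(1)[OF h] by (intro B.alg_finsum_insert) auto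
    moreover have "finsum A f I \<in> carrier A" using insert by (intro A.alg_finsum_closed) auto
    ultimately show ?case using insert star_homD(3)[OF h] by simp
  qed (simp add: star_hom_zero[OF h A B])
qed

context submonoid_of_group
begin

section \<open>Functions on P and on the boundary with common approximants\<close>

definition restr :: "(('g set => nat) => complex) => 'g => complex" where
  "restr s x = (if x \<in> P then s (point x) else 0)"

lemma indicator_span_SF:
  assumes S: "\<S> \<subseteq> J"
  shows "indicator_span \<S> = restr ` SF \<S>"
proof
  have val: "(\<Sum>S\<in>F. c S * indicator S x) = restr s x"
    if "F \<subseteq> \<S>" "\<And>\<eta>. \<eta> \<in> JH ==> s \<eta> = (\<Sum>S\<in>F. c S * of_nat (\<eta> S))" for F c s and x :: 'g
  proof (cases "x \<in> P")
    case True
    then show ?thesis using that S by (auto simp: restr_def point_JH point_def indicator_def intro!: sum.cong)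
  next
    case False
    have "(\<Sum>S\<in>F. c S * indicator S x) = 0"
    proof (rule sum.neutral, rule ballI)
      fix T assume "T \<in> F"
      then have "x \<notin> T" using False J_subset[of T] S that(1) by blast
      then show "c T * indicator T x = 0" by simp
    qed
    then show ?thesis using False by (simp add: restr_def)
  qed
  show "indicator_span \<S> \<subseteq> restr ` SF \<S>"
  proof
    fix b assume "b \<in> indicator_span \<S>"
    then obtain F c where b: "b = (\<lambda>x. \<Sum>S\<in>F. c S * indicator S x)" "finite F" "F \<subseteq> \<S>"
      by (auto simp: indicator_span_def)
    let ?s = "\<lambda>\<eta>. \<Sum>S\<in>F. c S * of_nat (\<eta> S)"
    have "?s \<in> SF \<S>" using b(2,3) unfolding SF_def by blast
    moreover have "b = restr ?s" unfolding b(1) using val[OF b(3), of ?s c] by blast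
    ultimately show "b \<in> restr ` SF \<S>" by blast
  qed
  show "restr ` SF \<S> \<subseteq> indicator_span \<S>"
  proof
    fix b assume "b \<in> restr ` SF \<S>"
    then obtain s where s: "s \<in> SF \<S>" "b = restr s" by blast
    obtain F c where F: "finite F" "F \<subseteq> \<S>" "\<And>\<eta>. \<eta> \<in> JH ==> s \<eta> = (\<Sum>S\<in>F. c S * of_nat (\<eta> S))"
      using s(1) by (rule SF_E) blast
    have "b = (\<lambda>x. \<Sum>S\<in>F. c S * indicator S x)" using val[OF F(2,3)] s(2) by auto
    then show "b \<in> indicator_span \<S>" using F(1,2) unfolding indicator_span_def by blast
  qed
qed

lemma closed_span_iff:
  assumes S: "\<S> \<subseteq> J"
  shows "b \<in> closed_indicator_span \<S> \<longleftrightarrow>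
    (\<forall>x. x \<notin> P \<longrightarrow> b x = 0) \<and> (\<forall>e>0. \<exists>s\<in>SF \<S>. \<forall>x\<in>P. cmod (b x - s (point x)) \<le> e)"
proof
  assume "b \<in> closed_indicator_span \<S>"
  then obtain t where t: "\<And>n. t n \<in> restr ` SF \<S>" "uniform_limit UNIV t b sequentially"
    unfolding closed_indicator_span_def indicator_span_SF[OF S] by blast
  have ap: "\<exists>s\<in>SF \<S>. \<forall>x. cmod (b x - restr s x) \<le> e" if "e > 0" for e
  proof -
    have "\<forall>\<^sub>F n in sequentially. \<forall>x\<in>UNIV. dist (t n x) (b x) < e" by (rule uniform_limitD[OF t(2) that])
    then obtain n where n: "\<forall>x. dist (t n x) (b x) < e" unfolding eventually_sequentially by blast
    obtain s where "s \<in> SF \<S>" "t n = restr s" using t(1) by blast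
    then show ?thesis using n by (intro bexI[of _ s]) (auto simp: dist_norm norm_minus_commute less_imp_le)
  qed
  have "b x = 0" if x: "x \<notin> P" for x
  proof -
    have "cmod (b x) \<le> 0 + e" if e: "e > 0" for e
    proof -
      obtain s where "\<forall>x. cmod (b x - restr s x) \<le> e" using ap[OF e] by blast
      from spec[OF this, of x] show ?thesis using x by (simp add: restr_def)
    qed
    then have "cmod (b x) \<le> 0" by (rule field_le_epsilon)
    then show ?thesis by simp
  qed
  moreover have "\<exists>s\<in>SF \<S>. \<forall>x\<in>P. cmod (b x - s (point x)) \<le> e" if "e > 0" for e
    using ap[OF that] by (metis restr_def)
  ultimately show "(\<forall>x. x \<notin> P \<longrightarrow> b x = 0) \<and> (\<forall>e>0. \<exists>s\<in>SF \<S>. \<forall>x\<in>P. cmod (b x - s (point x)) \<le> e)" by blast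
next
  assume *: "(\<forall>x. x \<notin> P \<longrightarrow> b x = 0) \<and> (\<forall>e>0. \<exists>s\<in>SF \<S>. \<forall>x\<in>P. cmod (b x - s (point x)) \<le> e)"
  have "\<exists>s. s \<in> SF \<S> \<and> (\<forall>x\<in>P. cmod (b x - s (point x)) \<le> 1 / real (Suc n))" for n
    using * by (simp add: Bex_def)
  then obtain s where s: "\<And>n. s n \<in> SF \<S>" "\<And>n x. x \<in> P ==> cmod (b x - s n (point x)) \<le> 1 / real (Suc n)"
    by metis
  have "uniform_limit UNIV (\<lambda>n. restr (s n)) b sequentially"
  proof (rule uniform_limitI)
    fix e :: real assume "e > 0"
    then obtain M where M: "1 / real (Suc M) < e" using nat_approx_posE by blast
    show "\<forall>\<^sub>F n in sequentially. \<forall>x\<in>UNIV. dist (restr (s n) x) (b x) < e"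
      unfolding eventually_sequentially
    proof (intro exI allI impI ballI)
      fix n x assume "M \<le> n"
      have "1 / real (Suc n) \<le> 1 / real (Suc M)" using \<open>M \<le> n\<close> by (simp add: field_simps)
      then show "dist (restr (s n) x) (b x) < e"
        using s(2)[of x n] M * \<open>e > 0\<close> by (cases "x \<in> P") (auto simp: restr_def dist_norm norm_minus_commute)
    qed
  qed
  then show "b \<in> closed_indicator_span \<S>"
    unfolding closed_indicator_span_def indicator_span_SF[OF S]
    by (intro CollectI exI[of _ "\<lambda>n. restr (s n)"] conjI allI imageI s(1))
qed

text \<open>\<open>Rel \<S> b h\<close>: the function \<open>b\<close> on \<open>P\<close> and the function \<open>h\<close> on the boundary have the same
  approximations by combinations of members of \<open>\<S>\<close>. For \<open>\<S> = J\<close> this is the graph of the quotient map.\<close>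

definition Rel :: "'g set set => ('g => complex) => (('g set => nat) => complex) => bool" where
  "Rel \<S> b h \<longleftrightarrow> (\<forall>x. x \<notin> P \<longrightarrow> b x = 0) \<and> (\<forall>\<xi>. \<xi> \<notin> Bd \<longrightarrow> h \<xi> = 0) \<and>
     (\<forall>e>0. \<exists>s\<in>SF \<S>. (\<forall>x\<in>P. cmod (b x - s (point x)) \<le> e) \<and> (\<forall>\<xi>\<in>Bd. cmod (h \<xi> - s \<xi>) \<le> e))"

lemma Rel_E:
  assumes "Rel \<S> b h" "e > 0"
  obtains s where "s \<in> SF \<S>" "\<And>x. x \<in> P ==> cmod (b x - s (point x)) \<le> e" "\<And>\<xi>. \<xi> \<in> Bd ==> cmod (h \<xi> - s \<xi>) \<le> e"
  using assms unfolding Rel_def by blast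

lemma Rel_zero_off: "Rel \<S> b h ==> x \<notin> P ==> b x = 0" "Rel \<S> b h ==> \<xi> \<notin> Bd ==> h \<xi> = 0"
  by (simp_all add: Rel_def)

lemma RelI:
  assumes "\<And>x. x \<notin> P ==> b x = 0" "\<And>\<xi>. \<xi> \<notin> Bd ==> h \<xi> = 0"
    "\<And>e. e > 0 ==> \<exists>s\<in>SF \<S>. (\<forall>x\<in>P. cmod (b x - s (point x)) \<le> e) \<and> (\<forall>\<xi>\<in>Bd. cmod (h \<xi> - s \<xi>) \<le> e)"
  shows "Rel \<S> b h"
  using assms unfolding Rel_def by blast

lemma Rel_closed_span: "[|Rel \<S> b h; \<S> \<subseteq> J|] ==> b \<in> closed_indicator_span \<S>"
  unfolding closed_span_iff Rel_def by blast

lemma Rel_BI: "Rel (JJ g) b h ==> h \<in> BI g"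
proof (rule BI_I)
  assume r: "Rel (JJ g) b h"
  show "h \<eta> = 0" if "\<eta> \<notin> Bd" for \<eta> by (rule Rel_zero_off(2)[OF r that])
  fix e :: real assume "e > 0"
  then obtain s where "s \<in> SF (JJ g)" "\<And>\<xi>. \<xi> \<in> Bd ==> cmod (h \<xi> - s \<xi>) \<le> e"
    using Rel_E[OF r] by blast
  then show "\<exists>s\<in>SF (JJ g). \<forall>\<eta>\<in>Bd. cmod (h \<eta> - s \<eta>) \<le> e" by (intro bexI[of _ s] ballI)
qed

lemma Rel_mono: "[|Rel \<S> b h; \<S> \<subseteq> \<T>|] ==> Rel \<T> b h"
  unfolding Rel_def using SF_mono by meson

lemma JJ_subset_J: "JJ g \<subseteq> J"
  using JJ_J by blast

text \<open>Every boundary value of a combination is also taken at a point of P. Hence approximants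
  that converge uniformly on P converge uniformly on the boundary.\<close>

lemma Rel_exists_right:
  assumes b: "b \<in> closed_indicator_span \<S>" and S: "\<S> \<subseteq> J"
  shows "\<exists>h. Rel \<S> b h"
proof -
  note * = b[unfolded closed_span_iff[OF S]]
  have "\<exists>s. s \<in> SF \<S> \<and> (\<forall>x\<in>P. cmod (b x - s (point x)) \<le> 1 / real (Suc n))" for n
    using * by (simp add: Bex_def)
  then obtain s where s: "\<And>n. s n \<in> SF \<S>" "\<And>n x. x \<in> P ==> cmod (b x - s n (point x)) \<le> 1 / real (Suc n)"
    by metis
  have r0: "(\<lambda>n. 2 / real (Suc n)) \<longlonglongrightarrow> 0"
    using tendsto_mult[OF tendsto_const[of 2] LIMSEQ_inverse_real_of_nat] by (simp add: divide_inverse)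
  have "\<exists>l. \<forall>n. cmod (l - s n \<xi>) \<le> 2 / real (Suc n)" if \<xi>: "\<xi> \<in> Bd" for \<xi>
  proof (rule summable_limit_bound[OF _ r0])
    fix n m :: nat assume nm: "n \<le> m"
    have "(\<lambda>\<eta>. s m \<eta> - s n \<eta>) \<in> SF J" using s(1) S by (intro SF_diff SF_mono[OF s(1) S])
    from SF_density[OF this \<xi>, of "{}"] obtain q where q: "q \<in> \<Delta> {}" "s m (point q) - s n (point q) = s m \<xi> - s n \<xi>" by auto
    have qP: "q \<in> P" by (rule Delta_P[OF q(1)])
    have "cmod (s m (point q) - s n (point q)) \<le> 1 / real (Suc n) + 1 / real (Suc m)"
      using norm_triangle_ineq4[of "b q - s n (point q)" "b q - s m (point q)"] s(2)[OF qP, of n] s(2)[OF qP, of m] by simp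
    also have "1 / real (Suc m) \<le> 1 / real (Suc n)" using nm by (simp add: field_simps)
    finally show "cmod (s m \<xi> - s n \<xi>) \<le> 2 / real (Suc n)" using q(2) by simp
  qed
  then obtain l where l: "\<And>\<xi> n. \<xi> \<in> Bd ==> cmod (l \<xi> - s n \<xi>) \<le> 2 / real (Suc n)" by metis
  let ?h = "\<lambda>\<xi>. if \<xi> \<in> Bd then l \<xi> else 0"
  have "Rel \<S> b ?h"
  proof (rule RelI)
    fix e :: real assume "e > 0"
    then have "\<forall>\<^sub>F n in sequentially. 2 / real (Suc n) < e" by (rule order_tendstoD(2)[OF r0])
    then obtain n where n: "2 / real (Suc n) < e" unfolding eventually_sequentially by blast
    have "1 / real (Suc n) \<le> 2 / real (Suc n)" by (intro divide_right_mono) auto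
    then have n1: "1 / real (Suc n) \<le> e" using n by linarith
    have "cmod (b x - s n (point x)) \<le> e" if "x \<in> P" for x using s(2)[OF that, of n] n1 by linarith
    moreover have "cmod (?h \<xi> - s n \<xi>) \<le> e" if "\<xi> \<in> Bd" for \<xi> using l[OF that, of n] n that by simp
    ultimately show "\<exists>s\<in>SF \<S>. (\<forall>x\<in>P. cmod (b x - s (point x)) \<le> e) \<and> (\<forall>\<xi>\<in>Bd. cmod (?h \<xi> - s \<xi>) \<le> e)"
      using s(1)[of n] by (intro bexI[of _ "s n"] conjI ballI)
  qed (use * in auto)
  then show ?thesis by blast
qed

text \<open>This gives surjectivity of the quotient map, even from the ideal attached to g. Bounds
  on the boundary say nothing about values on P, so each correction is cut off at a size that does
  not affect the boundary but makes the corrections summable on P.\<close>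

lemma Rel_exists_left:
  assumes h: "h \<in> BI g"
  shows "\<exists>b. Rel (JJ g) b h"
proof -
  define good where "good n s \<longleftrightarrow> s \<in> SF (JJ g) \<and> (\<forall>\<xi>\<in>Bd. cmod (h \<xi> - s \<xi>) \<le> (1/2) ^ n)"
    for n :: nat and s
  have "\<exists>s. \<forall>n. good n (s n) \<and> (\<forall>x\<in>P. cmod (s (Suc n) (point x) - s n (point x)) \<le> 2 * (1/2) ^ n)"
  proof (rule dependent_nat_choice)
    show "\<exists>s. good 0 s" using BI_approx[OF h, of 1] by (auto simp: good_def)
    fix s n assume s: "good n s"
    obtain t where t: "t \<in> SF (JJ g)" "\<And>\<xi>. \<xi> \<in> Bd ==> cmod (h \<xi> - t \<xi>) \<le> (1/2) ^ Suc n"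
      using BI_approx[OF h, of "(1/2) ^ Suc n"] by auto
    \<comment> \<open>On the boundary \<open>t \<xi> - s \<xi>\<close> has modulus at most the sum
      of the two errors, (1/2)^n and (1/2)^(n+1). This is below the threshold, so the cut-off
      changes values only elsewhere.\<close>
    define \<tau> where "\<tau> z = (if cmod z \<le> 2 * (1/2) ^ n then z else 0)" for z :: complex
    let ?s = "\<lambda>\<eta>. s \<eta> + \<tau> (t \<eta> - s \<eta>)"
    have sS: "s \<in> SF (JJ g)" using s by (simp add: good_def)
    have "(\<lambda>\<eta>. \<tau> (t \<eta> - s \<eta>)) \<in> SF (JJ g)"
      by (rule SF_comp[OF SF_diff[OF t(1) sS]]) (auto simp: JJ_J JJ_Int_J \<tau>_def)
    then have "?s \<in> SF (JJ g)" by (intro SF_add sS)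
    moreover have "cmod (h \<xi> - ?s \<xi>) \<le> (1/2) ^ Suc n" if \<xi>: "\<xi> \<in> Bd" for \<xi>
    proof -
      have "cmod (t \<xi> - s \<xi>) \<le> (1/2) ^ n + (1/2) ^ Suc n"
        using norm_triangle_ineq4[of "h \<xi> - s \<xi>" "h \<xi> - t \<xi>"] t(2)[OF \<xi>] s \<xi> by (fastforce simp: good_def)
      also have "\<dots> \<le> 2 * (1/2) ^ n" by simp
      finally have "?s \<xi> = t \<xi>" by (simp add: \<tau>_def)
      then show ?thesis using t(2)[OF \<xi>] by simp
    qed
    moreover have "cmod (?s (point x) - s (point x)) \<le> 2 * (1/2) ^ n" for x by (simp add: \<tau>_def)
    ultimately show "\<exists>s'. good (Suc n) s' \<and> (\<forall>x\<in>P. cmod (s' (point x) - s (point x)) \<le> 2 * (1/2) ^ n)"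
      unfolding good_def by (intro exI[of _ ?s]) blast
  qed
  then obtain s where s: "\<And>n. s n \<in> SF (JJ g)" "\<And>n \<xi>. \<xi> \<in> Bd ==> cmod (h \<xi> - s n \<xi>) \<le> (1/2) ^ n"
    "\<And>n x. x \<in> P ==> cmod (s (Suc n) (point x) - s n (point x)) \<le> 2 * (1/2) ^ n"
    unfolding good_def by blast
  \<comment> \<open>The tail from n on of the geometric series with terms
    \<open>2 * (1/2) ^ n\<close> is \<open>4 * (1/2) ^ n\<close>.\<close>
  have r0: "(\<lambda>n. 4 * (1/2 :: real) ^ n) \<longlonglongrightarrow> 0"
    using tendsto_mult[OF tendsto_const[of "4::real"] LIMSEQ_power_zero[of "1/2 :: real"]] by simp
  have "\<exists>l. \<forall>n. cmod (l - s n (point x)) \<le> 4 * (1/2) ^ n" if x: "x \<in> P" for x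
  proof (rule summable_limit_bound[OF _ r0])
    fix n m :: nat assume nm: "n \<le> m"
    have "cmod (s (n + k) (point x) - s n (point x)) \<le> 4 * (1/2) ^ n - 4 * (1/2) ^ (n + k)" for k
    proof (induction k)
      case (Suc k)
      then show ?case
        using norm_triangle_ineq[of "s (Suc (n + k)) (point x) - s (n + k) (point x)" "s (n + k) (point x) - s n (point x)"]
          s(3)[OF x, of "n + k"] by simp
    qed simp
    from this[of "m - n"] show "cmod (s m (point x) - s n (point x)) \<le> 4 * (1/2) ^ n"
      using nm by (smt (verit) le_add_diff_inverse zero_le_power divide_nonneg_nonneg)
  qed
  then obtain l where l: "\<And>x n. x \<in> P ==> cmod (l x - s n (point x)) \<le> 4 * (1/2) ^ n" by metis
  let ?b = "\<lambda>x. if x \<in> P then l x else 0"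
  have "Rel (JJ g) ?b h"
  proof (rule RelI)
    show "h \<xi> = 0" if "\<xi> \<notin> Bd" for \<xi> by (rule BI_Bd[OF h that])
    fix e :: real assume "e > 0"
    then obtain n where n: "4 * (1/2) ^ n < e" using order_tendstoD(2)[OF r0] by (auto simp: eventually_sequentially)
    have "(1/2 :: real) ^ n \<le> 4 * (1/2) ^ n" by simp
    then have "cmod (?b x - s n (point x)) \<le> e" if "x \<in> P" for x using l[OF that, of n] n that by simp
    moreover have "cmod (h \<xi> - s n \<xi>) \<le> e" if "\<xi> \<in> Bd" for \<xi>
      using s(2)[OF that, of n] n \<open>(1/2 :: real) ^ n \<le> 4 * (1/2) ^ n\<close> by linarith
    ultimately show "\<exists>s\<in>SF (JJ g). (\<forall>x\<in>P. cmod (?b x - s (point x)) \<le> e) \<and> (\<forall>\<xi>\<in>Bd. cmod (h \<xi> - s \<xi>) \<le> e)"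
      using s(1) by (intro bexI[of _ "s n"]) auto
  qed simp
  then show ?thesis by blast
qed

lemma Rel_add: "[|Rel \<S> b h; Rel \<S> b' h'|] ==> Rel \<S> (\<lambda>x. b x + b' x) (\<lambda>\<xi>. h \<xi> + h' \<xi>)"
proof (rule RelI)
  assume r: "Rel \<S> b h" "Rel \<S> b' h'"
  show "b x + b' x = 0" if "x \<notin> P" for x using r that by (simp add: Rel_zero_off)
  show "h \<xi> + h' \<xi> = 0" if "\<xi> \<notin> Bd" for \<xi> using r that by (simp add: Rel_zero_off)
  fix e :: real assume "e > 0"
  then have e: "e/2 > 0" by simp
  obtain s where s: "s \<in> SF \<S>" "\<And>x. x \<in> P ==> cmod (b x - s (point x)) \<le> e/2" "\<And>\<xi>. \<xi> \<in> Bd ==> cmod (h \<xi> - s \<xi>) \<le> e/2"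
    using Rel_E[OF r(1) e] by blast
  obtain t where t: "t \<in> SF \<S>" "\<And>x. x \<in> P ==> cmod (b' x - t (point x)) \<le> e/2" "\<And>\<xi>. \<xi> \<in> Bd ==> cmod (h' \<xi> - t \<xi>) \<le> e/2"
    using Rel_E[OF r(2) e] by blast
  have tri: "cmod (a + a' - (c + c')) \<le> e" if "cmod (a - c) \<le> e/2" "cmod (a' - c') \<le> e/2" for a a' c c'
    using norm_triangle_ineq[of "a - c" "a' - c'"] that by (simp add: algebra_simps)
  show "\<exists>s\<in>SF \<S>. (\<forall>x\<in>P. cmod (b x + b' x - s (point x)) \<le> e) \<and> (\<forall>\<xi>\<in>Bd. cmod (h \<xi> + h' \<xi> - s \<xi>) \<le> e)"
    by (intro bexI[of _ "\<lambda>\<eta>. s \<eta> + t \<eta>"] conjI ballI tri s t SF_add)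
qed

lemma Rel_smult: "Rel \<S> b h ==> Rel \<S> (\<lambda>x. c * b x) (\<lambda>\<xi>. c * h \<xi>)"
proof (rule RelI)
  assume r: "Rel \<S> b h"
  show "c * b x = 0" if "x \<notin> P" for x using r that by (simp add: Rel_zero_off)
  show "c * h \<xi> = 0" if "\<xi> \<notin> Bd" for \<xi> using r that by (simp add: Rel_zero_off)
  fix e :: real assume e: "e > 0"
  have c: "cmod c + 1 > 0" by (simp add: add_nonneg_pos)
  then obtain s where s: "s \<in> SF \<S>" "\<And>x. x \<in> P ==> cmod (b x - s (point x)) \<le> e/(cmod c + 1)"
    "\<And>\<xi>. \<xi> \<in> Bd ==> cmod (h \<xi> - s \<xi>) \<le> e/(cmod c + 1)"
    using Rel_E[OF r, of "e/(cmod c + 1)"] e by auto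
  have tri: "cmod (c * a - c * a') \<le> e" if "cmod (a - a') \<le> e/(cmod c + 1)" for a a'
  proof -
    have "cmod (c * a - c * a') \<le> (cmod c + 1) * cmod (a - a')"
      by (simp add: right_diff_distrib[symmetric] norm_mult distrib_right)
    also have "\<dots> \<le> (cmod c + 1) * (e/(cmod c + 1))" using that c by (intro mult_left_mono) auto
    also have "\<dots> = e" using c by simp
    finally show ?thesis .
  qed
  show "\<exists>s\<in>SF \<S>. (\<forall>x\<in>P. cmod (c * b x - s (point x)) \<le> e) \<and> (\<forall>\<xi>\<in>Bd. cmod (c * h \<xi> - s \<xi>) \<le> e)"
    by (intro bexI[of _ "\<lambda>\<eta>. c * s \<eta>"] conjI ballI tri s SF_smult)
qed

lemma Rel_cnj: "Rel \<S> b h ==> Rel \<S> (\<lambda>x. cnj (b x)) (\<lambda>\<xi>. cnj (h \<xi>))"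
proof (rule RelI)
  assume r: "Rel \<S> b h"
  show "cnj (b x) = 0" if "x \<notin> P" for x using r that by (simp add: Rel_zero_off)
  show "cnj (h \<xi>) = 0" if "\<xi> \<notin> Bd" for \<xi> using r that by (simp add: Rel_zero_off)
  fix e :: real assume e: "e > 0"
  obtain s where s: "s \<in> SF \<S>" "\<And>x. x \<in> P ==> cmod (b x - s (point x)) \<le> e" "\<And>\<xi>. \<xi> \<in> Bd ==> cmod (h \<xi> - s \<xi>) \<le> e"
    using Rel_E[OF r e] by blast
  have tri: "cmod (cnj a - cnj a') \<le> e" if "cmod (a - a') \<le> e" for a a'
    using that by (metis complex_cnj_diff complex_mod_cnj)
  show "\<exists>s\<in>SF \<S>. (\<forall>x\<in>P. cmod (cnj (b x) - s (point x)) \<le> e) \<and> (\<forall>\<xi>\<in>Bd. cmod (cnj (h \<xi>) - s \<xi>) \<le> e)"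
    by (intro bexI[of _ "\<lambda>\<eta>. cnj (s \<eta>)"] conjI ballI tri s SF_cnj)
qed

lemma SF_bounded: "s \<in> SF \<S> ==> \<exists>M. \<forall>\<eta>\<in>JH. cmod (s \<eta>) \<le> M"
proof -
  assume "s \<in> SF \<S>"
  then obtain F c where F: "finite F" "F \<subseteq> \<S>" "\<And>\<eta>. \<eta> \<in> JH ==> s \<eta> = (\<Sum>S\<in>F. c S * of_nat (\<eta> S))"
    by (rule SF_E) blast
  have "cmod (s \<eta>) \<le> (\<Sum>S\<in>F. cmod (c S))" if \<eta>: "\<eta> \<in> JH" for \<eta>
  proof -
    have "cmod (c S * of_nat (\<eta> S)) \<le> cmod (c S)" for S using JH_cases[OF \<eta>, of S] by auto
    then show ?thesis unfolding F(3)[OF \<eta>] by (intro order_trans[OF norm_sum] sum_mono)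
  qed
  then show ?thesis by blast
qed

lemma Rel_bounded: "Rel \<S> b h ==> \<exists>M>0. (\<forall>x. cmod (b x) \<le> M) \<and> (\<forall>\<xi>. cmod (h \<xi>) \<le> M)"
proof -
  assume r: "Rel \<S> b h"
  obtain s where s: "s \<in> SF \<S>" "\<And>x. x \<in> P ==> cmod (b x - s (point x)) \<le> 1" "\<And>\<xi>. \<xi> \<in> Bd ==> cmod (h \<xi> - s \<xi>) \<le> 1"
    using Rel_E[OF r, of 1] by auto
  obtain M where M: "\<And>\<eta>. \<eta> \<in> JH ==> cmod (s \<eta>) \<le> M" using SF_bounded[OF s(1)] by blast
  have tri: "cmod a \<le> \<bar>M\<bar> + 1" if "cmod (a - c) \<le> 1" "cmod c \<le> M" for a c
    using norm_triangle_ineq[of "a - c" c] that by simp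
  have "cmod (b x) \<le> \<bar>M\<bar> + 1" for x
    using tri[OF s(2) M[OF point_JH], of x] Rel_zero_off(1)[OF r, of x] by (cases "x \<in> P") auto
  moreover have "cmod (h \<xi>) \<le> \<bar>M\<bar> + 1" for \<xi>
    using tri[OF s(3) M[OF Bd_JH], of \<xi>] Rel_zero_off(2)[OF r, of \<xi>] by (cases "\<xi> \<in> Bd") auto
  ultimately show ?thesis by (intro exI[of _ "\<bar>M\<bar> + 1"]) auto
qed

lemma Rel_mult:
  assumes r: "Rel J b h" "Rel J b' h'"
  shows "Rel J (\<lambda>x. b x * b' x) (\<lambda>\<xi>. h \<xi> * h' \<xi>)"
proof (rule RelI)
  show "b x * b' x = 0" if "x \<notin> P" for x using r that by (simp add: Rel_zero_off)
  show "h \<xi> * h' \<xi> = 0" if "\<xi> \<notin> Bd" for \<xi> using r that by (simp add: Rel_zero_off)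
  fix e :: real assume e: "e > 0"
  obtain M where M: "M > 0" "\<And>x. cmod (b x) \<le> M" "\<And>\<xi>. cmod (h \<xi>) \<le> M" using Rel_bounded[OF r(1)] by blast
  obtain M' where M': "M' > 0" "\<And>x. cmod (b' x) \<le> M'" "\<And>\<xi>. cmod (h' \<xi>) \<le> M'" using Rel_bounded[OF r(2)] by blast
  \<comment> \<open>With \<open>d \<le> 1\<close> the product estimate is
    \<open>M * d + d * (M' + 1) = d * (M + M' + 1)\<close>.\<close>
  define d where "d = min 1 (e / (M + M' + 1))"
  have d: "d > 0" "d \<le> 1" "d * (M + M' + 1) \<le> e"
  proof -
    have pos: "M + M' + 1 > 0" using M(1) M'(1) by simp
    then show "d > 0" "d \<le> 1" using e by (simp_all add: d_def)
    have "d \<le> e / (M + M' + 1)" by (simp add: d_def)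
    then show "d * (M + M' + 1) \<le> e" using pos by (simp add: pos_le_divide_eq)
  qed
  obtain s where s: "s \<in> SF J" "\<And>x. x \<in> P ==> cmod (b x - s (point x)) \<le> d" "\<And>\<xi>. \<xi> \<in> Bd ==> cmod (h \<xi> - s \<xi>) \<le> d"
    using Rel_E[OF r(1) d(1)] by blast
  obtain t where t: "t \<in> SF J" "\<And>x. x \<in> P ==> cmod (b' x - t (point x)) \<le> d" "\<And>\<xi>. \<xi> \<in> Bd ==> cmod (h' \<xi> - t \<xi>) \<le> d"
    using Rel_E[OF r(2) d(1)] by blast
  have tri: "cmod (a * a' - c * c') \<le> e"
    if "cmod a \<le> M" "cmod a' \<le> M'" "cmod (a - c) \<le> d" "cmod (a' - c') \<le> d" for a a' c c'
  proof -
    have "a * a' - c * c' = a * (a' - c') + (a - c) * c'" by (simp add: algebra_simps)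
    then have "cmod (a * a' - c * c') \<le> cmod a * cmod (a' - c') + cmod (a - c) * cmod c'"
      by (metis norm_mult norm_triangle_ineq)
    also have "\<dots> \<le> M * d + d * (M' + 1)"
    proof (intro add_mono mult_mono)
      show "cmod c' \<le> M' + 1" using norm_triangle_ineq4[of a' "a' - c'"] that d by simp
    qed (use that d M(1) in auto)
    also have "\<dots> = d * (M + M' + 1)" by (simp add: algebra_simps)
    finally show ?thesis using d by linarith
  qed
  have "(\<lambda>\<eta>. s \<eta> * t \<eta>) \<in> SF J" by (rule SF_mult[OF s(1) t(1)]) auto
  then show "\<exists>s\<in>SF J. (\<forall>x\<in>P. cmod (b x * b' x - s (point x)) \<le> e) \<and> (\<forall>\<xi>\<in>Bd. cmod (h \<xi> * h' \<xi> - s \<xi>) \<le> e)"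
    by (intro bexI[of _ "\<lambda>\<eta>. s \<eta> * t \<eta>"] conjI ballI tri s t M M')
qed

lemma Rel_ind: "S \<in> \<S> ==> \<S> \<subseteq> J ==> Rel \<S> (indicator S) (eps S)"
proof (rule RelI)
  assume S: "S \<in> \<S>" "\<S> \<subseteq> J"
  show "indicator S x = 0" if "x \<notin> P" for x using J_subset[of S] S that by (auto simp: indicator_def)
  show "eps S \<xi> = 0" if "\<xi> \<notin> Bd" for \<xi> using that by (simp add: eps_def)
  fix e :: real assume "e > 0"
  then show "\<exists>s\<in>SF \<S>. (\<forall>x\<in>P. cmod (indicator S x - s (point x)) \<le> e) \<and> (\<forall>\<xi>\<in>Bd. cmod (eps S \<xi> - s \<xi>) \<le> e)"
    using S by (intro bexI[of _ "\<lambda>\<eta>. of_nat (\<eta> S)"] SF_ind) (auto simp: eps_def point_def indicator_def)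
qed

lemma Rel_Dr: "Rel J b h ==> b \<in> Dr G P"
  unfolding Dr_def using Rel_closed_span by blast

text \<open>The kernel of the quotient map. A boundary value of an approximant is taken in every
  \<Delta> F, so decay of b along these sets forces h to vanish. Conversely, for a suitable F all
  values of an approximant on \<Delta> F are boundary values, and these are small if h
  vanishes.\<close>

lemma Rel_Dr0:
  assumes r: "Rel J b h" shows "b \<in> {b \<in> Dr G P. \<forall>e>0. \<exists>F. finite F \<and> F \<subseteq> carrier G \<and> (\<forall>x\<in>\<Delta> F. cmod (b x) \<le> e)}
    \<longleftrightarrow> h = (\<lambda>_. 0)"
proof
  assume b: "b \<in> {b \<in> Dr G P. \<forall>e>0. \<exists>F. finite F \<and> F \<subseteq> carrier G \<and> (\<forall>x\<in>\<Delta> F. cmod (b x) \<le> e)}"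
  have "h \<xi> = 0" if \<xi>: "\<xi> \<in> Bd" for \<xi>
  proof -
    have "cmod (h \<xi>) \<le> 0 + e" if "e > 0" for e
    proof -
      have e: "e/3 > 0" using that by simp
      obtain s where s: "s \<in> SF J" "\<And>x. x \<in> P ==> cmod (b x - s (point x)) \<le> e/3" "\<And>\<xi>. \<xi> \<in> Bd ==> cmod (h \<xi> - s \<xi>) \<le> e/3"
        using Rel_E[OF r e] by blast
      obtain F where F: "finite F" "F \<subseteq> carrier G" "\<forall>x\<in>\<Delta> F. cmod (b x) \<le> e/3" using b e by blast
      obtain q where q: "q \<in> \<Delta> F" "s (point q) = s \<xi>" using SF_density[OF s(1) \<xi> F(1,2)] by blast
      have "cmod (s \<xi>) \<le> e/3 + e/3"
        using norm_triangle_ineq4[of "b q" "b q - s (point q)"] s(2)[OF Delta_P[OF q(1)]] F(3) q by force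
      then show ?thesis using norm_triangle_ineq[of "h \<xi> - s \<xi>" "s \<xi>"] s(3)[OF \<xi>] by simp
    qed
    then have "cmod (h \<xi>) \<le> 0" by (rule field_le_epsilon)
    then show ?thesis by simp
  qed
  then show "h = (\<lambda>_. 0)" using Rel_zero_off(2)[OF r] by blast
next
  assume h: "h = (\<lambda>_. 0)"
  have "\<exists>F. finite F \<and> F \<subseteq> carrier G \<and> (\<forall>x\<in>\<Delta> F. cmod (b x) \<le> e)" if "e > 0" for e
  proof -
    have e: "e/2 > 0" using that by simp
    obtain s where s: "s \<in> SF J" "\<And>x. x \<in> P ==> cmod (b x - s (point x)) \<le> e/2" "\<And>\<xi>. \<xi> \<in> Bd ==> cmod (h \<xi> - s \<xi>) \<le> e/2"
      using Rel_E[OF r e] by blast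
    obtain F where F: "finite F" "F \<subseteq> carrier G" "\<And>q. q \<in> \<Delta> F ==> \<exists>\<xi>\<in>Bd. s \<xi> = s (point q)"
      using SF_Delta[OF s(1)] by blast
    have "cmod (b x) \<le> e" if x: "x \<in> \<Delta> F" for x
    proof -
      obtain \<xi> where "\<xi> \<in> Bd" "s \<xi> = s (point x)" using F(3)[OF x] by blast
      then have "cmod (s (point x)) \<le> e/2" using s(3)[of \<xi>] h by simp
      then show ?thesis using norm_triangle_ineq[of "b x - s (point x)" "s (point x)"] s(2)[OF Delta_P[OF x]] by simp
    qed
    then show ?thesis using F by blast
  qed
  then show "b \<in> {b \<in> Dr G P. \<forall>e>0. \<exists>F. finite F \<and> F \<subseteq> carrier G \<and> (\<forall>x\<in>\<Delta> F. cmod (b x) \<le> e)}"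
    using Rel_Dr[OF r] by blast
qed

lemma Rel_zero: "Rel \<S> (\<lambda>_. 0) (\<lambda>_. 0)"
  by (rule RelI) (auto intro!: bexI[OF _ SF_zero])

text \<open>The zero function lies in the kernel, so the boundary function h - h' related to it
  vanishes.\<close>

lemma Rel_unique:
  assumes "Rel J b h" "Rel J b h'"
  shows "h = h'"
proof -
  have "Rel J (\<lambda>x. b x + (- 1) * b x) (\<lambda>\<xi>. h \<xi> + (- 1) * h' \<xi>)" by (intro Rel_add Rel_smult assms)
  then have r: "Rel J (\<lambda>_. 0) (\<lambda>\<xi>. h \<xi> - h' \<xi>)" by simp
  have "(\<lambda>_. 0) \<in> Dr G P" using Rel_Dr[OF Rel_zero] .
  then have "(\<lambda>\<xi>. h \<xi> - h' \<xi>) = (\<lambda>_. 0)"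
    using Rel_Dr0[OF r] by (auto intro!: exI[of _ "{}"])
  then show ?thesis by (simp add: fun_eq_iff)
qed

section \<open>Multiplication operators on square-summable functions\<close>

lemma l2_norm_mult_le:
  assumes \<xi>: "\<xi> \<in> l2_space X" and b: "\<And>x. x \<in> X ==> cmod (b x) \<le> c" and c: "c \<ge> 0"
  shows "l2_norm (\<lambda>p. b p * \<xi> p) \<le> c * l2_norm \<xi>"
proof -
  have s: "(\<lambda>p. (cmod (\<xi> p))\<^sup>2) summable_on UNIV" and z: "\<And>p. p \<notin> X ==> \<xi> p = 0" using \<xi> by (auto simp: l2_space_def)
  have sc: "(\<lambda>p. c\<^sup>2 * (cmod (\<xi> p))\<^sup>2) summable_on UNIV" by (intro summable_on_cmult_right s)
  have le: "(cmod (b p * \<xi> p))\<^sup>2 \<le> c\<^sup>2 * (cmod (\<xi> p))\<^sup>2" for p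
    using b[of p] z[of p] by (cases "p \<in> X") (auto simp: norm_mult power_mult_distrib intro!: mult_right_mono power_mono)
  have "(\<Sum>\<^sub>\<infinity>p. (cmod (b p * \<xi> p))\<^sup>2) \<le> (\<Sum>\<^sub>\<infinity>p. c\<^sup>2 * (cmod (\<xi> p))\<^sup>2)"
    by (rule infsum_mono[OF summable_on_comparison_test[OF sc] sc]) (use le in auto)
  also have "\<dots> = c\<^sup>2 * (\<Sum>\<^sub>\<infinity>p. (cmod (\<xi> p))\<^sup>2)" by (rule infsum_cmult_right[OF s])
  finally show ?thesis
    unfolding l2_norm_def using c real_sqrt_le_mono by (fastforce simp: real_sqrt_mult)
qed

lemma mult_op_norm_le:
  assumes b: "\<And>x. x \<in> X ==> cmod (b x) \<le> c" and c: "c \<ge> 0"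
  shows "0 \<le> mult_op_norm b X" "mult_op_norm b X \<le> c"
proof -
  let ?U = "{\<xi> \<in> l2_space X. l2_norm \<xi> \<le> 1}"
  have z: "(\<lambda>_. 0) \<in> ?U" by (simp add: l2_space_def l2_norm_def)
  have le: "l2_norm (\<lambda>p. b p * \<xi> p) \<le> c" if "\<xi> \<in> ?U" for \<xi>
    using l2_norm_mult_le[of \<xi> X b c] b c that mult_left_mono[of "l2_norm \<xi>" 1 c] by fastforce
  show "mult_op_norm b X \<le> c" unfolding mult_op_norm_def using z le by (intro cSUP_least) auto
  have "l2_norm (\<lambda>p. b p * (\<lambda>_. 0) p) \<le> mult_op_norm b X"
    unfolding mult_op_norm_def using le by (intro cSUP_upper z bdd_aboveI2[of _ _ c]) auto
  then show "0 \<le> mult_op_norm b X" by (simp add: l2_norm_def)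
qed

text \<open>Tested on the unit vector at x. The bound c ensures that the supremum in
  \<open>mult_op_norm\<close> is taken over a bounded set.\<close>

lemma mult_op_norm_ge:
  assumes b: "\<And>x. x \<in> X ==> cmod (b x) \<le> c" and c: "c \<ge> 0" and x: "x \<in> X"
  shows "cmod (b x) \<le> mult_op_norm b X"
proof -
  let ?U = "{\<xi> \<in> l2_space X. l2_norm \<xi> \<le> 1}"
  let ?d = "\<lambda>p. if p = x then 1 else 0 :: complex"
  have inf: "(\<Sum>\<^sub>\<infinity>p. (cmod (a * ?d p))\<^sup>2) = (cmod a)\<^sup>2" for a
  proof -
    have "(\<Sum>\<^sub>\<infinity>p. (cmod (a * ?d p))\<^sup>2) = (\<Sum>\<^sub>\<infinity>p\<in>{x}. (cmod (a * ?d p))\<^sup>2)" by (rule infsum_cong_neutral) auto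
    then show ?thesis by simp
  qed
  have "(\<lambda>p. (cmod (?d p))\<^sup>2) summable_on UNIV \<longleftrightarrow> (\<lambda>p. (cmod (?d p))\<^sup>2) summable_on {x}"
    by (rule summable_on_cong_neutral) auto
  then have d: "?d \<in> ?U" using x inf[of 1] by (simp add: l2_space_def l2_norm_def)
  have le: "l2_norm (\<lambda>p. b p * \<xi> p) \<le> c" if "\<xi> \<in> ?U" for \<xi>
    using l2_norm_mult_le[of \<xi> X b c] b c that mult_left_mono[of "l2_norm \<xi>" 1 c] by fastforce
  have "l2_norm (\<lambda>p. b p * ?d p) \<le> mult_op_norm b X"
    unfolding mult_op_norm_def using le by (intro cSUP_upper d bdd_aboveI2[of _ _ c]) auto
  moreover have "(\<lambda>p. b p * ?d p) = (\<lambda>p. b x * ?d p)" by auto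
  ultimately show ?thesis using inf[of "b x"] by (simp add: l2_norm_def)
qed

text \<open>The operator norm on \<Delta> F is the supremum of the modulus of b there. As \<Delta> F
  shrinks when F grows, a single good F settles all larger ones, which turns the limit into an
  existence statement.\<close>

lemma Dr0_iff:
  "Dr0 G P = {b \<in> Dr G P. \<forall>e>0. \<exists>F. finite F \<and> F \<subseteq> carrier G \<and> (\<forall>x\<in>\<Delta> F. cmod (b x) \<le> e)}"
proof -
  have "((\<lambda>F. mult_op_norm b (\<Delta> F)) \<longlongrightarrow> 0) (finite_subsets_at_top (carrier G)) \<longleftrightarrow>
      (\<forall>e>0. \<exists>F. finite F \<and> F \<subseteq> carrier G \<and> (\<forall>x\<in>\<Delta> F. cmod (b x) \<le> e))" if bD: "b \<in> Dr G P" for b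
  proof -
    obtain h where "Rel J b h" using Rel_exists_right[of b J] bD unfolding Dr_def by blast
    then obtain M where M: "M > 0" "\<And>x. cmod (b x) \<le> M" using Rel_bounded by blast
    have nn: "0 \<le> mult_op_norm b X" for X using mult_op_norm_le(1)[of X b M] M by simp
    show ?thesis
    proof
      assume lim: "((\<lambda>F. mult_op_norm b (\<Delta> F)) \<longlongrightarrow> 0) (finite_subsets_at_top (carrier G))"
      show "\<forall>e>0. \<exists>F. finite F \<and> F \<subseteq> carrier G \<and> (\<forall>x\<in>\<Delta> F. cmod (b x) \<le> e)"
      proof (intro allI impI)
        fix e :: real assume "e > 0"
        then have "\<forall>\<^sub>F F in finite_subsets_at_top (carrier G). mult_op_norm b (\<Delta> F) < e"
          by (rule order_tendstoD(2)[OF lim])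
        then obtain F where F: "finite F" "F \<subseteq> carrier G" "mult_op_norm b (\<Delta> F) < e"
          unfolding eventually_finite_subsets_at_top by blast
        have "cmod (b x) \<le> e" if "x \<in> \<Delta> F" for x
          using mult_op_norm_ge[of "\<Delta> F" b M x] M that F(3) by simp
        then show "\<exists>F. finite F \<and> F \<subseteq> carrier G \<and> (\<forall>x\<in>\<Delta> F. cmod (b x) \<le> e)" using F by blast
      qed
    next
      assume *: "\<forall>e>0. \<exists>F. finite F \<and> F \<subseteq> carrier G \<and> (\<forall>x\<in>\<Delta> F. cmod (b x) \<le> e)"
      show "((\<lambda>F. mult_op_norm b (\<Delta> F)) \<longlongrightarrow> 0) (finite_subsets_at_top (carrier G))"
      proof (rule tendstoI)
        fix e :: real assume "e > 0"
        then have "e/2 > 0" by simp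
        then obtain F where F: "finite F" "F \<subseteq> carrier G" "\<forall>x\<in>\<Delta> F. cmod (b x) \<le> e/2" using * by blast
        have "dist (mult_op_norm b (\<Delta> F')) 0 < e" if "F \<subseteq> F'" for F'
          using mult_op_norm_le(2)[of "\<Delta> F'" b "e/2"] F(3) Delta_mono[OF that] \<open>e > 0\<close> nn[of "\<Delta> F'"] by (fastforce simp: dist_norm)
        then show "\<forall>\<^sub>F F in finite_subsets_at_top (carrier G). dist (mult_op_norm b (\<Delta> F)) 0 < e"
          using F(1,2) unfolding eventually_finite_subsets_at_top by blast
      qed
    qed
  qed
  then show ?thesis unfolding Dr0_def by blast
qed

lemma Rel_Dr0_iff: "Rel J b h ==> b \<in> Dr0 G P \<longleftrightarrow> h = (\<lambda>_. 0)"
  unfolding Dr0_iff by (rule Rel_Dr0)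

text \<open>The translated approximant serves P and the boundary at once, so the quotient map
  intertwines the two partial actions.\<close>

lemma Rel_gamma:
  assumes g: "g \<in> carrier G" and r: "Rel (JJ (inv g)) b h"
  shows "Rel (JJ g) (gamma G g b) (BA g h)"
proof (rule RelI)
  show "BA g h \<xi> = 0" if "\<xi> \<notin> Bd" for \<xi> using that V_Bd by (auto simp: BA_eq)
  have ap: "\<exists>t\<in>SF (JJ g). (\<forall>x. cmod (gamma G g b x - restr t x) \<le> e) \<and> (\<forall>\<xi>\<in>Bd. cmod (BA g h \<xi> - t \<xi>) \<le> e)"
    if e: "e > 0" for e
  proof -
    obtain s where s: "s \<in> SF (JJ (inv g))" "\<And>x. x \<in> P ==> cmod (b x - s (point x)) \<le> e" "\<And>\<xi>. \<xi> \<in> Bd ==> cmod (h \<xi> - s \<xi>) \<le> e"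
      using Rel_E[OF r e] by blast
    obtain t where t0: "t \<in> SF (JJ g)" "\<forall>\<eta>\<in>Bd. t \<eta> = (if \<eta> \<in> V g then s (act (inv g) \<eta>) else 0)"
      "\<forall>x\<in>carrier G. restr t x = restr s (inv g \<otimes> x)"
      using SF_translate[OF g s(1)] unfolding restr_def by blast
    note t = t0(1) t0(2)[rule_format] t0(3)[rule_format]
    have "cmod (gamma G g b x - restr t x) \<le> e" for x
    proof (cases "x \<in> carrier G")
      case True
      have "cmod (b y - restr s y) \<le> e" for y
        using s(2)[of y] Rel_zero_off(1)[OF r, of y] e by (cases "y \<in> P") (auto simp: restr_def)
      then show ?thesis using True by (simp add: gamma_def t(3))
    next
      case False
      then have "x \<notin> P" by auto
      then show ?thesis using False e by (simp add: gamma_def restr_def)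
    qed
    moreover have "cmod (BA g h \<xi> - t \<xi>) \<le> e" if "\<xi> \<in> Bd" for \<xi>
      using t(2)[OF that] s(3)[OF V_Bd[OF act_inv_V[OF g]], of \<xi>] e by (auto simp: BA_eq)
    ultimately show ?thesis using t(1) by blast
  qed
  show "gamma G g b x = 0" if x: "x \<notin> P" for x
  proof -
    have "cmod (gamma G g b x) \<le> 0 + e" if e: "e > 0" for e
    proof -
      obtain t where "\<forall>x. cmod (gamma G g b x - restr t x) \<le> e" using ap[OF e] by blast
      from spec[OF this, of x] show ?thesis using x by (simp add: restr_def)
    qed
    then have "cmod (gamma G g b x) \<le> 0" by (rule field_le_epsilon)
    then show ?thesis by simp
  qed
  fix e :: real assume "e > 0"
  from ap[OF this] show "\<exists>s\<in>SF (JJ g). (\<forall>x\<in>P. cmod (gamma G g b x - s (point x)) \<le> e) \<and> (\<forall>\<xi>\<in>Bd. cmod (BA g h \<xi> - s \<xi>) \<le> e)"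
    by (metis restr_def)
qed

section \<open>The quotient map and its fibres\<close>

abbreviation "DR \<equiv> Dr_alg G P"
abbreviation "D0 \<equiv> Dr0 G P"

text \<open>The quotient map from the diagonal algebra to the functions on the boundary; by
  \<open>Rel_unique\<close> the choice is forced.\<close>

definition \<kappa> :: "('g => complex) => ('g set => nat) => complex" where
  "\<kappa> b = (SOME h. Rel J b h)"

lemma DR_carrier: "carrier DR = Dr G P"
  by (simp add: Dr_alg_def fun_star_alg_def)

lemma DR_ops:
  "mult DR a b = (\<lambda>x. a x * b x)" "add DR a b = (\<lambda>x. a x + b x)" "one DR = indicator P"
  "zero DR = (\<lambda>_. 0)" "smult DR c a = (\<lambda>x. c * a x)" "star DR a = (\<lambda>x. cnj (a x))"
  by (simp_all add: Dr_alg_def fun_star_alg_def)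

lemma Rel_\<kappa>: "b \<in> Dr G P ==> Rel J b (\<kappa> b)"
proof -
  assume "b \<in> Dr G P"
  then have "\<exists>h. Rel J b h" unfolding Dr_def by (rule Rel_exists_right) simp
  then show ?thesis unfolding \<kappa>_def by (rule someI_ex)
qed

lemma \<kappa>_eq: "Rel J b h ==> \<kappa> b = h"
  using Rel_unique Rel_\<kappa> Rel_Dr by blast

lemma \<kappa>_CB: "b \<in> Dr G P ==> \<kappa> b \<in> carrier CB"
  using Rel_BI[of \<one> b "\<kappa> b"] Rel_\<kappa> unfolding JJ_one CB_BI by blast

lemma eps_P: "eps P = indicator Bd"
  using JH_P[OF Bd_JH] by (auto simp: eps_def indicator_def fun_eq_iff)

lemma \<kappa>_onto: "h \<in> carrier CB ==> \<exists>b\<in>Dr G P. \<kappa> b = h"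
  using Rel_exists_left[of h \<one>] \<kappa>_eq Rel_Dr unfolding JJ_one CB_BI by blast

lemma \<kappa>_ind: "S \<in> J ==> \<kappa> (indicator S) = eps S" "S \<in> J ==> indicator S \<in> Dr G P"
  using \<kappa>_eq[OF Rel_ind[of S J]] Rel_Dr[OF Rel_ind[of S J]] by auto

lemma star_algebra_DR: "star_algebra DR"
proof (rule star_algebraI)
  fix x y z assume x: "x \<in> carrier DR"
  note rx = Rel_\<kappa>[OF x[unfolded DR_carrier]]
  show "c \<odot>\<^bsub>DR\<^esub> x \<in> carrier DR" for c unfolding DR_carrier DR_ops by (rule Rel_Dr[OF Rel_smult[OF rx]])
  show "star DR x \<in> carrier DR" unfolding DR_carrier DR_ops by (rule Rel_Dr[OF Rel_cnj[OF rx]])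
  have off: "x p = 0" if "p \<notin> P" for p using Rel_zero_off(1)[OF rx that] .
  show "\<one>\<^bsub>DR\<^esub> \<otimes>\<^bsub>DR\<^esub> x = x" "x \<otimes>\<^bsub>DR\<^esub> \<one>\<^bsub>DR\<^esub> = x" using off by (auto simp: DR_ops indicator_def fun_eq_iff)
  assume y: "y \<in> carrier DR"
  note ry = Rel_\<kappa>[OF y[unfolded DR_carrier]]
  show "x \<oplus>\<^bsub>DR\<^esub> y \<in> carrier DR" unfolding DR_carrier DR_ops by (rule Rel_Dr[OF Rel_add[OF rx ry]])
  show "x \<otimes>\<^bsub>DR\<^esub> y \<in> carrier DR" unfolding DR_carrier DR_ops by (rule Rel_Dr[OF Rel_mult[OF rx ry]])
next
  show "\<zero>\<^bsub>DR\<^esub> \<in> carrier DR" unfolding DR_carrier DR_ops by (rule Rel_Dr[OF Rel_zero])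
  show "\<one>\<^bsub>DR\<^esub> \<in> carrier DR" unfolding DR_carrier DR_ops by (rule \<kappa>_ind(2)[OF P_J])
qed (simp_all add: DR_ops algebra_simps)

lemma \<kappa>_star_hom: "\<kappa> \<in> star_hom DR CB"
proof (rule star_homI)
  fix x y assume x: "x \<in> carrier DR"
  note rx = Rel_\<kappa>[OF x[unfolded DR_carrier]]
  show "\<kappa> x \<in> carrier CB" using x \<kappa>_CB by (simp add: DR_carrier)
  show "\<kappa> (c \<odot>\<^bsub>DR\<^esub> x) = c \<odot>\<^bsub>CB\<^esub> \<kappa> x" for c unfolding DR_ops CB_ops by (rule \<kappa>_eq[OF Rel_smult[OF rx]])
  show "\<kappa> (star DR x) = star CB (\<kappa> x)" unfolding DR_ops CB_ops by (rule \<kappa>_eq[OF Rel_cnj[OF rx]])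
  assume y: "y \<in> carrier DR"
  note ry = Rel_\<kappa>[OF y[unfolded DR_carrier]]
  show "\<kappa> (x \<oplus>\<^bsub>DR\<^esub> y) = \<kappa> x \<oplus>\<^bsub>CB\<^esub> \<kappa> y" unfolding DR_ops CB_ops by (rule \<kappa>_eq[OF Rel_add[OF rx ry]])
  show "\<kappa> (x \<otimes>\<^bsub>DR\<^esub> y) = \<kappa> x \<otimes>\<^bsub>CB\<^esub> \<kappa> y" unfolding DR_ops CB_ops by (rule \<kappa>_eq[OF Rel_mult[OF rx ry]])
next
  show "\<kappa> \<one>\<^bsub>DR\<^esub> = \<one>\<^bsub>CB\<^esub>" unfolding DR_ops CB_ops using \<kappa>_ind(1)[OF P_J] eps_P by simp
qed

text \<open>Shows in particular that \<open>D0\<close> is an ideal, on which the ring structure of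
  the quotient rests.\<close>

lemma D0_kernel: "D0 = a_kernel DR CB \<kappa>"
proof -
  have "D0 \<subseteq> Dr G P" by (auto simp: Dr0_def)
  then show ?thesis
    using Rel_Dr0_iff[OF Rel_\<kappa>] by (auto simp: a_kernel_def' CB_ops DR_carrier)
qed

lemma \<kappa>_ring_hom: "ring_hom_ring DR CB \<kappa>"
  using \<kappa>_star_hom star_algebra.ring_A[OF star_algebra_DR] star_algebra.ring_A[OF star_algebra_CB]
  by (intro ring_hom_ringI2) (auto simp: star_hom_def)

abbreviation "DQ \<equiv> Dr_quot G P"

text \<open>The fibre of \<kappa> over h, which is a coset of \<open>D0\<close>. In this notation
  the quotient algebra is a renaming of the algebra of functions on the boundary.\<close>

definition level :: "(('g set => nat) => complex) => ('g => complex) set" where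
  "level h = {b \<in> Dr G P. \<kappa> b = h}"

lemma coset_level: "a \<in> Dr G P ==> D0 +>\<^bsub>DR\<^esub> a = level (\<kappa> a)"
proof -
  assume a: "a \<in> Dr G P"
  interpret DR: star_algebra DR by (rule star_algebra_DR)
  note hD = star_homD[OF \<kappa>_star_hom]
  note hd = star_hom_diff[OF \<kappa>_star_hom star_algebra_DR star_algebra_CB]
  interpret CB: star_algebra CB by (rule star_algebra_CB)
  show ?thesis
  proof (rule Set.set_eqI, rule iffI)
    fix b assume "b \<in> D0 +>\<^bsub>DR\<^esub> a"
    then obtain d where d: "d \<in> D0" "b = d \<oplus>\<^bsub>DR\<^esub> a" by (auto simp: a_r_coset_def r_coset_def)
    have dD: "d \<in> Dr G P" "\<kappa> d = \<zero>\<^bsub>CB\<^esub>" using d(1) unfolding D0_kernel a_kernel_def' DR_carrier by auto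
    have "b \<in> Dr G P" using d dD a DR.alg_a_closed[of d a] by (simp add: DR_carrier)
    moreover have "\<kappa> b = \<kappa> a" unfolding d(2) using dD a \<kappa>_CB[OF a] by (simp add: hD DR_carrier CB.alg_l_zero)
    ultimately show "b \<in> level (\<kappa> a)" by (simp add: level_def)
  next
    fix b assume "b \<in> level (\<kappa> a)"
    then have b: "b \<in> Dr G P" "\<kappa> b = \<kappa> a" by (auto simp: level_def)
    have "\<kappa> (b \<ominus>\<^bsub>DR\<^esub> a) = \<zero>\<^bsub>CB\<^esub>" using b a \<kappa>_CB[OF a] by (simp add: hd DR_carrier)
    moreover have "b \<ominus>\<^bsub>DR\<^esub> a \<in> Dr G P" using DR.diff_closed[of b a] a b by (simp add: DR_carrier)
    ultimately have "b \<ominus>\<^bsub>DR\<^esub> a \<in> D0" unfolding D0_kernel a_kernel_def' DR_carrier by blast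
    moreover have "b = (b \<ominus>\<^bsub>DR\<^esub> a) \<oplus>\<^bsub>DR\<^esub> a" using DR.diff_add_cancel[of b a] a b by (simp add: DR_carrier)
    ultimately show "b \<in> D0 +>\<^bsub>DR\<^esub> a" unfolding a_r_coset_def r_coset_def by auto
  qed
qed

lemma level_nonempty: "h \<in> carrier CB ==> level h \<noteq> {}"
  using \<kappa>_onto by (auto simp: level_def)

lemma level_inj: "[|h \<in> carrier CB; level h = level h'|] ==> h = h'"
  using level_nonempty[of h] by (auto simp: level_def)

lemma DQ_carrier: "carrier DQ = level ` carrier CB"
proof -
  have "carrier DQ = (\<lambda>a. D0 +>\<^bsub>DR\<^esub> a) ` Dr G P"
    by (auto simp: Dr_quot_def quot_star_alg_def FactRing_def A_RCOSETS_def RCOSETS_def a_r_coset_def DR_carrier)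
  also have "\<dots> = level ` \<kappa> ` Dr G P" by (simp add: image_image coset_level cong: image_cong)
  also have "\<kappa> ` Dr G P = carrier CB" using \<kappa>_onto \<kappa>_CB by blast
  finally show ?thesis .
qed

lemma UN_level:
  assumes "h \<in> carrier CB" "\<And>a. [|a \<in> Dr G P; \<kappa> a = h|] ==> F a = c"
  shows "(\<Union>a\<in>level h. F a) = c"
  using level_nonempty[OF assms(1)] assms(2) by (auto simp: level_def)

text \<open>Sums and products are those of cosets of an ideal; scalar multiples and adjoints are
  unions over representatives, which collapse because all representatives give the same
  fibre.\<close>

lemma DQ_ops:
  "[|h \<in> carrier CB; h' \<in> carrier CB|] ==> level h \<otimes>\<^bsub>DQ\<^esub> level h' = level (h \<otimes>\<^bsub>CB\<^esub> h')"
  "[|h \<in> carrier CB; h' \<in> carrier CB|] ==> level h \<oplus>\<^bsub>DQ\<^esub> level h' = level (h \<oplus>\<^bsub>CB\<^esub> h')"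
  "\<one>\<^bsub>DQ\<^esub> = level \<one>\<^bsub>CB\<^esub>" "\<zero>\<^bsub>DQ\<^esub> = level \<zero>\<^bsub>CB\<^esub>"
  "h \<in> carrier CB ==> c \<odot>\<^bsub>DQ\<^esub> level h = level (c \<odot>\<^bsub>CB\<^esub> h)"
  "h \<in> carrier CB ==> star DQ (level h) = level (star CB h)"
proof -
  interpret h: ring_hom_ring DR CB \<kappa> by (rule \<kappa>_ring_hom)
  interpret DR: star_algebra DR by (rule star_algebra_DR)
  have id: "ideal D0 DR" unfolding D0_kernel by (rule h.kernel_is_ideal)
  interpret I: ideal D0 DR by (rule id)
  note hD = star_homD[OF \<kappa>_star_hom]
  have dq: "carrier DQ = carrier (DR Quot D0)" "mult DQ = mult (DR Quot D0)" "one DQ = one (DR Quot D0)"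
    "zero DQ = zero (DR Quot D0)" "add DQ = add (DR Quot D0)"
    "smult DQ = (\<lambda>c X. \<Union>a\<in>X. D0 +>\<^bsub>DR\<^esub> (c \<odot>\<^bsub>DR\<^esub> a))" "star DQ = (\<lambda>X. \<Union>a\<in>X. D0 +>\<^bsub>DR\<^esub> star DR a)"
    by (simp_all add: Dr_quot_def quot_star_alg_def)
  show "\<one>\<^bsub>DQ\<^esub> = level \<one>\<^bsub>CB\<^esub>"
    unfolding dq using coset_level[of "\<one>\<^bsub>DR\<^esub>"] DR.alg_one_closed by (simp add: FactRing_def DR_carrier hD)
  have "\<zero>\<^bsub>DR Quot D0\<^esub> = D0" by (simp add: FactRing_def)
  also have "D0 = level \<zero>\<^bsub>CB\<^esub>" unfolding level_def by (rule D0_kernel[unfolded a_kernel_def' DR_carrier])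
  finally show "\<zero>\<^bsub>DQ\<^esub> = level \<zero>\<^bsub>CB\<^esub>" unfolding dq .
  fix h assume h: "h \<in> carrier CB"
  obtain a where a: "a \<in> Dr G P" "\<kappa> a = h" using \<kappa>_onto[OF h] by blast
  show "c \<odot>\<^bsub>DQ\<^esub> level h = level (c \<odot>\<^bsub>CB\<^esub> h)"
    unfolding dq
  proof (rule UN_level[OF h])
    fix b assume "b \<in> Dr G P" "\<kappa> b = h"
    then show "D0 +>\<^bsub>DR\<^esub> (c \<odot>\<^bsub>DR\<^esub> b) = level (c \<odot>\<^bsub>CB\<^esub> h)"
      using coset_level[of "c \<odot>\<^bsub>DR\<^esub> b"] DR.smult_closed'[of b c] hD(5)[of b c] by (simp add: DR_carrier)
  qed
  show "star DQ (level h) = level (star CB h)"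
    unfolding dq
  proof (rule UN_level[OF h])
    fix b assume "b \<in> Dr G P" "\<kappa> b = h"
    then show "D0 +>\<^bsub>DR\<^esub> star DR b = level (star CB h)"
      using coset_level[of "star DR b"] DR.star_closed[of b] hD(6)[of b] by (simp add: DR_carrier)
  qed
  assume h': "h' \<in> carrier CB"
  obtain a' where a': "a' \<in> Dr G P" "\<kappa> a' = h'" using \<kappa>_onto[OF h'] by blast
  have l: "level h = D0 +>\<^bsub>DR\<^esub> a" "level h' = D0 +>\<^bsub>DR\<^esub> a'" using coset_level a a' by auto
  have c: "a \<in> carrier DR" "a' \<in> carrier DR" using a a' by (auto simp: DR_carrier)
  show "level h \<otimes>\<^bsub>DQ\<^esub> level h' = level (h \<otimes>\<^bsub>CB\<^esub> h')"
    unfolding dq l using I.rcoset_mult_add[OF c] coset_level[of "a \<otimes>\<^bsub>DR\<^esub> a'"] DR.alg_m_closed[OF c] hD(2)[OF c] a a'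
    by (simp add: FactRing_def DR_carrier)
  show "level h \<oplus>\<^bsub>DQ\<^esub> level h' = level (h \<oplus>\<^bsub>CB\<^esub> h')"
    unfolding dq l using I.a_rcos_sum[OF c] coset_level[of "a \<oplus>\<^bsub>DR\<^esub> a'"] DR.alg_a_closed[OF c] hD(3)[OF c] a a'
    by (simp add: FactRing_def DR_carrier)
qed

abbreviation "DI \<equiv> dot_gamma_ideal G P"
abbreviation "DA \<equiv> dot_gamma G P"

lemma gamma_ideal_Rel: "gamma_ideal G P g = {b. \<exists>h. Rel (JJ g) b h}"
proof -
  have "gamma_ideal G P g = closed_indicator_span (JJ g)" by (simp add: gamma_ideal_def JJ_def)
  then show ?thesis using Rel_exists_right[OF _ JJ_subset_J] Rel_closed_span[OF _ JJ_subset_J] by blast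
qed

lemma DI_eq: "DI g = level ` BI g"
proof -
  have "DI g = (\<lambda>b. level (\<kappa> b)) ` {b. \<exists>h. Rel (JJ g) b h}"
    unfolding dot_gamma_ideal_def gamma_ideal_Rel
    using coset_level Rel_Dr[OF Rel_mono[OF _ JJ_subset_J]] by (intro image_cong) auto
  also have "\<dots> = level ` BI g"
  proof
    show "(\<lambda>b. level (\<kappa> b)) ` {b. \<exists>h. Rel (JJ g) b h} \<subseteq> level ` BI g"
      using \<kappa>_eq[OF Rel_mono[OF _ JJ_subset_J]] Rel_BI by force
    show "level ` BI g \<subseteq> (\<lambda>b. level (\<kappa> b)) ` {b. \<exists>h. Rel (JJ g) b h}"
      using \<kappa>_eq[OF Rel_mono[OF _ JJ_subset_J]] Rel_exists_left by fastforce
  qed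
  finally show ?thesis .
qed

text \<open>The union in \<open>dot_gamma\<close> runs over representatives in the ideal for
  \<open>inv g\<close>. By \<open>Rel_exists_left\<close> there is one, and all of them lead to the
  same coset since \<open>Rel_gamma\<close> applies to each.\<close>

lemma DA_level:
  assumes g: "g \<in> carrier G" and h: "h \<in> BI (inv g)"
  shows "DA g (level h) = level (BA g h)"
proof -
  have eq: "D0 +>\<^bsub>DR\<^esub> gamma G g a = level (BA g h)" if a: "a \<in> level h" "a \<in> gamma_ideal G P (inv g)" for a
  proof -
    obtain h' where r: "Rel (JJ (inv g)) a h'" using a(2) gamma_ideal_Rel by blast
    have "h' = h" using \<kappa>_eq[OF Rel_mono[OF r JJ_subset_J]] a(1) by (simp add: level_def)
    then have "Rel (JJ g) (gamma G g a) (BA g h)" using Rel_gamma[OF g] r by blast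
    then have r': "Rel J (gamma G g a) (BA g h)" using Rel_mono JJ_subset_J by blast
    show ?thesis using coset_level[OF Rel_Dr[OF r']] \<kappa>_eq[OF r'] by simp
  qed
  obtain b where b: "Rel (JJ (inv g)) b h" using Rel_exists_left[OF h] by blast
  have "b \<in> level h \<inter> gamma_ideal G P (inv g)"
    using b \<kappa>_eq[OF Rel_mono[OF b JJ_subset_J]] Rel_Dr[OF Rel_mono[OF b JJ_subset_J]] gamma_ideal_Rel by (auto simp: level_def)
  then show ?thesis unfolding dot_gamma_def using eq by (intro UN_constant_eq[of b]) auto
qed

lemma star_algebra_DQ: "star_algebra DQ"
  by (rule star_algebra_image[OF star_algebra_CB, of level]) (simp_all add: DQ_carrier DQ_ops)

lemma level_star_hom: "level \<in> star_hom CB DQ"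
  by (rule star_homI) (simp_all add: DQ_carrier DQ_ops)

abbreviation "PQ \<equiv> partial_sections G DQ DI DA"

definition lift :: "('g => ('g set => nat) => complex) => 'g => ('g => complex) set" where
  "lift s = (\<lambda>g. level (s g))"

lemma level_zero_iff: "h \<in> carrier CB ==> level h = \<zero>\<^bsub>DQ\<^esub> \<longleftrightarrow> h = (\<lambda>_. 0)"
  using level_inj[of h "\<zero>\<^bsub>CB\<^esub>"] by (auto simp: DQ_ops CB_ops)

lemma lift_supp: "s \<in> carrier PS ==> {g \<in> carrier G. lift s g \<noteq> \<zero>\<^bsub>DQ\<^esub>} = supp s"
  using level_zero_iff[OF PS_CB] by (auto simp: lift_def supp_def)

lemma lift_onto: "lift ` carrier PS = carrier PQ"
proof
  have CB0: "(\<lambda>_. 0) \<in> carrier CB" by (simp add: CB_carrier)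
  show "lift ` carrier PS \<subseteq> carrier PQ"
  proof
    fix t assume "t \<in> lift ` carrier PS"
    then obtain s where s: "s \<in> carrier PS" "t = lift s" by blast
    have off: "t g = \<zero>\<^bsub>DQ\<^esub>" if "g \<notin> carrier G" for g
      using PS_off[OF s(1) that] level_zero_iff[OF CB0] by (simp add: s lift_def)
    then have "{g. t g \<noteq> \<zero>\<^bsub>DQ\<^esub>} = supp s" using lift_supp[OF s(1)] s(2) by auto
    moreover have "t g \<in> DI g" if "g \<in> carrier G" for g using PS_BI[OF s(1) that] by (simp add: s lift_def DI_eq)
    ultimately show "t \<in> carrier PQ" using off PS_supp[OF s(1)] by (simp add: partial_sections_def)
  qed
  show "carrier PQ \<subseteq> lift ` carrier PS"
  proof
    fix t assume "t \<in> carrier PQ"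
    then have t: "finite {g. t g \<noteq> \<zero>\<^bsub>DQ\<^esub>}" "\<And>g. g \<in> carrier G ==> t g \<in> level ` BI g"
      "\<And>g. g \<notin> carrier G ==> t g = \<zero>\<^bsub>DQ\<^esub>" by (auto simp: partial_sections_def DI_eq)
    have "\<exists>a. t g = level a \<and> (if g \<in> carrier G then a \<in> BI g else a = (\<lambda>_. 0))" for g
      using t(2)[of g] t(3)[of g] level_zero_iff[OF CB0] by (cases "g \<in> carrier G") auto
    then obtain s where s: "\<And>g. t g = level (s g)" "\<And>g. if g \<in> carrier G then s g \<in> BI g else s g = (\<lambda>_. 0)" by metis
    have "s g \<in> carrier CB" for g using s(2)[of g] CB0 by (auto simp: BI_iff split: if_splits)
    then have "s g = (\<lambda>_. 0)" if "g \<notin> {g. t g \<noteq> \<zero>\<^bsub>DQ\<^esub>}" for g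
      using that s(1)[of g] level_zero_iff[of "s g"] by simp
    then have "s \<in> carrier PS" using s(2) by (intro PS_I[OF t(1)]) (auto split: if_splits)
    moreover have "t = lift s" using s(1) by (auto simp: lift_def)
    ultimately show "t \<in> lift ` carrier PS" by blast
  qed
qed

lemma lift_inj: "inj_on lift (carrier PS)"
proof (rule inj_onI, rule ext)
  fix s t g assume "s \<in> carrier PS" "t \<in> carrier PS" "lift s = lift t"
  then show "s g = t g" using level_inj[OF PS_CB, of s g "t g"] by (simp add: lift_def fun_eq_iff)
qed

lemma lift_delta: "delta_section DQ (level a) g = lift (delta_section CB a g)"
  unfolding lift_def delta_section_def DQ_ops(4) by (rule ext) auto

lemma lift_mult:
  assumes x: "x \<in> carrier PS" and y: "y \<in> carrier PS"
  shows "lift (x \<otimes>\<^bsub>PS\<^esub> y) = lift x \<otimes>\<^bsub>PQ\<^esub> lift y"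
proof
  fix k
  show "lift (x \<otimes>\<^bsub>PS\<^esub> y) k = (lift x \<otimes>\<^bsub>PQ\<^esub> lift y) k"
  proof (cases "k \<in> carrier G")
    case True
    define f where "f g = BA g (BA (inv g) (x g) \<otimes>\<^bsub>CB\<^esub> y (inv g \<otimes> k))" for g
    have g: "f g \<in> carrier CB \<and> DA g (DA (inv g) (lift x g) \<otimes>\<^bsub>DQ\<^esub> lift y (inv g \<otimes> k)) = level (f g)"
      if "g \<in> supp x" for g
    proof -
      have g: "g \<in> carrier G" using that supp_carrier by blast
      have a: "BA (inv g) (x g) \<in> BI (inv g)" using BA_BI[of "inv g" "x g"] PS_BI[OF x g] g by simp
      have m: "BA (inv g) (x g) \<otimes>\<^bsub>CB\<^esub> y (inv g \<otimes> k) \<in> BI (inv g)" unfolding CB_ops by (rule BI_mult[OF a PS_CB[OF y]])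
      have "DA (inv g) (lift x g) = level (BA (inv g) (x g))"
        unfolding lift_def using DA_level[of "inv g" "x g"] PS_BI[OF x g] g by simp
      then have "DA (inv g) (lift x g) \<otimes>\<^bsub>DQ\<^esub> lift y (inv g \<otimes> k) = level (BA (inv g) (x g) \<otimes>\<^bsub>CB\<^esub> y (inv g \<otimes> k))"
        using a PS_CB[OF y] by (simp add: lift_def DQ_ops BI_iff)
      then show ?thesis unfolding f_def using DA_level[OF g m] BA_BI[OF g m] by (simp add: BI_iff)
    qed
    have "(lift x \<otimes>\<^bsub>PQ\<^esub> lift y) k = finsum DQ (\<lambda>g. DA g (DA (inv g) (lift x g) \<otimes>\<^bsub>DQ\<^esub> lift y (inv g \<otimes> k))) (supp x)"
      using True unfolding lift_supp[OF x, symmetric] by (simp add: partial_sections_def)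
    also have "\<dots> = finsum DQ (\<lambda>g. level (f g)) (supp x)"
      using g star_homD(1)[OF level_star_hom]
      by (intro star_algebra.alg_finsum_cong'[OF star_algebra_DQ]) auto
    also have "\<dots> = level (finsum CB f (supp x))"
      using g by (intro star_hom_finsum[OF level_star_hom star_algebra_CB star_algebra_DQ PS_supp[OF x], symmetric]) auto
    also have "finsum CB f (supp x) = (x \<otimes>\<^bsub>PS\<^esub> y) k"
      using True by (simp add: partial_sections_def f_def[abs_def] supp_def CB_ops)
    finally show ?thesis by (simp add: lift_def)
  next
    case False
    then show ?thesis by (simp add: lift_def partial_sections_def DQ_ops)
  qed
qed

lemma lift_ops:
  assumes x: "x \<in> carrier PS"
  shows "y \<in> carrier PS ==> lift (x \<oplus>\<^bsub>PS\<^esub> y) = lift x \<oplus>\<^bsub>PQ\<^esub> lift y"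
    and "lift (c \<odot>\<^bsub>PS\<^esub> x) = c \<odot>\<^bsub>PQ\<^esub> lift x"
    and "lift (star PS x) = star PQ (lift x)"
proof -
  show "lift (x \<oplus>\<^bsub>PS\<^esub> y) = lift x \<oplus>\<^bsub>PQ\<^esub> lift y" if "y \<in> carrier PS"
    using PS_CB[OF x] PS_CB[OF that] by (simp add: lift_def partial_sections_def DQ_ops)
  show "lift (c \<odot>\<^bsub>PS\<^esub> x) = c \<odot>\<^bsub>PQ\<^esub> lift x"
    using PS_CB[OF x] by (simp add: lift_def partial_sections_def DQ_ops)
  have "DA g (star DQ (level (x (inv g)))) = level (BA g (star CB (x (inv g))))" if g: "g \<in> carrier G" for g
  proof -
    have "star CB (x (inv g)) \<in> BI (inv g)" unfolding CB_ops using g by (intro BI_cnj PS_BI[OF x]) simp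
    then show ?thesis using DA_level[OF g] PS_CB[OF x] by (simp add: DQ_ops)
  qed
  then show "lift (star PS x) = star PQ (lift x)"
    by (auto simp: lift_def partial_sections_def DQ_ops fun_eq_iff)
qed

lemma lift_one: "lift \<one>\<^bsub>PS\<^esub> = \<one>\<^bsub>PQ\<^esub>" "lift \<zero>\<^bsub>PS\<^esub> = \<zero>\<^bsub>PQ\<^esub>"
  by (auto simp: lift_def partial_sections_def DQ_ops delta_section_def fun_eq_iff)

lemma star_algebra_PQ: "star_algebra PQ"
  by (rule star_algebra_image[OF star_algebra_PS lift_onto]) (simp_all add: lift_mult lift_ops lift_one)

lemma lift_star_hom: "lift \<in> star_hom PS PQ"
  by (rule star_homI) (use lift_onto in \<open>auto simp: lift_mult lift_ops lift_one\<close>)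

end

section \<open>Suprema of C*-seminorms\<close>

lemma cstar_seminormD:
  assumes "cstar_seminorm A p"
  shows "x \<in> carrier A ==> 0 \<le> p x"
    and "[|x \<in> carrier A; y \<in> carrier A|] ==> p (x \<oplus>\<^bsub>A\<^esub> y) \<le> p x + p y"
    and "x \<in> carrier A ==> p (c \<odot>\<^bsub>A\<^esub> x) = cmod c * p x"
    and "[|x \<in> carrier A; y \<in> carrier A|] ==> p (x \<otimes>\<^bsub>A\<^esub> y) \<le> p x * p y"
    and "x \<in> carrier A ==> p (star A x \<otimes>\<^bsub>A\<^esub> x) = (p x)\<^sup>2"
  using assms unfolding cstar_seminorm_def by blast+

lemma cstar_seminorm_zero: "cstar_seminorm A (\<lambda>_. 0)"
  by (simp add: cstar_seminorm_def)

lemma cstar_seminorm_pullback: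
  assumes A: "star_algebra A" and h: "h \<in> star_hom A B" and q: "cstar_seminorm B q"
  shows "cstar_seminorm A (\<lambda>x. q (h x))"
proof -
  note D = cstar_seminormD[OF q] and hD = star_homD[OF h]
  note sc = star_algebra.star_closed[OF A]
  show ?thesis
    unfolding cstar_seminorm_def
    by (intro conjI ballI allI) (simp_all add: D hD sc)
qed

lemma cstar_seminorm_cong:
  assumes A: "star_algebra A" and eq: "\<And>x. x \<in> carrier A ==> p x = q x" and q: "cstar_seminorm A q"
  shows "cstar_seminorm A p"
proof -
  interpret A: star_algebra A by fact
  note D = cstar_seminormD[OF q]
  show ?thesis
    unfolding cstar_seminorm_def
    by (intro conjI ballI allI) (simp_all add: eq D A.alg_a_closed A.alg_m_closed A.star_closed)
qed

lemma cstar_seminorm_SUP: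
  assumes A: "star_algebra A" and S: "S \<noteq> {}" "\<And>p. p \<in> S ==> cstar_seminorm A p"
    and bound: "\<And>p x. [|p \<in> S; x \<in> carrier A|] ==> p x \<le> M x"
  shows "cstar_seminorm A (\<lambda>x. SUP p\<in>S. p x)"
proof -
  interpret A: star_algebra A by fact
  let ?N = "\<lambda>x. SUP p\<in>S. p x"
  have up: "p x \<le> ?N x" if p: "p \<in> S" and x: "x \<in> carrier A" for p x
  proof (rule cSUP_upper[OF p])
    show "bdd_above ((\<lambda>p. p x) ` S)" using bound[OF _ x] by (intro bdd_aboveI[of _ "M x"]) auto
  qed
  have least: "?N x \<le> r" if "\<And>p. p \<in> S ==> p x \<le> r" for x r
    by (rule cSUP_least[OF S(1) that])
  note D = cstar_seminormD[OF S(2)]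
  obtain p0 where p0: "p0 \<in> S" using S(1) by blast
  have nn: "0 \<le> ?N x" if "x \<in> carrier A" for x
    using D(1)[OF p0 that] up[OF p0 that] by linarith
  show ?thesis
    unfolding cstar_seminorm_def
  proof (intro conjI ballI allI)
    fix x assume x: "x \<in> carrier A"
    show "0 \<le> ?N x" by (rule nn[OF x])
    show "?N (c \<odot>\<^bsub>A\<^esub> x) = cmod c * ?N x" for c
    proof (rule antisym)
      show "?N (c \<odot>\<^bsub>A\<^esub> x) \<le> cmod c * ?N x"
        by (rule least) (simp add: D(3)[OF _ x] mult_left_mono up[OF _ x])
      show "cmod c * ?N x \<le> ?N (c \<odot>\<^bsub>A\<^esub> x)"
      proof (cases "c = 0")
        case True
        then show ?thesis using nn[of "c \<odot>\<^bsub>A\<^esub> x"] x by simp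
      next
        case False
        have "?N x \<le> ?N (c \<odot>\<^bsub>A\<^esub> x) / cmod c"
        proof (rule least)
          fix p assume p: "p \<in> S"
          have "cmod c * p x \<le> ?N (c \<odot>\<^bsub>A\<^esub> x)"
            using up[OF p A.smult_closed'[OF x], of c] D(3)[OF p x, of c] by simp
          then show "p x \<le> ?N (c \<odot>\<^bsub>A\<^esub> x) / cmod c"
            using False by (simp add: pos_le_divide_eq mult.commute)
        qed
        then show ?thesis using False by (simp add: pos_le_divide_eq mult.commute)
      qed
    qed
    show "?N (star A x \<otimes>\<^bsub>A\<^esub> x) = (?N x)\<^sup>2"
    proof (rule antisym)
      have sx: "star A x \<otimes>\<^bsub>A\<^esub> x \<in> carrier A" by (intro A.alg_m_closed A.star_closed x)
      show "?N (star A x \<otimes>\<^bsub>A\<^esub> x) \<le> (?N x)\<^sup>2"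
      proof (rule least)
        fix p assume p: "p \<in> S"
        show "p (star A x \<otimes>\<^bsub>A\<^esub> x) \<le> (?N x)\<^sup>2"
          unfolding D(5)[OF p x] by (rule power_mono[OF up[OF p x] D(1)[OF p x]])
      qed
      have "?N x \<le> sqrt (?N (star A x \<otimes>\<^bsub>A\<^esub> x))"
      proof (rule least)
        fix p assume p: "p \<in> S"
        show "p x \<le> sqrt (?N (star A x \<otimes>\<^bsub>A\<^esub> x))"
          using up[OF p sx] unfolding D(5)[OF p x] by (rule real_le_rsqrt)
      qed
      then have "(?N x)\<^sup>2 \<le> (sqrt (?N (star A x \<otimes>\<^bsub>A\<^esub> x)))\<^sup>2" by (rule power_mono[OF _ nn[OF x]])
      then show "(?N x)\<^sup>2 \<le> ?N (star A x \<otimes>\<^bsub>A\<^esub> x)" by (simp only: real_sqrt_pow2[OF nn[OF sx]])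
    qed
    fix y assume y: "y \<in> carrier A"
    show "?N (x \<oplus>\<^bsub>A\<^esub> y) \<le> ?N x + ?N y"
    proof (rule least)
      fix p assume p: "p \<in> S"
      show "p (x \<oplus>\<^bsub>A\<^esub> y) \<le> ?N x + ?N y"
        using D(2)[OF p x y] up[OF p x] up[OF p y] by linarith
    qed
    show "?N (x \<otimes>\<^bsub>A\<^esub> y) \<le> ?N x * ?N y"
    proof (rule least)
      fix p assume p: "p \<in> S"
      show "p (x \<otimes>\<^bsub>A\<^esub> y) \<le> ?N x * ?N y"
        using D(4)[OF p x y] mult_mono[OF up[OF p x] up[OF p y] nn[OF x] D(1)[OF p y]] by linarith
    qed
  qed
qed

lemma largest_cstar_seminorm:
  assumes A: "star_algebra A" and bound: "\<And>q x. [|cstar_seminorm A q; x \<in> carrier A|] ==> q x \<le> M x"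
  shows "cstar_seminorm A (largest_cstar_seminorm A)"
    and "[|cstar_seminorm A q; x \<in> carrier A|] ==> q x \<le> largest_cstar_seminorm A x"
    and "x \<in> carrier A ==> largest_cstar_seminorm A x \<le> M x"
proof -
  show "cstar_seminorm A (largest_cstar_seminorm A)"
    unfolding largest_cstar_seminorm_def using cstar_seminorm_zero bound
    by (intro cstar_seminorm_SUP[OF A, of _ M]) auto
  show "q x \<le> largest_cstar_seminorm A x" if "cstar_seminorm A q" "x \<in> carrier A"
    unfolding largest_cstar_seminorm_def
  proof (rule cSUP_upper)
    show "bdd_above ((\<lambda>p. p x) ` {p. cstar_seminorm A p})"
      using bound[OF _ that(2)] by (intro bdd_aboveI[of _ "M x"]) auto
  qed (simp add: that)
  show "largest_cstar_seminorm A x \<le> M x" if "x \<in> carrier A"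
    unfolding largest_cstar_seminorm_def using cstar_seminorm_zero bound[OF _ that]
    by (intro cSUP_least) auto
qed

lemma star_hom_inv_into:
  assumes A: "star_algebra A" and h: "h \<in> star_hom A B" and bij: "bij_betw h (carrier A) (carrier B)"
  shows "inv_into (carrier A) h \<in> star_hom B A"
proof -
  interpret A: star_algebra A by fact
  let ?k = "inv_into (carrier A) h"
  note hD = star_homD[OF h]
  have inj: "inj_on h (carrier A)" and im: "h ` carrier A = carrier B" using bij by (auto simp: bij_betw_def)
  have kc: "?k y \<in> carrier A" and hk: "h (?k y) = y" if "y \<in> carrier B" for y
    using that im by (auto intro: inv_into_into f_inv_into_f)
  have kI: "?k y = x" if "x \<in> carrier A" "h x = y" for x y
    using inv_into_f_f[OF inj that(1)] that(2) by simp
  show ?thesis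
    by (rule star_homI)
      (auto intro!: kI simp: kc hk hD A.alg_m_closed A.alg_a_closed A.alg_one_closed A.star_closed)
qed

lemma largest_cstar_seminorm_iso:
  assumes A: "star_algebra A" and B: "star_algebra B" and h: "h \<in> star_hom A B"
    and bij: "bij_betw h (carrier A) (carrier B)" and x: "x \<in> carrier A"
  shows "largest_cstar_seminorm B (h x) = largest_cstar_seminorm A x"
proof -
  let ?k = "inv_into (carrier A) h"
  have k: "?k \<in> star_hom B A" by (rule star_hom_inv_into[OF A h bij])
  have kh: "?k (h x) = x" using bij x by (simp add: bij_betw_def)
  have "(\<lambda>q. q (h x)) ` {q. cstar_seminorm B q} = (\<lambda>p. p x) ` {p. cstar_seminorm A p}"
  proof (intro equalityI subsetI)
    fix r assume "r \<in> (\<lambda>q. q (h x)) ` {q. cstar_seminorm B q}"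
    then obtain q where "cstar_seminorm B q" "r = q (h x)" by blast
    then show "r \<in> (\<lambda>p. p x) ` {p. cstar_seminorm A p}"
      using cstar_seminorm_pullback[OF A h] by (intro image_eqI[of _ _ "\<lambda>x. q (h x)"]) auto
  next
    fix r assume "r \<in> (\<lambda>p. p x) ` {p. cstar_seminorm A p}"
    then obtain p where "cstar_seminorm A p" "r = p x" by blast
    then show "r \<in> (\<lambda>q. q (h x)) ` {q. cstar_seminorm B q}"
      using cstar_seminorm_pullback[OF B k] kh by (intro image_eqI[of _ _ "\<lambda>y. p (?k y)"]) auto
  qed
  then show ?thesis by (simp add: largest_cstar_seminorm_def)
qed

lemma isomorphic_via_completion:
  assumes A: "star_algebra A" and C: "star_algebra C" and h: "h \<in> star_hom A C"
    and p: "cstar_seminorm A p" and q: "cstar_seminorm C q"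
    and eq: "\<And>x. x \<in> carrier A ==> p x = q (h x)"
    and dense: "\<And>s e. [|s \<in> carrier C; e > 0|] ==> \<exists>x\<in>carrier A. q (s \<ominus>\<^bsub>C\<^esub> h x) < e"
    and gens: "\<And>i. i \<in> I ==> x i \<in> carrier A" "\<And>i. i \<in> I ==> completion_emb A p (x i) = a i"
      "\<And>i. i \<in> I ==> completion_emb C q (h (x i)) = c i"
  shows "isomorphic_via I (completion A p) a (completion C q) c"
proof -
  interpret A: cstar_seminormed A p by (intro cstar_seminormed.intro cstar_seminormed_axioms.intro A p)
  interpret C: cstar_seminormed C q by (intro cstar_seminormed.intro cstar_seminormed_axioms.intro C q)
  interpret Q: cstar_seminormed "completion C q" "nrm (completion C q)" by (rule C.cstar_seminormed_completion)
  have hC: "h x \<in> carrier C" if "x \<in> carrier A" for x by (rule star_homD(1)[OF h that])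
  note eD = star_homD[OF C.emb_star_hom]
  show ?thesis
  proof (rule isomorphic_via_of_dense[OF A A.cstar_algebra_completion C.cstar_algebra_completion
        A.emb_star_hom star_hom_comp[OF h C.emb_star_hom], where x = x])
    show "nrm (completion A p) (completion_emb A p x) = nrm (completion C q) (completion_emb C q (h x))"
      if "x \<in> carrier A" for x
      using A.nrm_emb[OF that] C.nrm_emb[OF hC[OF that]] eq[OF that] by simp
    show "\<exists>x\<in>carrier A. nrm (completion A p) (X \<ominus>\<^bsub>completion A p\<^esub> completion_emb A p x) < e"
      if "X \<in> carrier (completion A p)" "e > 0" for X e
      by (rule A.emb_dense[OF that])
    show "\<exists>x\<in>carrier A. nrm (completion C q) (X \<ominus>\<^bsub>completion C q\<^esub> completion_emb C q (h x)) < e"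
      if X: "X \<in> carrier (completion C q)" and e: "e > 0" for X and e :: real
    proof -
      have e2: "e/2 > 0" using e by simp
      obtain s where s: "s \<in> carrier C" "nrm (completion C q) (X \<ominus>\<^bsub>completion C q\<^esub> completion_emb C q s) < e/2"
        using C.emb_dense[OF X e2] by blast
      obtain x where x: "x \<in> carrier A" "q (s \<ominus>\<^bsub>C\<^esub> h x) < e/2" using dense[OF s(1) e2] by blast
      have "nrm (completion C q) (completion_emb C q s \<ominus>\<^bsub>completion C q\<^esub> completion_emb C q (h x)) = q (s \<ominus>\<^bsub>C\<^esub> h x)"
        using C.nrm_emb[OF C.diff_closed[OF s(1) hC[OF x(1)]]]
          star_hom_diff[OF C.emb_star_hom C C.star_algebra_completion s(1) hC[OF x(1)]] by simp
      then have "nrm (completion C q) (X \<ominus>\<^bsub>completion C q\<^esub> completion_emb C q (h x)) < e"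
        using Q.p_diff_triangle[OF X eD(1)[OF s(1)] eD(1)[OF hC[OF x(1)]]] s(2) x(2) by linarith
      then show ?thesis using x(1) by blast
    qed
  qed (use gens in auto)
qed

lemma isomorphic_via_refl: "cstar_algebra A ==> isomorphic_via I A a A a"
  unfolding isomorphic_via_def
  by (intro conjI bexI[of _ "\<lambda>x. x"]) (auto intro!: star_homI simp: bij_betw_def)

section \<open>The universal algebras\<close>

lemma free_hom_eval:
  assumes B: "star_algebra B" and h: "h \<in> star_hom (free_star_alg P) B" and x: "x \<in> carrier (free_star_alg P)"
  shows "h x = free_eval B (\<lambda>q. h (free_gen q)) x"
proof -
  let ?F = "free_star_alg P"
  let ?w = "\<lambda>q. h (free_gen q)"
  interpret F: star_algebra ?F by (rule star_algebra_free)
  have w: "?w \<in> P \<rightarrow> carrier B" by (intro Pi_I star_homD(1)[OF h] free_gen_carrier)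
  note hD = star_homD[OF h] and eD = star_homD[OF free_eval_star_hom[OF B w]]
  have m: "h (free_mono u) = free_eval B ?w (free_mono u)" if "fst ` set u \<subseteq> P" for u
    using free_hom_mono[OF h that] free_eval_mono[OF B w that] by simp
  show ?thesis
    using x
  proof (induction rule: free_induct)
    case zero
    then show ?case
      using star_hom_zero[OF h star_algebra_free B]
        star_hom_zero[OF free_eval_star_hom[OF B w] star_algebra_free B] by simp
  next
    case (add x c u)
    then show ?case
      using m[of u] free_mono_carrier[of u P] by (simp add: hD eD F.smult_closed')
  qed
qed

lemma word_val_cong:
  assumes "\<alpha> \<in> words P" and w: "\<And>q. q \<in> P ==> w q = w' q"
  shows "word_val B w \<alpha> = word_val B w' \<alpha>"
  using assms(1) by (induction rule: words_induct) (auto simp: w)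

lemma diff_prod_cong:
  assumes \<alpha>: "\<alpha> \<in> words P" and \<beta>s: "set \<beta>s \<subseteq> words P" and w: "\<And>q. q \<in> P ==> w q = w' q"
  shows "diff_prod B w \<alpha> \<beta>s = diff_prod B w' \<alpha> \<beta>s"
proof -
  have eq: "word_val B w \<beta> = word_val B w' \<beta>" if "\<beta> \<in> words P" for \<beta>
    by (rule word_val_cong[OF that w])
  have "foldr (\<lambda>\<beta> y. (word_val B w \<alpha> \<ominus>\<^bsub>B\<^esub> word_val B w \<beta>) \<otimes>\<^bsub>B\<^esub> y) \<beta>s z =
      foldr (\<lambda>\<beta> y. (word_val B w' \<alpha> \<ominus>\<^bsub>B\<^esub> word_val B w' \<beta>) \<otimes>\<^bsub>B\<^esub> y) \<beta>s z" for z
    using \<beta>s by (induction \<beta>s) (simp_all add: eq \<alpha>)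
  then show ?thesis by (simp add: diff_prod_def eq[OF \<alpha>])
qed

context submonoid_of_group
begin

lemma largest_PS:
  shows "cstar_seminorm PS (largest_cstar_seminorm PS)"
    and "[|cstar_seminorm PS q; x \<in> carrier PS|] ==> q x \<le> largest_cstar_seminorm PS x"
    and "x \<in> carrier PS ==> largest_cstar_seminorm PS x \<le> N1 x"
  using largest_cstar_seminorm[OF star_algebra_PS, of N1] cstar_seminorm_le_N1 by blast+

lemma delta_one_star_hom: "(\<lambda>a. delta_section CB a \<one>) \<in> star_hom CB PS"
proof (rule star_homI)
  fix a assume a: "a \<in> carrier CB"
  then show "delta_section CB a \<one> \<in> carrier PS" using CB_BI delta_closed by blast
  show "delta_section CB (c \<odot>\<^bsub>CB\<^esub> a) \<one> = c \<odot>\<^bsub>PS\<^esub> delta_section CB a \<one>" for c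
    by (simp add: delta_smult CB_ops)
  show "delta_section CB (star CB a) \<one> = star PS (delta_section CB a \<one>)"
    by (simp add: delta_one_star[OF a] CB_ops)
  fix b assume b: "b \<in> carrier CB"
  show "delta_section CB (a \<otimes>\<^bsub>CB\<^esub> b) \<one> = delta_section CB a \<one> \<otimes>\<^bsub>PS\<^esub> delta_section CB b \<one>"
    by (simp add: delta_one_mult[OF a b] CB_ops)
  show "delta_section CB (a \<oplus>\<^bsub>CB\<^esub> b) \<one> = delta_section CB a \<one> \<oplus>\<^bsub>PS\<^esub> delta_section CB b \<one>"
    by (simp add: delta_add CB_ops)
qed (simp add: PS_ops CB_ops)

lemma DD_neutral: "\<alpha> \<in> NW ==> DD \<alpha> = delta_section CB (eps (KK \<alpha>)) \<one>"
  by (simp add: DD_def K_rev_neutral NW_iff)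

lemma eps_CB: "S \<in> J ==> eps S \<in> carrier CB"
  using \<kappa>_ind \<kappa>_CB by metis

lemma family_of_diagonal_hom:
  assumes B: "star_algebra B" and \<rho>: "\<rho> \<in> star_hom CB B" and w1: "w \<one> = \<one>\<^bsub>B\<^esub>"
    and wv: "\<And>\<alpha>. \<alpha> \<in> NW ==> word_val B w \<alpha> = \<rho> (eps (KK \<alpha>))"
  shows "foundation_family G P B w"
proof -
  interpret B: star_algebra B by fact
  interpret CB: star_algebra CB by (rule star_algebra_CB)
  note \<rho>D = star_homD[OF \<rho>]
  note \<rho>0 = star_hom_zero[OF \<rho> star_algebra_CB B]
  have epsC: "eps (KK \<alpha>) \<in> carrier CB" if "\<alpha> \<in> NW" for \<alpha>
    using that by (intro eps_CB K_J NW_W)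
  have zeroI: "h = \<zero>\<^bsub>CB\<^esub>" if "h \<in> carrier CB" "\<And>\<xi>. \<xi> \<in> Bd ==> h \<xi> = 0" for h
  proof
    fix \<xi> show "h \<xi> = \<zero>\<^bsub>CB\<^esub> \<xi>" using that by (cases "\<xi> \<in> Bd") (auto simp: CB_carrier CB_ops)
  qed
  have cb_diff: "(a \<ominus>\<^bsub>CB\<^esub> b) \<xi> = a \<xi> - b \<xi>" if "a \<in> carrier CB" "b \<in> carrier CB" for a b \<xi>
    using CB.diff_eq_smult[OF that] by (simp add: CB_ops)
  have "T2 G P B w"
    unfolding T2_def
  proof (intro ballI impI)
    fix \<alpha> assume \<alpha>: "\<alpha> \<in> NW" and 0: "KK \<alpha> = {}"
    have "eps (KK \<alpha>) = \<zero>\<^bsub>CB\<^esub>"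
    proof (rule zeroI[OF epsC[OF \<alpha>]])
      fix \<xi> assume \<xi>: "\<xi> \<in> Bd"
      then have "\<xi> {} = 0" using JH_empty[OF Bd_JH[OF \<xi>]] JH_cases[OF Bd_JH[OF \<xi>]] by metis
      then show "eps (KK \<alpha>) \<xi> = 0" by (simp add: eps_def 0)
    qed
    then show "word_val B w \<alpha> = \<zero>\<^bsub>B\<^esub>" by (simp add: wv[OF \<alpha>] \<rho>0)
  qed
  moreover have "T3 G P B w" unfolding T3_def by (simp add: wv)
  moreover have "foundation_relations G P B w"
    unfolding foundation_relations_def
  proof (intro ballI allI impI, elim conjE)
    fix \<alpha> \<beta>s assume \<alpha>: "\<alpha> \<in> NW" and \<beta>s: "set \<beta>s \<subseteq> NW"
      and fs: "foundation_set G P (KK \<alpha>) (KK ` set \<beta>s)"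
    have hit: "\<exists>\<beta>\<in>set \<beta>s. \<xi> (KK \<beta>) = 1" if "\<xi> \<in> Bd" "\<xi> (KK \<alpha>) = 1" for \<xi>
      using that fs unfolding Bd_def by blast
    show "diff_prod B w \<alpha> \<beta>s = \<zero>\<^bsub>B\<^esub>"
    proof (cases "\<beta>s = []")
      case True
      have "eps (KK \<alpha>) = \<zero>\<^bsub>CB\<^esub>"
      proof (rule zeroI[OF epsC[OF \<alpha>]])
        fix \<xi> assume \<xi>: "\<xi> \<in> Bd"
        then have "\<xi> (KK \<alpha>) = 0" using hit[OF \<xi>] True JH_cases[OF Bd_JH[OF \<xi>], of "KK \<alpha>"] by auto
        then show "eps (KK \<alpha>) \<xi> = 0" by (simp add: eps_def)
      qed
      then show ?thesis using True by (simp add: diff_prod_def wv[OF \<alpha>] \<rho>0)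
    next
      case False
      define D where "D l = foldr (\<lambda>\<beta> y. (eps (KK \<alpha>) \<ominus>\<^bsub>CB\<^esub> eps (KK \<beta>)) \<otimes>\<^bsub>CB\<^esub> y) l \<one>\<^bsub>CB\<^esub>" for l
      have D_simps: "D [] = \<one>\<^bsub>CB\<^esub>" "D (\<beta> # l) = (eps (KK \<alpha>) \<ominus>\<^bsub>CB\<^esub> eps (KK \<beta>)) \<otimes>\<^bsub>CB\<^esub> D l" for \<beta> l
        by (simp_all add: D_def)
      have DC: "D l \<in> carrier CB" if "set l \<subseteq> NW" for l
        using that by (induction l) (auto simp: D_simps CB.alg_one_closed epsC \<alpha> intro!: CB.alg_m_closed CB.diff_closed)
      have D\<rho>: "foldr (\<lambda>\<beta> y. (word_val B w \<alpha> \<ominus>\<^bsub>B\<^esub> word_val B w \<beta>) \<otimes>\<^bsub>B\<^esub> y) l \<one>\<^bsub>B\<^esub> = \<rho> (D l)"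
        if "set l \<subseteq> NW" for l
        using that
      proof (induction l)
        case (Cons \<beta> l)
        then have \<beta>: "\<beta> \<in> NW" and l: "set l \<subseteq> NW" by auto
        have "\<rho> (D (\<beta> # l)) = \<rho> (eps (KK \<alpha>) \<ominus>\<^bsub>CB\<^esub> eps (KK \<beta>)) \<otimes>\<^bsub>B\<^esub> \<rho> (D l)"
          unfolding D_simps by (intro \<rho>D(2) CB.diff_closed epsC \<alpha> \<beta> DC l)
        also have "\<rho> (eps (KK \<alpha>) \<ominus>\<^bsub>CB\<^esub> eps (KK \<beta>)) = word_val B w \<alpha> \<ominus>\<^bsub>B\<^esub> word_val B w \<beta>"
          unfolding wv[OF \<alpha>] wv[OF \<beta>] by (rule star_hom_diff[OF \<rho> star_algebra_CB B epsC[OF \<alpha>] epsC[OF \<beta>]])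
        finally show ?case using Cons.IH[OF l] by simp
      qed (simp add: D_simps \<rho>D(4))
      have D0: "D l \<xi> = 0" if "\<beta> \<in> set l" "\<xi> (KK \<beta>) = \<xi> (KK \<alpha>)" "set l \<subseteq> NW" for l \<xi> \<beta>
        using that
      proof (induction l)
        case (Cons \<gamma> l)
        have "D (\<gamma> # l) \<xi> = (eps (KK \<alpha>) \<xi> - eps (KK \<gamma>) \<xi>) * D l \<xi>"
          unfolding D_simps using Cons.prems by (simp add: CB_ops(1) cb_diff epsC \<alpha>)
        then show ?case using Cons by (cases "\<gamma> = \<beta>") (auto simp: eps_def)
      qed simp
      have "D \<beta>s = \<zero>\<^bsub>CB\<^esub>"
      proof (rule zeroI[OF DC[OF \<beta>s]])
        fix \<xi> assume \<xi>: "\<xi> \<in> Bd"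
        have "\<exists>\<beta>\<in>set \<beta>s. \<xi> (KK \<beta>) = \<xi> (KK \<alpha>)"
        proof (cases "\<xi> (KK \<alpha>) = 1")
          case True
          then show ?thesis using hit[OF \<xi>] by simp
        next
          case 0: False
          obtain \<beta> where \<beta>: "\<beta> \<in> set \<beta>s" using False by (cases \<beta>s) auto
          have "KK \<beta> \<subseteq> KK \<alpha>" using fs \<beta> by (auto simp: foundation_set_def)
          then have "\<xi> (KK \<beta>) \<noteq> 1"
            using 0 JH_mono[OF Bd_JH[OF \<xi>], of "KK \<beta>" "KK \<alpha>"] K_J[OF NW_W[OF \<alpha>]] by blast
          then show ?thesis using 0 \<beta> JH_cases[OF Bd_JH[OF \<xi>]] by metis
        qed
        then show "D \<beta>s \<xi> = 0" using D0 \<beta>s by blast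
      qed
      then show ?thesis using D\<rho>[OF \<beta>s] False by (simp add: diff_prod_def \<rho>0)
    qed
  qed
  ultimately show ?thesis using w1 by (simp add: foundation_family_def T1_def)
qed

lemma gen_one: "gen \<one> = \<one>\<^bsub>PS\<^esub>"
proof -
  have "\<one> <# P = P" using P_carrier by (auto simp: l_coset_def subset_iff)
  then show ?thesis by (simp add: gen_def eps_P PS_ops)
qed

lemma gen_family: "foundation_family G P PS gen"
  by (rule family_of_diagonal_hom[where w = gen, OF star_algebra_PS delta_one_star_hom gen_one])
    (simp add: word_val_gen NW_W DD_neutral)

lemma word_val_ev: "\<alpha> \<in> W ==> ev (word_val FA free_gen \<alpha>) = word_val PS gen \<alpha>"
  and diff_prod_ev: "[|\<alpha> \<in> W; set \<beta>s \<subseteq> W|] ==>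
    ev (diff_prod FA free_gen \<alpha> \<beta>s) = diff_prod PS gen \<alpha> \<beta>s"
proof -
  have fg: "free_gen \<in> P \<rightarrow> carrier FA" by (intro Pi_I free_gen_carrier)
  show "ev (word_val FA free_gen \<alpha>) = word_val PS gen \<alpha>" if \<alpha>: "\<alpha> \<in> W"
    unfolding star_hom_word_val[OF ev_star_hom star_algebra_free fg \<alpha>]
    by (rule word_val_cong[OF \<alpha>]) (rule ev_gen)
  show "ev (diff_prod FA free_gen \<alpha> \<beta>s) = diff_prod PS gen \<alpha> \<beta>s"
    if \<alpha>: "\<alpha> \<in> W" and \<beta>s: "set \<beta>s \<subseteq> W"
    unfolding star_hom_diff_prod[OF ev_star_hom star_algebra_free star_algebra_PS fg \<alpha> \<beta>s]
    by (rule diff_prod_cong[OF \<alpha> \<beta>s]) (rule ev_gen)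
qed

lemma family_of_factoring_hom:
  assumes B: "star_algebra B" and h: "h \<in> star_hom FA B"
    and eq: "\<And>x y. [|x \<in> carrier FA; y \<in> carrier FA; ev x = ev y|] ==> h x = h y"
  shows "foundation_family G P B (\<lambda>q. h (free_gen q))"
proof -
  let ?F = "FA"
  let ?w = "\<lambda>q. h (free_gen q)"
  interpret F: star_algebra ?F by (rule star_algebra_free)
  have fg: "free_gen \<in> P \<rightarrow> carrier ?F" by (intro Pi_I free_gen_carrier)
  note wc = word_val_closed[OF star_algebra_free fg] and dc = diff_prod_closed[OF star_algebra_free fg]
  note hw = star_hom_word_val[OF h star_algebra_free fg, symmetric]
    and hd = star_hom_diff_prod[OF h star_algebra_free B fg, symmetric]
  note h0 = star_hom_zero[OF h star_algebra_free B]
    and ev0 = star_hom_zero[OF ev_star_hom star_algebra_free star_algebra_PS]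
  have zero: "h x = \<zero>\<^bsub>B\<^esub>" if "x \<in> carrier ?F" "ev x = \<zero>\<^bsub>PS\<^esub>" for x
    using eq[OF that(1) F.alg_zero_closed] that(2) h0 ev0 by simp
  have fam: "T1 G PS gen" "T2 G P PS gen" "T3 G P PS gen" "foundation_relations G P PS gen"
    using gen_family by (simp_all add: foundation_family_def)
  have "T1 G B ?w"
  proof -
    have "ev (free_gen \<one>) = ev \<one>\<^bsub>?F\<^esub>"
      using ev_gen[OF P_one] gen_one star_homD(4)[OF ev_star_hom] by simp
    from eq[OF free_gen_carrier[OF P_one] F.alg_one_closed this] show ?thesis
      using star_homD(4)[OF h] by (simp add: T1_def)
  qed
  moreover have "T2 G P B ?w"
    unfolding T2_def
  proof (intro ballI impI)
    fix \<alpha> assume \<alpha>: "\<alpha> \<in> NW" "KK \<alpha> = {}"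
    then have "ev (word_val ?F free_gen \<alpha>) = \<zero>\<^bsub>PS\<^esub>" using fam(2) word_val_ev[OF NW_W[OF \<alpha>(1)]] by (simp add: T2_def)
    then show "word_val B ?w \<alpha> = \<zero>\<^bsub>B\<^esub>" using zero[OF wc] hw NW_W[OF \<alpha>(1)] by simp
  qed
  moreover have "T3 G P B ?w"
    unfolding T3_def
  proof (intro ballI impI)
    fix \<alpha> \<beta> assume \<alpha>: "\<alpha> \<in> NW" and \<beta>: "\<beta> \<in> NW" and "KK \<alpha> = KK \<beta>"
    then have "word_val PS gen \<alpha> = word_val PS gen \<beta>" using fam(3) unfolding T3_def by blast
    then have "ev (word_val ?F free_gen \<alpha>) = ev (word_val ?F free_gen \<beta>)"
      unfolding word_val_ev[OF NW_W[OF \<alpha>]] word_val_ev[OF NW_W[OF \<beta>]] .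
    from eq[OF wc[OF NW_W[OF \<alpha>]] wc[OF NW_W[OF \<beta>]] this]
    show "word_val B ?w \<alpha> = word_val B ?w \<beta>" using hw NW_W[OF \<alpha>] NW_W[OF \<beta>] by simp
  qed
  moreover have "foundation_relations G P B ?w"
    unfolding foundation_relations_def
  proof (intro ballI allI impI, elim conjE)
    fix \<alpha> \<beta>s assume \<alpha>: "\<alpha> \<in> NW" and \<beta>s: "distinct \<beta>s" "set \<beta>s \<subseteq> NW"
      and fs: "foundation_set G P (KK \<alpha>) (KK ` set \<beta>s)"
    have W: "\<alpha> \<in> W" "set \<beta>s \<subseteq> W" using \<alpha> \<beta>s NW_W by auto
    have "ev (diff_prod ?F free_gen \<alpha> \<beta>s) = \<zero>\<^bsub>PS\<^esub>"
      using fam(4) \<alpha> \<beta>s fs diff_prod_ev[OF W] by (simp add: foundation_relations_def)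
    then show "diff_prod B ?w \<alpha> \<beta>s = \<zero>\<^bsub>B\<^esub>" using zero[OF dc[OF W]] hd[OF W] by simp
  qed
  ultimately show ?thesis by (simp add: foundation_family_def)
qed

lemma strongly_covariant_iff:
  assumes B: "cstar_algebra B" and w: "w \<in> P \<rightarrow> carrier B"
  shows "strongly_covariant G P B w \<longleftrightarrow> foundation_family G P B w"
proof
  have Bs: "star_algebra B" using B by (simp add: cstar_algebra_def)
  have bij: "bij_betw level (carrier CB) (carrier DQ)"
    using level_inj DQ_carrier by (auto simp: bij_betw_def intro!: inj_onI)
  {
    assume "strongly_covariant G P B w"
    then obtain \<phi> \<psi> where 1: "isometric_rep G P B w" "\<And>\<alpha>. \<alpha> \<in> NW ==> \<phi> (indicator (KK \<alpha>)) = word_val B w \<alpha>"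
      "\<psi> \<in> star_hom DQ B" "\<And>a. a \<in> Dr G P ==> \<phi> a = \<psi> (D0 +>\<^bsub>DR\<^esub> a)"
      unfolding strongly_covariant_def by blast
    show "foundation_family G P B w"
    proof (rule family_of_diagonal_hom[OF Bs star_hom_comp[OF level_star_hom 1(3)]])
      show "w \<one> = \<one>\<^bsub>B\<^esub>" using 1(1) by (simp add: isometric_rep_def)
      fix \<alpha> assume \<alpha>: "\<alpha> \<in> NW"
      note S = K_J[OF NW_W[OF \<alpha>]]
      have "word_val B w \<alpha> = \<psi> (D0 +>\<^bsub>DR\<^esub> indicator (KK \<alpha>))" using 1(2)[OF \<alpha>] 1(4)[OF \<kappa>_ind(2)[OF S]] by simp
      then show "word_val B w \<alpha> = \<psi> (level (eps (KK \<alpha>)))"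
        by (simp add: coset_level[OF \<kappa>_ind(2)[OF S]] \<kappa>_ind(1)[OF S])
    qed
  }
  assume fam: "foundation_family G P B w"
  obtain \<pi> where \<pi>: "\<pi> \<in> star_hom PS B" "\<And>x. x \<in> carrier FA ==> \<pi> (ev x) = free_eval B w x"
    using family_star_hom[OF B w fam] by blast
  define \<rho> where "\<rho> = (\<lambda>a. \<pi> (delta_section CB a \<one>))"
  have \<rho>: "\<rho> \<in> star_hom CB B" unfolding \<rho>_def by (rule star_hom_comp[OF delta_one_star_hom \<pi>(1)])
  have \<phi>: "(\<lambda>b. \<rho> (\<kappa> b)) \<in> star_hom DR B" by (rule star_hom_comp[OF \<kappa>_star_hom \<rho>])
  have \<psi>: "(\<lambda>X. \<rho> (inv_into (carrier CB) level X)) \<in> star_hom DQ B"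
    by (rule star_hom_comp[OF star_hom_inv_into[OF star_algebra_CB level_star_hom bij] \<rho>])
  have fg: "free_gen \<in> P \<rightarrow> carrier FA" by (intro Pi_I free_gen_carrier)
  have wv: "\<rho> (\<kappa> (indicator (KK \<alpha>))) = word_val B w \<alpha>" if \<alpha>: "\<alpha> \<in> NW" for \<alpha>
  proof -
    note W = NW_W[OF \<alpha>]
    have "\<rho> (\<kappa> (indicator (KK \<alpha>))) = \<pi> (word_val PS gen \<alpha>)"
      using \<kappa>_ind(1)[OF K_J[OF W]] DD_neutral[OF \<alpha>] word_val_gen[OF W] by (simp add: \<rho>_def)
    also have "\<dots> = free_eval B w (word_val FA free_gen \<alpha>)"
      using \<pi>(2)[OF word_val_closed[OF star_algebra_free fg W]] word_val_ev[OF W] by simp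
    also have "\<dots> = word_val B (\<lambda>q. free_eval B w (free_gen q)) \<alpha>"
      by (rule star_hom_word_val[OF free_eval_star_hom[OF Bs w] star_algebra_free fg W])
    also have "\<dots> = word_val B w \<alpha>"
      by (rule word_val_cong[OF W]) (rule free_eval_gen[OF Bs w])
    finally show ?thesis .
  qed
  have q: "\<rho> (\<kappa> a) = \<rho> (inv_into (carrier CB) level (D0 +>\<^bsub>DR\<^esub> a))" if a: "a \<in> Dr G P" for a
    using inv_into_f_f[OF bij_betw_imp_inj_on[OF bij] \<kappa>_CB[OF a]] coset_level[OF a] by simp
  show "strongly_covariant G P B w"
    unfolding strongly_covariant_def
    by (intro conjI bexI[OF _ \<phi>] bexI[OF _ \<psi>] ballI family_isometric_rep[OF B w fam] wv q)
qed

lemma foundation_iff_boundary: "foundation_family G P B w \<longleftrightarrow> boundary_family G P B w"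
proof
  assume f: "foundation_family G P B w"
  then have fr: "foundation_relations G P B w" by (simp add: foundation_family_def)
  have "T4 G P B w"
    unfolding T4_def
  proof (intro ballI allI impI, elim conjE)
    fix \<alpha> \<beta>s assume \<alpha>: "\<alpha> \<in> NW" and \<beta>s: "distinct \<beta>s" "set \<beta>s \<subseteq> NW" and eq: "KK \<alpha> = (\<Union>\<beta>\<in>set \<beta>s. KK \<beta>)"
    have "foundation_set G P (KK \<alpha>) (KK ` set \<beta>s)"
      unfolding foundation_set_def
    proof (intro conjI ballI)
      show "KK \<alpha> \<in> J" by (rule K_J[OF NW_W[OF \<alpha>]])
      show "KK ` set \<beta>s \<subseteq> J" using \<beta>s K_J NW_W by blast
      show "R \<subseteq> KK \<alpha>" if "R \<in> KK ` set \<beta>s" for R using that eq by blast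
      fix p assume p: "p \<in> KK \<alpha>"
      then have "p \<in> P" using J_subset[OF K_J[OF NW_W[OF \<alpha>]]] by blast
      then have "p \<in> p <# P" using P_one r_one by (force simp: l_coset_def)
      then show "(p <# P) \<inter> \<Union> (KK ` set \<beta>s) \<noteq> {}" using p unfolding eq by blast
    qed simp
    then show "diff_prod B w \<alpha> \<beta>s = \<zero>\<^bsub>B\<^esub>" using fr \<alpha> \<beta>s unfolding foundation_relations_def by blast
  qed
  moreover have "boundary_relations G P B w"
    using fr unfolding foundation_relations_def boundary_relations_def proper_foundation_set_def by blast
  ultimately show "boundary_family G P B w" using f by (simp add: foundation_family_def boundary_family_def)
next
  assume b: "boundary_family G P B w"
  have "foundation_relations G P B w"
    unfolding foundation_relations_def
  proof (intro ballI allI impI, elim conjE)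
    fix \<alpha> \<beta>s assume \<alpha>: "\<alpha> \<in> NW" and \<beta>s: "distinct \<beta>s" "set \<beta>s \<subseteq> NW"
      and fs: "foundation_set G P (KK \<alpha>) (KK ` set \<beta>s)"
    show "diff_prod B w \<alpha> \<beta>s = \<zero>\<^bsub>B\<^esub>"
    proof (cases "KK \<alpha> - \<Union> (KK ` set \<beta>s) = {}")
      case True
      then have "KK \<alpha> = \<Union> (KK ` set \<beta>s)" using fs unfolding foundation_set_def by blast
      then show ?thesis using b \<alpha> \<beta>s unfolding boundary_family_def T4_def by blast
    next
      case False
      then show ?thesis
        using b \<alpha> \<beta>s fs unfolding boundary_family_def boundary_relations_def proper_foundation_set_def by blast
    qed
  qed
  then show "foundation_family G P B w" using b by (simp add: foundation_family_def boundary_family_def)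
qed

lemma univ_seminorm_cong:
  assumes "\<And>p. cstar_seminorm FA p ==>
    \<Phi> (completion FA p) (\<lambda>g. completion_emb FA p (free_gen g)) =
    \<Psi> (completion FA p) (\<lambda>g. completion_emb FA p (free_gen g))"
  shows "univ_seminorm P \<Phi> = univ_seminorm P \<Psi>"
proof -
  have "{p. cstar_seminorm FA p \<and> \<Phi> (completion FA p) (\<lambda>g. completion_emb FA p (free_gen g))} =
      {p. cstar_seminorm FA p \<and> \<Psi> (completion FA p) (\<lambda>g. completion_emb FA p (free_gen g))}"
    using assms by blast
  then show ?thesis unfolding univ_seminorm_def by simp
qed

lemma univ_boundary: "univ_seminorm P (boundary_family G P) = univ_seminorm P (foundation_family G P)"
  by (rule univ_seminorm_cong) (simp add: foundation_iff_boundary)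

lemma free_completion:
  assumes p: "cstar_seminorm FA p"
  shows "cstar_algebra (completion FA p)"
    and "completion_emb FA p \<in> star_hom FA (completion FA p)"
    and "(\<lambda>g. completion_emb FA p (free_gen g)) \<in> P \<rightarrow> carrier (completion FA p)"
    and "x \<in> carrier FA ==> nrm (completion FA p) (completion_emb FA p x) = p x"
proof -
  interpret F: cstar_seminormed "FA" p
    by (intro cstar_seminormed.intro cstar_seminormed_axioms.intro star_algebra_free p)
  show "cstar_algebra (completion FA p)" by (rule F.cstar_algebra_completion)
  show "completion_emb FA p \<in> star_hom FA (completion FA p)"
    by (rule F.emb_star_hom)
  note eD = star_homD(1)[OF this]
  show "(\<lambda>g. completion_emb FA p (free_gen g)) \<in> P \<rightarrow> carrier (completion FA p)"
    by (intro Pi_I eD free_gen_carrier)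
  show "nrm (completion FA p) (completion_emb FA p x) = p x" if "x \<in> carrier FA"
    by (rule F.nrm_emb[OF that])
qed

lemma univ_covariant: "univ_seminorm P (strongly_covariant G P) = univ_seminorm P (foundation_family G P)"
  by (rule univ_seminorm_cong) (rule strongly_covariant_iff[OF free_completion(1,3)])

lemma univ_seminorm_foundation:
  assumes x: "x \<in> carrier FA"
  shows "univ_seminorm P (foundation_family G P) x = largest_cstar_seminorm PS (ev x)"
proof -
  let ?F = "FA"
  define S where "S = {p. cstar_seminorm ?F p \<and>
    foundation_family G P (completion ?F p) (\<lambda>g. completion_emb ?F p (free_gen g))}"
  have evx: "ev x \<in> carrier PS" by (rule star_homD(1)[OF ev_star_hom x])
  have up: "p x \<le> largest_cstar_seminorm PS (ev x)" if p: "p \<in> S" for p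
  proof -
    have pc: "cstar_seminorm ?F p" using p by (simp add: S_def)
    let ?B = "completion ?F p" and ?w = "\<lambda>g. completion_emb ?F p (free_gen g)"
    note fc = free_completion[OF pc]
    have Bs: "star_algebra ?B" using fc(1) by (simp add: cstar_algebra_def)
    obtain \<pi> where \<pi>: "\<pi> \<in> star_hom PS ?B" "\<And>x. x \<in> carrier ?F ==> \<pi> (ev x) = free_eval ?B ?w x"
      using family_star_hom[OF fc(1,3)] p unfolding S_def by blast
    have "\<pi> (ev x) = completion_emb ?F p x" using \<pi>(2)[OF x] free_hom_eval[OF Bs fc(2) x] by simp
    then have "p x = nrm ?B (\<pi> (ev x))" using fc(4)[OF x] by simp
    also have "\<dots> \<le> largest_cstar_seminorm PS (ev x)"
      using largest_PS(2)[OF cstar_seminorm_pullback[OF star_algebra_PS \<pi>(1) cstar_algebra.nrm_cstar_seminorm[OF fc(1)]] evx] .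
    finally show ?thesis .
  qed
  have mem: "(\<lambda>x. q (ev x)) \<in> S" if q: "cstar_seminorm PS q" for q
  proof -
    let ?p = "\<lambda>x. q (ev x)"
    have pc: "cstar_seminorm ?F ?p" by (rule cstar_seminorm_pullback[OF star_algebra_free ev_star_hom q])
    interpret F: cstar_seminormed ?F ?p
      by (intro cstar_seminormed.intro cstar_seminormed_axioms.intro star_algebra_free pc)
    interpret PS: cstar_seminormed PS q
      by (intro cstar_seminormed.intro cstar_seminormed_axioms.intro star_algebra_PS q)
    have "foundation_family G P (completion ?F ?p) (\<lambda>g. completion_emb ?F ?p (free_gen g))"
    proof (rule family_of_factoring_hom[OF F.star_algebra_completion F.emb_star_hom])
      fix x y assume x: "x \<in> carrier ?F" and y: "y \<in> carrier ?F" and eq: "ev x = ev y"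
      have "q (ev (x \<ominus>\<^bsub>?F\<^esub> y)) = 0"
        using star_hom_diff[OF ev_star_hom star_algebra_free star_algebra_PS x y] eq
          star_homD(1)[OF ev_star_hom y] by simp
      then show "completion_emb ?F ?p x = completion_emb ?F ?p y"
        unfolding F.emb_cls using F.cls_eq_iff[OF F.CS_const[OF x] F.CS_const[OF y]] by simp
    qed
    then show ?thesis using pc by (simp add: S_def)
  qed
  have ne: "S \<noteq> {}" using mem[OF cstar_seminorm_zero] by blast
  have bdd: "bdd_above ((\<lambda>p. p x) ` S)" using up by (intro bdd_aboveI[of _ "largest_cstar_seminorm PS (ev x)"]) auto
  have "(SUP p\<in>S. p x) = largest_cstar_seminorm PS (ev x)"
  proof (rule antisym)
    show "(SUP p\<in>S. p x) \<le> largest_cstar_seminorm PS (ev x)" using ne up by (rule cSUP_least)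
    show "largest_cstar_seminorm PS (ev x) \<le> (SUP p\<in>S. p x)"
      unfolding largest_cstar_seminorm_def
    proof (rule cSUP_least)
      show "{q. cstar_seminorm PS q} \<noteq> {}" using cstar_seminorm_zero by blast
      fix q assume "q \<in> {q. cstar_seminorm PS q}"
      then have "(\<lambda>x. q (ev x)) \<in> S" using mem by blast
      from cSUP_upper[OF this bdd] show "q (ev x) \<le> (SUP p\<in>S. p x)" .
    qed
  qed
  then show ?thesis unfolding univ_seminorm_def S_def .
qed

lemma cstar_seminorm_univ: "cstar_seminorm FA (univ_seminorm P (foundation_family G P))"
  by (rule cstar_seminorm_cong[OF star_algebra_free _
        cstar_seminorm_pullback[OF star_algebra_free ev_star_hom largest_PS(1)]]) (rule univ_seminorm_foundation)

lemma lift_bij: "bij_betw lift (carrier PS) (carrier PQ)"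
  using lift_inj lift_onto by (simp add: bij_betw_def)

lemma largest_PQ: "s \<in> carrier PS ==> largest_cstar_seminorm PQ (lift s) = largest_cstar_seminorm PS s"
  by (rule largest_cstar_seminorm_iso[OF star_algebra_PS star_algebra_PQ lift_star_hom lift_bij])

lemma cstar_seminorm_largest_PQ: "cstar_seminorm PQ (largest_cstar_seminorm PQ)"
proof -
  let ?k = "inv_into (carrier PS) lift"
  have k: "?k \<in> star_hom PQ PS" by (rule star_hom_inv_into[OF star_algebra_PS lift_star_hom lift_bij])
  have "largest_cstar_seminorm PQ x = largest_cstar_seminorm PS (?k x)" if "x \<in> carrier PQ" for x
    using largest_PQ[OF star_homD(1)[OF k that]] that lift_onto by (simp add: f_inv_into_f)
  then show ?thesis
    by (rule cstar_seminorm_cong[OF star_algebra_PQ _ cstar_seminorm_pullback[OF star_algebra_PQ k largest_PS(1)]])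
qed

lemma boundary_gen: "p \<in> P ==>
  boundary_crossed_product_gen G P p = completion_emb PS (largest_cstar_seminorm PS) (gen p)"
  by (simp add: boundary_crossed_product_gen_def crossed_product_elem_def gen_def eps_def boundary_eq_Bd)

lemma quotient_gen: "p \<in> P ==>
  quotient_crossed_product_gen G P p = completion_emb PQ (largest_cstar_seminorm PQ) (lift (gen p))"
proof -
  assume p: "p \<in> P"
  have S: "p <# P \<in> J" using p K_J[of "[\<one>, p]"] by (simp add: K_principal)
  have "D0 +>\<^bsub>DR\<^esub> indicator (p <# P) = level (eps (p <# P))"
    using coset_level[OF \<kappa>_ind(2)[OF S]] \<kappa>_ind(1)[OF S] by simp
  then show ?thesis
    by (simp add: quotient_crossed_product_gen_def crossed_product_elem_def lift_delta gen_def)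
qed

lemma isomorphic_univ_quotient:
  "isomorphic_via P (univ_cstar P (foundation_family G P)) (univ_gen P (foundation_family G P))
     (quotient_crossed_product G P) (quotient_crossed_product_gen G P)"
  unfolding univ_cstar_def quotient_crossed_product_def full_crossed_product_def
proof (rule isomorphic_via_completion[OF star_algebra_free star_algebra_PQ star_hom_comp[OF ev_star_hom lift_star_hom]
      cstar_seminorm_univ cstar_seminorm_largest_PQ])
  interpret PS: star_algebra PS by (rule star_algebra_PS)
  have evc: "ev x \<in> carrier PS" if "x \<in> carrier FA" for x by (rule star_homD(1)[OF ev_star_hom that])
  show "univ_seminorm P (foundation_family G P) x = largest_cstar_seminorm PQ (lift (ev x))"
    if "x \<in> carrier FA" for x
    using univ_seminorm_foundation[OF that] largest_PQ[OF evc[OF that]] by simp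
  fix t and e :: real assume t: "t \<in> carrier PQ" and e: "e > 0"
  obtain s where s: "s \<in> carrier PS" "t = lift s" using t lift_onto by blast
  obtain x where x: "x \<in> carrier FA" "N1 (s \<ominus>\<^bsub>PS\<^esub> ev x) < e" using ev_dense[OF s(1) e] by blast
  have d: "s \<ominus>\<^bsub>PS\<^esub> ev x \<in> carrier PS" by (rule PS.diff_closed[OF s(1) evc[OF x(1)]])
  have "largest_cstar_seminorm PQ (t \<ominus>\<^bsub>PQ\<^esub> lift (ev x)) = largest_cstar_seminorm PS (s \<ominus>\<^bsub>PS\<^esub> ev x)"
    using star_hom_diff[OF lift_star_hom star_algebra_PS star_algebra_PQ s(1) evc[OF x(1)]] largest_PQ[OF d] s(2) by simp
  then have "largest_cstar_seminorm PQ (t \<ominus>\<^bsub>PQ\<^esub> lift (ev x)) < e" using largest_PS(3)[OF d] x(2) by linarith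
  then show "\<exists>x\<in>carrier FA. largest_cstar_seminorm PQ (t \<ominus>\<^bsub>PQ\<^esub> lift (ev x)) < e" using x(1) by blast
next
  fix p assume p: "p \<in> P"
  show "free_gen p \<in> carrier FA" by (rule free_gen_carrier[OF p])
  show "completion_emb FA (univ_seminorm P (foundation_family G P)) (free_gen p) =
      univ_gen P (foundation_family G P) p" by (simp add: univ_gen_def)
  show "completion_emb PQ (largest_cstar_seminorm PQ) (lift (ev (free_gen p))) = quotient_crossed_product_gen G P p"
    by (simp add: quotient_gen[OF p] ev_gen[OF p])
qed

lemma isomorphic_quotient_boundary:
  "isomorphic_via P (quotient_crossed_product G P) (quotient_crossed_product_gen G P)
     (boundary_crossed_product G P) (boundary_crossed_product_gen G P)"
  unfolding boundary_crossed_product_def quotient_crossed_product_def full_crossed_product_def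
proof -
  let ?k = "inv_into (carrier PS) lift"
  have k: "?k \<in> star_hom PQ PS" by (rule star_hom_inv_into[OF star_algebra_PS lift_star_hom lift_bij])
  have kl: "?k (lift s) = s" if "s \<in> carrier PS" for s using inv_into_f_f[OF lift_inj that] .
  have lk: "lift (?k t) = t" if "t \<in> carrier PQ" for t using that lift_onto by (simp add: f_inv_into_f)
  interpret PS: star_algebra PS by (rule star_algebra_PS)
  have zero: "largest_cstar_seminorm PS \<zero>\<^bsub>PS\<^esub> = 0"
    using cstar_seminormD(3)[OF largest_PS(1) PS.alg_zero_closed, of 0] by simp
  have gc: "gen p \<in> carrier PS" if "p \<in> P" for p using gen_closed that by blast
  show "isomorphic_via P (completion PQ (largest_cstar_seminorm PQ)) (quotient_crossed_product_gen G P)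
      (completion PS (largest_cstar_seminorm PS)) (boundary_crossed_product_gen G P)"
  proof (rule isomorphic_via_completion[OF star_algebra_PQ star_algebra_PS k cstar_seminorm_largest_PQ largest_PS(1),
        where x = "\<lambda>p. lift (gen p)"])
    show "largest_cstar_seminorm PQ t = largest_cstar_seminorm PS (?k t)" if "t \<in> carrier PQ" for t
      using largest_PQ[OF star_homD(1)[OF k that]] lk[OF that] by simp
    show "\<exists>t\<in>carrier PQ. largest_cstar_seminorm PS (s \<ominus>\<^bsub>PS\<^esub> ?k t) < e" if "s \<in> carrier PS" "e > 0" for s and e :: real
      using that zero kl[OF that(1)] star_homD(1)[OF lift_star_hom that(1)] by (intro bexI[of _ "lift s"]) auto
    fix p assume p: "p \<in> P"
    show "lift (gen p) \<in> carrier PQ" by (rule star_homD(1)[OF lift_star_hom gc[OF p]])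
    show "completion_emb PQ (largest_cstar_seminorm PQ) (lift (gen p)) = quotient_crossed_product_gen G P p"
      by (simp add: quotient_gen[OF p])
    show "completion_emb PS (largest_cstar_seminorm PS) (?k (lift (gen p))) = boundary_crossed_product_gen G P p"
      by (simp add: boundary_gen[OF p] kl[OF gc[OF p]])
  qed
qed

lemma isomorphic_all:
  "isomorphic_via P (covariance_algebra G P) (covariance_gen G P)
     (univ_cstar P (foundation_family G P)) (univ_gen P (foundation_family G P)) \<and>
   isomorphic_via P (univ_cstar P (foundation_family G P)) (univ_gen P (foundation_family G P))
     (univ_cstar P (boundary_family G P)) (univ_gen P (boundary_family G P)) \<and>
   isomorphic_via P (univ_cstar P (boundary_family G P)) (univ_gen P (boundary_family G P))
     (quotient_crossed_product G P) (quotient_crossed_product_gen G P) \<and>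
   isomorphic_via P (quotient_crossed_product G P) (quotient_crossed_product_gen G P)
     (boundary_crossed_product G P) (boundary_crossed_product_gen G P)"
proof -
  have b: "univ_cstar P (boundary_family G P) = univ_cstar P (foundation_family G P)"
    "univ_gen P (boundary_family G P) = univ_gen P (foundation_family G P)"
    by (simp_all add: univ_cstar_def univ_gen_def fun_eq_iff univ_boundary)
  have c: "covariance_algebra G P = univ_cstar P (foundation_family G P)"
    "covariance_gen G P = univ_gen P (foundation_family G P)"
    by (simp_all add: covariance_algebra_def covariance_gen_def univ_cstar_def univ_gen_def fun_eq_iff univ_covariant)
  have "cstar_algebra (univ_cstar P (foundation_family G P))"
    unfolding univ_cstar_def by (rule free_completion(1)[OF cstar_seminorm_univ])
  then show ?thesis
    unfolding b c using isomorphic_via_refl isomorphic_univ_quotient isomorphic_quotient_boundary by blast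
qed

end

theorem theorem6p13:
  fixes G :: "('g, 'k) monoid_scheme" and P :: "'g set"
  assumes "group G" and "submonoid P G"
  shows
    "isomorphic_via P (covariance_algebra G P) (covariance_gen G P)
       (univ_cstar P (foundation_family G P)) (univ_gen P (foundation_family G P)) \<and>
     isomorphic_via P (univ_cstar P (foundation_family G P)) (univ_gen P (foundation_family G P))
       (univ_cstar P (boundary_family G P)) (univ_gen P (boundary_family G P)) \<and>
     isomorphic_via P (univ_cstar P (boundary_family G P)) (univ_gen P (boundary_family G P))
       (quotient_crossed_product G P) (quotient_crossed_product_gen G P) \<and>
     isomorphic_via P (quotient_crossed_product G P) (quotient_crossed_product_gen G P)
       (boundary_crossed_product G P) (boundary_crossed_product_gen G P)"
proof -
  interpret submonoid_of_group G P
    using assms by (intro submonoid_of_group.intro submonoid_of_group_axioms.intro)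
  show ?thesis by (rule isomorphic_all)
qed

end
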